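(* Let $G$ be a $d$-dimensional compact connected Lie group of rank $r$, with Lie algebra $\mathfrak g$, and let $m\ge 1$. For every principal $G$-bundle $P\to S^m$ there is an oriented real vector bundle $\xi$ over $S^m$ of rank $d-r+1$ such that $$\operatorname{ad}(P)\;\cong\;\xi\oplus\varepsilon^{r-1}.$$ In particular, $\operatorname{ad}(P)$ has at least $r-1$ everywhere linearly independent sections.
   Context: The rank of $G$ is the dimension of a maximal torus. $\operatorname{ad}(P):=P\times_{\operatorname{Ad}}\mathfrak g$ is the adjoint bundle of $P$, i.e. the real vector bundle with fiber $\mathfrak g$ associated to $P$ via the adjoint representation $\operatorname{Ad}\colon G\to\mathrm{SO}(\mathfrak g)$, where $\mathfrak g$ carries an $\operatorname{Ad}(G)$-invariant inner product. $\varepsilon^{k}$ denotes the trivial real vector bundle of rank $k$ over $S^m$. *)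

theory Defs
  imports
    "HOL-Analysis.Analysis"
    "HOL-Algebra.Product_Groups"
    "Jordan_Normal_Form.Determinant"
begin

section \<open>Smooth manifolds and smooth maps\<close>

text \<open>For open \<open>S\<close> and finite-dimensional \<open>'a\<close>, \<open>Ck_on k S f\<close> says that \<open>f\<close> is of class \<open>C^k\<close>
  on \<open>S\<close>: the differential exists and all directional derivatives are of class \<open>C^(k-1)\<close>.\<close>

primrec Ck_on ::
  "nat \<Rightarrow> 'a::euclidean_space set \<Rightarrow> ('a \<Rightarrow> 'b::euclidean_space) \<Rightarrow> bool" where
  "Ck_on 0 S f \<longleftrightarrow> continuous_on S f"
| "Ck_on (Suc k) S f \<longleftrightarrow>
     (\<exists>f'. (\<forall>x\<in>S. (f has_derivative f' x) (at x)) \<and> (\<forall>v. Ck_on k S (\<lambda>x. f' x v)))"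

definition smooth_on ::
  "'a::euclidean_space set \<Rightarrow> ('a \<Rightarrow> 'b::euclidean_space) \<Rightarrow> bool" where
  "smooth_on S f \<longleftrightarrow> (\<forall>k. Ck_on k S f)"

text \<open>A chart is a pair of its domain and its coordinate map, which is irrelevant outside the
  domain. Atlases are not required to be maximal.\<close>

type_synonym ('a, 'e) atlas = "('a set \<times> ('a \<Rightarrow> 'e)) set"

definition smooth_atlas :: "'a topology \<Rightarrow> ('a, 'e::euclidean_space) atlas \<Rightarrow> bool" where
  "smooth_atlas X A \<longleftrightarrow>
     (\<forall>(U, \<phi>)\<in>A. openin X U \<and> open (\<phi> ` U) \<and>
        homeomorphic_map (subtopology X U) (top_of_set (\<phi> ` U)) \<phi>) \<and>
     (\<Union>(U, \<phi>)\<in>A. U) = topspace X \<and>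
     (\<forall>(U, \<phi>)\<in>A. \<forall>(V, \<psi>)\<in>A. smooth_on (\<phi> ` (U \<inter> V)) (\<psi> \<circ> inv_into U \<phi>))"

definition smooth_map ::
  "'a topology \<Rightarrow> ('a, 'e::euclidean_space) atlas \<Rightarrow>
   'b topology \<Rightarrow> ('b, 'f::euclidean_space) atlas \<Rightarrow> ('a \<Rightarrow> 'b) \<Rightarrow> bool" where
  "smooth_map X A Y B f \<longleftrightarrow> continuous_map X Y f \<and>
     (\<forall>(U, \<phi>)\<in>A. \<forall>(V, \<psi>)\<in>B.
        smooth_on (\<phi> ` {x \<in> U. f x \<in> V}) (\<psi> \<circ> f \<circ> inv_into U \<phi>))"

definition prod_atlas ::
  "('a, 'e::euclidean_space) atlas \<Rightarrow> ('b, 'f::euclidean_space) atlas \<Rightarrow>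
   ('a \<times> 'b, 'e \<times> 'f) atlas" where
  "prod_atlas A B = {(U \<times> V, map_prod \<phi> \<psi>) | U \<phi> V \<psi>. (U, \<phi>) \<in> A \<and> (V, \<psi>) \<in> B}"

definition smooth_functions ::
  "'a topology \<Rightarrow> ('a, 'e::euclidean_space) atlas \<Rightarrow> ('a \<Rightarrow> real) set" where
  "smooth_functions X A = {f. smooth_map X A euclideanreal {(UNIV, id)} f}"


section \<open>Lie groups, their Lie algebra and the adjoint representation\<close>

text \<open>The dimension of the Lie group is \<open>DIM('e)\<close>, where \<open>'e\<close> is the model space of the charts.
  It is positive by the class \<open>euclidean_space\<close>, so the trivial group (of rank \<open>0\<close>) is not covered.\<close>

locale lie_group = group G for G :: "('g, 'u) monoid_scheme" (structure) +
  fixes T :: "'g topology" and A :: "('g, 'e::euclidean_space) atlas"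
  assumes topspace_eq: "topspace T = carrier G"
    and Hausdorff: "Hausdorff_space T"
    and second_countable: "second_countable T"
    and atlas: "smooth_atlas T A"
    and smooth_mult:
      "smooth_map (prod_topology T T) (prod_atlas A A) T A (\<lambda>(x, y). x \<otimes> y)"
    and smooth_inv: "smooth_map T A T A (\<lambda>x. inv x)"

text \<open>The Lie algebra is the tangent space at the identity, i.e. the space of derivations at the
  identity of the algebra of smooth functions (the last condition only fixes the irrelevant
  values of \<open>D\<close> outside this algebra). It is a linear subspace of \<open>('g \<Rightarrow> real) \<Rightarrow> real\<close> under the
  pointwise operations; since it is finite-dimensional, the topology of pointwise convergence is
  its usual topology as a finite-dimensional vector space.\<close>

definition lie_algebra ::
  "('g, 'u) monoid_scheme \<Rightarrow> 'g topology \<Rightarrow> ('g, 'e::euclidean_space) atlas \<Rightarrow>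
   (('g \<Rightarrow> real) \<Rightarrow> real) set" where
  "lie_algebra G T A = {D.
     (\<forall>f\<in>smooth_functions T A. \<forall>h\<in>smooth_functions T A.
        D (\<lambda>x. f x + h x) = D f + D h \<and>
        D (\<lambda>x. f x * h x) = f \<one>\<^bsub>G\<^esub> * D h + h \<one>\<^bsub>G\<^esub> * D f) \<and>
     (\<forall>f\<in>smooth_functions T A. \<forall>c. D (\<lambda>x. c * f x) = c * D f) \<and>
     (\<forall>f. f \<notin> smooth_functions T A \<longrightarrow> D f = 0)}"

definition lie_algebra_topology ::
  "('g, 'u) monoid_scheme \<Rightarrow> 'g topology \<Rightarrow> ('g, 'e::euclidean_space) atlas \<Rightarrow>
   (('g \<Rightarrow> real) \<Rightarrow> real) topology" where
  "lie_algebra_topology G T A = subtopology (powertop_real UNIV) (lie_algebra G T A)"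

text \<open>\<open>Ad(g)\<close> is the differential at the identity of the conjugation by \<open>g\<close>.\<close>

definition Ad ::
  "('g, 'u) monoid_scheme \<Rightarrow> 'g \<Rightarrow> (('g \<Rightarrow> real) \<Rightarrow> real) \<Rightarrow> (('g \<Rightarrow> real) \<Rightarrow> real)" where
  "Ad G g D = (\<lambda>f. D (\<lambda>x. f (g \<otimes>\<^bsub>G\<^esub> x \<otimes>\<^bsub>G\<^esub> inv\<^bsub>G\<^esub> g)))"


section \<open>Maximal tori and rank\<close>

definition circle_group :: "complex monoid" where
  "circle_group = \<lparr>carrier = sphere 0 1, monoid.mult = (*), one = 1\<rparr>"

text \<open>A \<open>k\<close>-dimensional torus in \<open>G\<close> is a subgroup that is isomorphic, as a topological group
  with the subspace topology, to \<open>(S^1)^k\<close>. In a Lie group such a subgroup is compact, hence a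
  closed Lie subgroup, and the isomorphism is automatically smooth.\<close>

definition torus_in :: "('g, 'u) monoid_scheme \<Rightarrow> 'g topology \<Rightarrow> nat \<Rightarrow> 'g set \<Rightarrow> bool" where
  "torus_in G T k H \<longleftrightarrow> subgroup H G \<and>
     (\<exists>f \<in> iso (product_group {..<k} (\<lambda>_. circle_group)) (G\<lparr>carrier := H\<rparr>).
        homeomorphic_map (product_topology (\<lambda>_. top_of_set (sphere 0 1)) {..<k})
          (subtopology T H) f)"

definition maximal_torus_in ::
  "('g, 'u) monoid_scheme \<Rightarrow> 'g topology \<Rightarrow> nat \<Rightarrow> 'g set \<Rightarrow> bool" where
  "maximal_torus_in G T k H \<longleftrightarrow> torus_in G T k H \<and>
     (\<forall>k' H'. torus_in G T k' H' \<and> H \<subseteq> H' \<longrightarrow> H' = H)"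

definition lie_rank :: "('g, 'u) monoid_scheme \<Rightarrow> 'g topology \<Rightarrow> nat \<Rightarrow> bool" where
  "lie_rank G T r \<longleftrightarrow> (\<exists>H. maximal_torus_in G T r H)"


section \<open>Real vector bundles\<close>

text \<open>The fibrewise operations are only relevant on vectors in a common fibre. The standard fibre
  \<open>\<real>\<^sup>k\<close> is \<^const>\<open>Euclidean_space\<close>, whose points are the sequences vanishing from index \<open>k\<close> on.\<close>

record ('b, 'v) vector_bundle =
  total :: "'v topology"
  bproj :: "'v \<Rightarrow> 'b"
  fadd :: "'v \<Rightarrow> 'v \<Rightarrow> 'v"
  fscale :: "real \<Rightarrow> 'v \<Rightarrow> 'v"
  fzero :: "'b \<Rightarrow> 'v"

definition local_triv ::
  "'b topology \<Rightarrow> ('b, 'v) vector_bundle \<Rightarrow> nat \<Rightarrow> 'b set \<Rightarrow> ('b \<times> (nat \<Rightarrow> real) \<Rightarrow> 'v) \<Rightarrow> bool"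
  where
  "local_triv B E k U \<phi> \<longleftrightarrow> openin B U \<and>
     homeomorphic_map (prod_topology (subtopology B U) (Euclidean_space k))
       (subtopology (total E) {e \<in> topspace (total E). bproj E e \<in> U}) \<phi> \<and>
     (\<forall>x\<in>U. \<phi> (x, \<lambda>_. 0) = fzero E x \<and>
        (\<forall>v\<in>topspace (Euclidean_space k). bproj E (\<phi> (x, v)) = x \<and>
           (\<forall>w\<in>topspace (Euclidean_space k).
              \<phi> (x, \<lambda>i. v i + w i) = fadd E (\<phi> (x, v)) (\<phi> (x, w))) \<and>
           (\<forall>c. \<phi> (x, \<lambda>i. c * v i) = fscale E c (\<phi> (x, v)))))"

definition real_vector_bundle ::
  "'b topology \<Rightarrow> ('b, 'v) vector_bundle \<Rightarrow> nat \<Rightarrow> bool" where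
  "real_vector_bundle B E k \<longleftrightarrow> continuous_map (total E) B (bproj E) \<and>
     (\<forall>x\<in>topspace B. \<exists>U \<phi>. x \<in> U \<and> local_triv B E k U \<phi>)"

definition transition_matrix ::
  "nat \<Rightarrow> 'b set \<Rightarrow> ('b \<times> (nat \<Rightarrow> real) \<Rightarrow> 'v) \<Rightarrow> ('b \<times> (nat \<Rightarrow> real) \<Rightarrow> 'v) \<Rightarrow> 'b \<Rightarrow> real mat"
  where
  "transition_matrix k V \<psi> \<phi> x = Matrix.mat k k (\<lambda>(i, j).
     snd (inv_into (V \<times> topspace (Euclidean_space k)) \<psi>
       (\<phi> (x, \<lambda>l. if l = j then 1 else 0))) i)"

text \<open>An orientation, given by an atlas of local trivializations (which are declared to be
  orientation-preserving) with transition functions of positive determinant.\<close>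

definition bundle_orientation ::
  "'b topology \<Rightarrow> ('b, 'v) vector_bundle \<Rightarrow> nat \<Rightarrow>
   ('b set \<times> ('b \<times> (nat \<Rightarrow> real) \<Rightarrow> 'v)) set \<Rightarrow> bool" where
  "bundle_orientation B E k \<Phi> \<longleftrightarrow>
     (\<forall>(U, \<phi>)\<in>\<Phi>. local_triv B E k U \<phi>) \<and>
     (\<Union>(U, \<phi>)\<in>\<Phi>. U) = topspace B \<and>
     (\<forall>(U, \<phi>)\<in>\<Phi>. \<forall>(V, \<psi>)\<in>\<Phi>. \<forall>x\<in>U \<inter> V.
        Determinant.det (transition_matrix k V \<psi> \<phi> x) > 0)"

definition oriented_vector_bundle ::
  "'b topology \<Rightarrow> ('b, 'v) vector_bundle \<Rightarrow> nat \<Rightarrow>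
   ('b set \<times> ('b \<times> (nat \<Rightarrow> real) \<Rightarrow> 'v)) set \<Rightarrow> bool" where
  "oriented_vector_bundle B E k \<Phi> \<longleftrightarrow>
     real_vector_bundle B E k \<and> bundle_orientation B E k \<Phi>"

definition trivial_bundle ::
  "'b topology \<Rightarrow> nat \<Rightarrow> ('b, 'b \<times> (nat \<Rightarrow> real)) vector_bundle" where
  "trivial_bundle B k = \<lparr>
     total = prod_topology B (Euclidean_space k),
     bproj = fst,
     fadd = (\<lambda>(x, v) (y, w). (x, \<lambda>i. v i + w i)),
     fscale = (\<lambda>c (x, v). (x, \<lambda>i. c * v i)),
     fzero = (\<lambda>x. (x, \<lambda>_. 0))\<rparr>"

definition whitney_sum ::
  "('b, 'v) vector_bundle \<Rightarrow> ('b, 'w) vector_bundle \<Rightarrow> ('b, 'v \<times> 'w) vector_bundle" where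
  "whitney_sum E F = \<lparr>
     total = subtopology (prod_topology (total E) (total F)) {(e, f). bproj E e = bproj F f},
     bproj = (\<lambda>(e, f). bproj E e),
     fadd = (\<lambda>(e, f) (e', f'). (fadd E e e', fadd F f f')),
     fscale = (\<lambda>c (e, f). (fscale E c e, fscale F c f)),
     fzero = (\<lambda>x. (fzero E x, fzero F x))\<rparr>"

definition bundle_isomorphic ::
  "('b, 'v) vector_bundle \<Rightarrow> ('b, 'w) vector_bundle \<Rightarrow> bool" where
  "bundle_isomorphic E F \<longleftrightarrow> (\<exists>h. homeomorphic_map (total E) (total F) h \<and>
     (\<forall>e\<in>topspace (total E). bproj F (h e) = bproj E e \<and>
        (\<forall>c. h (fscale E c e) = fscale F c (h e)) \<and>
        (\<forall>e'\<in>topspace (total E). bproj E e' = bproj E e \<longrightarrow>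
           h (fadd E e e') = fadd F (h e) (h e'))))"

definition bundle_section ::
  "'b topology \<Rightarrow> ('b, 'v) vector_bundle \<Rightarrow> ('b \<Rightarrow> 'v) \<Rightarrow> bool" where
  "bundle_section B E s \<longleftrightarrow>
     continuous_map B (total E) s \<and> (\<forall>x\<in>topspace B. bproj E (s x) = x)"

text \<open>The linear combination of \<open>c 0, \<dots>, c (n - 1)\<close> and the vectors \<open>e 0, \<dots>, e (n - 1)\<close> of the
  fibre over \<open>x\<close>.\<close>

primrec fibre_lincomb ::
  "('b, 'v) vector_bundle \<Rightarrow> 'b \<Rightarrow> (nat \<Rightarrow> real) \<Rightarrow> (nat \<Rightarrow> 'v) \<Rightarrow> nat \<Rightarrow> 'v" where
  "fibre_lincomb E x c e 0 = fzero E x"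
| "fibre_lincomb E x c e (Suc n) = fadd E (fibre_lincomb E x c e n) (fscale E (c n) (e n))"

definition fibre_lin_indep ::
  "('b, 'v) vector_bundle \<Rightarrow> 'b \<Rightarrow> (nat \<Rightarrow> 'v) \<Rightarrow> nat \<Rightarrow> bool" where
  "fibre_lin_indep E x e n \<longleftrightarrow>
     (\<forall>c. fibre_lincomb E x c e n = fzero E x \<longrightarrow> (\<forall>i<n. c i = 0))"


section \<open>Principal bundles and the adjoint bundle\<close>

definition principal_bundle ::
  "('g, 'u) monoid_scheme \<Rightarrow> 'g topology \<Rightarrow> 'b topology \<Rightarrow>
   'p topology \<Rightarrow> ('p \<Rightarrow> 'b) \<Rightarrow> ('p \<Rightarrow> 'g \<Rightarrow> 'p) \<Rightarrow> bool" where
  "principal_bundle G T B P \<pi> act \<longleftrightarrow>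
     continuous_map P B \<pi> \<and>
     continuous_map (prod_topology P T) P (\<lambda>(p, g). act p g) \<and>
     (\<forall>p\<in>topspace P. act p \<one>\<^bsub>G\<^esub> = p \<and>
        (\<forall>g\<in>carrier G. \<pi> (act p g) = \<pi> p \<and>
           (\<forall>h\<in>carrier G. act (act p g) h = act p (g \<otimes>\<^bsub>G\<^esub> h)))) \<and>
     (\<forall>x\<in>topspace B. \<exists>U \<phi>. x \<in> U \<and> openin B U \<and>
        homeomorphic_map (prod_topology (subtopology B U) T)
          (subtopology P {p \<in> topspace P. \<pi> p \<in> U}) \<phi> \<and>
        (\<forall>y\<in>U. \<forall>g\<in>carrier G. \<pi> (\<phi> (y, g)) = y \<and>
           (\<forall>h\<in>carrier G. \<phi> (y, g \<otimes>\<^bsub>G\<^esub> h) = act (\<phi> (y, g)) h)))"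

definition quotient_topology :: "'a topology \<Rightarrow> ('a \<Rightarrow> 'b) \<Rightarrow> 'b topology" where
  "quotient_topology X q =
     topology (\<lambda>S. S \<subseteq> q ` topspace X \<and> openin X {x \<in> topspace X. q x \<in> S})"

lemma openin_quotient_topology:
  "openin (quotient_topology X q) S \<longleftrightarrow>
     S \<subseteq> q ` topspace X \<and> openin X {x \<in> topspace X. q x \<in> S}"
proof -
  have "istopology (\<lambda>S. S \<subseteq> q ` topspace X \<and> openin X {x \<in> topspace X. q x \<in> S})"
    unfolding istopology_def
  proof (rule conjI; intro allI impI)
    fix S S'
    assume "S \<subseteq> q ` topspace X \<and> openin X {x \<in> topspace X. q x \<in> S}"
      and "S' \<subseteq> q ` topspace X \<and> openin X {x \<in> topspace X. q x \<in> S'}"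
    moreover have "{x \<in> topspace X. q x \<in> S \<inter> S'} =
        {x \<in> topspace X. q x \<in> S} \<inter> {x \<in> topspace X. q x \<in> S'}"
      by auto
    ultimately show "S \<inter> S' \<subseteq> q ` topspace X \<and> openin X {x \<in> topspace X. q x \<in> S \<inter> S'}"
      by auto
  next
    fix K
    assume K: "\<forall>S\<in>K. S \<subseteq> q ` topspace X \<and> openin X {x \<in> topspace X. q x \<in> S}"
    have "{x \<in> topspace X. q x \<in> \<Union>K} = (\<Union>S\<in>K. {x \<in> topspace X. q x \<in> S})"
      by auto
    with K show "\<Union>K \<subseteq> q ` topspace X \<and> openin X {x \<in> topspace X. q x \<in> \<Union>K}"
      by auto
  qed
  then show ?thesis
    by (simp add: quotient_topology_def)
qed

lemma quotient_map_quotient_topology: "quotient_map X (quotient_topology X q) q"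
proof -
  have "{x \<in> topspace X. q x \<in> q ` topspace X} = topspace X"
    by auto
  then have "openin (quotient_topology X q) (q ` topspace X)"
    by (simp add: openin_quotient_topology)
  then have "topspace (quotient_topology X q) = q ` topspace X"
    by (meson openin_quotient_topology openin_subset openin_topspace subset_antisym)
  then show ?thesis
    by (simp add: quotient_map_def openin_quotient_topology)
qed

text \<open>The class of \<open>(p, D)\<close> in the quotient of \<open>P \<times> lie_algebra G\<close> by the right action
  \<open>(p, D) \<cdot> g = (p \<cdot> g, Ad(g\<^sup>-\<^sup>1) D)\<close>.\<close>

definition adjoint_class ::
  "('g, 'u) monoid_scheme \<Rightarrow> ('p \<Rightarrow> 'g \<Rightarrow> 'p) \<Rightarrow>
   'p \<times> (('g \<Rightarrow> real) \<Rightarrow> real) \<Rightarrow> ('p \<times> (('g \<Rightarrow> real) \<Rightarrow> real)) set" where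
  "adjoint_class G act = (\<lambda>(p, D). {(act p g, Ad G (inv\<^bsub>G\<^esub> g) D) | g. g \<in> carrier G})"

text \<open>The operations are \<open>[p, D] + [p, D'] = [p, D + D']\<close> and \<open>c [p, D] = [p, c D]\<close>, written in
  terms of all representatives.\<close>

definition adjoint_bundle ::
  "('g, 'u) monoid_scheme \<Rightarrow> 'g topology \<Rightarrow> ('g, 'e::euclidean_space) atlas \<Rightarrow>
   'p topology \<Rightarrow> ('p \<Rightarrow> 'b) \<Rightarrow> ('p \<Rightarrow> 'g \<Rightarrow> 'p) \<Rightarrow>
   ('b, ('p \<times> (('g \<Rightarrow> real) \<Rightarrow> real)) set) vector_bundle" where
  "adjoint_bundle G T A P \<pi> act = \<lparr>
     total = quotient_topology (prod_topology P (lie_algebra_topology G T A))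
       (adjoint_class G act),
     bproj = (\<lambda>C. the_elem ((\<lambda>(p, D). \<pi> p) ` C)),
     fadd = (\<lambda>C C'. {(p, \<lambda>f. D f + D' f) | p D D'. (p, D) \<in> C \<and> (p, D') \<in> C'}),
     fscale = (\<lambda>c C. {(p, \<lambda>f. c * D f) | p D. (p, D) \<in> C}),
     fzero = (\<lambda>x. {(p, \<lambda>f. 0) | p. p \<in> topspace P \<and> \<pi> p = x})\<rparr>"

end

theory Submission
  imports Defs
begin

text \<open>
  Cover the sphere by two overlapping neighbourhoods of hemispheres. The bundle \<open>P\<close> has a section
  over each of them, so that \<open>ad(P)\<close> is obtained by clutching two trivial bundles with fibre \<open>\<gg>\<close>
  along \<open>x \<mapsto> Ad(c x)\<close>, where \<open>c\<close> takes values in \<open>G\<close>. A torus of dimension \<open>r\<close> has \<open>r\<close> linearly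
  independent tangent vectors \<open>v\<^sub>0, v\<^sub>1, \<dots>\<close> that are fixed by \<open>Ad\<close> of the torus. The orbit
  \<open>{(Ad(g) v\<^sub>i)\<^sub>i | g \<in> G}\<close> therefore has dimension at most \<open>d - r\<close>, and counting dimensions yields
  vectors \<open>S\<^sub>i\<close> (\<open>i < r - 1\<close>) such that the vectors \<open>(1 - t) Ad(g) v\<^sub>i + t S\<^sub>i\<close> are linearly independent
  for all \<open>g \<in> G\<close> and \<open>0 \<le> t \<le> 1\<close>. The constant frame \<open>(v\<^sub>i)\<close> over one hemisphere reads \<open>(Ad(c x) v\<^sub>i)\<close>
  in the other trivialization and extends over the other hemisphere along these segments, as the
  constant frame \<open>(S\<^sub>i)\<close> near its pole. The complement of the resulting \<open>r - 1\<close> sections is \<open>\<xi>\<close>; it is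
  orientable because \<open>det Ad(g) > 0\<close> on the connected group \<open>G\<close>.

  No smooth structure on the sphere or the orbits is used: dimension is measured by covering
  numbers, i.e. by \<open>O(N\<^bsup>d - r\<^esup>)\<close> balls of radius \<open>1/N\<close>.
\<close>

section \<open>Calculus of \<open>C\<^sup>k\<close> maps\<close>

no_notation Matrix.scalar_prod (infix "\<bullet>" 70)

text \<open>The number r - 1 comes from a parameter count. A linear relation that involves the next
  vector S_k depends on k coefficients, on the position on the segment and on a point of the orbit,
  hence on k + 1 + (d - r) parameters. For k + 2 \<le> r these are fewer than d, and almost every
  S_k avoids all relations. The subtractions in the statement are truncated, so r \<ge> 1 and r
  \<le> d have to be proved. For r = 0 the claim would ask for a bundle \<xi> of rank d + 1; a
  compact group of positive dimension must therefore be shown to contain a circle. The one-parameter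
  subgroups for this come not from a differential equation but from iterated square roots, whose
  errors are controlled by the mixed second difference of the multiplication. The complement \<xi>
  is an orthogonal one. The inner product is that of an ambient trivial bundle with fibre of twice
  the dimension, into which ad(P) is embedded by means of cut-off functions.\<close>

lemma Ck_on_SucI:
  assumes "\<And>x. x \<in> S \<Longrightarrow> (f has_derivative f' x) (at x)" "\<And>v. Ck_on k S (\<lambda>x. f' x v)"
  shows "Ck_on (Suc k) S f"
  unfolding Ck_on.simps(2) using assms by (intro exI[of _ f']) blast

lemma Ck_on_SucE:
  assumes "Ck_on (Suc k) S f"
  obtains f' where "\<And>x. x \<in> S \<Longrightarrow> (f has_derivative f' x) (at x)" "\<And>v. Ck_on k S (\<lambda>x. f' x v)"
  using assms unfolding Ck_on.simps(2) by blast

declare Ck_on.simps(2)[simp del]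

lemma Ck_on_subset: "Ck_on k S f \<Longrightarrow> R \<subseteq> S \<Longrightarrow> Ck_on k R f"
proof (induction k arbitrary: f)
  case 0
  then show ?case using continuous_on_subset by simp blast
next
  case (Suc k)
  obtain f' where f': "\<And>x. x \<in> S \<Longrightarrow> (f has_derivative f' x) (at x)" "\<And>v. Ck_on k S (\<lambda>x. f' x v)"
    using Ck_on_SucE[OF Suc.prems(1)] by metis
  show ?case
    by (rule Ck_on_SucI[of _ _ f']) (use f' Suc in blast)+
qed

lemma Ck_on_cong:
  assumes "open S" "\<And>x. x \<in> S \<Longrightarrow> f x = g x" "Ck_on k S f"
  shows "Ck_on k S g"
proof (cases k)
  case 0
  then show ?thesis using assms continuous_on_cong[of S S f g] by simp
next
  case (Suc j)
  obtain f' where f': "\<And>x. x \<in> S \<Longrightarrow> (f has_derivative f' x) (at x)"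
    and ck: "\<And>v. Ck_on j S (\<lambda>x. f' x v)"
    using Ck_on_SucE assms(3)[unfolded Suc] by metis
  have "(g has_derivative f' x) (at x)" if "x \<in> S" for x
    using has_derivative_transform_within_open[OF f'[OF that] assms(1) that assms(2)] .
  then show ?thesis unfolding Suc using ck by (rule Ck_on_SucI)
qed

text \<open>The derivative in \<open>Ck_on\<close> is an existential witness, and witnesses from
  different neighbourhoods must be one function before the induction hypothesis applies. On an open
  set each of them is the Frechet derivative, which serves as the common choice.\<close>

lemma Ck_on_local:
  assumes "\<And>x. x \<in> S \<Longrightarrow> \<exists>U. open U \<and> x \<in> U \<and> Ck_on k U f"
  shows "Ck_on k S f"
  using assms
proof (induction k arbitrary: f)
  case 0
  then show ?case
    using continuous_on_eq_continuous_at continuous_at_imp_continuous_on by (metis Ck_on.simps(1))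
next
  case (Suc k)
  define F where "F x = frechet_derivative f (at x)" for x
  have *: "\<exists>U. open U \<and> x \<in> U \<and> (\<forall>y\<in>U. (f has_derivative F y) (at y)) \<and> (\<forall>v. Ck_on k U (\<lambda>y. F y v))"
    if x: "x \<in> S" for x
  proof -
    obtain U where U: "open U" "x \<in> U" "Ck_on (Suc k) U f"
      using Suc.prems[OF x] by blast
    obtain f' where f': "\<And>y. y \<in> U \<Longrightarrow> (f has_derivative f' y) (at y)"
      and ck: "\<And>v. Ck_on k U (\<lambda>y. f' y v)"
      using Ck_on_SucE[OF U(3)] by metis
    have eq: "f' y = F y" if "y \<in> U" for y
      using frechet_derivative_at[OF f'[OF that]] by (simp add: F_def)
    have "Ck_on k U (\<lambda>y. F y v)" for v
      by (rule Ck_on_cong[OF U(1) _ ck[of v]]) (simp add: eq)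
    moreover have "(f has_derivative F y) (at y)" if "y \<in> U" for y
      using f'[OF that] eq[OF that] by simp
    ultimately show ?thesis using U by (intro exI[of _ U]) blast
  qed
  show ?case
  proof (rule Ck_on_SucI)
    show "(f has_derivative F x) (at x)" if "x \<in> S" for x using *[OF that] by blast
    show "Ck_on k S (\<lambda>y. F y v)" for v
      by (rule Suc.IH) (use * in blast)
  qed
qed

lemma Ck_on_SucD: "Ck_on (Suc k) S f \<Longrightarrow> Ck_on k S f"
proof (induction k arbitrary: f)
  case 0
  obtain f' where "\<And>x. x \<in> S \<Longrightarrow> (f has_derivative f' x) (at x)"
    using Ck_on_SucE[OF 0] by metis
  then have "\<forall>x\<in>S. isCont f x" using has_derivative_continuous by blast
  then show ?case by (simp add: continuous_at_imp_continuous_on)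
next
  case (Suc k)
  obtain f' where f': "\<And>x. x \<in> S \<Longrightarrow> (f has_derivative f' x) (at x)" "\<And>v. Ck_on (Suc k) S (\<lambda>x. f' x v)"
    using Ck_on_SucE[OF Suc.prems] by metis
  show ?case
    by (rule Ck_on_SucI[of _ _ f']) (use f' Suc.IH in blast)+
qed

lemma Ck_on_le: "Ck_on n S f \<Longrightarrow> k \<le> n \<Longrightarrow> Ck_on k S f"
proof (induction n)
  case (Suc n)
  then show ?case using Ck_on_SucD by (metis le_Suc_eq)
qed simp

lemma Ck_on_continuous: "Ck_on k S f \<Longrightarrow> continuous_on S f"
  using Ck_on_le[of k S f 0] by simp

lemma Ck_on_const: "Ck_on k S (\<lambda>x. c)"
proof (induction k arbitrary: c)
  case (Suc k)
  then show ?case by (intro Ck_on_SucI[of _ _ "\<lambda>_ _. 0"]) auto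
qed simp

lemma Ck_on_bounded_linear: "bounded_linear f \<Longrightarrow> Ck_on k S f"
proof (cases k)
  case (Suc j)
  assume "bounded_linear f"
  then show ?thesis unfolding Suc
    by (intro Ck_on_SucI[of _ _ "\<lambda>_. f"] Ck_on_const bounded_linear_imp_has_derivative)
qed (simp add: linear_continuous_on)

lemma Ck_on_add: "Ck_on k S f \<Longrightarrow> Ck_on k S g \<Longrightarrow> Ck_on k S (\<lambda>x. f x + g x)"
proof (induction k arbitrary: f g)
  case 0
  then show ?case by (auto intro: continuous_intros)
next
  case (Suc k)
  obtain f' where f': "\<And>x. x \<in> S \<Longrightarrow> (f has_derivative f' x) (at x)" "\<And>v. Ck_on k S (\<lambda>x. f' x v)"
    using Ck_on_SucE[OF Suc.prems(1)] by metis
  obtain g' where g': "\<And>x. x \<in> S \<Longrightarrow> (g has_derivative g' x) (at x)" "\<And>v. Ck_on k S (\<lambda>x. g' x v)"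
    using Ck_on_SucE[OF Suc.prems(2)] by metis
  show ?case
    by (intro Ck_on_SucI[of _ _ "\<lambda>x v. f' x v + g' x v"] has_derivative_add f' g' Suc.IH)
qed

lemma Ck_on_bilinear:
  assumes "bounded_bilinear B"
  shows "Ck_on k S f \<Longrightarrow> Ck_on k S g \<Longrightarrow> Ck_on k S (\<lambda>x. B (f x) (g x))"
proof (induction k arbitrary: f g)
  case 0
  then show ?case by (auto intro: bounded_bilinear.continuous_on[OF assms])
next
  case (Suc k)
  obtain f' where f': "\<And>x. x \<in> S \<Longrightarrow> (f has_derivative f' x) (at x)" "\<And>v. Ck_on k S (\<lambda>x. f' x v)"
    using Ck_on_SucE[OF Suc.prems(1)] by metis
  obtain g' where g': "\<And>x. x \<in> S \<Longrightarrow> (g has_derivative g' x) (at x)" "\<And>v. Ck_on k S (\<lambda>x. g' x v)"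
    using Ck_on_SucE[OF Suc.prems(2)] by metis
  have "Ck_on k S f" "Ck_on k S g" using Suc.prems Ck_on_SucD by blast+
  then show ?case
    by (intro Ck_on_SucI[of _ _ "\<lambda>x v. B (f x) (g' x v) + B (f' x v) (g x)"] Ck_on_add
      bounded_bilinear.FDERIV[OF assms] Suc.IH f' g')
qed

lemma Ck_on_sum:
  assumes "\<And>i. i \<in> I \<Longrightarrow> Ck_on k S (f i)"
  shows "Ck_on k S (\<lambda>x. \<Sum>i\<in>I. f i x)"
proof (cases "finite I")
  case True
  then show ?thesis using assms
    by (induction I) (auto intro: Ck_on_const Ck_on_add)
qed (simp add: Ck_on_const)

text \<open>\<open>Ck_on\<close> controls the derivative of \<open>g\<close> in fixed directions
  only, whereas the chain rule evaluates it in the moving direction \<open>f' x v\<close>. Expanding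
  this direction in the basis leaves fixed directions with scalar coefficients of class C^k, so sums
  and products suffice.\<close>

lemma Ck_on_compose:
  fixes f :: "'a::euclidean_space \<Rightarrow> 'b::euclidean_space" and g :: "'b \<Rightarrow> 'c::euclidean_space"
  assumes "f ` S \<subseteq> R"
  shows "Ck_on k S f \<Longrightarrow> Ck_on k R g \<Longrightarrow> Ck_on k S (\<lambda>x. g (f x))"
proof (induction k arbitrary: g)
  case 0
  then show ?case using assms continuous_on_compose2 by (metis Ck_on.simps(1))
next
  case (Suc k)
  obtain f' where f': "\<And>x. x\<in>S \<Longrightarrow> (f has_derivative f' x) (at x)" "\<And>v. Ck_on k S (\<lambda>x. f' x v)"
    using Ck_on_SucE[OF Suc.prems(1)] by metis
  obtain g' where g': "\<And>x. x\<in>R \<Longrightarrow> (g has_derivative g' x) (at x)" "\<And>v. Ck_on k R (\<lambda>x. g' x v)"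
    using Ck_on_SucE[OF Suc.prems(2)] by metis
  define h where "h x v = (\<Sum>b\<in>Basis. (f' x v \<bullet> b) *\<^sub>R g' (f x) b)" for x v
  have "((\<lambda>x. g (f x)) has_derivative h x) (at x)" if "x \<in> S" for x
  proof -
    have gf: "(g has_derivative g' (f x)) (at (f x))" using g' that assms by blast
    then have lin: "linear (g' (f x))" by (rule has_derivative_linear)
    have "h x = (\<lambda>v. g' (f x) (f' x v))"
    proof
      fix v
      have "g' (f x) (f' x v) = g' (f x) (\<Sum>b\<in>Basis. (f' x v \<bullet> b) *\<^sub>R b)"
        by (simp add: euclidean_representation)
      then show "h x v = g' (f x) (f' x v)"
        by (simp add: h_def linear_sum[OF lin] linear_scale[OF lin])
    qed
    then show ?thesis using has_derivative_compose[OF f'(1)[OF that] gf] by simp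
  qed
  moreover have "Ck_on k S (\<lambda>x. h x v)" for v
    unfolding h_def
  proof (intro Ck_on_sum Ck_on_bilinear[OF bounded_bilinear_scaleR])
    fix b :: 'b assume "b \<in> Basis"
    show "Ck_on k S (\<lambda>x. f' x v \<bullet> b)"
      by (intro Ck_on_bilinear[OF bounded_bilinear_inner] f' Ck_on_const)
    have "Ck_on k S f" using Suc.prems Ck_on_SucD by blast
    then show "Ck_on k S (\<lambda>x. g' (f x) b)" using Suc.IH[OF _ g'(2)] by blast
  qed
  ultimately show ?case by (rule Ck_on_SucI)
qed

lemma Ck_on_Pair:
  assumes "Ck_on k S f" "Ck_on k S g"
  shows "Ck_on k S (\<lambda>x. (f x, g x))"
proof -
  have 1: "bounded_linear (\<lambda>x. (x, 0))" "bounded_linear (\<lambda>x. (0, x))"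
    by (auto intro!: bounded_linear_Pair bounded_linear_ident bounded_linear_zero)
  have "Ck_on k S (\<lambda>x. (f x, 0) + (0, g x))"
    by (intro Ck_on_add Ck_on_compose[OF subset_UNIV assms(1) Ck_on_bounded_linear[OF 1(1)]]
       Ck_on_compose[OF subset_UNIV assms(2) Ck_on_bounded_linear[OF 1(2)]])
  then show ?thesis by simp
qed

text \<open>Continuity of the derivative is known direction by direction. On the compact set each
  basis direction has a bound, and the sum of these bounds the operator norm; convexity then gives
  the mean value inequality.\<close>

lemma Ck_on_lipschitz:
  fixes f :: "'a::euclidean_space \<Rightarrow> 'b::euclidean_space"
  assumes "Ck_on 1 S f" "compact K" "convex K" "K \<subseteq> S"
  shows "\<exists>C\<ge>0. \<forall>x\<in>K. \<forall>y\<in>K. norm (f x - f y) \<le> C * norm (x - y)"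
proof -
  obtain f' where f': "\<And>x. x\<in>S \<Longrightarrow> (f has_derivative f' x) (at x)"
    and c: "\<And>v. continuous_on S (\<lambda>x. f' x v)"
    using Ck_on_SucE[of 0 S f] assms(1) unfolding One_nat_def Ck_on.simps(1) by metis
  have "\<exists>M. \<forall>x\<in>K. norm (f' x b) \<le> M" for b
    using compact_continuous_image[OF continuous_on_subset[OF c assms(4)] assms(2)]
      compact_imp_bounded by (metis bounded_iff imageI)
  then obtain M where M: "\<And>x b. x \<in> K \<Longrightarrow> norm (f' x b) \<le> M b" by metis
  define C where "C = (\<Sum>b\<in>Basis. \<bar>M b\<bar>)"
  have "norm (f' x v) \<le> C * norm v" if "x \<in> K" for x v
  proof -
    have lin: "linear (f' x)" using f' that assms(4) has_derivative_linear by blast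
    have "f' x v = f' x (\<Sum>b\<in>Basis. (v \<bullet> b) *\<^sub>R b)"
      by (simp add: euclidean_representation)
    also have "\<dots> = (\<Sum>b\<in>Basis. (v \<bullet> b) *\<^sub>R f' x b)"
      by (simp add: linear_sum[OF lin] linear_scale[OF lin])
    also have "norm \<dots> \<le> (\<Sum>b\<in>Basis. norm v * \<bar>M b\<bar>)"
    proof (intro sum_norm_le)
      fix b :: 'a assume b: "b \<in> Basis"
      show "norm ((v \<bullet> b) *\<^sub>R f' x b) \<le> norm v * \<bar>M b\<bar>"
        using M[OF that, of b] Basis_le_norm[OF b, of v] by (auto intro!: mult_mono)
    qed
    finally show ?thesis by (simp add: C_def sum_distrib_left mult.commute)
  qed
  then have on: "onorm (f' x) \<le> C" if "x \<in> K" for x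
    using that by (intro onorm_bound) (auto simp: C_def sum_nonneg)
  have "norm (f x - f y) \<le> C * norm (x - y)" if "x \<in> K" "y \<in> K" for x y
    by (rule differentiable_bound[OF assms(3) has_derivative_at_withinI[OF f'[OF subsetD[OF assms(4)]]] on that])
  then show ?thesis by (intro exI[of _ C]) (auto simp: C_def sum_nonneg)
qed

lemma smooth_onD: "smooth_on S f \<Longrightarrow> Ck_on k S f"
  by (simp add: smooth_on_def)

lemma smooth_on_subset: "smooth_on S f \<Longrightarrow> R \<subseteq> S \<Longrightarrow> smooth_on R f"
  unfolding smooth_on_def by (blast intro: Ck_on_subset)

lemma smooth_on_cong:
  "open S \<Longrightarrow> (\<And>x. x \<in> S \<Longrightarrow> f x = g x) \<Longrightarrow> smooth_on S f \<Longrightarrow> smooth_on S g"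
  unfolding smooth_on_def by (blast intro: Ck_on_cong[of S f g])

lemma smooth_on_local:
  "(\<And>x. x \<in> S \<Longrightarrow> \<exists>U. open U \<and> x \<in> U \<and> smooth_on U f) \<Longrightarrow> smooth_on S f"
  unfolding smooth_on_def using Ck_on_local by metis

lemma smooth_on_compose:
  "smooth_on S f \<Longrightarrow> smooth_on R g \<Longrightarrow> f ` S \<subseteq> R \<Longrightarrow> smooth_on S (\<lambda>x. g (f x))"
  unfolding smooth_on_def by (blast intro: Ck_on_compose[of f S R _ g])

lemma smooth_on_const: "smooth_on S (\<lambda>x. c)"
  by (simp add: smooth_on_def Ck_on_const)

lemma smooth_on_bounded_linear: "bounded_linear f \<Longrightarrow> smooth_on S f"
  by (simp add: smooth_on_def Ck_on_bounded_linear)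

lemma smooth_on_Pair: "smooth_on S f \<Longrightarrow> smooth_on S g \<Longrightarrow> smooth_on S (\<lambda>x. (f x, g x))"
  by (simp add: smooth_on_def Ck_on_Pair)

lemma smooth_on_bilinear:
  assumes "bounded_bilinear B" "smooth_on S f" "smooth_on S g"
  shows "smooth_on S (\<lambda>x. B (f x) (g x))"
  using assms(2,3) unfolding smooth_on_def
  by (intro allI Ck_on_bilinear[OF assms(1)]) blast+

lemma smooth_on_add: "smooth_on S f \<Longrightarrow> smooth_on S g \<Longrightarrow> smooth_on S (\<lambda>x. f x + g x)"
  by (simp add: smooth_on_def Ck_on_add)

section \<open>Smooth bump functions\<close>

definition flat_exp :: "nat \<Rightarrow> real \<Rightarrow> real" where
  "flat_exp n s = (if s > 0 then exp (- 1 / s) * (1 / s) ^ n else 0)"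

lemma flat_exp_tendsto: "(flat_exp n \<longlongrightarrow> 0) (at 0)"
proof -
  have "((\<lambda>s. (inverse s)^n / exp (inverse s)) \<longlongrightarrow> 0) (at_right (0::real))"
    by (rule filterlim_compose[OF tendsto_power_div_exp_0 filterlim_inverse_at_top_right])
  then have "(flat_exp n \<longlongrightarrow> 0) (at_right 0)"
  proof (rule Lim_transform_eventually)
    have "(inverse s)^n / exp (inverse s) = flat_exp n s" if "s > 0" for s
      using that by (simp add: flat_exp_def exp_minus divide_inverse mult.commute)
    then show "\<forall>\<^sub>F s in at_right 0. (inverse s)^n / exp (inverse s) = flat_exp n s"
      unfolding eventually_at_filter by (intro always_eventually) auto
  qed
  moreover have "(flat_exp n \<longlongrightarrow> 0) (at_left 0)"
  proof (rule Lim_transform_eventually[OF tendsto_const])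
    show "\<forall>\<^sub>F s in at_left 0. 0 = flat_exp n s"
      unfolding eventually_at_filter by (intro always_eventually) (auto simp: flat_exp_def)
  qed
  ultimately show ?thesis by (simp add: filterlim_split_at)
qed

text \<open>The index \<open>n\<close> is there for this formula: the functions exp(-1/s) s^(-n),
  extended by 0, are closed under differentiation up to linear combinations, so that smoothness is
  one induction for all \<open>n\<close> at once. At 0 the difference quotient of
  \<open>flat_exp n\<close> is \<open>flat_exp (n + 1)\<close>.\<close>

lemma flat_exp_deriv:
  "(flat_exp n has_field_derivative flat_exp (n+2) s - of_nat n * flat_exp (n+1) s) (at s)"
proof -
  consider "s > 0" | "s = 0" | "s < 0" by linarith
  then show ?thesis
  proof cases
    case 1
    have "((\<lambda>s. exp (- inverse s) * (inverse s) ^ n) has_field_derivative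
        (exp (- inverse s) * (inverse s ^ 2) * inverse s ^ n +
         (of_nat n * inverse s ^ (n - 1) * (- (inverse s ^ 2))) * exp (- inverse s))) (at s)"
      using 1 by (auto intro!: derivative_eq_intros simp: power2_eq_square)
    moreover have "(of_nat n * inverse s ^ (n - 1) * (- (inverse s ^ 2))) * exp (- inverse s) =
        - of_nat n * (exp (- inverse s) * inverse s ^ (n+1))"
      by (cases n) (simp_all add: power2_eq_square algebra_simps)
    moreover have "exp (- inverse s) * (inverse s ^ 2) * inverse s ^ n = exp (- inverse s) * inverse s ^ (n+2)"
      by (simp add: power_add power2_eq_square)
    moreover have "exp (- inverse s) * inverse s ^ k = flat_exp k s" for k
      using 1 by (simp add: flat_exp_def divide_inverse)
    ultimately have "((\<lambda>s. exp (- inverse s) * (inverse s) ^ n) has_field_derivative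
        (flat_exp (n+2) s + (- of_nat n * flat_exp (n+1) s))) (at s)"
      by (simp only:)
    then have "((\<lambda>s. exp (- inverse s) * (inverse s) ^ n) has_field_derivative
        (flat_exp (n+2) s - of_nat n * flat_exp (n+1) s)) (at s)"
      by simp
    then show ?thesis
      by (rule has_field_derivative_transform_within_open[of _ _ _ "{0<..}"])
        (use 1 in \<open>auto simp: flat_exp_def divide_inverse\<close>)
  next
    case 2
    have "((\<lambda>h. flat_exp n h / h) \<longlongrightarrow> 0) (at 0)"
    proof (rule Lim_transform_eventually[OF flat_exp_tendsto[of "n+1"]])
      show "\<forall>\<^sub>F h in at 0. flat_exp (n + 1) h = flat_exp n h / h"
        unfolding eventually_at_filter by (intro always_eventually) (auto simp: flat_exp_def)
    qed
    then show ?thesis unfolding 2 DERIV_def by (simp add: flat_exp_def)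
  next
    case 3
    have "((\<lambda>s::real. 0) has_field_derivative
        (flat_exp (n+2) s - of_nat n * flat_exp (n+1) s)) (at s)"
      using 3 by (simp add: flat_exp_def)
    then show ?thesis
      by (rule has_field_derivative_transform_within_open[of _ _ _ "{..<0}"])
        (use 3 in \<open>auto simp: flat_exp_def\<close>)
  qed
qed

lemma smooth_on_flat_exp: "smooth_on S (flat_exp n)"
proof -
  have "Ck_on k UNIV (flat_exp n)" for k
  proof (induction k arbitrary: n)
    case 0
    then show ?case
      using DERIV_isCont[OF flat_exp_deriv] by (simp add: continuous_at_imp_continuous_on)
  next
    case (Suc k)
    have "(flat_exp n has_derivative (\<lambda>v. (flat_exp (n+2) s + (- of_nat n) * flat_exp (n+1) s) * v)) (at s)" for s
      using flat_exp_deriv[of n s] by (simp add: has_field_derivative_def)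
    moreover have "Ck_on k UNIV (\<lambda>s. (flat_exp (n+2) s + (- of_nat n) * flat_exp (n+1) s) * v)" for v
      by (intro Ck_on_bilinear[OF bounded_bilinear_mult] Ck_on_add Suc Ck_on_const)
    ultimately show ?case by (rule Ck_on_SucI)
  qed
  then show ?thesis unfolding smooth_on_def using Ck_on_subset by blast
qed

lemma ex_smooth_bump:
  fixes x0 :: "'a::euclidean_space"
  assumes "\<delta> > 0"
  shows "\<exists>\<beta>::'a \<Rightarrow> real. smooth_on UNIV \<beta> \<and> \<beta> x0 = 1 \<and> (\<forall>x. \<delta> \<le> norm (x - x0) \<longrightarrow> \<beta> x = 0)"
proof -
  \<comment> \<open>The factor in front cancels the value exp(-1/\<delta>^2) at the centre; outside
    the ball the argument of \<open>flat_exp\<close> is not positive.\<close>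
  define \<beta> where "\<beta> x = exp (1 / \<delta>\<^sup>2) * flat_exp 0 (\<delta>\<^sup>2 + (- 1) * ((x + (-x0)) \<bullet> (x + (-x0))))" for x
  have "smooth_on UNIV (\<lambda>x::'a. x + (- x0))"
    by (rule smooth_on_add[OF smooth_on_bounded_linear[OF bounded_linear_ident] smooth_on_const])
  then have "smooth_on UNIV (\<lambda>x. \<delta>\<^sup>2 + (- 1) * ((x + (-x0)) \<bullet> (x + (-x0))))"
    by (intro smooth_on_add smooth_on_const smooth_on_bilinear[OF bounded_bilinear_mult]
      smooth_on_bilinear[OF bounded_bilinear_inner] smooth_on_bounded_linear[OF bounded_linear_ident])
  then have "smooth_on UNIV \<beta>"
    unfolding \<beta>_def
    by (intro smooth_on_bilinear[OF bounded_bilinear_mult] smooth_on_const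
      smooth_on_compose[OF _ smooth_on_flat_exp[of UNIV]]) auto
  moreover have "\<beta> x0 = 1"
    using assms by (simp add: \<beta>_def flat_exp_def exp_minus)
  moreover have "\<beta> x = 0" if "\<delta> \<le> norm (x - x0)" for x
  proof -
    have "\<delta>\<^sup>2 \<le> (norm (x - x0))\<^sup>2" using that assms by (intro power_mono) auto
    then show ?thesis by (simp add: \<beta>_def flat_exp_def power2_norm_eq_inner)
  qed
  ultimately show ?thesis by blast
qed

section \<open>Hadamard's lemma\<close>

lemma scaleR_unit_in_ball:
  fixes x :: "'a::real_normed_vector"
  assumes "x \<in> ball 0 e" "0 \<le> t" "t \<le> 1"
  shows "t *\<^sub>R x \<in> ball 0 e"
proof -
  have "norm (t *\<^sub>R x) \<le> 1 * norm x"
    unfolding norm_scaleR by (rule mult_right_mono) (use assms in auto)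
  then show ?thesis using assms(1) by simp
qed

text \<open>Differentiating \<open>f (t *\<^sub>R x)\<close> in \<open>x\<close> produces another
  factor t, so the induction only closes with an arbitrary power \<open>t ^ j\<close> under the
  integral. The case that is wanted is \<open>j = 0\<close>.\<close>

lemma Ck_on_integral_ray:
  fixes f :: "'a::euclidean_space \<Rightarrow> real"
  shows "Ck_on k (ball 0 e) f \<Longrightarrow>
    Ck_on k (ball 0 e) (\<lambda>x. integral {0..1} (\<lambda>t. t ^ j * f (t *\<^sub>R x)))"
proof (induction k arbitrary: f j)
  case 0
  have "continuous_on (ball 0 e \<times> cbox 0 1) (\<lambda>(x, t). t ^ j * f (t *\<^sub>R x))"
    unfolding case_prod_unfold
  proof (intro continuous_intros continuous_on_compose2[OF 0[simplified]])
    show "(\<lambda>x. snd x *\<^sub>R fst x) ` (ball (0::'a) e \<times> cbox 0 1) \<subseteq> ball 0 e"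
    proof (rule image_subsetI)
      fix p :: "'a \<times> real" assume p: "p \<in> ball 0 e \<times> cbox 0 1"
      show "snd p *\<^sub>R fst p \<in> ball 0 e"
        by (rule scaleR_unit_in_ball) (use p in \<open>simp_all add: mem_Times_iff\<close>)
    qed
  qed
  then show ?case
    using integral_continuous_on_param[of "ball 0 e" "0::real" 1 "\<lambda>x t. t ^ j * f (t *\<^sub>R x)"]
    by (simp only: Ck_on.simps(1) cbox_interval)
next
  case (Suc k)
  obtain f' where f': "\<And>x. x\<in>ball 0 e \<Longrightarrow> (f has_derivative f' x) (at x)"
    and c: "\<And>v. Ck_on k (ball 0 e) (\<lambda>x. f' x v)"
    using Ck_on_SucE[OF Suc.prems] by metis
  have in_ball: "t *\<^sub>R x \<in> ball 0 e" if "x \<in> ball 0 e" "t \<in> cbox 0 1" for x::'a and t::real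
    by (rule scaleR_unit_in_ball) (use that in simp_all)
  \<comment> \<open>\<open>leibniz_rule\<close> wants the derivative as one continuous function into
    the space of bounded linear maps, hence the passage through \<open>Blinfun\<close> and the
    componentwise proof of continuity.\<close>
  define D where "D x t = (t^(j+1)) *\<^sub>R Blinfun (f' (t *\<^sub>R x))" for x and t::real
  have bl: "bounded_linear (f' x)" if "x \<in> ball 0 e" for x
    using f'[OF that] has_derivative_bounded_linear by blast
  have D: "blinfun_apply (D x t) v = t^(j+1) * f' (t *\<^sub>R x) v" if "x \<in> ball 0 e" "t \<in> cbox 0 1" for x v t
    using bl[OF in_ball[OF that]] by (simp add: D_def scaleR_blinfun.rep_eq bounded_linear_Blinfun_apply)
  have cont: "continuous_on (ball 0 e \<times> cbox 0 1) (\<lambda>(x, t). D x t)"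
  proof (rule continuous_on_blinfun_componentwise)
    fix b :: 'a assume "b \<in> Basis"
    have "continuous_on (ball 0 e \<times> cbox 0 1) (\<lambda>p. snd p ^ (j+1) * f' (snd p *\<^sub>R fst p) b)"
      by (intro continuous_intros continuous_on_compose2[OF Ck_on_continuous[OF c]])
        (use in_ball in \<open>auto simp del: mem_ball mem_ball_0\<close>)
    then show "continuous_on (ball 0 e \<times> cbox 0 1) (\<lambda>x. blinfun_apply (case x of (x, t) \<Rightarrow> D x t) b)"
      by (rule continuous_on_eq) (auto simp: D)
  qed
  have fc: "continuous_on (ball 0 e) f" using Suc.prems Ck_on_continuous by blast
  have int: "(\<lambda>t. t ^ j * f (t *\<^sub>R x)) integrable_on cbox 0 1" if "x \<in> ball 0 e" for x
    by (intro integrable_continuous continuous_intros continuous_on_compose2[OF fc])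
      (use in_ball[OF that] in \<open>auto simp del: mem_ball mem_ball_0\<close>)
  define F where "F x v = integral {0..1} (\<lambda>t. t ^ (j+1) * f' (t *\<^sub>R x) v)" for x v
  have "((\<lambda>x. integral {0..1} (\<lambda>t. t ^ j * f (t *\<^sub>R x))) has_derivative F x) (at x)"
    if x: "x \<in> ball 0 e" for x
  proof -
    have "((\<lambda>x. integral (cbox 0 1) (\<lambda>t. t ^ j * f (t *\<^sub>R x))) has_derivative
       integral (cbox 0 1) (D x)) (at x within ball 0 e)"
    proof (rule leibniz_rule[OF _ int cont x convex_ball])
      fix x :: 'a and t :: real assume x: "x \<in> ball 0 e" "t \<in> cbox 0 1"
      have "((\<lambda>x. f (t *\<^sub>R x)) has_derivative (\<lambda>v. f' (t *\<^sub>R x) (t *\<^sub>R v))) (at x)"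
        by (rule has_derivative_compose[of "\<lambda>x. t *\<^sub>R x" "\<lambda>v. t *\<^sub>R v" x UNIV f, OF _ f'[OF in_ball[OF x]]])
          (intro derivative_intros)
      then have "((\<lambda>x. t ^ j * f (t *\<^sub>R x)) has_derivative (\<lambda>v. t^j * f' (t *\<^sub>R x) (t *\<^sub>R v))) (at x)"
        by (rule has_derivative_mult_right)
      moreover have "(\<lambda>v. t^j * f' (t *\<^sub>R x) (t *\<^sub>R v)) = blinfun_apply (D x t)"
        using linear_scale[OF bounded_linear.linear[OF bl[OF in_ball[OF x]]]]
        by (auto simp: D[OF x])
      ultimately show "((\<lambda>x. t ^ j * f (t *\<^sub>R x)) has_derivative blinfun_apply (D x t)) (at x within ball 0 e)"
        using has_derivative_at_withinI by metis
    qed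
    moreover have "blinfun_apply (integral (cbox 0 1) (D x)) = F x"
    proof
      fix v
      have "D x integrable_on cbox 0 1"
      proof (rule integrable_continuous)
        have "continuous_on (cbox 0 1) (\<lambda>t. (\<lambda>(x, t). D x t) (x, t))"
          by (rule continuous_on_compose2[OF cont]) (use x in \<open>auto intro!: continuous_intros\<close>)
        then show "continuous_on (cbox 0 1) (D x)" by simp
      qed
      from integral_linear[OF this, of "\<lambda>B. blinfun_apply B v"]
      have "integral (cbox 0 1) (\<lambda>t. blinfun_apply (D x t) v) = blinfun_apply (integral (cbox 0 1) (D x)) v"
        by (simp add: o_def blinfun.bounded_linear_left)
      moreover have "integral (cbox 0 1) (\<lambda>t. blinfun_apply (D x t) v) = F x v"
        unfolding F_def cbox_interval by (rule integral_cong) (use D[OF x] in \<open>simp add: cbox_interval\<close>)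
      ultimately show "blinfun_apply (integral (cbox 0 1) (D x)) v = F x v" by simp
    qed
    ultimately show ?thesis
      using x by (simp add: cbox_interval at_within_open[OF _ open_ball])
  qed
  moreover have "Ck_on k (ball 0 e) (\<lambda>x. F x v)" for v
    unfolding F_def by (rule Suc.IH) (rule c)
  ultimately show ?case by (rule Ck_on_SucI)
qed

text \<open>The coefficient of a coordinate is the integral of the corresponding partial derivative
  along the ray from 0 to \<open>x\<close>. What matters is that these coefficients are smooth: a
  derivation can be evaluated on the products by the Leibniz rule, which reduces it to its values on
  the coordinates.\<close>

lemma hadamard:
  fixes f :: "'a::euclidean_space \<Rightarrow> real"
  assumes sm: "smooth_on (ball 0 e) f" and "e > 0"
  obtains G where "\<And>b. b \<in> Basis \<Longrightarrow> smooth_on (ball 0 e) (G b)"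
    and "\<And>x. x \<in> ball 0 e \<Longrightarrow> f x = f 0 + (\<Sum>b\<in>Basis. (x \<bullet> b) * G b x)"
    and "(f has_derivative (\<lambda>v. \<Sum>b\<in>Basis. (v \<bullet> b) * G b 0)) (at 0)"
proof -
  have sm2: "\<forall>k. Ck_on (Suc k) (ball 0 e) f" using sm unfolding smooth_on_def by blast
  define f' where "f' x = frechet_derivative f (at x)" for x
  have f': "(f has_derivative f' x) (at x)" if "x \<in> ball 0 e" for x
  proof -
    obtain g where "\<forall>x\<in>ball 0 e. (f has_derivative g x) (at x)"
      using sm2[rule_format, of 0, unfolded Ck_on.simps(2)] by blast
    then have "f differentiable at x" using that unfolding differentiable_def by blast
    then show ?thesis by (simp add: frechet_derivative_works f'_def)
  qed
  have ck: "Ck_on k (ball 0 e) (\<lambda>x. f' x v)" for k v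
  proof -
    obtain g where g: "\<And>x. x \<in> ball 0 e \<Longrightarrow> (f has_derivative g x) (at x)" "Ck_on k (ball 0 e) (\<lambda>x. g x v)"
      using Ck_on_SucE[OF sm2[rule_format, of k]] by metis
    show ?thesis
    proof (rule Ck_on_cong[OF open_ball _ g(2)])
      show "g x v = f' x v" if "x \<in> ball 0 e" for x
        using has_derivative_unique[OF g(1)[OF that] f'[OF that]] by simp
    qed
  qed
  define G where "G b x = integral {0..1} (\<lambda>t. f' (t *\<^sub>R x) b)" for b x
  have in_ball: "t *\<^sub>R x \<in> ball 0 e" if "x \<in> ball 0 e" "t \<in> {0..1}" for x::'a and t::real
    by (rule scaleR_unit_in_ball) (use that in simp_all)
  show ?thesis
  proof
    fix b :: 'a assume "b \<in> Basis"
    show "smooth_on (ball 0 e) (G b)"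
      using Ck_on_integral_ray[OF ck[of _ b], of _ 0] by (simp add: smooth_on_def G_def[abs_def])
  next
    fix x :: 'a assume x: "x \<in> ball 0 e"
    have "((\<lambda>t. f' (t *\<^sub>R x) x) has_integral f (1 *\<^sub>R x) - f (0 *\<^sub>R x)) {0..1}"
    proof (rule fundamental_theorem_of_calculus)
      fix t :: real assume t: "t \<in> {0..1}"
      have "((\<lambda>t. f (t *\<^sub>R x)) has_derivative (\<lambda>h. f' (t *\<^sub>R x) (h *\<^sub>R x))) (at t)"
        by (rule has_derivative_compose[of "\<lambda>t. t *\<^sub>R x" "\<lambda>h. h *\<^sub>R x" t UNIV f, OF _ f'[OF in_ball[OF x t]]])
          (intro derivative_intros)
      then show "((\<lambda>t. f (t *\<^sub>R x)) has_vector_derivative f' (t *\<^sub>R x) x) (at t within {0..1})"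
        unfolding has_vector_derivative_def
        using linear_scale[OF has_derivative_linear[OF f'[OF in_ball[OF x t]]]]
        by (auto intro: has_derivative_at_withinI)
    qed simp
    then have "f x - f 0 = integral {0..1} (\<lambda>t. f' (t *\<^sub>R x) x)"
      by (simp add: integral_unique)
    also have "\<dots> = integral {0..1} (\<lambda>t. \<Sum>b\<in>Basis. (x \<bullet> b) * f' (t *\<^sub>R x) b)"
    proof (rule integral_cong)
      fix t :: real assume t: "t \<in> {0..1}"
      note lin = has_derivative_linear[OF f'[OF in_ball[OF x t]]]
      have "f' (t *\<^sub>R x) x = f' (t *\<^sub>R x) (\<Sum>b\<in>Basis. (x \<bullet> b) *\<^sub>R b)"
        by (simp add: euclidean_representation)
      then show "f' (t *\<^sub>R x) x = (\<Sum>b\<in>Basis. (x \<bullet> b) * f' (t *\<^sub>R x) b)"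
        by (simp add: linear_sum[OF lin] linear_scale[OF lin])
    qed
    also have "\<dots> = (\<Sum>b\<in>Basis. (x \<bullet> b) * G b x)"
    proof (subst integral_sum)
      fix b :: 'a assume "b \<in> Basis"
      have "continuous_on {0..1} (\<lambda>t. f' (t *\<^sub>R x) b)"
        by (rule continuous_on_compose2[OF Ck_on_continuous[OF ck]])
          (use in_ball[OF x] in \<open>auto intro!: continuous_intros\<close>)
      then show "(\<lambda>t. x \<bullet> b * f' (t *\<^sub>R x) b) integrable_on {0..1}"
        by (intro integrable_continuous_real continuous_intros)
    qed (auto simp: G_def)
    finally show "f x = f 0 + (\<Sum>b\<in>Basis. (x \<bullet> b) * G b x)" by simp
  next
    have 0: "(0::'a) \<in> ball 0 e" using assms by simp
    note lin = has_derivative_linear[OF f'[OF 0]]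
    have "f' 0 = (\<lambda>v. \<Sum>b\<in>Basis. (v \<bullet> b) * G b 0)"
    proof
      fix v
      have "f' 0 v = f' 0 (\<Sum>b\<in>Basis. (v \<bullet> b) *\<^sub>R b)"
        by (simp add: euclidean_representation)
      then show "f' 0 v = (\<Sum>b\<in>Basis. (v \<bullet> b) * G b 0)"
        by (simp add: G_def linear_sum[OF lin] linear_scale[OF lin])
    qed
    then show "(f has_derivative (\<lambda>v. \<Sum>b\<in>Basis. (v \<bullet> b) * G b 0)) (at 0)"
      using f'[OF 0] by simp
  qed
qed

section \<open>First derivatives and mixed second differences\<close>

lemma smooth_on_has_derivative:
  assumes "smooth_on S f" "x \<in> S"
  shows "(f has_derivative frechet_derivative f (at x)) (at x)"
proof -
  have "Ck_on (Suc 0) S f" using assms(1) by (rule smooth_onD)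
  then obtain g where "\<forall>x\<in>S. (f has_derivative g x) (at x)"
    unfolding Ck_on.simps(2) by auto
  then have "f differentiable (at x)" using assms(2) unfolding differentiable_def by auto
  then show ?thesis by (simp add: frechet_derivative_works)
qed

lemma smooth_on_continuous: "smooth_on S f \<Longrightarrow> continuous_on S f"
  using Ck_on_continuous[OF smooth_onD[of S f 0]] .

text \<open>Apply the mean value inequality to u \<mapsto> m(u, v) - m(u, v'). Its derivative is a
  difference of derivatives of \<open>m\<close> at two points that are \<open>norm (v - v')\<close>
  apart, and the derivative of a C^2 map is Lipschitz on a compact ball. For the multiplication in a
  chart, specializing some of the points to 0 gives the estimates of products near the
  identity.\<close>

lemma mixed_difference:
  fixes m :: "'e::euclidean_space \<times> 'e \<Rightarrow> 'e"
  assumes m: "Ck_on 2 S m" and S: "open S" "(0, 0) \<in> S"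
  obtains \<rho> C where "\<rho> > 0" "C > 0" "ball 0 \<rho> \<times> ball 0 \<rho> \<subseteq> S"
    "\<And>u u' v v'. u \<in> ball 0 \<rho> \<Longrightarrow> u' \<in> ball 0 \<rho> \<Longrightarrow> v \<in> ball 0 \<rho> \<Longrightarrow> v' \<in> ball 0 \<rho> \<Longrightarrow>
      norm (m (u, v) - m (u, v') - m (u', v) + m (u', v')) \<le> C * norm (u - u') * norm (v - v')"
proof -
  obtain A B where AB: "open A" "open B" "(0, 0) \<in> A \<times> B" "A \<times> B \<subseteq> S"
    using open_prod_elim[OF S] by metis
  obtain r1 where r1: "r1 > 0" "cball 0 r1 \<subseteq> A" using AB open_contains_cball[of A] by auto
  obtain r2 where r2: "r2 > 0" "cball 0 r2 \<subseteq> B" using AB open_contains_cball[of B] by auto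
  define r where "r = min r1 r2"
  have r: "r > 0" "cball 0 r \<times> cball 0 r \<subseteq> S"
    using r1 r2 AB(4) unfolding r_def by auto (meson SigmaI in_mono mem_cball_0)+
  have "Ck_on (Suc 1) S m" using m by (simp add: numeral_2_eq_2)
  then obtain m' where m': "\<And>p. p \<in> S \<Longrightarrow> (m has_derivative m' p) (at p)"
    and ck: "\<And>w. Ck_on 1 S (\<lambda>p. m' p w)"
    by (rule Ck_on_SucE) blast
  have "\<exists>L\<ge>0. \<forall>p\<in>cball 0 r \<times> cball 0 r. \<forall>q\<in>cball 0 r \<times> cball 0 r.
      norm (m' p w - m' q w) \<le> L * norm (p - q)" for w
    by (rule Ck_on_lipschitz[OF ck _ _ r(2)]) (auto intro: compact_Times convex_Times)
  then obtain L where L: "\<And>w. L w \<ge> 0" "\<And>w p q. p \<in> cball 0 r \<times> cball 0 r \<Longrightarrow> q \<in> cball 0 r \<times> cball 0 r \<Longrightarrow>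
      norm (m' p w - m' q w) \<le> L w * norm (p - q)" by metis
  define C where "C = (\<Sum>b\<in>Basis. L (b, 0)) + 1"
  have C: "C > 0" unfolding C_def using L(1) by (intro add_nonneg_pos sum_nonneg) auto
  show ?thesis
  proof (rule that[OF r(1) C])
    show "ball 0 r \<times> ball 0 r \<subseteq> S" using r(2) by (meson Sigma_mono ball_subset_cball subset_trans)
  next
    fix u u' v v' :: 'e
    assume uv: "u \<in> ball 0 r" "u' \<in> ball 0 r" "v \<in> ball 0 r" "v' \<in> ball 0 r"
    define h where "h x = m (x, v) - m (x, v')" for x
    define h' where "h' x w = m' (x, v) (w, 0) - m' (x, v') (w, 0)" for x w
    have "(h has_derivative h' x) (at x within cball 0 r)" if "x \<in> cball 0 r" for x
    proof -
      have *: "((\<lambda>x. m (x, v)) has_derivative (\<lambda>w. m' (x, v) (w, 0))) (at x)" if "v \<in> cball 0 r" for v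
      proof -
        have "(x, v) \<in> S" using r(2) \<open>x \<in> cball 0 r\<close> that by blast
        then have "(m has_derivative m' (x, v)) (at (x, v))" by (rule m')
        moreover have "((\<lambda>x. (x, v)) has_derivative (\<lambda>w. (w, 0))) (at x)"
          by (intro derivative_intros)
        ultimately show ?thesis
          using has_derivative_compose[of "\<lambda>x. (x, v)" "\<lambda>w. (w, 0)" x UNIV m "m' (x, v)"] by simp
      qed
      show ?thesis unfolding h_def h'_def
        by (rule has_derivative_at_withinI[OF has_derivative_diff[OF *[of v] *[of v']]]) (use uv in auto)
    qed
    moreover have "onorm (h' x) \<le> C * norm (v - v')" if x: "x \<in> cball 0 r" for x
    proof (rule onorm_bound)
      show "0 \<le> C * norm (v - v')" using C by simp
      fix w :: 'e
      have xv: "(x, v) \<in> cball 0 r \<times> cball 0 r" "(x, v') \<in> cball 0 r \<times> cball 0 r" using x uv by auto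
      have lin: "linear (m' (x, v))" "linear (m' (x, v'))"
        by (rule has_derivative_linear[OF m'[OF subsetD[OF r(2) xv(1)]]]
            has_derivative_linear[OF m'[OF subsetD[OF r(2) xv(2)]]])+
      have emb: "linear (\<lambda>w::'e. (w, 0::'e))" by (rule linearI) auto
      have lin': "linear (h' x)"
        unfolding h'_def
        using linear_compose_sub[OF linear_compose[OF emb lin(1)] linear_compose[OF emb lin(2)]]
        by (simp add: o_def)
      have "h' x w = h' x (\<Sum>b\<in>Basis. (w \<bullet> b) *\<^sub>R b)" by (simp add: euclidean_representation)
      also have "\<dots> = (\<Sum>b\<in>Basis. (w \<bullet> b) *\<^sub>R h' x b)"
        by (simp add: linear_sum[OF lin'] linear_scale[OF lin'])
      also have "norm \<dots> \<le> (\<Sum>b\<in>Basis. norm w * (L (b, 0) * norm (v - v')))"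
      proof (rule sum_norm_le)
        fix b :: 'e assume b: "b \<in> Basis"
        have "norm (h' x b) \<le> L (b, 0) * norm (v - v')"
          using L(2)[OF xv, of "(b, 0)"] by (simp add: h'_def)
        then show "norm ((w \<bullet> b) *\<^sub>R h' x b) \<le> norm w * (L (b, 0) * norm (v - v'))"
          using Basis_le_norm[OF b, of w] by (auto intro!: mult_mono)
      qed
      also have "\<dots> = (\<Sum>b\<in>Basis. L (b, 0)) * norm (v - v') * norm w"
        by (simp add: sum_distrib_left sum_distrib_right mult_ac)
      also have "\<dots> \<le> C * norm (v - v') * norm w"
        unfolding C_def by (intro mult_right_mono) auto
      finally show "norm (h' x w) \<le> C * norm (v - v') * norm w" .
    qed
    ultimately have "norm (h u - h u') \<le> C * norm (v - v') * norm (u - u')"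
      by (rule differentiable_bound[OF convex_cball[of 0 r]]) (use uv in auto)
    then show "norm (m (u, v) - m (u, v') - m (u', v) + m (u', v')) \<le> C * norm (u - u') * norm (v - v')"
      by (simp add: h_def algebra_simps)
  qed
qed

section \<open>Charts of a compact Lie group\<close>

locale smooth_atlas_on =
  fixes T :: "'a topology" and A :: "('a, 'e::euclidean_space) atlas"
  assumes smooth_atlas: "smooth_atlas T A"
begin

lemma chart:
  assumes "(U, \<phi>) \<in> A"
  shows "openin T U" "open (\<phi> ` U)" "inj_on \<phi> U" "U \<subseteq> topspace T"
    "continuous_map (subtopology T U) euclidean \<phi>"
    "continuous_map (top_of_set (\<phi> ` U)) T (inv_into U \<phi>)"
    "\<And>V. openin T V \<Longrightarrow> open (\<phi> ` (U \<inter> V))"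
proof -
  have *: "openin T U" "open (\<phi> ` U)" and
    h: "homeomorphic_map (subtopology T U) (top_of_set (\<phi> ` U)) \<phi>"
    using smooth_atlas assms unfolding smooth_atlas_def by auto
  show "openin T U" "open (\<phi> ` U)" by fact+
  show sub: "U \<subseteq> topspace T" using *(1) by (rule openin_subset)
  then have top: "topspace (subtopology T U) = U" by auto
  show inj: "inj_on \<phi> U" using h homeomorphic_imp_injective_map top by metis
  show "continuous_map (subtopology T U) euclidean \<phi>"
    using homeomorphic_imp_continuous_map[OF h] continuous_map_in_subtopology by blast
  obtain g where g: "homeomorphic_maps (subtopology T U) (top_of_set (\<phi> ` U)) \<phi> g"
    using h homeomorphic_map_maps by blast
  have "continuous_map (top_of_set (\<phi> ` U)) T g"
    using g unfolding homeomorphic_maps_def continuous_map_in_subtopology by blast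
  moreover have "g y = inv_into U \<phi> y" if "y \<in> topspace (top_of_set (\<phi> ` U))" for y
    using g that inj unfolding homeomorphic_maps_def top by auto
  ultimately show "continuous_map (top_of_set (\<phi> ` U)) T (inv_into U \<phi>)"
    by (rule continuous_map_eq)
  fix V assume "openin T V"
  then have "openin (subtopology T U) (U \<inter> V)" by (simp add: openin_subtopology_Int2 Int_commute)
  then have "openin (top_of_set (\<phi> ` U)) (\<phi> ` (U \<inter> V))"
    using homeomorphic_imp_open_map[OF h] unfolding open_map_def by blast
  then show "open (\<phi> ` (U \<inter> V))" using *(2) openin_open_trans by blast
qed

lemma inv_into_chart:
  assumes "(U, \<phi>) \<in> A"
  shows "x \<in> U \<Longrightarrow> inv_into U \<phi> (\<phi> x) = x"
    "u \<in> \<phi> ` U \<Longrightarrow> inv_into U \<phi> u \<in> U \<and> \<phi> (inv_into U \<phi> u) = u"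
  using chart(3)[OF assms] by (auto simp: inv_into_into f_inv_into_f)

lemma chart_at: "x \<in> topspace T \<Longrightarrow> \<exists>U \<phi>. (U, \<phi>) \<in> A \<and> x \<in> U"
  using smooth_atlas unfolding smooth_atlas_def by blast

lemma chart_transition:
  "(U, \<phi>) \<in> A \<Longrightarrow> (V, \<psi>) \<in> A \<Longrightarrow> smooth_on (\<phi> ` (U \<inter> V)) (\<lambda>u. \<psi> (inv_into U \<phi> u))"
  using smooth_atlas unfolding smooth_atlas_def o_def by fast

lemma openin_preimage_chart:
  assumes "(U, \<phi>) \<in> A" "continuous_map T X f" "openin X V"
  shows "openin T {x \<in> U. f x \<in> V}"
proof -
  have "openin T {x \<in> topspace T. f x \<in> V}" using assms(2,3) openin_continuous_map_preimage by blast
  moreover have "{x \<in> U. f x \<in> V} = U \<inter> {x \<in> topspace T. f x \<in> V}"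
    using chart(4)[OF assms(1)] by auto
  ultimately show ?thesis using chart(1)[OF assms(1)] by (simp add: openin_Int)
qed

text \<open>Continuity, which \<open>smooth_map\<close> asks for separately, is inherited from
  smoothness in the charts, because charts are homeomorphisms onto open sets and cover the
  space.\<close>

lemma smooth_functions_iff:
  "f \<in> smooth_functions T A \<longleftrightarrow> (\<forall>(U, \<phi>)\<in>A. smooth_on (\<phi> ` U) (\<lambda>u. f (inv_into U \<phi> u)))"
  (is "?l \<longleftrightarrow> ?r")
proof
  assume ?l
  then show ?r unfolding smooth_functions_def smooth_map_def by (auto simp: o_def)
next
  assume r: ?r
  have "continuous_map T euclideanreal f"
    unfolding continuous_map_eq_topcontinuous_at topcontinuous_at_def
  proof (intro ballI conjI allI impI)
    fix x V assume x: "x \<in> topspace T" and V: "openin euclideanreal V \<and> f x \<in> V"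
    obtain U \<phi> where U: "(U, \<phi>) \<in> A" "x \<in> U" using chart_at[OF x] by auto
    have sm: "smooth_on (\<phi> ` U) (\<lambda>u. f (inv_into U \<phi> u))" using r U by auto
    have "continuous_map (top_of_set (\<phi> ` U)) euclideanreal (\<lambda>u. f (inv_into U \<phi> u))"
      using smooth_on_continuous[OF sm] by simp
    moreover have "continuous_map (subtopology T U) (top_of_set (\<phi> ` U)) \<phi>"
      using chart(5)[OF U(1)] by (simp add: continuous_map_in_subtopology image_subset_iff)
    ultimately have "continuous_map (subtopology T U) euclideanreal (\<lambda>x. f (inv_into U \<phi> (\<phi> x)))"
      using continuous_map_compose unfolding o_def by blast
    then have "continuous_map (subtopology T U) euclideanreal f"
      by (rule continuous_map_eq) (use inv_into_chart[OF U(1)] in auto)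
    then have "openin (subtopology T U) {y \<in> topspace (subtopology T U). f y \<in> V}"
      using V openin_continuous_map_preimage by blast
    then have "openin T {y \<in> topspace (subtopology T U). f y \<in> V}"
      using chart(1)[OF U(1)] openin_trans_full by blast
    then show "\<exists>W. openin T W \<and> x \<in> W \<and> (\<forall>y\<in>W. f y \<in> V)"
      using x U V by (intro exI[of _ "{y \<in> topspace (subtopology T U). f y \<in> V}"]) auto
  qed auto
  then show ?l using r unfolding smooth_functions_def smooth_map_def by (auto simp: o_def)
qed

lemma smooth_functions_chart:
  "f \<in> smooth_functions T A \<Longrightarrow> (U, \<phi>) \<in> A \<Longrightarrow> smooth_on (\<phi> ` U) (\<lambda>u. f (inv_into U \<phi> u))"
  unfolding smooth_functions_iff by auto

lemma smooth_functions_const: "(\<lambda>x. c) \<in> smooth_functions T A"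
  unfolding smooth_functions_iff by (auto simp: smooth_on_const)

lemma smooth_functions_add:
  "f \<in> smooth_functions T A \<Longrightarrow> h \<in> smooth_functions T A \<Longrightarrow> (\<lambda>x. f x + h x) \<in> smooth_functions T A"
  unfolding smooth_functions_iff by (auto intro!: smooth_on_add)

lemma smooth_functions_mult:
  "f \<in> smooth_functions T A \<Longrightarrow> h \<in> smooth_functions T A \<Longrightarrow> (\<lambda>x. f x * h x) \<in> smooth_functions T A"
  unfolding smooth_functions_iff by (auto intro!: smooth_on_bilinear[OF bounded_bilinear_mult])

lemma smooth_functions_sum:
  "(\<And>i. i \<in> I \<Longrightarrow> f i \<in> smooth_functions T A) \<Longrightarrow> (\<lambda>x. \<Sum>i\<in>I. f i x) \<in> smooth_functions T A"
  by (induction I rule: infinite_finite_induct)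
    (auto intro: smooth_functions_const smooth_functions_add)

lemma smooth_functions_compose:
  assumes f: "f \<in> smooth_functions T A" and h: "smooth_map T A T A h"
  shows "(\<lambda>x. f (h x)) \<in> smooth_functions T A"
  unfolding smooth_functions_iff
proof (clarify)
  fix U \<phi> assume U: "(U, \<phi>) \<in> A"
  have hc: "continuous_map T T h" using h unfolding smooth_map_def by auto
  show "smooth_on (\<phi> ` U) (\<lambda>u. f (h (inv_into U \<phi> u)))"
  proof (rule smooth_on_local)
    fix u assume u: "u \<in> \<phi> ` U"
    define x where "x = inv_into U \<phi> u"
    have x: "x \<in> U" "\<phi> x = u" using inv_into_chart(2)[OF U u] by (auto simp: x_def)
    have "h x \<in> topspace T" using hc x(1) chart(4)[OF U] by (auto simp: continuous_map_def)
    then obtain V \<psi> where V: "(V, \<psi>) \<in> A" "h x \<in> V" using chart_at by metis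
    define N where "N = {x \<in> U. h x \<in> V}"
    have N: "openin T N" unfolding N_def by (rule openin_preimage_chart[OF U hc chart(1)[OF V(1)]])
    have oN: "open (\<phi> ` N)" using chart(7)[OF U N] unfolding N_def
      by (metis (no_types, lifting) Int_absorb1 mem_Collect_eq subsetI)
    have "smooth_on (\<phi> ` N) (\<lambda>u. \<psi> (h (inv_into U \<phi> u)))"
      using h U V(1) unfolding smooth_map_def N_def o_def by fast
    moreover have "(\<lambda>u. \<psi> (h (inv_into U \<phi> u))) ` \<phi> ` N \<subseteq> \<psi> ` V"
      using inv_into_chart(1)[OF U] by (auto simp: N_def)
    ultimately have "smooth_on (\<phi> ` N) (\<lambda>u. f (inv_into V \<psi> (\<psi> (h (inv_into U \<phi> u)))))"
      by (rule smooth_on_compose[OF _ smooth_functions_chart[OF f V(1)]])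
    then have "smooth_on (\<phi> ` N) (\<lambda>u. f (h (inv_into U \<phi> u)))"
      by (rule smooth_on_cong[OF oN, rotated])
        (use inv_into_chart(1)[OF U] inv_into_chart(1)[OF V(1)] in \<open>auto simp: N_def\<close>)
    then show "\<exists>W. open W \<and> u \<in> W \<and> smooth_on W (\<lambda>u. f (h (inv_into U \<phi> u)))"
      using oN x V by (intro exI[of _ "\<phi> ` N"]) (auto simp: N_def)
  qed
qed

end

section \<open>Multiplication and translations in charts\<close>

context lie_group
begin

sublocale smooth_atlas_on T A
  by unfold_locales (rule atlas)

lemma continuous_mult: "continuous_map (prod_topology T T) T (\<lambda>(x, y). x \<otimes> y)"
  using smooth_mult unfolding smooth_map_def by blast

lemma continuous_inv: "continuous_map T T (\<lambda>x. inv x)"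
  using smooth_inv unfolding smooth_map_def by blast

text \<open>A chart of \<open>prod_atlas\<close> is a \<open>map_prod\<close>, and its inverse is
  the pair of the inverses. This turns the smoothness assumption on the multiplication into a
  statement about an open set of pairs of coordinates.\<close>

lemma smooth_mult_charts:
  assumes U: "(U, \<phi>) \<in> A" and V: "(V, \<psi>) \<in> A" and W: "(W, \<eta>) \<in> A"
  shows "open {(u, v) \<in> \<phi> ` U \<times> \<psi> ` V. inv_into U \<phi> u \<otimes> inv_into V \<psi> v \<in> W}" (is "open ?O")
    and "smooth_on {(u, v) \<in> \<phi> ` U \<times> \<psi> ` V. inv_into U \<phi> u \<otimes> inv_into V \<psi> v \<in> W}
      (\<lambda>(u, v). \<eta> (inv_into U \<phi> u \<otimes> inv_into V \<psi> v))"
proof -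
  have "continuous_map (prod_topology (top_of_set (\<phi> ` U)) (top_of_set (\<psi> ` V))) (prod_topology T T)
      (\<lambda>(u, v). (inv_into U \<phi> u, inv_into V \<psi> v))"
    unfolding continuous_map_prod_top using chart(6)[OF U] chart(6)[OF V] by auto
  from continuous_map_compose[OF this continuous_mult]
  have "continuous_map (prod_topology (top_of_set (\<phi> ` U)) (top_of_set (\<psi> ` V))) T
      (\<lambda>(u, v). inv_into U \<phi> u \<otimes> inv_into V \<psi> v)"
    by (simp add: o_def case_prod_unfold)
  moreover have "prod_topology (top_of_set (\<phi> ` U)) (top_of_set (\<psi> ` V)) = top_of_set (\<phi> ` U \<times> \<psi> ` V)"
    by (simp add: prod_topology_subtopology_eu)
  ultimately have c: "continuous_map (top_of_set (\<phi> ` U \<times> \<psi> ` V)) T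
      (\<lambda>(u, v). inv_into U \<phi> u \<otimes> inv_into V \<psi> v)"
    by simp
  have "openin (top_of_set (\<phi> ` U \<times> \<psi> ` V)) ?O"
  proof -
    have "?O = {p \<in> topspace (top_of_set (\<phi> ` U \<times> \<psi> ` V)). (case p of (u, v) \<Rightarrow> inv_into U \<phi> u \<otimes> inv_into V \<psi> v) \<in> W}"
      by auto
    then show ?thesis using openin_continuous_map_preimage[OF c chart(1)[OF W]] by presburger
  qed
  moreover have "open (\<phi> ` U \<times> \<psi> ` V)" using chart(2)[OF U] chart(2)[OF V] by (rule open_Times)
  ultimately show op: "open ?O" using openin_open_trans by blast
  have UV: "(U \<times> V, map_prod \<phi> \<psi>) \<in> prod_atlas A A" unfolding prod_atlas_def using U V by blast
  define F where "F = \<eta> \<circ> (\<lambda>(x, y). x \<otimes> y) \<circ> inv_into (U \<times> V) (map_prod \<phi> \<psi>)"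
  have sm: "smooth_on (map_prod \<phi> \<psi> ` {p \<in> U \<times> V. (case p of (x, y) \<Rightarrow> x \<otimes> y) \<in> W}) F"
    using smooth_mult UV W unfolding smooth_map_def F_def by fast
  have inj: "inj_on (map_prod \<phi> \<psi>) (U \<times> V)"
    using chart(3)[OF U] chart(3)[OF V] by (auto simp: inj_on_def)
  have inv: "inv_into (U \<times> V) (map_prod \<phi> \<psi>) (u, v) = (inv_into U \<phi> u, inv_into V \<psi> v)"
    if "u \<in> \<phi> ` U" "v \<in> \<psi> ` V" for u v
    by (rule inv_into_f_eq[OF inj]) (use that inv_into_chart(2)[OF U] inv_into_chart(2)[OF V] in auto)
  have "smooth_on ?O F"
  proof (rule smooth_on_subset[OF sm], rule subsetI)
    fix p assume "p \<in> ?O"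
    then obtain u v where p: "p = (u, v)" "u \<in> \<phi> ` U" "v \<in> \<psi> ` V" "inv_into U \<phi> u \<otimes> inv_into V \<psi> v \<in> W"
      by auto
    then show "p \<in> map_prod \<phi> \<psi> ` {p \<in> U \<times> V. (case p of (x, y) \<Rightarrow> x \<otimes> y) \<in> W}"
      using inv_into_chart(2)[OF U p(2)] inv_into_chart(2)[OF V p(3)]
      by (intro image_eqI[of _ _ "(inv_into U \<phi> u, inv_into V \<psi> v)"]) auto
  qed
  then show "smooth_on ?O (\<lambda>(u, v). \<eta> (inv_into U \<phi> u \<otimes> inv_into V \<psi> v))"
    by (rule smooth_on_cong[OF op, rotated]) (auto simp: F_def inv)
qed

lemma continuous_translations:
  assumes g: "g \<in> carrier G"
  shows "continuous_map T T (\<lambda>x. g \<otimes> x)" "continuous_map T T (\<lambda>x. x \<otimes> g)"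
proof -
  have "continuous_map T (prod_topology T T) (\<lambda>x. (g, x))" "continuous_map T (prod_topology T T) (\<lambda>x. (x, g))"
    using g by (auto intro!: continuous_map_pairedI simp: topspace_eq)
  from this[THEN continuous_map_compose[OF _ continuous_mult]]
  show "continuous_map T T (\<lambda>x. g \<otimes> x)" "continuous_map T T (\<lambda>x. x \<otimes> g)"
    by (simp_all add: o_def)
qed

lemma smooth_translations:
  assumes g: "g \<in> carrier G"
  shows "smooth_map T A T A (\<lambda>x. g \<otimes> x)" "smooth_map T A T A (\<lambda>x. x \<otimes> g)"
proof -
  obtain V \<psi> where V: "(V, \<psi>) \<in> A" "g \<in> V" using chart_at g topspace_eq by metis
  note cl = continuous_translations[OF g]
  have "smooth_on (\<phi> ` {x \<in> U. g \<otimes> x \<in> W}) (\<lambda>u. \<eta> (g \<otimes> inv_into U \<phi> u))"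
     "smooth_on (\<phi> ` {x \<in> U. x \<otimes> g \<in> W}) (\<lambda>u. \<eta> (inv_into U \<phi> u \<otimes> g))"
    if U: "(U, \<phi>) \<in> A" and W: "(W, \<eta>) \<in> A" for U \<phi> W \<eta>
  proof -
    have "smooth_on (\<phi> ` {x \<in> U. g \<otimes> x \<in> W})
        (\<lambda>u. (\<lambda>(u, v). \<eta> (inv_into V \<psi> u \<otimes> inv_into U \<phi> v)) (\<psi> g, u))"
      by (rule smooth_on_compose[OF _ smooth_mult_charts(2)[OF V(1) U W]])
        (use V(2) inv_into_chart(1)[OF V(1)] inv_into_chart(1)[OF U] in
          \<open>auto intro!: smooth_on_Pair smooth_on_const smooth_on_bounded_linear[OF bounded_linear_ident]\<close>)
    then show "smooth_on (\<phi> ` {x \<in> U. g \<otimes> x \<in> W}) (\<lambda>u. \<eta> (g \<otimes> inv_into U \<phi> u))"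
      using inv_into_chart(1)[OF V] by simp
    have "smooth_on (\<phi> ` {x \<in> U. x \<otimes> g \<in> W})
        (\<lambda>u. (\<lambda>(u, v). \<eta> (inv_into U \<phi> u \<otimes> inv_into V \<psi> v)) (u, \<psi> g))"
      by (rule smooth_on_compose[OF _ smooth_mult_charts(2)[OF U V(1) W]])
        (use V(2) inv_into_chart(1)[OF V(1)] inv_into_chart(1)[OF U] in
          \<open>auto intro!: smooth_on_Pair smooth_on_const smooth_on_bounded_linear[OF bounded_linear_ident]\<close>)
    then show "smooth_on (\<phi> ` {x \<in> U. x \<otimes> g \<in> W}) (\<lambda>u. \<eta> (inv_into U \<phi> u \<otimes> g))"
      using inv_into_chart(1)[OF V] by simp
  qed
  then show "smooth_map T A T A (\<lambda>x. g \<otimes> x)" "smooth_map T A T A (\<lambda>x. x \<otimes> g)"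
    unfolding smooth_map_def o_def using cl by auto
qed

lemma smooth_functions_conj:
  assumes f: "f \<in> smooth_functions T A" and g: "g \<in> carrier G"
  shows "(\<lambda>x. f (g \<otimes> x \<otimes> inv g)) \<in> smooth_functions T A"
  using smooth_functions_compose[OF smooth_functions_compose[OF f smooth_translations(2)[of "inv g"]]
      smooth_translations(1)[OF g]] g by simp

end

section \<open>The Lie algebra in a chart at the identity\<close>

locale lie_group_chart = lie_group G T A
  for G :: "('g, 'u) monoid_scheme" (structure) and T :: "'g topology"
    and A :: "('g, 'e::euclidean_space) atlas" +
  fixes U :: "'g set" and \<phi> :: "'g \<Rightarrow> 'e"
  assumes U_chart: "(U, \<phi>) \<in> A" and one_U: "\<one> \<in> U"
begin

text \<open>The chart is translated so that the identity becomes the origin. In these coordinates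
  the product near the identity is the sum, up to an error bounded by the product of the
  norms.\<close>

definition psi :: "'g \<Rightarrow> 'e" where "psi x = \<phi> x - \<phi> \<one>"
definition theta :: "'e \<Rightarrow> 'g" where "theta u = inv_into U \<phi> (u + \<phi> \<one>)"

lemma psi_image: "psi ` U = (\<lambda>v. v - \<phi> \<one>) ` \<phi> ` U"
  by (auto simp: psi_def)

lemma psi_one [simp]: "psi \<one> = 0"
  by (simp add: psi_def)

lemma theta_psi [simp]: "x \<in> U \<Longrightarrow> theta (psi x) = x"
  using inv_into_chart(1)[OF U_chart] by (simp add: theta_def psi_def)

lemma psi_theta: "u \<in> psi ` U \<Longrightarrow> theta u \<in> U \<and> psi (theta u) = u"
  by auto

lemma theta_zero [simp]: "theta 0 = \<one>"
  using theta_psi[OF one_U] by simp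

lemma mem_psi_image: "u \<in> psi ` U \<longleftrightarrow> u + \<phi> \<one> \<in> \<phi> ` U"
  unfolding psi_image by (auto simp: image_iff) (metis add_diff_cancel_right')

lemma open_psi_image: "openin T V \<Longrightarrow> open (psi ` (U \<inter> V))"
proof -
  assume "openin T V"
  then have "open ((\<lambda>v. v - \<phi> \<one>) ` \<phi> ` (U \<inter> V))"
    using chart(7)[OF U_chart] open_translation_subtract by blast
  moreover have "(\<lambda>v. v - \<phi> \<one>) ` \<phi> ` (U \<inter> V) = psi ` (U \<inter> V)"
    by (auto simp: psi_def)
  ultimately show ?thesis by simp
qed

lemma open_psi_U: "open (psi ` U)"
  using open_psi_image[OF chart(1)[OF U_chart]] by simp

lemma continuous_psi: "continuous_map (subtopology T U) euclidean psi"
  unfolding psi_def by (intro continuous_intros chart(5)[OF U_chart])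

lemma smooth_shift: "smooth_on S (\<lambda>u. u + \<phi> \<one>)" "smooth_on S (\<lambda>u. u - \<phi> \<one>)"
  using smooth_on_add[OF smooth_on_bounded_linear[OF bounded_linear_ident] smooth_on_const[of _ "\<phi> \<one>"]]
    smooth_on_add[OF smooth_on_bounded_linear[OF bounded_linear_ident] smooth_on_const[of _ "- \<phi> \<one>"]] by simp_all

lemma continuous_theta: "continuous_map (top_of_set (psi ` U)) T theta"
proof -
  have "continuous_map (top_of_set (psi ` U)) (top_of_set (\<phi> ` U)) (\<lambda>u. u + \<phi> \<one>)"
    by (auto simp: mem_psi_image intro!: continuous_intros)
  from continuous_map_compose[OF this chart(6)[OF U_chart]] show ?thesis
    by (simp add: o_def theta_def[abs_def])
qed

lemma smooth_functions_theta:
  assumes "f \<in> smooth_functions T A"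
  shows "smooth_on (psi ` U) (\<lambda>u. f (theta u))"
  unfolding theta_def
  by (rule smooth_on_compose[OF smooth_shift(1) smooth_functions_chart[OF assms U_chart]])
    (auto simp: psi_def)

lemma zero_psi_U: "0 \<in> psi ` U"
  using one_U by (intro image_eqI[of _ _ \<one>]) auto

text \<open>This identifies the model space with the tangent space at the identity. The default 0 is
  the value that \<open>lie_algebra\<close> prescribes off \<open>smooth_functions\<close>.\<close>

definition J :: "'e \<Rightarrow> ('g \<Rightarrow> real) \<Rightarrow> real" where
  "J v f = (if f \<in> smooth_functions T A then frechet_derivative (\<lambda>u. f (theta u)) (at 0) v else 0)"

lemma smooth_functions_has_derivative:
  assumes "f \<in> smooth_functions T A"
  shows "((\<lambda>u. f (theta u)) has_derivative (\<lambda>v. J v f)) (at 0)"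
  using smooth_on_has_derivative[OF smooth_functions_theta[OF assms] zero_psi_U] assms
  by (simp add: J_def)

lemma J_eqI:
  assumes "f \<in> smooth_functions T A" "((\<lambda>u. f (theta u)) has_derivative f') (at 0)"
  shows "J v f = f' v"
  using has_derivative_unique[OF smooth_functions_has_derivative[OF assms(1)] assms(2)] by metis

lemma J_add: "J (v + w) = (\<lambda>f. J v f + J w f)" and J_scale: "J (c *\<^sub>R v) = (\<lambda>f. c * J v f)"
proof -
  have lin: "linear (\<lambda>v. J v f)" for f
  proof (cases "f \<in> smooth_functions T A")
    case True
    then show ?thesis using smooth_functions_has_derivative has_derivative_linear by blast
  next
    case False
    then show ?thesis by (auto simp: J_def intro!: linearI)
  qed
  show "J (v + w) = (\<lambda>f. J v f + J w f)" "J (c *\<^sub>R v) = (\<lambda>f. c * J v f)"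
    using linear_add[OF lin] linear_scale[OF lin] by auto
qed

lemma J_in_lie_algebra: "J v \<in> lie_algebra G T A"
proof -
  have "J v (\<lambda>x. f x + h x) = J v f + J v h \<and> J v (\<lambda>x. f x * h x) = f \<one> * J v h + h \<one> * J v f"
    if f: "f \<in> smooth_functions T A" and h: "h \<in> smooth_functions T A" for f h
  proof -
    note df = smooth_functions_has_derivative[OF f] and dh = smooth_functions_has_derivative[OF h]
    have "J v (\<lambda>x. f x + h x) = J v f + J v h"
      by (rule J_eqI[OF smooth_functions_add[OF f h] has_derivative_add[OF df dh]])
    moreover have "J v (\<lambda>x. f x * h x) = f (theta 0) * J v h + J v f * h (theta 0)"
      by (rule J_eqI[OF smooth_functions_mult[OF f h] has_derivative_mult[OF df dh]])
    ultimately show ?thesis by (simp add: mult.commute)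
  qed
  moreover have "J v (\<lambda>x. c * f x) = c * J v f" if f: "f \<in> smooth_functions T A" for f c
    by (rule J_eqI[OF smooth_functions_mult[OF smooth_functions_const f]
          has_derivative_mult_right[OF smooth_functions_has_derivative[OF f]]])
  ultimately show ?thesis unfolding lie_algebra_def by (auto simp: J_def)
qed

text \<open>Group identities hold on the carrier only, so functions that agree there must be
  interchangeable even if their values elsewhere differ.\<close>

lemma smooth_functions_cong:
  assumes f: "f \<in> smooth_functions T A" and eq: "\<And>x. x \<in> carrier G \<Longrightarrow> f x = f' x"
  shows "f' \<in> smooth_functions T A"
  unfolding smooth_functions_iff
proof clarify
  fix V \<eta> assume V: "(V, \<eta>) \<in> A"
  show "smooth_on (\<eta> ` V) (\<lambda>u. f' (inv_into V \<eta> u))"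
    by (rule smooth_on_cong[OF chart(2)[OF V] _ smooth_functions_chart[OF f V]])
      (use eq inv_into_chart(2)[OF V] chart(4)[OF V] topspace_eq in blast)
qed

lemma J_cong:
  assumes eq: "\<And>x. x \<in> carrier G \<Longrightarrow> f x = f' x"
  shows "J v f = J v f'"
proof (cases "f \<in> smooth_functions T A")
  case True
  have "((\<lambda>u. f' (theta u)) has_derivative (\<lambda>v. J v f)) (at 0)"
    by (rule has_derivative_transform_within_open[OF smooth_functions_has_derivative[OF True] open_psi_U zero_psi_U])
      (use eq psi_theta chart(4)[OF U_chart] topspace_eq in blast)
  then show ?thesis using J_eqI[OF smooth_functions_cong[OF True eq]] by metis
next
  case False
  then have "f' \<notin> smooth_functions T A" using smooth_functions_cong[of f' f] eq by metis
  then show ?thesis using False by (simp add: J_def)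
qed

text \<open>The bump is later known to be 1 at the origin only, not near it. Its derivative
  therefore appears in the computations and has to cancel.\<close>

definition ext :: "('e \<Rightarrow> real) \<Rightarrow> ('e \<Rightarrow> real) \<Rightarrow> 'g \<Rightarrow> real" where
  "ext \<beta> h x = (if x \<in> U then \<beta> (psi x) * h (psi x) else 0)"

lemma openin_psi_ball: "openin T {x \<in> U. psi x \<in> ball 0 e}"
proof -
  have "openin (subtopology T U) {y \<in> topspace (subtopology T U). psi y \<in> ball 0 e}"
    by (rule openin_continuous_map_preimage[OF continuous_psi]) simp
  moreover have "{y \<in> topspace (subtopology T U). psi y \<in> ball 0 e} = {x \<in> U. psi x \<in> ball 0 e}"
    using chart(4)[OF U_chart] by auto
  ultimately show ?thesis using chart(1)[OF U_chart] openin_trans_full by metis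
qed

text \<open>The difficulty is the edge of the chart. As \<open>T\<close> is Hausdorff, the compact
  set \<open>K\<close> that contains the support of the bump is closed, so the function is 0 on the
  open complement of \<open>K\<close>. The radius \<open>e\<close>, twice that of \<open>K\<close>,
  leaves room for an open set around \<open>K\<close> on which the formula in the chart
  applies.\<close>

lemma smooth_ext:
  assumes e: "0 < e" "cball 0 e \<subseteq> psi ` U" and \<beta>: "smooth_on UNIV \<beta>" "\<And>u. e / 2 \<le> norm u \<Longrightarrow> \<beta> u = 0"
    and h: "smooth_on (ball 0 e) h"
  shows "ext \<beta> h \<in> smooth_functions T A"
  unfolding smooth_functions_iff
proof clarify
  fix V \<eta> assume V: "(V, \<eta>) \<in> A"
  define K where "K = theta ` cball 0 (e/2)"
  have sub: "cball 0 (e/2) \<subseteq> psi ` U" using e by (auto intro: subset_trans[OF _ e(2)])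
  have "compactin (top_of_set (psi ` U)) (cball 0 (e/2))"
    using sub by (simp add: compactin_subtopology)
  then have "compactin T K" unfolding K_def by (rule image_compactin[OF _ continuous_theta])
  then have K: "closedin T K" using Hausdorff compactin_imp_closedin by blast
  define N where "N = {x \<in> U. psi x \<in> ball 0 e}"
  have N: "openin T N" unfolding N_def by (rule openin_psi_ball)
  have KN: "K \<subseteq> N"
  proof
    fix x assume "x \<in> K"
    then obtain w where w: "w \<in> cball 0 (e/2)" "x = theta w" by (auto simp: K_def)
    then have "x \<in> U" "psi x = w" using psi_theta sub by auto
    then show "x \<in> N" using w(1) e(1) by (simp add: N_def)
  qed
  show "smooth_on (\<eta> ` V) (\<lambda>u. ext \<beta> h (inv_into V \<eta> u))"
  proof (rule smooth_on_local)
    fix u assume u: "u \<in> \<eta> ` V"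
    define x where "x = inv_into V \<eta> u"
    have x: "x \<in> V" "\<eta> x = u" using inv_into_chart(2)[OF V u] by (auto simp: x_def)
    show "\<exists>W. open W \<and> u \<in> W \<and> smooth_on W (\<lambda>u. ext \<beta> h (inv_into V \<eta> u))"
    proof (cases "x \<in> N")
      case True
      have op: "open (\<eta> ` (V \<inter> N))" using chart(7)[OF V N] .
      have "smooth_on (\<eta> ` (V \<inter> N)) (\<lambda>u. \<phi> (inv_into V \<eta> u))"
        by (rule smooth_on_subset[OF chart_transition[OF V U_chart]]) (auto simp: N_def)
      then have s1: "smooth_on (\<eta> ` (V \<inter> N)) (\<lambda>u. psi (inv_into V \<eta> u))"
        unfolding psi_def by (rule smooth_on_compose[OF _ smooth_shift(2)]) (rule subset_UNIV)
      have s2: "smooth_on (ball 0 e) (\<lambda>w. \<beta> w * h w)"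
        by (rule smooth_on_bilinear[OF bounded_bilinear_mult smooth_on_subset[OF \<beta>(1) subset_UNIV] h])
      have "smooth_on (\<eta> ` (V \<inter> N)) (\<lambda>u. \<beta> (psi (inv_into V \<eta> u)) * h (psi (inv_into V \<eta> u)))"
        by (rule smooth_on_compose[OF s1 s2]) (use inv_into_chart(1)[OF V] in \<open>auto simp: N_def\<close>)
      then have "smooth_on (\<eta> ` (V \<inter> N)) (\<lambda>u. ext \<beta> h (inv_into V \<eta> u))"
        by (rule smooth_on_cong[OF op, rotated])
          (use inv_into_chart(1)[OF V] in \<open>auto simp: N_def ext_def\<close>)
      then show ?thesis using op x True by (intro exI[of _ "\<eta> ` (V \<inter> N)"]) auto
    next
      case False
      have oK: "openin T (topspace T - K)" using K by blast
      have op: "open (\<eta> ` (V \<inter> (topspace T - K)))" using chart(7)[OF V oK] .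
      have "ext \<beta> h y = 0" if "y \<notin> K" for y
      proof (cases "y \<in> U")
        case True
        then have "\<not> norm (psi y) \<le> e / 2"
          using that theta_psi[OF True] unfolding K_def by (metis image_eqI mem_cball_0)
        then show ?thesis using \<beta>(2)[of "psi y"] by (simp add: ext_def)
      qed (simp add: ext_def)
      then have "smooth_on (\<eta> ` (V \<inter> (topspace T - K))) (\<lambda>u. ext \<beta> h (inv_into V \<eta> u))"
        by (intro smooth_on_cong[OF op _ smooth_on_const[of _ 0]]) (use inv_into_chart(1)[OF V] in auto)
      moreover have "x \<notin> K" using False KN by auto
      ultimately show ?thesis using op x chart(4)[OF V]
        by (intro exI[of _ "\<eta> ` (V \<inter> (topspace T - K))"]) auto
    qed
  qed
qed

lemma J_ext_coord:
  assumes e: "0 < e" "cball 0 e \<subseteq> psi ` U" and \<beta>: "smooth_on UNIV \<beta>" "\<And>u. e / 2 \<le> norm u \<Longrightarrow> \<beta> u = 0" "\<beta> 0 = 1"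
  shows "J v (ext \<beta> (\<lambda>u. u \<bullet> b)) = v \<bullet> b"
proof -
  have h: "smooth_on (ball 0 e) (\<lambda>u::'e. u \<bullet> b)"
    by (rule smooth_on_bounded_linear[OF bounded_linear_inner_left])
  note db = smooth_on_has_derivative[OF \<beta>(1) UNIV_I[of 0]]
  have "((\<lambda>u. \<beta> u * (u \<bullet> b)) has_derivative
      (\<lambda>v. \<beta> 0 * (v \<bullet> b) + frechet_derivative \<beta> (at 0) v * (0 \<bullet> b))) (at 0)"
    by (rule has_derivative_mult[OF db]) (intro derivative_intros)
  then have "((\<lambda>u. ext \<beta> (\<lambda>u. u \<bullet> b) (theta u)) has_derivative
      (\<lambda>v. \<beta> 0 * (v \<bullet> b) + frechet_derivative \<beta> (at 0) v * (0 \<bullet> b))) (at 0)"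
    by (rule has_derivative_transform_within_open[OF _ open_psi_U zero_psi_U])
      (auto simp: ext_def)
  from J_eqI[OF smooth_ext[OF e \<beta>(1,2) h] this] show ?thesis by (simp add: \<beta>(3))
qed

lemma lie_algebraD:
  assumes D: "D \<in> lie_algebra G T A" and f: "f \<in> smooth_functions T A"
  shows "h \<in> smooth_functions T A \<Longrightarrow> D (\<lambda>x. f x + h x) = D f + D h"
    and "h \<in> smooth_functions T A \<Longrightarrow> D (\<lambda>x. f x * h x) = f \<one> * D h + h \<one> * D f"
    and "D (\<lambda>x. c * f x) = c * D f"
proof -
  note c = D[unfolded lie_algebra_def mem_Collect_eq]
  have 1: "\<forall>f\<in>smooth_functions T A. \<forall>h\<in>smooth_functions T A.
        D (\<lambda>x. f x + h x) = D f + D h \<and>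
        D (\<lambda>x. f x * h x) = f \<one> * D h + h \<one> * D f"
    and 2: "\<forall>f\<in>smooth_functions T A. \<forall>c. D (\<lambda>x. c * f x) = c * D f"
    by (rule conjunct1[OF c], rule conjunct1[OF conjunct2[OF c]])
  show "D (\<lambda>x. f x + h x) = D f + D h" "D (\<lambda>x. f x * h x) = f \<one> * D h + h \<one> * D f"
    if "h \<in> smooth_functions T A" using bspec[OF bspec[OF 1 f] that] by auto
  show "D (\<lambda>x. c * f x) = c * D f" using bspec[OF 2 f] by auto
qed

lemma lie_algebra_sum:
  assumes D: "D \<in> lie_algebra G T A" and "finite I" "\<And>i. i \<in> I \<Longrightarrow> f i \<in> smooth_functions T A"
  shows "D (\<lambda>x. \<Sum>i\<in>I. f i x) = (\<Sum>i\<in>I. D (f i))"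
  using assms(2,3)
proof (induction I)
  case empty
  show ?case using lie_algebraD(3)[OF D smooth_functions_const[of 0], of 0] by simp
next
  case (insert i I)
  have "D (\<lambda>x. f i x + (\<Sum>i\<in>I. f i x)) = D (f i) + D (\<lambda>x. \<Sum>i\<in>I. f i x)"
    by (rule lie_algebraD(1)[OF D]) (use insert.prems in \<open>auto intro: smooth_functions_sum\<close>)
  then show ?case using insert by simp
qed

text \<open>Near the identity, Hadamard's lemma writes f as a constant plus products of coordinates
  with smooth functions. Multiplied by cut-offs, this becomes an identity between global smooth
  functions, and the Leibniz rule at \<open>\<one>\<close> expresses \<open>D f\<close> by the
  values of \<open>D\<close> on the cut-off coordinates. The right-hand side has the same
  expression.\<close>

lemma lie_algebra_eq_J:
  assumes e: "0 < e" "cball 0 e \<subseteq> psi ` U" and \<beta>: "smooth_on UNIV \<beta>" "\<And>u. e / 2 \<le> norm u \<Longrightarrow> \<beta> u = 0" "\<beta> 0 = 1"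
    and D: "D \<in> lie_algebra G T A"
  shows "D = J (\<Sum>b\<in>Basis. D (ext \<beta> (\<lambda>u. u \<bullet> b)) *\<^sub>R b)" (is "D = J ?v")
proof
  fix f
  show "D f = J ?v f"
  proof (cases "f \<in> smooth_functions T A")
    case False
    then show ?thesis using D by (auto simp: lie_algebra_def J_def)
  next
    case f: True
    note Dadd = lie_algebraD(1)[OF D] and Dmult = lie_algebraD(2)[OF D] and Dscale = lie_algebraD(3)[OF D]
    define F where "F u = f (theta u)" for u
    have "smooth_on (ball 0 e) F" unfolding F_def
      by (rule smooth_on_subset[OF smooth_functions_theta[OF f]])
        (use e(2) ball_subset_cball in blast)
    then obtain H where H: "\<And>b. b \<in> Basis \<Longrightarrow> smooth_on (ball 0 e) (H b)"
      and FH: "\<And>x. x \<in> ball 0 e \<Longrightarrow> F x = F 0 + (\<Sum>b\<in>Basis. (x \<bullet> b) * H b x)"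
      and dF: "(F has_derivative (\<lambda>v. \<Sum>b\<in>Basis. (v \<bullet> b) * H b 0)) (at 0)"
      by (rule hadamard[OF _ e(1)]) (rule that)
    define X where "X b = ext \<beta> (\<lambda>u. u \<bullet> b)" for b
    define Y where "Y b = ext \<beta> (H b)" for b
    define Z where "Z = ext \<beta> (\<lambda>u. 1)"
    have X: "X b \<in> smooth_functions T A" for b
      unfolding X_def by (rule smooth_ext[OF e \<beta>(1,2) smooth_on_bounded_linear[OF bounded_linear_inner_left]])
    have Y: "Y b \<in> smooth_functions T A" if "b \<in> Basis" for b
      unfolding Y_def by (rule smooth_ext[OF e \<beta>(1,2) H[OF that]])
    have Z: "Z \<in> smooth_functions T A"
      unfolding Z_def by (rule smooth_ext[OF e \<beta>(1,2) smooth_on_const])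
    have at1: "X b \<one> = 0" "Y b \<one> = H b 0" "Z \<one> = 1" for b
      using one_U by (simp_all add: X_def Y_def Z_def ext_def \<beta>(3))
    have ZZ: "(\<lambda>x. Z x * Z x) \<in> smooth_functions T A" by (rule smooth_functions_mult[OF Z Z])
    have XY: "(\<lambda>x. X b x * Y b x) \<in> smooth_functions T A" if "b \<in> Basis" for b
      by (rule smooth_functions_mult[OF X Y[OF that]])
    \<comment> \<open>The bump enters squared because both \<open>X b\<close> and \<open>Y b\<close>
      carry it as a factor. Once \<open>D\<close> is applied, the two occurrences of
      \<open>D (\<lambda>x. Z x * Z x)\<close> cancel.\<close>
    have id: "Z x * Z x * f x = f \<one> * (Z x * Z x) + (\<Sum>b\<in>Basis. X b x * Y b x)" for x
    proof (cases "x \<in> U \<and> norm (psi x) < e")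
      case True
      then have "f x = f \<one> + (\<Sum>b\<in>Basis. (psi x \<bullet> b) * H b (psi x))"
        using FH[of "psi x"] by (simp add: F_def)
      then show ?thesis using True
        by (simp add: X_def Y_def Z_def ext_def algebra_simps sum_distrib_left sum_distrib_right)
    next
      case False
      then have "Z x = 0" "X b x = 0" for b
        using \<beta>(2)[of "psi x"] e(1) by (auto simp: X_def Z_def ext_def)
      then show ?thesis by simp
    qed
    have "D (\<lambda>x. Z x * Z x * f x) = D f + f \<one> * D (\<lambda>x. Z x * Z x)"
      using Dmult[OF ZZ f] at1 by simp
    moreover have "D (\<lambda>x. Z x * Z x * f x) = f \<one> * D (\<lambda>x. Z x * Z x) + (\<Sum>b\<in>Basis. D (\<lambda>x. X b x * Y b x))"
      unfolding id
      using Dadd[OF smooth_functions_mult[OF smooth_functions_const[of "f \<one>"] ZZ] smooth_functions_sum[of Basis "\<lambda>b x. X b x * Y b x", OF XY]]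
        Dscale[OF ZZ] lie_algebra_sum[OF D finite_Basis, of "\<lambda>b x. X b x * Y b x", OF XY] by simp
    moreover have "D (\<lambda>x. X b x * Y b x) = H b 0 * D (X b)" if "b \<in> Basis" for b
      using Dmult[OF X Y[OF that]] at1 by simp
    ultimately have Df: "D f = (\<Sum>b\<in>Basis. H b 0 * D (X b))" by simp
    have "J ?v f = (\<Sum>b\<in>Basis. (?v \<bullet> b) * H b 0)"
      using J_eqI[OF f] dF unfolding F_def by blast
    also have "\<dots> = (\<Sum>b\<in>Basis. H b 0 * D (X b))"
      by (rule sum.cong) (simp_all add: X_def mult.commute)
    finally show ?thesis using Df by simp
  qed
qed

lemma ex_bump: obtains e \<beta> where "0 < e" "cball 0 e \<subseteq> psi ` U" "smooth_on UNIV (\<beta>::'e \<Rightarrow> real)"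
    "\<And>u. e / 2 \<le> norm u \<Longrightarrow> \<beta> u = 0" "\<beta> 0 = 1"
proof -
  obtain e where e: "0 < e" "cball 0 e \<subseteq> psi ` U"
    using open_psi_U zero_psi_U open_contains_cball by blast
  obtain \<beta> :: "'e \<Rightarrow> real" where "smooth_on UNIV \<beta>" "\<beta> 0 = 1" "\<And>x. e / 2 \<le> norm (x - 0) \<longrightarrow> \<beta> x = 0"
    using ex_smooth_bump[of "e/2" "0::'e"] e(1) by auto
  then show ?thesis using e that[of e \<beta>] by simp
qed

text \<open>The inverse reads off the values of \<open>D\<close> on the cut-off coordinates, and
  evaluation at a function is continuous for pointwise convergence.\<close>

lemma homeomorphic_J: "homeomorphic_map euclidean (lie_algebra_topology G T A) J"
proof -
  obtain e and \<beta> :: "'e \<Rightarrow> real" where e: "0 < e" "cball 0 e \<subseteq> psi ` U" and \<beta>: "smooth_on UNIV \<beta>"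
    "\<And>u. e / 2 \<le> norm u \<Longrightarrow> \<beta> u = 0" "\<beta> 0 = 1"
    by (rule ex_bump) (rule that)
  define R where "R D = (\<Sum>b\<in>Basis. D (ext \<beta> (\<lambda>u. u \<bullet> b)) *\<^sub>R b)" for D
  have "continuous_map euclidean (lie_algebra_topology G T A) J"
    unfolding lie_algebra_topology_def continuous_map_in_subtopology continuous_map_componentwise_UNIV
  proof (intro conjI allI)
    fix f
    have "linear (\<lambda>v. J v f)" using J_add J_scale by (auto intro!: linearI)
    then show "continuous_map euclidean euclideanreal (\<lambda>v. J v f)"
      using linear_continuous_on linear_conv_bounded_linear by auto
  qed (use J_in_lie_algebra in auto)
  moreover have "continuous_map (lie_algebra_topology G T A) euclidean R"
    unfolding R_def lie_algebra_topology_def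
  proof (intro continuous_map_from_subtopology continuous_map_sum finite_Basis)
    fix b :: 'e
    have "continuous_map (powertop_real UNIV) euclideanreal (\<lambda>D. D (ext \<beta> (\<lambda>u. u \<bullet> b)))"
      by (rule continuous_map_product_projection) simp
    then show "continuous_map (powertop_real UNIV) euclidean (\<lambda>D. D (ext \<beta> (\<lambda>u. u \<bullet> b)) *\<^sub>R b)"
      by (rule continuous_map_compose[of _ _ _ _ "\<lambda>c. c *\<^sub>R b", unfolded o_def])
        (auto intro!: continuous_intros)
  qed
  moreover have "R (J v) = v" for v
    by (simp add: R_def J_ext_coord[OF e \<beta>(1) \<beta>(2) \<beta>(3)] euclidean_representation)
  moreover have "J (R D) = D" if "D \<in> lie_algebra G T A" for D
    using lie_algebra_eq_J[OF e \<beta> that] by (simp add: R_def)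
  ultimately have "homeomorphic_maps euclidean (lie_algebra_topology G T A) J R"
    unfolding homeomorphic_maps_def by (auto simp: lie_algebra_topology_def)
  then show ?thesis using homeomorphic_maps_map by blast
qed

lemma inj_J: "inj J"
  using homeomorphic_imp_injective_map[OF homeomorphic_J] by simp

definition conj_chart :: "'g \<Rightarrow> 'e \<Rightarrow> 'e" where
  "conj_chart g u = psi (g \<otimes> theta u \<otimes> inv g)"

definition a :: "'g \<Rightarrow> 'e \<Rightarrow> 'e" where "a g = frechet_derivative (conj_chart g) (at 0)"

text \<open>For \<open>g\<close> away from the identity, \<open>g \<otimes> x\<close> leaves the
  chart \<open>U\<close>. The conjugation is therefore factored through a chart at \<open>g\<close>:
  left translation from \<open>U\<close> to \<open>V\<close>, then right translation from
  \<open>V\<close> back to \<open>U\<close>.\<close>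

lemma conj_chart:
  assumes g: "g \<in> carrier G"
  shows "(conj_chart g has_derivative a g) (at 0)"
    and "\<exists>S. open S \<and> 0 \<in> S \<and> (\<forall>u\<in>S. theta u \<in> U \<and> g \<otimes> theta u \<otimes> inv g \<in> U)"
proof -
  obtain V \<eta> where V: "(V, \<eta>) \<in> A" "g \<in> V" using chart_at g topspace_eq by metis
  have g': "inv g \<in> carrier G" using g by simp
  define N1 where "N1 = {x \<in> U. g \<otimes> x \<in> V}"
  define N2 where "N2 = {y \<in> V. y \<otimes> inv g \<in> U}"
  have N1: "openin T N1" unfolding N1_def
    by (rule openin_preimage_chart[OF U_chart continuous_translations(1)[OF g] chart(1)[OF V(1)]])
  have N2: "openin T N2" unfolding N2_def
    by (rule openin_preimage_chart[OF V(1) continuous_translations(2)[OF g'] chart(1)[OF U_chart]])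
  define N where "N = {x \<in> U. g \<otimes> x \<in> N2}"
  have N: "openin T N" unfolding N_def
    by (rule openin_preimage_chart[OF U_chart continuous_translations(1)[OF g] N2])
  have NU: "N \<subseteq> U" "N \<subseteq> N1" by (auto simp: N_def N1_def N2_def)
  have "smooth_on (\<phi> ` N1) (\<lambda>u. \<eta> (g \<otimes> inv_into U \<phi> u))"
    using smooth_translations(1)[OF g] U_chart V(1) unfolding smooth_map_def N1_def o_def by fast
  then have s1: "smooth_on (\<phi> ` N) (\<lambda>u. \<eta> (g \<otimes> inv_into U \<phi> u))"
    using NU(2) by (auto intro: smooth_on_subset)
  have s2: "smooth_on (\<eta> ` N2) (\<lambda>u. \<phi> (inv_into V \<eta> u \<otimes> inv g))"
    using smooth_translations(2)[OF g'] U_chart V(1) unfolding smooth_map_def N2_def o_def by fast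
  have "smooth_on (\<phi> ` N) (\<lambda>u. \<phi> (inv_into V \<eta> (\<eta> (g \<otimes> inv_into U \<phi> u)) \<otimes> inv g))"
    by (rule smooth_on_compose[OF s1 s2]) (use NU(1) inv_into_chart(1)[OF U_chart] in \<open>auto simp: N_def\<close>)
  moreover have "open (\<phi> ` N)" using chart(7)[OF U_chart N] NU(1) by (simp add: Int_absorb1)
  ultimately have s3: "smooth_on (\<phi> ` N) (\<lambda>u. \<phi> (g \<otimes> inv_into U \<phi> u \<otimes> inv g))"
    by (elim smooth_on_cong[rotated 2])
      (use NU(1) inv_into_chart(1)[OF U_chart] inv_into_chart(1)[OF V(1)] in \<open>auto simp: N_def N2_def\<close>)
  have "smooth_on (psi ` N) (\<lambda>u. \<phi> (g \<otimes> inv_into U \<phi> (u + \<phi> \<one>) \<otimes> inv g))"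
    by (rule smooth_on_compose[OF smooth_shift(1) s3]) (auto simp: psi_def)
  then have "smooth_on (psi ` N) (conj_chart g)"
    unfolding conj_chart_def[abs_def] psi_def theta_def
    by (rule smooth_on_compose[OF _ smooth_shift(2)]) (rule subset_UNIV)
  moreover have "\<one> \<in> N" using V(2) g one_U by (simp add: N_def N2_def)
  then have 0: "0 \<in> psi ` N" by (intro image_eqI[of _ _ \<one>]) auto
  ultimately show "(conj_chart g has_derivative a g) (at 0)"
    unfolding a_def by (rule smooth_on_has_derivative)
  have "open (psi ` N)" using open_psi_image[OF N] NU(1) by (simp add: Int_absorb1)
  moreover have "theta u \<in> U \<and> g \<otimes> theta u \<otimes> inv g \<in> U" if "u \<in> psi ` N" for u
    using that NU(1) by (auto simp: N_def N2_def)
  ultimately show "\<exists>S. open S \<and> 0 \<in> S \<and> (\<forall>u\<in>S. theta u \<in> U \<and> g \<otimes> theta u \<otimes> inv g \<in> U)"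
    using 0 by metis
qed

lemma J_a:
  assumes g: "g \<in> carrier G"
  shows "J (a g v) f = J v (\<lambda>x. f (g \<otimes> x \<otimes> inv g))"
proof (cases "f \<in> smooth_functions T A")
  case f: True
  obtain S where S: "open S" "0 \<in> S" "\<And>u. u \<in> S \<Longrightarrow> theta u \<in> U \<and> g \<otimes> theta u \<otimes> inv g \<in> U"
    using conj_chart(2)[OF g] by metis
  have "conj_chart g 0 = 0" using g by (simp add: conj_chart_def)
  then have "((\<lambda>u. f (theta u)) has_derivative (\<lambda>v. J v f)) (at (conj_chart g 0))"
    using smooth_functions_has_derivative[OF f] by simp
  from has_derivative_compose[OF conj_chart(1)[OF g] this]
  have "((\<lambda>u. f (theta (conj_chart g u))) has_derivative (\<lambda>v. J (a g v) f)) (at 0)" .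
  then have "((\<lambda>u. f (g \<otimes> theta u \<otimes> inv g)) has_derivative (\<lambda>v. J (a g v) f)) (at 0)"
    by (rule has_derivative_transform_within_open[OF _ S(1,2)]) (use S(3) in \<open>simp add: conj_chart_def\<close>)
  from J_eqI[OF smooth_functions_conj[OF f g] this] show ?thesis by simp
next
  case False
  \<comment> \<open>If neither function is smooth, both sides are the default 0. Conjugating back
    with \<open>inv g\<close> shows that smoothness of the conjugated function would give that of
    \<open>f\<close>.\<close>
  have "(\<lambda>x. f (g \<otimes> x \<otimes> inv g)) \<notin> smooth_functions T A"
  proof
    assume "(\<lambda>x. f (g \<otimes> x \<otimes> inv g)) \<in> smooth_functions T A"
    from smooth_functions_conj[OF this, of "inv g"]
    have "(\<lambda>x. f (g \<otimes> (inv g \<otimes> x \<otimes> inv (inv g)) \<otimes> inv g)) \<in> smooth_functions T A"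
      using g by simp
    then have "f \<in> smooth_functions T A"
    proof (rule smooth_functions_cong)
      fix x assume x: "x \<in> carrier G"
      have "g \<otimes> (inv g \<otimes> x \<otimes> g) = x \<otimes> g"
        using g x by (simp add: m_assoc[symmetric])
      moreover have "x \<otimes> g \<otimes> inv g = x" using g x by (simp add: m_assoc)
      ultimately show "f (g \<otimes> (inv g \<otimes> x \<otimes> inv (inv g)) \<otimes> inv g) = f x"
        using g by simp
    qed
    then show False using False by simp
  qed
  then show ?thesis using False by (simp add: J_def)
qed

lemma a_mult:
  assumes "g \<in> carrier G" "h \<in> carrier G"
  shows "a (g \<otimes> h) v = a g (a h v)"
proof -
  have "J (a (g \<otimes> h) v) f = J (a g (a h v)) f" for f
    unfolding J_a[OF m_closed[OF assms]] J_a[OF assms(1)] J_a[OF assms(2)]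
    by (rule J_cong) (use assms in \<open>simp add: m_assoc inv_mult_group\<close>)
  then show ?thesis using inj_J by (auto dest: injD)
qed

lemma mult_estimate:
  obtains \<rho> C where "\<rho> > 0" "C > 0" "ball 0 \<rho> \<subseteq> psi ` U"
    "\<And>x x' y y'. \<lbrakk>x \<in> U; x' \<in> U; y \<in> U; y' \<in> U; norm (psi x) < \<rho>; norm (psi x') < \<rho>;
      norm (psi y) < \<rho>; norm (psi y') < \<rho>\<rbrakk> \<Longrightarrow> x \<otimes> y \<in> U \<and>
      norm (psi (x \<otimes> y) - psi (x \<otimes> y') - psi (x' \<otimes> y) + psi (x' \<otimes> y'))
        \<le> C * norm (psi x - psi x') * norm (psi y - psi y')"
proof -
  define Q where "Q = {(u, v) \<in> \<phi> ` U \<times> \<phi> ` U. inv_into U \<phi> u \<otimes> inv_into U \<phi> v \<in> U}"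
  define S where "S = (\<lambda>p. p + (\<phi> \<one>, \<phi> \<one>)) -` Q"
  define m where "m p = psi (theta (fst p) \<otimes> theta (snd p))" for p
  note ch = smooth_mult_charts[OF U_chart U_chart U_chart, folded Q_def]
  have S: "open S" unfolding S_def
    by (rule open_vimage[OF ch(1)]) (intro continuous_intros)
  have S0: "(0, 0) \<in> S"
    using one_U inv_into_chart(1)[OF U_chart one_U] by (auto simp: S_def Q_def)
  have S_sub: "u \<in> psi ` U \<and> v \<in> psi ` U \<and> theta u \<otimes> theta v \<in> U" if "(u, v) \<in> S" for u v
    using that unfolding S_def Q_def by (auto simp: mem_psi_image theta_def simp del: image_iff)
  have "smooth_on S (\<lambda>p. p + (\<phi> \<one>, \<phi> \<one>))"
    by (rule smooth_on_add[OF smooth_on_bounded_linear[OF bounded_linear_ident] smooth_on_const])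
  from smooth_on_compose[OF this ch(2)]
  have "smooth_on S (\<lambda>p. \<phi> (theta (fst p) \<otimes> theta (snd p)))"
    by (simp add: S_def theta_def case_prod_unfold image_subset_iff)
  then have "smooth_on S m"
    unfolding m_def[abs_def] psi_def by (rule smooth_on_compose[OF _ smooth_shift(2)]) (rule subset_UNIV)
  then have "Ck_on 2 S m" by (rule smooth_onD)
  then obtain \<rho> C where r: "\<rho> > 0" "C > 0" "ball 0 \<rho> \<times> ball 0 \<rho> \<subseteq> S"
    and est: "\<And>u u' v v'. u \<in> ball 0 \<rho> \<Longrightarrow> u' \<in> ball 0 \<rho> \<Longrightarrow> v \<in> ball 0 \<rho> \<Longrightarrow> v' \<in> ball 0 \<rho> \<Longrightarrow>
      norm (m (u, v) - m (u, v') - m (u', v) + m (u', v')) \<le> C * norm (u - u') * norm (v - v')"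
    by (rule mixed_difference[OF _ S S0]) (rule that)
  show ?thesis
  proof (rule that[OF r(1,2)])
    show "ball 0 \<rho> \<subseteq> psi ` U" using r(3) S_sub by auto
  next
    fix x x' y y'
    assume xy: "x \<in> U" "x' \<in> U" "y \<in> U" "y' \<in> U" "norm (psi x) < \<rho>" "norm (psi x') < \<rho>"
      "norm (psi y) < \<rho>" "norm (psi y') < \<rho>"
    then have "(psi x, psi y) \<in> S" using r(3) by auto
    then have "x \<otimes> y \<in> U" using S_sub[of "psi x" "psi y"] xy by simp
    then show "x \<otimes> y \<in> U \<and>
      norm (psi (x \<otimes> y) - psi (x \<otimes> y') - psi (x' \<otimes> y) + psi (x' \<otimes> y'))
        \<le> C * norm (psi x - psi x') * norm (psi y - psi y')"
      using est[of "psi x" "psi x'" "psi y" "psi y'"] xy by (simp add: m_def)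
  qed
qed

end

text \<open>The properties of a Lie group in a chart at \<open>\<one>\<close> on which the rest of the proof relies; the
  automorphism \<open>a g\<close> of the model space is \<open>Ad(g)\<close> in this chart. The estimate \<open>mixed_est\<close> on the mixed
  second difference replaces all further use of smoothness.\<close>

locale lie_chart = group G for G :: "('g, 'u) monoid_scheme" (structure) +
  fixes T :: "'g topology" and \<psi> :: "'g \<Rightarrow> 'e::euclidean_space" and \<theta> :: "'e \<Rightarrow> 'g"
    and U :: "'g set" and \<rho> C :: real and a :: "'g \<Rightarrow> 'e \<Rightarrow> 'e"
  assumes topspace_T: "topspace T = carrier G"
    and compact_T: "compact_space T" and Hausdorff_T: "Hausdorff_space T"
    and cont_mult: "continuous_map (prod_topology T T) T (\<lambda>(x, y). x \<otimes> y)"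
    and cont_inv: "continuous_map T T (\<lambda>x. inv x)"
    and openin_U: "openin T U" and one_in_U: "\<one> \<in> U" and psi_one: "\<psi> \<one> = 0"
    and cont_psi: "continuous_map (subtopology T U) euclidean \<psi>"
    and theta_in_U: "norm u < \<rho> \<Longrightarrow> \<theta> u \<in> U" and psi_theta: "norm u < \<rho> \<Longrightarrow> \<psi> (\<theta> u) = u"
    and theta_psi: "x \<in> U \<Longrightarrow> \<theta> (\<psi> x) = x"
    and cont_theta: "continuous_map (top_of_set (ball 0 \<rho>)) T \<theta>"
    and rho_pos: "0 < \<rho>" and C_pos: "0 < C"
    and mult_in_U: "\<lbrakk>x \<in> U; y \<in> U; norm (\<psi> x) < \<rho>; norm (\<psi> y) < \<rho>\<rbrakk> \<Longrightarrow> x \<otimes> y \<in> U"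
    and mixed_est: "\<lbrakk>x \<in> U; x' \<in> U; y \<in> U; y' \<in> U; norm (\<psi> x) < \<rho>; norm (\<psi> x') < \<rho>;
      norm (\<psi> y) < \<rho>; norm (\<psi> y') < \<rho>\<rbrakk> \<Longrightarrow>
      norm (\<psi> (x \<otimes> y) - \<psi> (x \<otimes> y') - \<psi> (x' \<otimes> y) + \<psi> (x' \<otimes> y'))
        \<le> C * norm (\<psi> x - \<psi> x') * norm (\<psi> y - \<psi> y')"
    and a_linear: "g \<in> carrier G \<Longrightarrow> linear (a g)"
    and a_mult: "g \<in> carrier G \<Longrightarrow> h \<in> carrier G \<Longrightarrow> a (g \<otimes> h) v = a g (a h v)"
    and a_deriv: "g \<in> carrier G \<Longrightarrow> ((\<lambda>u. \<psi> (g \<otimes> \<theta> u \<otimes> inv g)) has_derivative a g) (at 0)"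
    and a_one: "a \<one> v = v"

theorem (in lie_group) ex_lie_chart:
  assumes "compact_space T"
  obtains \<psi> :: "'g \<Rightarrow> 'e" and \<theta> U \<rho> C a and J :: "'e \<Rightarrow> ('g \<Rightarrow> real) \<Rightarrow> real"
  where "lie_chart G T \<psi> \<theta> U \<rho> C a"
    "homeomorphic_map euclidean (lie_algebra_topology G T A) J"
    "\<And>v w. J (v + w) = (\<lambda>f. J v f + J w f)" "\<And>c v. J (c *\<^sub>R v) = (\<lambda>f. c * J v f)"
    "\<And>g v. g \<in> carrier G \<Longrightarrow> Ad G g (J v) = J (a g v)"
proof -
  obtain U \<phi> where U: "(U, \<phi>) \<in> A" "\<one> \<in> U" using chart_at topspace_eq one_closed by metis
  interpret c: lie_group_chart G T A U \<phi> by unfold_locales (fact U)+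
  obtain \<rho> C where r: "\<rho> > 0" "C > 0" "ball 0 \<rho> \<subseteq> c.psi ` U"
    and est: "\<And>x x' y y'. \<lbrakk>x \<in> U; x' \<in> U; y \<in> U; y' \<in> U; norm (c.psi x) < \<rho>; norm (c.psi x') < \<rho>;
      norm (c.psi y) < \<rho>; norm (c.psi y') < \<rho>\<rbrakk> \<Longrightarrow> x \<otimes> y \<in> U \<and>
      norm (c.psi (x \<otimes> y) - c.psi (x \<otimes> y') - c.psi (x' \<otimes> y) + c.psi (x' \<otimes> y'))
        \<le> C * norm (c.psi x - c.psi x') * norm (c.psi y - c.psi y')"
    by (rule c.mult_estimate) (rule that)
  have sub: "u \<in> c.psi ` U" if "norm u < \<rho>" for u using that r(3) by auto
  have "c.J (c.a \<one> v) = c.J v" for v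
  proof
    fix f show "c.J (c.a \<one> v) f = c.J v f"
      unfolding c.J_a[OF one_closed] by (rule c.J_cong) simp
  qed
  then have one: "c.a \<one> v = v" for v using c.inj_J by (auto dest: injD)
  have "lie_chart G T c.psi c.theta U \<rho> C c.a"
  proof (intro lie_chart.intro lie_chart_axioms.intro)
    show "group G" by (rule is_group)
    show "((\<lambda>u. c.psi (g \<otimes> c.theta u \<otimes> inv g)) has_derivative c.a g) (at 0)" if "g \<in> carrier G" for g
      using c.conj_chart(1)[OF that] by (simp add: c.conj_chart_def[abs_def])
    show "linear (c.a g)" if "g \<in> carrier G" for g
      using c.conj_chart(1)[OF that] has_derivative_linear by blast
    show "continuous_map (top_of_set (ball 0 \<rho>)) T c.theta"
      using continuous_map_from_subtopology_mono[OF c.continuous_theta r(3)] .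
    show "c.theta u \<in> U" "c.psi (c.theta u) = u" if "norm u < \<rho>" for u
      using c.psi_theta[OF sub[OF that]] by auto
    show "x \<otimes> y \<in> U" if "x \<in> U" "y \<in> U" "norm (c.psi x) < \<rho>" "norm (c.psi y) < \<rho>" for x y
      using est[of x x y y] that by blast
  qed (use topspace_eq assms Hausdorff continuous_mult continuous_inv chart(1)[OF U(1)] U(2) c.continuous_psi
        est c.a_mult r(1,2) one in \<open>simp_all\<close>)
  moreover have "Ad G g (c.J v) = c.J (c.a g v)" if "g \<in> carrier G" for g v
    by (rule ext) (simp add: Ad_def c.J_a[OF that])
  ultimately show ?thesis
    using that[of c.psi c.theta U \<rho> C c.a c.J] c.homeomorphic_J c.J_add c.J_scale by blast
qed

section \<open>Neighbourhoods of the identity and approximate additivity\<close>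

context lie_chart
begin

definition B :: "real \<Rightarrow> 'g set" where "B e = {x \<in> U. norm (\<psi> x) < e}"

lemma U_carrier: "U \<subseteq> carrier G"
  using openin_subset[OF openin_U] topspace_T by simp

lemma B_carrier: "B e \<subseteq> carrier G"
  using U_carrier by (auto simp: B_def)

lemma B_closed: "x \<in> B e \<Longrightarrow> x \<in> carrier G"
  using B_carrier by auto

lemma B_mono: "e \<le> e' \<Longrightarrow> B e \<subseteq> B e'"
  by (auto simp: B_def)

lemma one_in_B: "0 < e \<Longrightarrow> \<one> \<in> B e"
  using one_in_U psi_one by (simp add: B_def)

lemma openin_B: "openin T (B e)"
proof -
  have "openin (subtopology T U) {y \<in> topspace (subtopology T U). \<psi> y \<in> ball 0 e}"
    by (rule openin_continuous_map_preimage[OF cont_psi]) simp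
  moreover have "{y \<in> topspace (subtopology T U). \<psi> y \<in> ball 0 e} = B e"
    using openin_subset[OF openin_U] by (auto simp: B_def)
  ultimately show ?thesis using openin_U openin_trans_full by metis
qed

lemma theta_zero [simp]: "\<theta> 0 = \<one>"
  using theta_psi[OF one_in_U] psi_one by simp

lemma theta_in_B: "norm u < e \<Longrightarrow> e \<le> \<rho> \<Longrightarrow> \<theta> u \<in> B e"
  using theta_in_U psi_theta by (simp add: B_def)

lemma B_eqI: "x \<in> U \<Longrightarrow> y \<in> U \<Longrightarrow> \<psi> x = \<psi> y \<Longrightarrow> x = y"
  using theta_psi by metis

lemma B_nbhd:
  assumes "openin T W" "\<one> \<in> W"
  obtains e where "0 < e" "e \<le> \<rho>" "B e \<subseteq> W"
proof -
  have "openin (top_of_set (ball 0 \<rho>)) {u \<in> topspace (top_of_set (ball 0 \<rho>)). \<theta> u \<in> W}"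
    by (rule openin_continuous_map_preimage[OF cont_theta assms(1)])
  then have "open {u \<in> ball 0 \<rho>. \<theta> u \<in> W}"
    using openin_open_trans[OF _ open_ball] by simp
  moreover have "0 \<in> {u \<in> ball 0 \<rho>. \<theta> u \<in> W}" using assms(2) rho_pos by simp
  ultimately obtain e where e: "0 < e" "ball 0 e \<subseteq> {u \<in> ball 0 \<rho>. \<theta> u \<in> W}"
    using open_contains_ball by blast
  show ?thesis
  proof (rule that[of "min e \<rho>"])
    show "B (min e \<rho>) \<subseteq> W"
    proof
      fix x assume "x \<in> B (min e \<rho>)"
      then have x: "x \<in> U" "\<psi> x \<in> ball 0 e" by (auto simp: B_def)
      then have "\<theta> (\<psi> x) \<in> W" using e(2) by blast
      then show "x \<in> W" using theta_psi[OF x(1)] by simp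
    qed
  qed (use e rho_pos in auto)
qed

lemma cont_mult_comp:
  "continuous_map X T f \<Longrightarrow> continuous_map X T g \<Longrightarrow> continuous_map X T (\<lambda>x. f x \<otimes> g x)"
  using continuous_map_compose[OF continuous_map_pairedI cont_mult] by (simp add: o_def)

lemma cont_inv_comp: "continuous_map X T f \<Longrightarrow> continuous_map X T (\<lambda>x. inv (f x))"
  using continuous_map_compose[OF _ cont_inv] by (simp add: o_def)

lemma cont_const: "g \<in> carrier G \<Longrightarrow> continuous_map X T (\<lambda>x. g)"
  by (simp add: topspace_T)

lemma limitin_mult:
  assumes "limitin T x l F" "limitin T y k F"
  shows "limitin T (\<lambda>n. x n \<otimes> y n) (l \<otimes> k) F"
proof -
  have "limitin (prod_topology T T) (\<lambda>n. (x n, y n)) (l, k) F"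
    using assms by (simp add: limitin_pairwise o_def)
  from continuous_map_limit[OF cont_mult this] show ?thesis by (simp add: o_def)
qed

text \<open>Basic radius: products of two elements of \<open>B r1\<close> stay in the chart, with controlled errors.\<close>

definition r1 :: real where "r1 = Min {1, \<rho> / 4, 1 / (16 * C)}"

lemma r1: "0 < r1" "r1 \<le> 1" "4 * r1 \<le> \<rho>" "16 * C * r1 \<le> 1"
proof -
  show "0 < r1" using rho_pos C_pos by (simp add: r1_def)
  show "r1 \<le> 1" by (simp add: r1_def)
  have "r1 \<le> \<rho> / 4" "r1 \<le> 1 / (16 * C)" by (simp_all add: r1_def)
  then show "4 * r1 \<le> \<rho>" "16 * C * r1 \<le> 1" using C_pos by (simp_all add: field_simps)
qed

lemma Cr1: "0 \<le> s \<Longrightarrow> s \<le> r1 \<Longrightarrow> C * s \<le> 1 / 16"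
  using r1(4) mult_left_mono[of s r1 C] C_pos by linarith

lemma B_rho: "x \<in> B \<rho> \<longleftrightarrow> x \<in> U \<and> norm (\<psi> x) < \<rho>"
  by (simp add: B_def)

lemma Br1_rho: "x \<in> B r1 \<Longrightarrow> x \<in> B \<rho>"
  using B_mono[of r1 \<rho>] r1 by auto

lemma mixed_B:
  assumes "x \<in> B \<rho>" "x' \<in> B \<rho>" "y \<in> B \<rho>" "y' \<in> B \<rho>"
  shows "norm (\<psi> (x \<otimes> y) - \<psi> (x \<otimes> y') - \<psi> (x' \<otimes> y) + \<psi> (x' \<otimes> y'))
        \<le> C * norm (\<psi> x - \<psi> x') * norm (\<psi> y - \<psi> y')"
  using assms mixed_est by (simp add: B_rho)

lemma mult_B_U: "x \<in> B \<rho> \<Longrightarrow> y \<in> B \<rho> \<Longrightarrow> x \<otimes> y \<in> U"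
  using mult_in_U by (simp add: B_rho)

text \<open>The mixed difference with \<open>x' = y' = \<one>\<close>. The next two lemmas put only
  \<open>x' = \<one>\<close> and only \<open>y' = \<one>\<close>, respectively.\<close>

lemma mult_est:
  assumes "x \<in> B \<rho>" "y \<in> B \<rho>"
  shows "norm (\<psi> (x \<otimes> y) - \<psi> x - \<psi> y) \<le> C * norm (\<psi> x) * norm (\<psi> y)"
  using mixed_B[OF assms(1) one_in_B[OF rho_pos] assms(2) one_in_B[OF rho_pos]]
    B_closed[OF assms(1)] B_closed[OF assms(2)] psi_one by simp

lemma mult_est_left:
  assumes "x \<in> B \<rho>" "y \<in> B \<rho>" "y' \<in> B \<rho>"
  shows "norm (\<psi> (x \<otimes> y) - \<psi> (x \<otimes> y') - (\<psi> y - \<psi> y')) \<le> C * norm (\<psi> x) * norm (\<psi> y - \<psi> y')"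
  using mixed_B[OF assms(1) one_in_B[OF rho_pos] assms(2,3)]
    B_closed[OF assms(1)] B_closed[OF assms(2)] B_closed[OF assms(3)] psi_one
  by (simp add: algebra_simps)

lemma mult_est_right:
  assumes "x \<in> B \<rho>" "x' \<in> B \<rho>" "y \<in> B \<rho>"
  shows "norm (\<psi> (x \<otimes> y) - \<psi> (x' \<otimes> y) - (\<psi> x - \<psi> x')) \<le> C * norm (\<psi> x - \<psi> x') * norm (\<psi> y)"
  using mixed_B[OF assms one_in_B[OF rho_pos]]
    B_closed[OF assms(1)] B_closed[OF assms(2)] B_closed[OF assms(3)] psi_one
  by (simp add: algebra_simps)

lemma norm_mult_le:
  assumes "x \<in> B r1" "y \<in> B r1"
  shows "norm (\<psi> (x \<otimes> y)) \<le> norm (\<psi> x) + 2 * norm (\<psi> y)"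
proof -
  have "norm (\<psi> (x \<otimes> y)) \<le> norm (\<psi> (x \<otimes> y) - \<psi> x - \<psi> y) + norm (\<psi> x) + norm (\<psi> y)"
    using norm_triangle_ineq[of "\<psi> (x \<otimes> y) - \<psi> x - \<psi> y" "\<psi> x + \<psi> y"]
      norm_triangle_ineq[of "\<psi> x" "\<psi> y"] by simp
  moreover have "C * norm (\<psi> x) * norm (\<psi> y) \<le> 1 * norm (\<psi> y)"
    using Cr1[of "norm (\<psi> x)"] assms(1) by (intro mult_right_mono) (auto simp: B_def)
  ultimately show ?thesis using mult_est[OF Br1_rho[OF assms(1)] Br1_rho[OF assms(2)]] by linarith
qed

lemma norm_mult_diff_le:
  assumes "x \<in> B r1" "y \<in> B r1"
  shows "norm (\<psi> (x \<otimes> y) - \<psi> x) \<le> 2 * norm (\<psi> y)"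
proof -
  have "norm (\<psi> (x \<otimes> y) - \<psi> x) \<le> norm (\<psi> (x \<otimes> y) - \<psi> x - \<psi> y) + norm (\<psi> y)"
    using norm_triangle_ineq[of "\<psi> (x \<otimes> y) - \<psi> x - \<psi> y" "\<psi> y"] by simp
  moreover have "C * norm (\<psi> x) * norm (\<psi> y) \<le> 1 * norm (\<psi> y)"
    using Cr1[of "norm (\<psi> x)"] assms(1) by (intro mult_right_mono) (auto simp: B_def)
  ultimately show ?thesis using mult_est[OF Br1_rho[OF assms(1)] Br1_rho[OF assms(2)]] by linarith
qed

text \<open>In the chart, squaring is doubling up to a map of Lipschitz constant 1/8; the two
  estimates replace one factor at a time. Both the uniqueness of square roots in \<open>B r1\<close>
  and the contraction that produces them rest on this.\<close>

lemma square_lipschitz: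
  assumes x: "x \<in> B r1" and z: "z \<in> B r1"
  shows "norm (\<psi> (x \<otimes> x) - \<psi> (z \<otimes> z) - 2 *\<^sub>R (\<psi> x - \<psi> z)) \<le> norm (\<psi> x - \<psi> z) / 8"
proof -
  let ?d = "norm (\<psi> x - \<psi> z)"
  have 1: "norm (\<psi> (x \<otimes> x) - \<psi> (x \<otimes> z) - (\<psi> x - \<psi> z)) \<le> C * norm (\<psi> x) * ?d"
    using mult_est_left[OF Br1_rho[OF x] Br1_rho[OF x] Br1_rho[OF z]] .
  have 2: "norm (\<psi> (x \<otimes> z) - \<psi> (z \<otimes> z) - (\<psi> x - \<psi> z)) \<le> C * ?d * norm (\<psi> z)"
    using mult_est_right[OF Br1_rho[OF x] Br1_rho[OF z] Br1_rho[OF z]] .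
  have cx: "C * norm (\<psi> x) \<le> 1 / 16" and cz: "C * norm (\<psi> z) \<le> 1 / 16"
    using Cr1[of "norm (\<psi> x)"] Cr1[of "norm (\<psi> z)"] x z by (auto simp: B_def)
  have 3: "norm (\<psi> (x \<otimes> x) - \<psi> (x \<otimes> z) - (\<psi> x - \<psi> z)) \<le> 1 / 16 * ?d"
    using 1 mult_right_mono[OF cx norm_ge_zero[of "\<psi> x - \<psi> z"]] by linarith
  have 4: "norm (\<psi> (x \<otimes> z) - \<psi> (z \<otimes> z) - (\<psi> x - \<psi> z)) \<le> 1 / 16 * ?d"
    using 2 mult_right_mono[OF cz norm_ge_zero[of "\<psi> x - \<psi> z"]]
    unfolding mult.assoc mult.commute[of ?d] by linarith
  have eq: "\<psi> (x \<otimes> x) - \<psi> (z \<otimes> z) - 2 *\<^sub>R (\<psi> x - \<psi> z) =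
      (\<psi> (x \<otimes> x) - \<psi> (x \<otimes> z) - (\<psi> x - \<psi> z)) + (\<psi> (x \<otimes> z) - \<psi> (z \<otimes> z) - (\<psi> x - \<psi> z))"
    by (simp add: scaleR_2 algebra_simps)
  show ?thesis
    unfolding eq using 3 4 norm_triangle_ineq[of "\<psi> (x \<otimes> x) - \<psi> (x \<otimes> z) - (\<psi> x - \<psi> z)"
        "\<psi> (x \<otimes> z) - \<psi> (z \<otimes> z) - (\<psi> x - \<psi> z)"]
    by linarith
qed

lemma square_unique:
  assumes x: "x \<in> B r1" and z: "z \<in> B r1" and eq: "x \<otimes> x = z \<otimes> z"
  shows "x = z"
proof -
  have "2 * norm (\<psi> x - \<psi> z) \<le> norm (\<psi> x - \<psi> z) / 8"
    using square_lipschitz[OF x z] eq by simp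
  then have "norm (\<psi> x - \<psi> z) \<le> 0" using norm_ge_zero[of "\<psi> x - \<psi> z"] by linarith
  then have "\<psi> x = \<psi> z" by simp
  then show ?thesis using B_eqI x z by (auto simp: B_def)
qed

text \<open>The product of \<open>x\<close> with the quotient is \<open>y\<close>, and the error of
  its expansion is at most a sixteenth of the norm of the quotient, so it can be absorbed. This
  converts closeness in the chart into closeness in the group.\<close>

lemma inv_mult_est:
  assumes x: "x \<in> B r1" and y: "y \<in> B r1" and q: "inv x \<otimes> y \<in> B r1"
  shows "norm (\<psi> (inv x \<otimes> y)) \<le> 2 * norm (\<psi> x - \<psi> y)"
proof -
  let ?q = "inv x \<otimes> y"
  have "x \<otimes> ?q = y" using B_closed[OF x] B_closed[OF y] by (simp add: m_assoc[symmetric])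
  then have "norm (\<psi> y - \<psi> x - \<psi> ?q) \<le> C * norm (\<psi> x) * norm (\<psi> ?q)"
    using mult_est[OF Br1_rho[OF x] Br1_rho[OF q]] by simp
  also have "\<dots> \<le> 1 / 16 * norm (\<psi> ?q)"
    using Cr1[of "norm (\<psi> x)"] x by (intro mult_right_mono) (auto simp: B_def)
  finally have "norm (\<psi> y - \<psi> x - \<psi> ?q) \<le> 1 / 16 * norm (\<psi> ?q)" .
  moreover have "norm (\<psi> ?q) \<le> norm (\<psi> y - \<psi> x) + norm (\<psi> y - \<psi> x - \<psi> ?q)"
    using norm_triangle_ineq4[of "\<psi> y - \<psi> x" "\<psi> y - \<psi> x - \<psi> ?q"] by simp
  moreover have "norm (\<psi> y - \<psi> x) = norm (\<psi> x - \<psi> y)" by (rule norm_minus_commute)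
  ultimately show ?thesis using norm_ge_zero[of "\<psi> ?q"] by linarith
qed

lemma inv_mult_nbhd:
  assumes "0 < e"
  obtains e' where "0 < e'" "e' \<le> r1" "\<And>x y. x \<in> B e' \<Longrightarrow> y \<in> B e' \<Longrightarrow> inv x \<otimes> y \<in> B e"
proof -
  have "continuous_map (prod_topology T T) T (\<lambda>p. inv (fst p) \<otimes> snd p)"
    by (intro cont_mult_comp cont_inv_comp continuous_map_fst continuous_map_snd)
  from openin_continuous_map_preimage[OF this openin_B, of e]
  have S: "openin (prod_topology T T) {p \<in> topspace (prod_topology T T). inv (fst p) \<otimes> snd p \<in> B e}" .
  have c: "compactin T {\<one>}" by (simp add: topspace_T)
  have "{\<one>} \<times> {\<one>} \<subseteq> {p \<in> topspace (prod_topology T T). inv (fst p) \<otimes> snd p \<in> B e}"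
    using one_in_B[OF assms] topspace_T by simp
  then obtain V W where VW': "openin T V" "openin T W" "{\<one>} \<subseteq> V" "{\<one>} \<subseteq> W"
    and VW: "V \<times> W \<subseteq> {p \<in> topspace (prod_topology T T). inv (fst p) \<otimes> snd p \<in> B e}"
    by (rule Wallace_theorem_prod_topology[OF c c S]) (rule that)
  obtain e0 where e0: "0 < e0" "e0 \<le> \<rho>" "B e0 \<subseteq> V \<inter> W"
    by (rule B_nbhd[of "V \<inter> W"]) (use VW' in auto)
  show ?thesis
  proof (rule that[of "min e0 r1"])
    fix x y assume "x \<in> B (min e0 r1)" "y \<in> B (min e0 r1)"
    then have "x \<in> V" "y \<in> W" using e0(3) B_mono[of "min e0 r1" e0] by auto
    then show "inv x \<otimes> y \<in> B e" using VW by auto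
  qed (use e0 r1 in auto)
qed

text \<open>The radius can be chosen independently of \<open>g\<close> by the tube lemma, as G is
  compact.\<close>

lemma conj_nbhd:
  assumes "0 < e"
  obtains e' where "0 < e'" "e' \<le> r1" "\<And>g x. g \<in> carrier G \<Longrightarrow> x \<in> B e' \<Longrightarrow> g \<otimes> x \<otimes> inv g \<in> B e"
proof -
  let ?W = "{p \<in> topspace (prod_topology T T). fst p \<otimes> snd p \<otimes> inv (fst p) \<in> B e}"
  have "continuous_map (prod_topology T T) T (\<lambda>p. fst p \<otimes> snd p \<otimes> inv (fst p))"
    by (intro cont_mult_comp cont_inv_comp continuous_map_fst continuous_map_snd)
  then have W: "openin (prod_topology T T) ?W"
    using openin_B by (rule openin_continuous_map_preimage)
  have "compactin T (carrier G)" using compact_T topspace_T by (simp add: compact_space_def)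
  moreover have "carrier G \<times> {\<one>} \<subseteq> ?W" using topspace_T one_in_B[OF assms] by auto
  ultimately obtain V V' where V: "openin T V'" "carrier G \<subseteq> V" "\<one> \<in> V'" "V \<times> V' \<subseteq> ?W"
    using tube_lemma_left[OF W, of "carrier G" \<one>] topspace_T by auto
  then obtain e0 where e0: "0 < e0" "e0 \<le> \<rho>" "B e0 \<subseteq> V'"
    using B_nbhd[of V'] by auto
  show ?thesis
  proof (rule that[of "min e0 r1"])
    fix g x assume "g \<in> carrier G" "x \<in> B (min e0 r1)"
    then have "(g, x) \<in> V \<times> V'" using V(2) e0(3) B_mono[of "min e0 r1" e0] by auto
    then have "(g, x) \<in> ?W" using V(4) by blast
    then show "g \<otimes> x \<otimes> inv g \<in> B e" by simp
  qed (use e0 r1 in auto)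
qed

lemma finite_cover:
  assumes "0 < e"
  obtains F where "finite F" "F \<subseteq> carrier G" "\<And>g. g \<in> carrier G \<Longrightarrow> \<exists>f\<in>F. inv f \<otimes> g \<in> B e"
proof -
  define W where "W f = {g \<in> topspace T. inv f \<otimes> g \<in> B e}" for f
  have "openin T (W f)" if "f \<in> carrier G" for f
    unfolding W_def
    by (rule openin_continuous_map_preimage[OF _ openin_B])
      (intro cont_mult_comp cont_const inv_closed that continuous_map_id[unfolded id_def])
  then have 1: "\<forall>X\<in>W ` carrier G. openin T X" by blast
  have "g \<in> W g" if "g \<in> carrier G" for g
    using that one_in_B[OF assms] topspace_T by (simp add: W_def)
  then have 2: "topspace T \<subseteq> \<Union>(W ` carrier G)" using topspace_T by auto
  obtain FF where "finite FF" "FF \<subseteq> W ` carrier G" "topspace T \<subseteq> \<Union>FF"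
    using compact_T[unfolded compact_space_alt] 1 2 by meson
  then obtain F where F: "finite F" "F \<subseteq> carrier G" "topspace T \<subseteq> \<Union>(W ` F)"
    by (metis finite_subset_image)
  show ?thesis
  proof (rule that[OF F(1,2)])
    fix g assume "g \<in> carrier G"
    then obtain f where "f \<in> F" "g \<in> W f" using F(3) topspace_T by auto
    then show "\<exists>f\<in>F. inv f \<otimes> g \<in> B e" by (auto simp: W_def)
  qed
qed

text \<open>The weight \<open>t + C t\<^sup>2\<close> at least doubles under squaring, which makes successive square roots
  decay like \<open>2\<^sup>-\<^sup>n\<close> without a product of error factors.\<close>

lemma square_weight:
  assumes x: "x \<in> B r1"
  shows "2 * (norm (\<psi> x) + C * (norm (\<psi> x))\<^sup>2) \<le> norm (\<psi> (x \<otimes> x)) + C * (norm (\<psi> (x \<otimes> x)))\<^sup>2"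
proof -
  let ?s = "norm (\<psi> x)" and ?t = "norm (\<psi> (x \<otimes> x))"
  have s: "0 \<le> ?s" "C * ?s \<le> 1 / 16" using Cr1[of ?s] x by (auto simp: B_def)
  have "norm (\<psi> (x \<otimes> x) - \<psi> x - \<psi> x) \<le> C * ?s * ?s"
    by (rule mult_est[OF Br1_rho[OF x] Br1_rho[OF x]])
  moreover have "norm (2 *\<^sub>R \<psi> x) \<le> ?t + norm (\<psi> (x \<otimes> x) - \<psi> x - \<psi> x)"
    using norm_triangle_ineq4[of "\<psi> (x \<otimes> x)" "\<psi> (x \<otimes> x) - \<psi> x - \<psi> x"] by (simp add: scaleR_2)
  ultimately have t: "2 * ?s - C * ?s * ?s \<le> ?t" by simp
  have cs: "C * ?s * ?s \<le> 1 / 16 * ?s" using s by (intro mult_right_mono) auto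
  then have t': "31 / 16 * ?s \<le> ?t" using t by simp
  have "(31 / 16 * ?s)\<^sup>2 \<le> ?t\<^sup>2" using t' s by (intro power_mono) auto
  moreover have "(31 / 16 * ?s)\<^sup>2 = 961 / 256 * ?s\<^sup>2" by (simp add: power_mult_distrib power2_eq_square)
  ultimately have "3 * ?s\<^sup>2 \<le> ?t\<^sup>2" using zero_le_power2[of ?s] by linarith
  then have "C * (3 * ?s\<^sup>2) \<le> C * ?t\<^sup>2" using C_pos by (intro mult_left_mono) auto
  then show ?thesis using t by (simp add: power2_eq_square algebra_simps)
qed

section \<open>Sequences of successive square roots\<close>

definition dyadic :: "(nat \<Rightarrow> 'g) \<Rightarrow> bool" where
  "dyadic x \<longleftrightarrow> (\<forall>n. x n \<in> B r1 \<and> x (Suc n) \<otimes> x (Suc n) = x n)"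

lemma dyadic_norm:
  assumes "dyadic x"
  shows "norm (\<psi> (x n)) \<le> 2 * norm (\<psi> (x 0)) / 2 ^ n"
proof -
  have x: "x n \<in> B r1" "x (Suc n) \<otimes> x (Suc n) = x n" for n using assms by (auto simp: dyadic_def)
  define F where "F n = norm (\<psi> (x n)) + C * (norm (\<psi> (x n)))\<^sup>2" for n
  have step: "2 * F (Suc n) \<le> F n" for n
    using square_weight[OF x(1)[of "Suc n"]] x(2)[of n] by (simp add: F_def)
  have "2 ^ n * F n \<le> F 0" for n
  proof (induction n)
    case (Suc n)
    have "2 ^ Suc n * F (Suc n) = 2 ^ n * (2 * F (Suc n))" by simp
    also have "\<dots> \<le> 2 ^ n * F n" using step by (intro mult_left_mono) auto
    finally show ?case using Suc.IH by (rule order_trans)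
  qed simp
  moreover have "norm (\<psi> (x n)) \<le> F n" using C_pos by (simp add: F_def)
  then have "2 ^ n * norm (\<psi> (x n)) \<le> 2 ^ n * F n" by (intro mult_left_mono) auto
  moreover have "F 0 \<le> 2 * norm (\<psi> (x 0))"
  proof -
    have "C * norm (\<psi> (x 0)) * norm (\<psi> (x 0)) \<le> 1 * norm (\<psi> (x 0))"
      using Cr1[of "norm (\<psi> (x 0))"] x(1)[of 0] by (intro mult_right_mono) (auto simp: B_def)
    then show ?thesis by (simp add: F_def power2_eq_square mult.assoc)
  qed
  ultimately have "2 ^ n * norm (\<psi> (x n)) \<le> 2 * norm (\<psi> (x 0))" by (meson order_trans)
  then show ?thesis by (simp add: field_simps)
qed

text \<open>The increment at \<open>n\<close> is \<open>2 ^ n\<close> times a multiplication error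
  of order \<open>4 ^ -n\<close>, so the sequence converges geometrically. The limit plays the role
  of the logarithm of \<open>x 0\<close>, and the chart agrees with it up to second order.\<close>

lemma dyadic_limit:
  assumes "dyadic x"
  obtains v where "(\<lambda>n. 2 ^ n *\<^sub>R \<psi> (x n)) \<longlonglongrightarrow> v" "norm (v - \<psi> (x 0)) \<le> 2 * C * (norm (\<psi> (x 0)))\<^sup>2"
proof -
  have x: "x n \<in> B r1" "x (Suc n) \<otimes> x (Suc n) = x n" for n using assms by (auto simp: dyadic_def)
  let ?s = "norm (\<psi> (x 0))"
  define d where "d n = 2 ^ Suc n *\<^sub>R \<psi> (x (Suc n)) - 2 ^ n *\<^sub>R \<psi> (x n)" for n
  have d: "norm (d n) \<le> C * ?s\<^sup>2 * (1/2) ^ n" for n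
  proof -
    let ?u = "norm (\<psi> (x (Suc n)))"
    have "norm (\<psi> (x n) - \<psi> (x (Suc n)) - \<psi> (x (Suc n))) \<le> C * ?u * ?u"
      using mult_est[OF Br1_rho[OF x(1)[of "Suc n"]] Br1_rho[OF x(1)[of "Suc n"]]] x(2)[of n] by simp
    moreover have "d n = - (2 ^ n *\<^sub>R (\<psi> (x n) - \<psi> (x (Suc n)) - \<psi> (x (Suc n))))"
      by (simp add: d_def algebra_simps scaleR_2 flip: scaleR_scaleR)
    ultimately have "norm (d n) \<le> 2 ^ n * (C * ?u * ?u)" by simp
    also have "\<dots> \<le> 2 ^ n * (C * (2 * ?s / 2 ^ Suc n) * (2 * ?s / 2 ^ Suc n))"
      using dyadic_norm[OF assms, of "Suc n"] C_pos by (intro mult_left_mono mult_mono) auto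
    also have "\<dots> = C * ?s\<^sup>2 * (1/2) ^ n" by (simp add: field_simps power2_eq_square)
    finally show ?thesis .
  qed
  have sg: "summable (\<lambda>n. C * ?s\<^sup>2 * (1/2) ^ n)" by (intro summable_mult summable_geometric) simp
  have sd: "summable (\<lambda>n. norm (d n))" by (rule summable_comparison_test'[OF sg, of 0]) (use d in simp)
  have tel: "(\<Sum>i<n. d i) = 2 ^ n *\<^sub>R \<psi> (x n) - \<psi> (x 0)" for n
    by (induction n) (simp_all add: d_def)
  have "(\<lambda>n. \<Sum>i<n. d i) \<longlonglongrightarrow> suminf d"
    using summable_LIMSEQ[OF summable_norm_cancel[OF sd]] .
  then have "(\<lambda>n. (2 ^ n *\<^sub>R \<psi> (x n) - \<psi> (x 0)) + \<psi> (x 0)) \<longlonglongrightarrow> suminf d + \<psi> (x 0)"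
    unfolding tel by (intro tendsto_add tendsto_const)
  then have 1: "(\<lambda>n. 2 ^ n *\<^sub>R \<psi> (x n)) \<longlonglongrightarrow> suminf d + \<psi> (x 0)" by simp
  have "norm (suminf d) \<le> (\<Sum>n. norm (d n))" by (rule summable_norm[OF sd])
  also have "\<dots> \<le> (\<Sum>n. C * ?s\<^sup>2 * (1/2) ^ n)" by (rule suminf_le[OF d sd sg])
  also have "\<dots> = 2 * C * ?s\<^sup>2" by (simp add: suminf_mult[OF summable_geometric] suminf_geometric)
  finally show ?thesis using that[OF 1] by simp
qed

section \<open>The adjoint action near the identity and its continuity\<close>

lemma conj_limit:
  assumes g: "g \<in> carrier G"
  shows "((\<lambda>t::real. \<psi> (g \<otimes> \<theta> (t *\<^sub>R v) \<otimes> inv g) /\<^sub>R t) \<longlongrightarrow> a g v) (at 0)"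
proof -
  define f where "f u = \<psi> (g \<otimes> \<theta> u \<otimes> inv g)" for u
  have f0: "f 0 = 0" using g psi_one by (simp add: f_def)
  have 1: "((\<lambda>t::real. t *\<^sub>R v) has_derivative (\<lambda>t. t *\<^sub>R v)) (at 0)" by (intro derivative_intros)
  have "(f has_derivative a g) (at (0 *\<^sub>R v))" using a_deriv[OF g] by (simp add: f_def[abs_def])
  from has_derivative_compose[OF 1 this]
  have "((\<lambda>t. f (t *\<^sub>R v)) has_derivative (\<lambda>t. t *\<^sub>R a g v)) (at 0)"
    using linear_scale[OF a_linear[OF g]] by simp
  then have "((\<lambda>t. (f (t *\<^sub>R v) - t *\<^sub>R a g v) /\<^sub>R norm t) \<longlongrightarrow> 0) (at 0)"
    using f0 by (simp add: has_derivative_def)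
  then have "((\<lambda>t. norm ((f (t *\<^sub>R v) - t *\<^sub>R a g v) /\<^sub>R norm t)) \<longlongrightarrow> 0) (at 0)"
    by (rule tendsto_norm_zero)
  moreover have "\<forall>\<^sub>F t in at 0. norm ((f (t *\<^sub>R v) - t *\<^sub>R a g v) /\<^sub>R norm t) = norm (f (t *\<^sub>R v) /\<^sub>R t - a g v)"
  proof -
    have "norm ((f (t *\<^sub>R v) - t *\<^sub>R a g v) /\<^sub>R norm t) = norm (f (t *\<^sub>R v) /\<^sub>R t - a g v)" if "t \<noteq> 0" for t
    proof -
      have "f (t *\<^sub>R v) /\<^sub>R t - a g v = (f (t *\<^sub>R v) - t *\<^sub>R a g v) /\<^sub>R t"
        using that by (simp add: scaleR_diff_right)
      then show ?thesis by simp
    qed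
    then show ?thesis unfolding eventually_at_filter by simp
  qed
  ultimately have "((\<lambda>t. norm (f (t *\<^sub>R v) /\<^sub>R t - a g v)) \<longlongrightarrow> 0) (at 0)"
    by (rule Lim_transform_eventually)
  then have "((\<lambda>t. f (t *\<^sub>R v) /\<^sub>R t - a g v) \<longlongrightarrow> 0) (at 0)" by (rule tendsto_norm_zero_cancel)
  then show ?thesis unfolding f_def by (rule LIM_zero_cancel)
qed

text \<open>For \<open>y' = x \<otimes> y \<otimes> inv x\<close>, the products
  \<open>y' \<otimes> x\<close> and \<open>x \<otimes> y\<close> coincide; expanding both shows that
  conjugation displaces \<open>y\<close> by at most a multiple of
  \<open>norm (\<psi> x) * norm (\<psi> y)\<close>. Dividing by t along a line through 0 passes to
  the differential.\<close>

lemma a_est: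
  assumes x: "x \<in> B r1"
  shows "norm (a x v - v) \<le> 3 * C * norm (\<psi> x) * norm v"
proof -
  obtain e where e: "0 < e" "e \<le> r1" "\<And>g x. g \<in> carrier G \<Longrightarrow> x \<in> B e \<Longrightarrow> g \<otimes> x \<otimes> inv g \<in> B r1"
    by (rule conj_nbhd[OF r1(1)]) (rule that)
  have xc: "x \<in> carrier G" by (rule B_closed[OF x])
  have est: "norm (\<psi> (x \<otimes> \<theta> w \<otimes> inv x) - w) \<le> 3 * C * norm (\<psi> x) * norm w" if w: "norm w < e" for w
  proof -
    define y where "y = \<theta> w"
    define y' where "y' = x \<otimes> y \<otimes> inv x"
    have y: "y \<in> B e" "\<psi> y = w"
      using theta_in_B[OF w] psi_theta[of w] w e(2) r1 by (auto simp: y_def)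
    have yr: "y \<in> B r1" using y B_mono[OF e(2)] by auto
    have y': "y' \<in> B r1" unfolding y'_def by (rule e(3)[OF xc y(1)])
    have eq: "y' \<otimes> x = x \<otimes> y" unfolding y'_def using xc B_closed[OF yr] by (simp add: m_assoc)
    have 1: "norm (\<psi> (x \<otimes> y) - \<psi> x - w) \<le> C * norm (\<psi> x) * norm w"
      using mult_est[OF Br1_rho[OF x] Br1_rho[OF yr]] y(2) by simp
    have 2: "norm (\<psi> (x \<otimes> y) - \<psi> y' - \<psi> x) \<le> C * norm (\<psi> x) * norm (\<psi> y')"
      using mult_est[OF Br1_rho[OF y'] Br1_rho[OF x]] eq by (simp add: mult.commute mult.left_commute)
    have 3: "norm (\<psi> y' - w) \<le> C * norm (\<psi> x) * norm w + C * norm (\<psi> x) * norm (\<psi> y')"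
      using 1 2 norm_triangle_ineq4[of "\<psi> (x \<otimes> y) - \<psi> x - w" "\<psi> (x \<otimes> y) - \<psi> y' - \<psi> x"] by simp
    have cx: "C * norm (\<psi> x) \<le> 1 / 16" using Cr1[of "norm (\<psi> x)"] x by (auto simp: B_def)
    have 4: "norm (\<psi> y') \<le> norm w + norm (\<psi> y' - w)" using norm_triangle_ineq[of w "\<psi> y' - w"] by simp
    have 5: "norm (\<psi> y') \<le> 2 * norm w"
      using 3 4 mult_right_mono[OF cx norm_ge_zero[of w]] mult_right_mono[OF cx norm_ge_zero[of "\<psi> y'"]]
        norm_ge_zero[of w] by linarith
    have "C * norm (\<psi> x) * norm (\<psi> y') \<le> C * norm (\<psi> x) * (2 * norm w)"
      using 5 C_pos by (intro mult_left_mono) auto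
    then have "norm (\<psi> y' - w) \<le> 3 * C * norm (\<psi> x) * norm w" using 3 by simp
    then show ?thesis by (simp add: y'_def y_def)
  qed
  have "((\<lambda>t::real. \<psi> (x \<otimes> \<theta> (t *\<^sub>R v) \<otimes> inv x) /\<^sub>R t - v) \<longlongrightarrow> a x v - v) (at 0)"
    by (intro tendsto_diff conj_limit[OF xc] tendsto_const)
  moreover have "\<forall>\<^sub>F t::real in at 0. norm (\<psi> (x \<otimes> \<theta> (t *\<^sub>R v) \<otimes> inv x) /\<^sub>R t - v) \<le> 3 * C * norm (\<psi> x) * norm v"
  proof -
    have "((\<lambda>t::real. norm (t *\<^sub>R v)) \<longlongrightarrow> norm (0 *\<^sub>R v)) (at 0)" by (intro tendsto_intros)
    then have "\<forall>\<^sub>F t::real in at 0. norm (t *\<^sub>R v) < e"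
      using e(1) by (intro order_tendstoD(2)[of _ "norm (0 *\<^sub>R v)"]) auto
    then have "\<forall>\<^sub>F t::real in at 0. t \<noteq> 0 \<and> norm (t *\<^sub>R v) < e"
      by (simp add: eventually_at_filter)
    then show ?thesis
    proof (rule eventually_mono)
      fix t :: real assume t: "t \<noteq> 0 \<and> norm (t *\<^sub>R v) < e"
      let ?z = "\<psi> (x \<otimes> \<theta> (t *\<^sub>R v) \<otimes> inv x)"
      have "?z /\<^sub>R t - v = (?z - t *\<^sub>R v) /\<^sub>R t" using t by (simp add: scaleR_diff_right)
      then have "norm (?z /\<^sub>R t - v) = norm (?z - t *\<^sub>R v) / \<bar>t\<bar>" by (simp add: divide_inverse mult.commute)
      also have "\<dots> \<le> (3 * C * norm (\<psi> x) * norm (t *\<^sub>R v)) / \<bar>t\<bar>"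
        using est[of "t *\<^sub>R v"] t by (intro divide_right_mono) auto
      also have "\<dots> = 3 * C * norm (\<psi> x) * norm v" using t by simp
      finally show "norm (?z /\<^sub>R t - v) \<le> 3 * C * norm (\<psi> x) * norm v" .
    qed
  qed
  ultimately show ?thesis by (rule Lim_norm_ubound[rotated]) simp
qed

text \<open>At the identity this is \<open>a_est\<close>; multiplicativity carries it to any
  \<open>g0\<close>.\<close>

lemma cont_a: "continuous_map T euclidean (\<lambda>g. a g v)"
  unfolding continuous_map_eq_topcontinuous_at topcontinuous_at_def
proof (intro ballI conjI allI impI)
  fix g0 V assume g0: "g0 \<in> topspace T" and V: "openin euclidean V \<and> a g0 v \<in> V"
  have g0c: "g0 \<in> carrier G" using g0 topspace_T by simp
  obtain eps where eps: "eps > 0" "ball (a g0 v) eps \<subseteq> V" using V open_contains_ball[of V] by auto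
  obtain K where K: "K > 0" "\<And>w. norm (a g0 w) \<le> K * norm w"
    using linear_bounded_pos[OF a_linear[OF g0c]] by blast
  define e where "e = min r1 (eps / (K * (3 * C * norm v) + 1))"
  have den: "K * (3 * C * norm v) + 1 > 0" using K(1) C_pos by (intro add_nonneg_pos mult_nonneg_nonneg) auto
  have e: "e > 0" using eps(1) den r1(1) by (simp add: e_def)
  define W where "W = {g \<in> topspace T. inv g0 \<otimes> g \<in> B e}"
  have "openin T W" unfolding W_def
    by (rule openin_continuous_map_preimage[OF _ openin_B])
      (intro cont_mult_comp cont_const inv_closed g0c continuous_map_id[unfolded id_def])
  moreover have "g0 \<in> W" using g0 g0c one_in_B[OF e] by (simp add: W_def)
  moreover have "a g v \<in> V" if "g \<in> W" for g
  proof -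
    define q where "q = inv g0 \<otimes> g"
    have gc: "g \<in> carrier G" and q: "q \<in> B e" using that topspace_T by (auto simp: W_def q_def)
    have qr: "q \<in> B r1" using q B_mono[of e r1] by (auto simp: e_def)
    have "g = g0 \<otimes> q" using gc g0c by (simp add: q_def m_assoc[symmetric])
    then have "a g v - a g0 v = a g0 (a q v - v)"
      using a_mult[OF g0c B_closed[OF q]] linear_diff[OF a_linear[OF g0c]] by simp
    then have "norm (a g v - a g0 v) \<le> K * norm (a q v - v)" using K(2) by simp
    also have "\<dots> \<le> K * (3 * C * norm (\<psi> q) * norm v)"
      using a_est[OF qr] K(1) by (intro mult_left_mono) auto
    also have "\<dots> \<le> K * (3 * C * norm v) * e"
    proof -
      have "K * (3 * C * norm v) * norm (\<psi> q) \<le> K * (3 * C * norm v) * e"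
        using q K(1) C_pos by (intro mult_left_mono) (auto simp: B_def)
      then show ?thesis by (simp add: mult_ac)
    qed
    also have "\<dots> < (K * (3 * C * norm v) + 1) * e" using e by (simp add: algebra_simps)
    also have "\<dots> \<le> eps"
    proof -
      have "e \<le> eps / (K * (3 * C * norm v) + 1)" by (simp add: e_def)
      then show ?thesis using pos_le_divide_eq[OF den] by (simp add: mult.commute)
    qed
    finally have "dist (a g0 v) (a g v) < eps" by (simp add: dist_norm norm_minus_commute)
    then show ?thesis using eps(2) by auto
  qed
  ultimately show "\<exists>W. openin T W \<and> g0 \<in> W \<and> (\<forall>g\<in>W. a g v \<in> V)" by blast
qed auto

lemma a_sum_basis:
  assumes "g \<in> carrier G"
  shows "a g v = (\<Sum>b\<in>Basis. (v \<bullet> b) *\<^sub>R a g b)"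
proof -
  note lin = a_linear[OF assms]
  have "a g v = a g (\<Sum>b\<in>Basis. (v \<bullet> b) *\<^sub>R b)" by (simp add: euclidean_representation)
  then show ?thesis by (simp add: linear_sum[OF lin] linear_scale[OF lin])
qed

lemma (in -) continuous_map_scaleR:
  fixes h :: "'a \<Rightarrow> 'b::real_normed_vector"
  assumes "continuous_map X euclideanreal f" "continuous_map X euclidean h"
  shows "continuous_map X euclidean (\<lambda>x. f x *\<^sub>R h x)"
proof -
  have "continuous_map X (prod_topology euclidean euclidean) (\<lambda>x. (f x, h x))"
    by (intro continuous_map_pairedI assms)
  then have 1: "continuous_map X euclidean (\<lambda>x. (f x, h x))" by (simp only: prod_topology_euclidean)
  have "continuous_map euclidean euclidean (\<lambda>p. fst p *\<^sub>R (snd p :: 'b))"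
    by (auto intro!: continuous_intros)
  from continuous_map_compose[OF 1 this] show ?thesis by (simp add: o_def)
qed

lemma cont_a_comp:
  assumes f: "continuous_map X T f" and h: "continuous_map X euclidean h"
  shows "continuous_map X euclidean (\<lambda>x. a (f x) (h x))"
proof -
  have "continuous_map X euclidean (\<lambda>x. a (f x) b)" for b
    using continuous_map_compose[OF f cont_a] by (simp add: o_def)
  moreover have "continuous_map X euclideanreal (\<lambda>x. h x \<bullet> b)" for b
    using continuous_map_compose[OF h, of euclideanreal "\<lambda>v. v \<bullet> b"]
    by (simp add: o_def continuous_on_inner continuous_on_const continuous_on_id)
  ultimately have "continuous_map X euclidean (\<lambda>x. \<Sum>b\<in>Basis. (h x \<bullet> b) *\<^sub>R a (f x) b)"
    by (intro continuous_map_sum continuous_map_scaleR finite_Basis)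
  then show ?thesis
  proof (rule continuous_map_eq)
    fix x assume "x \<in> topspace X"
    then have "f x \<in> carrier G" using f topspace_T by (auto simp: continuous_map_def)
    then show "(\<Sum>b\<in>Basis. (h x \<bullet> b) *\<^sub>R a (f x) b) = a (f x) (h x)" using a_sum_basis by metis
  qed
qed

lemma a_bounded:
  obtains M where "M > 0" "\<And>g v. g \<in> carrier G \<Longrightarrow> norm (a g v) \<le> M * norm v"
proof -
  have "\<exists>M. \<forall>g\<in>carrier G. norm (a g b) \<le> M" for b
  proof -
    have "compactin euclidean ((\<lambda>g. a g b) ` topspace T)"
      using image_compactin[OF _ cont_a] compact_T by (auto simp: compact_space_def)
    then have "bounded ((\<lambda>g. a g b) ` carrier G)" using topspace_T compact_imp_bounded by simp
    then show ?thesis by (auto simp: bounded_iff)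
  qed
  then obtain M where M: "\<And>b g. g \<in> carrier G \<Longrightarrow> norm (a g b) \<le> M b" by metis
  define K where "K = (\<Sum>b\<in>Basis. \<bar>M b\<bar>) + 1"
  have K: "K > 0" unfolding K_def by (intro add_nonneg_pos sum_nonneg) auto
  show ?thesis
  proof (rule that[OF K])
    fix g v assume g: "g \<in> carrier G"
    have "norm (a g v) \<le> (\<Sum>b\<in>Basis. norm v * \<bar>M b\<bar>)"
      unfolding a_sum_basis[OF g, of v]
    proof (rule sum_norm_le)
      fix b :: 'e assume b: "b \<in> Basis"
      show "norm ((v \<bullet> b) *\<^sub>R a g b) \<le> norm v * \<bar>M b\<bar>"
        using Basis_le_norm[OF b, of v] M[OF g, of b] by (auto intro!: mult_mono)
    qed
    also have "\<dots> = (\<Sum>b\<in>Basis. \<bar>M b\<bar>) * norm v" by (simp add: sum_distrib_left mult.commute)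
    also have "\<dots> \<le> K * norm v" unfolding K_def by (intro mult_right_mono) auto
    finally show "norm (a g v) \<le> K * norm v" .
  qed
qed

lemma a_inv: "g \<in> carrier G \<Longrightarrow> a (inv g) (a g v) = v" "g \<in> carrier G \<Longrightarrow> a g (a (inv g) v) = v"
  using a_mult[of "inv g" g v] a_mult[of g "inv g" v] a_one by simp_all

section \<open>One-parameter subgroups\<close>

definition one_param :: "(real \<Rightarrow> 'g) \<Rightarrow> bool" where
  "one_param x \<longleftrightarrow> (\<forall>s t. x (s + t) = x s \<otimes> x t) \<and> continuous_map euclideanreal T x"

lemma one_paramD:
  assumes "one_param x"
  shows "x (s + t) = x s \<otimes> x t" "continuous_map euclideanreal T x" "x t \<in> carrier G" "x 0 = \<one>"
    "x (- t) = inv (x t)"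
proof -
  show add: "x (s + t) = x s \<otimes> x t" for s t using assms by (simp add: one_param_def)
  show "continuous_map euclideanreal T x" using assms by (simp add: one_param_def)
  then show c: "x t \<in> carrier G" for t using topspace_T by (auto simp: continuous_map_def)
  have "x 0 \<otimes> x 0 = x 0" using add[of 0 0] by simp
  then show 0: "x 0 = \<one>" using c[of 0] by (metis l_cancel_one)
  have "x t \<otimes> x (- t) = \<one>" using add[of t "- t"] 0 by simp
  then show "x (- t) = inv (x t)" using c inv_equality[of "x (- t)" "x t"] inv_comm by metis
qed

lemma one_param_near:
  assumes x: "one_param x" and W: "openin T W" "\<one> \<in> W"
  obtains t0 where "t0 > 0" "\<And>t. \<bar>t\<bar> \<le> t0 \<Longrightarrow> x t \<in> W"
proof -
  have "openin euclideanreal {t \<in> topspace euclideanreal. x t \<in> W}"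
    by (rule openin_continuous_map_preimage[OF one_paramD(2)[OF x] W(1)])
  then have "open {t. x t \<in> W}" by simp
  moreover have "0 \<in> {t. x t \<in> W}" using one_paramD(4)[OF x] W(2) by simp
  ultimately obtain d where "d > 0" "cball 0 d \<subseteq> {t. x t \<in> W}" using open_contains_cball by blast
  then show ?thesis using that[of d] by (auto simp: subset_iff dist_norm)
qed

text \<open>The deviation \<open>D\<close> from the linear function vanishes at \<open>t0\<close>.
  Doubling modulo \<open>t0\<close> maps [0, t0] to itself and doubles the value of
  \<open>D\<close>, so a non-zero value would contradict boundedness.\<close>

lemma additive_bounded_interval:
  fixes L :: "real \<Rightarrow> 'b::real_normed_vector"
  assumes t0: "t0 > 0"
    and add: "\<And>s t. \<bar>s\<bar> \<le> t0 \<Longrightarrow> \<bar>t\<bar> \<le> t0 \<Longrightarrow> \<bar>s + t\<bar> \<le> t0 \<Longrightarrow> L (s + t) = L s + L t"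
    and bd: "\<And>t. \<bar>t\<bar> \<le> t0 \<Longrightarrow> norm (L t) \<le> M"
    and t: "\<bar>t\<bar> \<le> t0"
  shows "L t = (t / t0) *\<^sub>R L t0"
proof -
  define D where "D s = L s - (s / t0) *\<^sub>R L t0" for s
  have Dadd: "D (s + t) = D s + D t" if "\<bar>s\<bar> \<le> t0" "\<bar>t\<bar> \<le> t0" "\<bar>s + t\<bar> \<le> t0" for s t
    using add[OF that] by (simp add: D_def add_divide_distrib scaleR_add_left)
  have D0: "D t0 = 0" using t0 by (simp add: D_def)
  have Dz: "D 0 = 0" using Dadd[of 0 0] t0 by simp
  have Dneg: "D (- s) = - D s" if "\<bar>s\<bar> \<le> t0" for s
  proof -
    have "D (s + - s) = D s + D (- s)" by (rule Dadd) (use that t0 in auto)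
    then show ?thesis using Dz by (simp add: eq_neg_iff_add_eq_0 add.commute)
  qed
  have "2 ^ n * norm (D s) \<le> 2 * M" if "0 \<le> s" "s \<le> t0" for n s
    using that
  proof (induction n arbitrary: s)
    case 0
    have "norm (D s) \<le> norm (L s) + norm ((s / t0) *\<^sub>R L t0)" unfolding D_def by (rule norm_triangle_ineq4)
    also have "norm ((s / t0) *\<^sub>R L t0) \<le> 1 * norm (L t0)"
      unfolding norm_scaleR using 0 t0 by (intro mult_right_mono) auto
    finally show ?case using bd[of s] bd[of t0] 0 t0 by simp
  next
    case (Suc n)
    define s' where "s' = (if 2 * s \<le> t0 then 2 * s else 2 * s - t0)"
    have s': "0 \<le> s'" "s' \<le> t0" using Suc.prems by (auto simp: s'_def)
    have "D s' = 2 *\<^sub>R D s"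
    proof (cases "2 * s \<le> t0")
      case True
      then show ?thesis using Dadd[of s s] Suc.prems by (simp add: s'_def scaleR_2)
    next
      case False
      have "D (s + (s - t0)) = D s + D (s - t0)" by (rule Dadd) (use False Suc.prems in auto)
      moreover have "D (s + - t0) = D s + D (- t0)" by (rule Dadd) (use False Suc.prems in auto)
      ultimately show ?thesis using Dneg[of t0] D0 t0 False by (simp add: s'_def scaleR_2 algebra_simps)
    qed
    then have "norm (D s') = 2 * norm (D s)" by simp
    then show ?case using Suc.IH[OF s'] by simp
  qed
  then have Dzero: "D s = 0" if s: "0 \<le> s" "s \<le> t0" for s
  proof -
    have "norm (D s) = 0"
    proof (rule ccontr)
      assume "norm (D s) \<noteq> 0"
      then have pos: "norm (D s) > 0" by simp
      obtain n where "2 * M / norm (D s) < 2 ^ n" using real_arch_pow[of 2 "2 * M / norm (D s)"] by auto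
      then have "2 * M < 2 ^ n * norm (D s)" using pos by (simp add: divide_less_eq)
      then show False using \<open>\<And>s n. 0 \<le> s \<Longrightarrow> s \<le> t0 \<Longrightarrow> 2 ^ n * norm (D s) \<le> 2 * M\<close>[OF s, of n] by simp
    qed
    then show ?thesis by simp
  qed
  have "D t = 0"
  proof (cases "t \<ge> 0")
    case False
    then show ?thesis using Dneg[of t] Dzero[of "- t"] t by simp
  qed (use Dzero t in auto)
  then show ?thesis by (simp add: D_def)
qed

text \<open>The logarithm \<open>L t\<close> of the dyadic sequence \<open>x (t / 2 ^ n)\<close> is
  additive in t, because the multiplication error at scale \<open>2 ^ -n\<close> is of order
  \<open>4 ^ -n\<close>; being bounded it is linear, and its slope is the tangent vector. The last
  bound says in particular that tangent vector 0 forces the subgroup to be trivial near 0.\<close>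

lemma one_param_derivative:
  assumes x: "one_param x"
  obtains v t0 K where "t0 > 0" "K \<ge> 0"
    "\<And>t. \<bar>t\<bar> \<le> t0 \<Longrightarrow> x t \<in> B r1 \<and> norm (\<psi> (x t) - t *\<^sub>R v) \<le> K * t\<^sup>2 \<and> norm (\<psi> (x t)) \<le> 2 * \<bar>t\<bar> * norm v"
proof -
  obtain t0 where t0: "t0 > 0" "\<And>t. \<bar>t\<bar> \<le> t0 \<Longrightarrow> x t \<in> B r1"
    by (rule one_param_near[OF x openin_B one_in_B[OF r1(1)]]) (rule that)
  have dy: "dyadic (\<lambda>n. x (t / 2 ^ n))" if t: "\<bar>t\<bar> \<le> t0" for t
    unfolding dyadic_def
  proof (intro allI conjI)
    fix n
    have "\<bar>t / 2 ^ n\<bar> \<le> \<bar>t\<bar>" by (simp add: abs_divide divide_le_eq mult_le_cancel_left1)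
    then show "x (t / 2 ^ n) \<in> B r1" using t0(2) t by simp
    show "x (t / 2 ^ Suc n) \<otimes> x (t / 2 ^ Suc n) = x (t / 2 ^ n)"
      using one_paramD(1)[OF x, of "t / 2 ^ Suc n" "t / 2 ^ Suc n"] by simp
  qed
  define L where "L t = lim (\<lambda>n. 2 ^ n *\<^sub>R \<psi> (x (t / 2 ^ n)))" for t
  have L: "(\<lambda>n. 2 ^ n *\<^sub>R \<psi> (x (t / 2 ^ n))) \<longlonglongrightarrow> L t" "norm (L t - \<psi> (x t)) \<le> 2 * C * (norm (\<psi> (x t)))\<^sup>2"
    if t: "\<bar>t\<bar> \<le> t0" for t
  proof -
    obtain v where v: "(\<lambda>n. 2 ^ n *\<^sub>R \<psi> (x (t / 2 ^ n))) \<longlonglongrightarrow> v"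
      "norm (v - \<psi> (x (t / 2 ^ 0))) \<le> 2 * C * (norm (\<psi> (x (t / 2 ^ 0))))\<^sup>2"
      by (rule dyadic_limit[OF dy[OF t]]) (rule that)
    then have "L t = v" unfolding L_def by (simp add: limI)
    then show "(\<lambda>n. 2 ^ n *\<^sub>R \<psi> (x (t / 2 ^ n))) \<longlonglongrightarrow> L t" "norm (L t - \<psi> (x t)) \<le> 2 * C * (norm (\<psi> (x t)))\<^sup>2"
      using v by simp_all
  qed
  have small: "2 * C * norm (\<psi> (x t)) \<le> 1 / 8" if t: "\<bar>t\<bar> \<le> t0" for t
    using Cr1[of "norm (\<psi> (x t))"] t0(2)[OF t] by (auto simp: B_def)
  have Ld: "norm (L t - \<psi> (x t)) \<le> 1 / 8 * norm (\<psi> (x t))" if t: "\<bar>t\<bar> \<le> t0" for t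
    using L(2)[OF t] mult_right_mono[OF small[OF t] norm_ge_zero[of "\<psi> (x t)"]]
    by (simp add: power2_eq_square mult.assoc)
  have Lnorm: "norm (\<psi> (x t)) \<le> 2 * norm (L t)" if t: "\<bar>t\<bar> \<le> t0" for t
  proof -
    have "norm (\<psi> (x t)) \<le> norm (L t) + norm (L t - \<psi> (x t))"
      using norm_triangle_ineq4[of "L t" "L t - \<psi> (x t)"] by simp
    then show ?thesis using Ld[OF t] norm_ge_zero[of "L t"] by linarith
  qed
  have Lb: "norm (L t) \<le> 2" if t: "\<bar>t\<bar> \<le> t0" for t
    using Ld[OF t] norm_triangle_ineq[of "L t - \<psi> (x t)" "\<psi> (x t)"] t0(2)[OF t] r1(2)
    by (auto simp: B_def)
  have Ladd: "L (s + t) = L s + L t" if st: "\<bar>s\<bar> \<le> t0" "\<bar>t\<bar> \<le> t0" "\<bar>s + t\<bar> \<le> t0" for s t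
  proof -
    have "(\<lambda>n. 2 ^ n *\<^sub>R \<psi> (x ((s + t) / 2 ^ n)) - 2 ^ n *\<^sub>R \<psi> (x (s / 2 ^ n)) - 2 ^ n *\<^sub>R \<psi> (x (t / 2 ^ n)))
        \<longlonglongrightarrow> L (s + t) - L s - L t"
      by (intro tendsto_diff L st)
    moreover have "(\<lambda>n. 2 ^ n *\<^sub>R \<psi> (x ((s + t) / 2 ^ n)) - 2 ^ n *\<^sub>R \<psi> (x (s / 2 ^ n)) - 2 ^ n *\<^sub>R \<psi> (x (t / 2 ^ n)))
        \<longlonglongrightarrow> 0"
    proof (rule Lim_null_comparison)
      show "(\<lambda>n. (4 * C) * (1 / 2) ^ n) \<longlonglongrightarrow> 0"
        by (intro tendsto_mult_right_zero LIMSEQ_power_zero) simp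
      show "\<forall>\<^sub>F n in sequentially. norm (2 ^ n *\<^sub>R \<psi> (x ((s + t) / 2 ^ n)) - 2 ^ n *\<^sub>R \<psi> (x (s / 2 ^ n))
          - 2 ^ n *\<^sub>R \<psi> (x (t / 2 ^ n))) \<le> (4 * C) * (1 / 2) ^ n"
      proof (rule always_eventually, rule allI)
        fix n
        let ?p = "x (s / 2 ^ n)" and ?q = "x (t / 2 ^ n)"
        have pq: "?p \<in> B r1" "?q \<in> B r1" using dy[OF st(1)] dy[OF st(2)] by (auto simp: dyadic_def)
        have n: "norm (\<psi> ?p) \<le> 2 / 2 ^ n" "norm (\<psi> ?q) \<le> 2 / 2 ^ n"
          using dyadic_norm[OF dy[OF st(1)], of n] dyadic_norm[OF dy[OF st(2)], of n] t0(2)[OF st(1)] t0(2)[OF st(2)] r1(2)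
          by (auto simp: B_def elim!: order_trans intro!: divide_right_mono)
        have eq: "x ((s + t) / 2 ^ n) = ?p \<otimes> ?q"
          using one_paramD(1)[OF x, of "s / 2 ^ n" "t / 2 ^ n"] by (simp add: add_divide_distrib)
        have "norm (2 ^ n *\<^sub>R \<psi> (?p \<otimes> ?q) - 2 ^ n *\<^sub>R \<psi> ?p - 2 ^ n *\<^sub>R \<psi> ?q) =
            2 ^ n * norm (\<psi> (?p \<otimes> ?q) - \<psi> ?p - \<psi> ?q)"
          by (simp flip: scaleR_diff_right)
        also have "\<dots> \<le> 2 ^ n * (C * norm (\<psi> ?p) * norm (\<psi> ?q))"
          by (intro mult_left_mono mult_est Br1_rho pq) simp
        also have "\<dots> \<le> 2 ^ n * (C * (2 / 2 ^ n) * (2 / 2 ^ n))"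
          using n C_pos by (intro mult_left_mono mult_mono) auto
        also have "\<dots> = (4 * C) * (1 / 2) ^ n" by (simp add: field_simps)
        finally show "norm (2 ^ n *\<^sub>R \<psi> (x ((s + t) / 2 ^ n)) - 2 ^ n *\<^sub>R \<psi> ?p - 2 ^ n *\<^sub>R \<psi> ?q)
            \<le> (4 * C) * (1 / 2) ^ n" unfolding eq .
      qed
    qed
    ultimately have "L (s + t) - L s - L t = 0" by (rule LIMSEQ_unique)
    then show ?thesis by (simp add: algebra_simps)
  qed
  define v where "v = L t0 /\<^sub>R t0"
  have Lv: "L t = t *\<^sub>R v" if t: "\<bar>t\<bar> \<le> t0" for t
    using additive_bounded_interval[of t0 L 2 t, OF t0(1) Ladd Lb t] by (simp add: v_def divide_inverse)
  show ?thesis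
  proof (rule that[OF t0(1), of "2 * C * (2 * norm v)\<^sup>2"])
    show "0 \<le> 2 * C * (2 * norm v)\<^sup>2" using C_pos by simp
    fix t :: real assume t: "\<bar>t\<bar> \<le> t0"
    have n: "norm (\<psi> (x t)) \<le> 2 * \<bar>t\<bar> * norm v" using Lnorm[OF t] Lv[OF t] by simp
    have "norm (\<psi> (x t) - t *\<^sub>R v) \<le> 2 * C * (norm (\<psi> (x t)))\<^sup>2"
      using L(2)[OF t] Lv[OF t] by (simp add: norm_minus_commute)
    also have "\<dots> \<le> 2 * C * (2 * \<bar>t\<bar> * norm v)\<^sup>2"
      using n C_pos by (intro mult_left_mono power_mono) auto
    also have "\<dots> = 2 * C * (2 * norm v)\<^sup>2 * t\<^sup>2" by (simp add: power_mult_distrib)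
    finally show "x t \<in> B r1 \<and> norm (\<psi> (x t) - t *\<^sub>R v) \<le> 2 * C * (2 * norm v)\<^sup>2 * t\<^sup>2 \<and>
        norm (\<psi> (x t)) \<le> 2 * \<bar>t\<bar> * norm v"
      using n t0(2)[OF t] by simp
  qed
qed

end

lemma convergent_geometric_increments:
  fixes f :: "nat \<Rightarrow> 'a::banach"
  assumes "\<And>n. norm (f (Suc n) - f n) \<le> c * (1/2) ^ n"
  shows "convergent f"
proof -
  have "summable (\<lambda>n. f (Suc n) - f n)"
    by (rule summable_comparison_test'[of "\<lambda>n. c * (1/2) ^ n" 0])
      (use assms in \<open>auto intro!: summable_mult summable_geometric\<close>)
  then have "convergent (\<lambda>n. \<Sum>i<n. f (Suc i) - f i)" by (simp add: summable_iff_convergent)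
  moreover have "(\<Sum>i<n. f (Suc i) - f i) = f n - f 0" for n by (induction n) simp_all
  ultimately have "convergent (\<lambda>n. (f n - f 0) + f 0)" by (intro convergent_add convergent_const) simp
  then show ?thesis by simp
qed

section \<open>One-parameter subgroups through points near the identity\<close>

context lie_chart
begin

text \<open>The chart coordinate of the root is a fixed point of \<open>f\<close>, a contraction
  with constant 1/16 by \<open>square_lipschitz\<close>. Since \<open>f\<close> maps 0 to half of
  \<open>v\<close>, it preserves the ball of radius \<open>norm v\<close>.\<close>

lemma root_exists:
  assumes y: "y \<in> B r1"
  shows "\<exists>x\<in>B r1. x \<otimes> x = y"
proof -
  define v where "v = \<psi> y"
  have v: "norm v < r1" using y by (simp add: B_def v_def)
  define S where "S = cball (0::'e) (norm v)"
  define f where "f u = (1/2) *\<^sub>R (v - (\<psi> (\<theta> u \<otimes> \<theta> u) - 2 *\<^sub>R u))" for u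
  have S: "\<theta> u \<in> B r1 \<and> \<psi> (\<theta> u) = u" if "u \<in> S" for u
  proof -
    have "norm u < r1" using that v by (simp add: S_def)
    then show ?thesis using theta_in_B[of u r1] psi_theta[of u] r1 by auto
  qed
  have lip: "norm (f u - f w) \<le> 1 / 16 * norm (u - w)" if uw: "u \<in> S" "w \<in> S" for u w
  proof -
    have "f u - f w = - ((1/2) *\<^sub>R (\<psi> (\<theta> u \<otimes> \<theta> u) - \<psi> (\<theta> w \<otimes> \<theta> w) - 2 *\<^sub>R (u - w)))"
      by (simp add: f_def algebra_simps)
    then have "norm (f u - f w) = 1 / 2 * norm (\<psi> (\<theta> u \<otimes> \<theta> u) - \<psi> (\<theta> w \<otimes> \<theta> w) - 2 *\<^sub>R (u - w))"
      by simp
    also have "\<dots> \<le> 1 / 2 * (norm (u - w) / 8)"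
      using square_lipschitz[of "\<theta> u" "\<theta> w"] S[OF uw(1)] S[OF uw(2)] by (intro mult_left_mono) auto
    finally show ?thesis by simp
  qed
  have 0: "0 \<in> S" by (simp add: S_def)
  have f0: "f 0 = (1/2) *\<^sub>R v" using psi_one by (simp add: f_def)
  have "f ` S \<subseteq> S"
  proof
    fix z assume "z \<in> f ` S"
    then obtain u where u: "u \<in> S" "z = f u" by auto
    have "norm (f u) \<le> norm (f u - f 0) + norm (f 0)" using norm_triangle_ineq[of "f u - f 0" "f 0"] by simp
    also have "\<dots> \<le> 1 / 16 * norm u + 1 / 2 * norm v" using lip[OF u(1) 0] f0 by simp
    also have "\<dots> \<le> norm v"
    proof -
      have "norm u \<le> norm v" using u(1) by (simp add: S_def)
      then show ?thesis using norm_ge_zero[of v] by linarith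
    qed
    finally show "z \<in> S" using u(2) by (simp add: S_def)
  qed
  moreover have "complete S" unfolding S_def by (intro compact_imp_complete compact_cball)
  ultimately have "\<exists>!u\<in>S. f u = u"
    by (intro Banach_fix[of S "1/16" f]) (use 0 lip in \<open>auto simp: dist_norm\<close>)
  then obtain u where u: "u \<in> S" "f u = u" by blast
  have "2 *\<^sub>R f u = v - (\<psi> (\<theta> u \<otimes> \<theta> u) - 2 *\<^sub>R u)" by (simp add: f_def)
  then have "v = \<psi> (\<theta> u \<otimes> \<theta> u)" using u(2) by simp
  moreover have tu: "\<theta> u \<in> B r1" using S[OF u(1)] by simp
  ultimately have "\<theta> u \<otimes> \<theta> u = y"
    using y by (intro B_eqI mult_B_U Br1_rho) (auto simp: v_def B_def)
  then show ?thesis using tu by blast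
qed

definition root :: "'g \<Rightarrow> 'g" where "root y = (SOME x. x \<in> B r1 \<and> x \<otimes> x = y)"

lemma root: "y \<in> B r1 \<Longrightarrow> root y \<in> B r1 \<and> root y \<otimes> root y = y"
  unfolding root_def using root_exists[of y] by (intro someI_ex[of "\<lambda>x. x \<in> B r1 \<and> x \<otimes> x = y"]) blast

definition rts :: "'g \<Rightarrow> nat \<Rightarrow> 'g" where "rts y n = (root ^^ n) y"

lemma rts_0 [simp]: "rts y 0 = y" by (simp add: rts_def)

lemma rts_B: "y \<in> B r1 \<Longrightarrow> rts y n \<in> B r1"
  by (induction n) (use root in \<open>auto simp: rts_def\<close>)

lemma rts_Suc: "y \<in> B r1 \<Longrightarrow> rts y (Suc n) \<otimes> rts y (Suc n) = rts y n"
  using root[OF rts_B[of y n]] by (simp add: rts_def)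

lemma dyadic_rts: "y \<in> B r1 \<Longrightarrow> dyadic (rts y)"
  using rts_B rts_Suc by (simp add: dyadic_def)

lemma rts_carrier: "y \<in> B r1 \<Longrightarrow> rts y n \<in> carrier G"
  using rts_B B_closed by blast

lemma rts_pow_2:
  assumes "y \<in> B r1"
  shows "rts y n [^] (k::int) = rts y (Suc n) [^] (2 * k)"
proof -
  note c = rts_carrier[OF assms]
  have "rts y n = rts y (Suc n) [^] (2::int)"
    using int_pow_mult[OF c[of "Suc n"], of 1 1] rts_Suc[OF assms, of n] c by simp
  then show ?thesis using int_pow_pow[OF c[of "Suc n"], of 2 k] by (simp add: mult.commute)
qed

lemma rts_pow: "y \<in> B r1 \<Longrightarrow> rts y n [^] (2 ^ n * k :: int) = y [^] k"
proof (induction n arbitrary: k)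
  case 0
  then show ?case by simp
next
  case (Suc n)
  have "rts y (Suc n) [^] (2 ^ Suc n * k :: int) = rts y n [^] (2 ^ n * k)"
    using rts_pow_2[OF Suc.prems, of n "2 ^ n * k"] by (simp add: mult.assoc)
  then show ?case using Suc by simp
qed

lemma limitin_rts:
  assumes y: "y \<in> B r1" and c: "\<And>n. c n = \<one> \<or> c n = rts y n"
  shows "limitin T c \<one> sequentially"
  unfolding limitin_sequentially
proof (intro conjI allI impI)
  show "\<one> \<in> topspace T" using topspace_T by simp
  fix W assume "openin T W \<and> \<one> \<in> W"
  then obtain e where e: "0 < e" "e \<le> \<rho>" "B e \<subseteq> W"
    by (elim conjE) (rule B_nbhd[of W], auto)
  obtain N where N: "2 * norm (\<psi> y) / e < 2 ^ N" using real_arch_pow[of 2] by auto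
  have "c n \<in> W" if n: "n \<ge> N" for n
  proof -
    have "2 * norm (\<psi> y) < 2 ^ N * e" using N e(1) by (simp add: divide_less_eq)
    also have "\<dots> \<le> 2 ^ n * e" using n e(1) by (intro mult_right_mono power_increasing) auto
    finally have "2 * norm (\<psi> y) / 2 ^ n < e" by (simp add: divide_less_eq mult.commute)
    then have "norm (\<psi> (rts y n)) < e" using dyadic_norm[OF dyadic_rts[OF y], of n] by simp
    then have "rts y n \<in> B e" using rts_B[OF y, of n] by (simp add: B_def)
    then show ?thesis using c[of n] e(3) one_in_B[OF e(1)] by auto
  qed
  then show "\<exists>N. \<forall>n\<ge>N. c n \<in> W" by blast
qed

text \<open>Approximates \<open>y\<close> to the power \<open>t\<close> by rounding the exponent
  down to a multiple of \<open>2 ^ -n\<close>.\<close>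

definition E :: "'g \<Rightarrow> nat \<Rightarrow> real \<Rightarrow> 'g" where
  "E y n t = rts y n [^] \<lfloor>2 ^ n * t\<rfloor>"

lemma E_carrier: "y \<in> B r1 \<Longrightarrow> E y n t \<in> carrier G"
  using rts_carrier by (simp add: E_def)

lemma E_Suc:
  assumes y: "y \<in> B r1"
  obtains s where "s = \<one> \<or> s = rts y (Suc n)" "E y (Suc n) t = E y n t \<otimes> s"
proof -
  note c = rts_carrier[OF y]
  let ?b = "\<lfloor>2 ^ n * t\<rfloor>"
  have "\<lfloor>2 * (2 ^ n * t)\<rfloor> = 2 * ?b \<or> \<lfloor>2 * (2 ^ n * t)\<rfloor> = 2 * ?b + 1" by linarith
  then have cases: "\<lfloor>2 ^ Suc n * t\<rfloor> = 2 * ?b \<or> \<lfloor>2 ^ Suc n * t\<rfloor> = 2 * ?b + 1" by (simp add: mult.assoc)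
  have "E y n t = rts y (Suc n) [^] (2 * ?b)" using rts_pow_2[OF y] by (simp add: E_def)
  moreover have "rts y (Suc n) [^] (2 * ?b + 1) = rts y (Suc n) [^] (2 * ?b) \<otimes> rts y (Suc n)"
    using int_pow_mult[OF c[of "Suc n"], of "2 * ?b" 1] c by simp
  ultimately show ?thesis
    using cases that[of \<one>] that[of "rts y (Suc n)"] E_carrier[OF y, of n t] by (auto simp: E_def)
qed

text \<open>For \<open>n = k\<close> the exponent is rounded down to 0. Each step from
  \<open>n\<close> to \<open>n + 1\<close> contributes at most
  \<open>4 * norm (\<psi> y) / 2 ^ (n + 1)\<close>, and the difference in the bound is the exact sum
  of these contributions. The radius \<open>r1 / 4\<close> keeps the sum below
  \<open>r1\<close>.\<close>

lemma E_small:
  assumes y: "y \<in> B (r1 / 4)" and t: "0 \<le> t" "t < 1 / 2 ^ k" and n: "k \<le> n"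
  shows "E y n t \<in> B r1 \<and> norm (\<psi> (E y n t)) \<le> 4 * norm (\<psi> y) * (1 / 2 ^ k - 1 / 2 ^ n)"
  using n
proof (induction n rule: dec_induct)
  case base
  have "\<lfloor>2 ^ k * t\<rfloor> = 0" using t by (simp add: floor_eq_iff field_simps)
  then show ?case using one_in_B[OF r1(1)] psi_one by (simp add: E_def)
next
  case (step n)
  have yr: "y \<in> B r1" using y B_mono[of "r1/4" r1] r1 by auto
  have yn: "4 * norm (\<psi> y) < r1" using y by (simp add: B_def)
  obtain s where s: "s = \<one> \<or> s = rts y (Suc n)" "E y (Suc n) t = E y n t \<otimes> s" by (rule E_Suc[OF yr])
  have sB: "s \<in> B r1" using s(1) rts_B[OF yr] one_in_B[OF r1(1)] by auto
  have sn: "norm (\<psi> s) \<le> 2 * norm (\<psi> y) / 2 ^ Suc n"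
    using s(1) dyadic_norm[OF dyadic_rts[OF yr], of "Suc n"] psi_one by auto
  have "norm (\<psi> (E y (Suc n) t)) \<le> norm (\<psi> (E y n t)) + 2 * norm (\<psi> s)"
    unfolding s(2) by (rule norm_mult_le) (use step sB in auto)
  also have "\<dots> \<le> 4 * norm (\<psi> y) * (1 / 2 ^ k - 1 / 2 ^ n) + 4 * norm (\<psi> y) / 2 ^ Suc n"
    using step sn by simp
  also have "\<dots> = 4 * norm (\<psi> y) * (1 / 2 ^ k - 1 / 2 ^ Suc n)" by (simp add: field_simps)
  finally have 1: "norm (\<psi> (E y (Suc n) t)) \<le> 4 * norm (\<psi> y) * (1 / 2 ^ k - 1 / 2 ^ Suc n)" .
  have "(1::real) / 2 ^ k - 1 / 2 ^ Suc n \<le> 1"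
  proof -
    have "(1::real) / 2 ^ k \<le> 1" by (simp add: divide_le_eq)
    moreover have "0 \<le> (1::real) / 2 ^ Suc n" by simp
    ultimately show ?thesis by linarith
  qed
  then have "4 * norm (\<psi> y) * (1 / 2 ^ k - 1 / 2 ^ Suc n) \<le> 4 * norm (\<psi> y) * 1"
    by (intro mult_left_mono) auto
  then have "norm (\<psi> (E y (Suc n) t)) < r1" using 1 yn by linarith
  moreover have "E y (Suc n) t \<in> U" unfolding s(2) using step sB by (intro mult_B_U Br1_rho) auto
  ultimately show ?case using 1 by (simp add: B_def)
qed

text \<open>The bounds for all \<open>k\<close> together express continuity of the limit at t = 0;
  continuity of the whole one-parameter subgroup is derived from them.\<close>

lemma E_limit:
  assumes y: "y \<in> B (r1 / 4)" and t: "0 \<le> t" "t < 1"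
  obtains l where "limitin T (\<lambda>n. E y n t) l sequentially" "l \<in> U"
    "\<And>k. t < 1 / 2 ^ k \<Longrightarrow> norm (\<psi> l) \<le> 4 * norm (\<psi> y) / 2 ^ k"
proof -
  have yr: "y \<in> B r1" using y B_mono[of "r1/4" r1] r1 by auto
  have yn: "4 * norm (\<psi> y) < r1" using y by (simp add: B_def)
  have EB: "E y n t \<in> B r1" for n using E_small[OF y t(1), of 0 n] t by simp
  have "norm (\<psi> (E y (Suc n) t) - \<psi> (E y n t)) \<le> 2 * norm (\<psi> y) * (1/2) ^ n" for n
  proof -
    obtain s where s: "s = \<one> \<or> s = rts y (Suc n)" "E y (Suc n) t = E y n t \<otimes> s" by (rule E_Suc[OF yr])
    have sB: "s \<in> B r1" using s(1) rts_B[OF yr] one_in_B[OF r1(1)] by auto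
    have sn: "norm (\<psi> s) \<le> 2 * norm (\<psi> y) / 2 ^ Suc n"
      using s(1) dyadic_norm[OF dyadic_rts[OF yr], of "Suc n"] psi_one by auto
    have "norm (\<psi> (E y (Suc n) t) - \<psi> (E y n t)) \<le> 2 * norm (\<psi> s)"
      unfolding s(2) by (rule norm_mult_diff_le[OF EB sB])
    also have "\<dots> \<le> 2 * norm (\<psi> y) * (1/2) ^ n" using sn by (simp add: field_simps)
    finally show ?thesis .
  qed
  then have "convergent (\<lambda>n. \<psi> (E y n t))" by (rule convergent_geometric_increments)
  then obtain u where u: "(\<lambda>n. \<psi> (E y n t)) \<longlonglongrightarrow> u" by (auto simp: convergent_def)
  have bd: "norm u \<le> 4 * norm (\<psi> y) / 2 ^ k" if k: "t < 1 / 2 ^ k" for k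
  proof (rule Lim_norm_ubound[OF _ u])
    show "\<forall>\<^sub>F n in sequentially. norm (\<psi> (E y n t)) \<le> 4 * norm (\<psi> y) / 2 ^ k"
      unfolding eventually_sequentially
    proof (intro exI[of _ k] allI impI)
      fix n assume "k \<le> n"
      then have "norm (\<psi> (E y n t)) \<le> 4 * norm (\<psi> y) * (1 / 2 ^ k - 1 / 2 ^ n)"
        using E_small[OF y t(1) k] by simp
      also have "\<dots> \<le> 4 * norm (\<psi> y) * (1 / 2 ^ k)" by (intro mult_left_mono) auto
      finally show "norm (\<psi> (E y n t)) \<le> 4 * norm (\<psi> y) / 2 ^ k" by simp
    qed
  qed simp
  have ur: "norm u < \<rho>" using bd[of 0] t yn r1 by simp
  have "limitin (top_of_set (ball 0 \<rho>)) (\<lambda>n. \<psi> (E y n t)) u sequentially"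
    using u ur by simp
  from continuous_map_limit[OF cont_theta this]
  have "limitin T (\<lambda>n. E y n t) (\<theta> u) sequentially"
    using theta_psi EB by (simp add: o_def B_def)
  then show ?thesis using that[of "\<theta> u"] theta_in_U[OF ur] psi_theta[OF ur] bd by simp
qed

lemma E_split:
  assumes y: "y \<in> B r1"
  shows "E y n t = y [^] \<lfloor>t\<rfloor> \<otimes> E y n (frac t)"
proof -
  note c = rts_carrier[OF y]
  have "2 ^ n * t = 2 ^ n * frac t + of_int (2 ^ n * \<lfloor>t\<rfloor>)" by (simp add: frac_def algebra_simps)
  then have "\<lfloor>2 ^ n * t\<rfloor> = 2 ^ n * \<lfloor>t\<rfloor> + \<lfloor>2 ^ n * frac t\<rfloor>" by (metis add.commute floor_add_int)
  then show ?thesis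
    using int_pow_mult[OF c[of n]] rts_pow[OF y, of n "\<lfloor>t\<rfloor>"] by (simp add: E_def)
qed

lemma E_limit_ex:
  assumes y: "y \<in> B (r1 / 4)"
  shows "\<exists>l. limitin T (\<lambda>n. E y n t) l sequentially"
proof -
  have yr: "y \<in> B r1" using y B_mono[of "r1/4" r1] r1 by auto
  obtain l where l: "limitin T (\<lambda>n. E y n (frac t)) l sequentially"
    by (rule E_limit[OF y, of "frac t"]) (auto simp: frac_lt_1)
  have "limitin T (\<lambda>n. y [^] \<lfloor>t\<rfloor>) (y [^] \<lfloor>t\<rfloor>) sequentially"
    using B_closed[OF yr] topspace_T by simp
  from limitin_mult[OF this l] show ?thesis unfolding E_split[OF yr, symmetric] by blast
qed

lemma limitin_unique:
  "limitin T f l sequentially \<Longrightarrow> limitin T f k sequentially \<Longrightarrow> l = k"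
  using limitin_Hausdorff_unique[OF _ _ trivial_limit_sequentially Hausdorff_T] .

text \<open>The last two clauses are what the construction of a periodic subgroup requires. An
  element \<open>z\<close> that commutes with \<open>y\<close> commutes with all its roots, because
  conjugation by \<open>z\<close> turns a root into another root in \<open>B r1\<close>, where
  square roots are unique.\<close>

lemma one_param_through:
  obtains e0 where "0 < e0" "\<And>y. y \<in> B e0 \<Longrightarrow> \<exists>\<eta>. one_param \<eta> \<and> \<eta> 1 = y \<and>
    (\<forall>t. 0 \<le> t \<and> t < 1 \<longrightarrow> \<eta> t \<in> U \<and> norm (\<psi> (\<eta> t)) \<le> 4 * norm (\<psi> y)) \<and>
    (\<forall>z\<in>carrier G. z \<otimes> y = y \<otimes> z \<longrightarrow> (\<forall>t. z \<otimes> \<eta> t = \<eta> t \<otimes> z))"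
proof -
  obtain e1 where e1: "0 < e1" "e1 \<le> r1" "\<And>g x. g \<in> carrier G \<Longrightarrow> x \<in> B e1 \<Longrightarrow> g \<otimes> x \<otimes> inv g \<in> B r1"
    by (rule conj_nbhd[OF r1(1)]) (rule that)
  \<comment> \<open>\<open>r1 / 4\<close> is the radius required by \<open>E_limit\<close>. The
    roots of \<open>y\<close> have norm at most \<open>2 * norm (\<psi> y)\<close>, so
    \<open>e1 / 2\<close> keeps them where all conjugates stay in \<open>B r1\<close>.\<close>
  define e0 where "e0 = min (r1 / 4) (e1 / 2)"
  have "\<exists>\<eta>. one_param \<eta> \<and> \<eta> 1 = y \<and>
    (\<forall>t. 0 \<le> t \<and> t < 1 \<longrightarrow> \<eta> t \<in> U \<and> norm (\<psi> (\<eta> t)) \<le> 4 * norm (\<psi> y)) \<and>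
    (\<forall>z\<in>carrier G. z \<otimes> y = y \<otimes> z \<longrightarrow> (\<forall>t. z \<otimes> \<eta> t = \<eta> t \<otimes> z))" if ye: "y \<in> B e0" for y
  proof -
    have y: "y \<in> B (r1 / 4)"
    proof -
      have "e0 \<le> r1 / 4" by (simp add: e0_def)
      then show ?thesis using ye B_mono by blast
    qed
    have yr: "y \<in> B r1" using y B_mono[of "r1/4" r1] r1 by auto
    note c = rts_carrier[OF yr]
    define \<eta> where "\<eta> t = (SOME l. limitin T (\<lambda>n. E y n t) l sequentially)" for t
    have lim: "limitin T (\<lambda>n. E y n t) (\<eta> t) sequentially" for t
      unfolding \<eta>_def using someI_ex[OF E_limit_ex[OF y, of t]] .
    have car: "\<eta> t \<in> carrier G" for t using limitin_topspace[OF lim] topspace_T by simp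
    have small: "\<eta> t \<in> U \<and> norm (\<psi> (\<eta> t)) \<le> 4 * norm (\<psi> y) / 2 ^ k" if t: "0 \<le> t" "t < 1 / 2 ^ k" for t k
    proof -
      have "(1::real) / 2 ^ k \<le> 1" by (simp add: divide_le_eq)
      then have "t < 1" using t by linarith
      from E_limit[OF y t(1) this] obtain l where l: "limitin T (\<lambda>n. E y n t) l sequentially" "l \<in> U"
        "\<And>k. t < 1 / 2 ^ k \<Longrightarrow> norm (\<psi> l) \<le> 4 * norm (\<psi> y) / 2 ^ k" by metis
      then show ?thesis using limitin_unique[OF l(1) lim] t by simp
    qed
    have add: "\<eta> (s + t) = \<eta> s \<otimes> \<eta> t" for s t
    proof -
      \<comment> \<open>The defect of additivity. The sum of two rounded-down exponents misses the
        rounded-down sum by 0 or 1, so the factor is \<open>\<one>\<close> or the n-th root, and it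
        tends to \<open>\<one>\<close>.\<close>
      define d where "d n = rts y n [^] (\<lfloor>2 ^ n * (s + t)\<rfloor> - \<lfloor>2 ^ n * s\<rfloor> - \<lfloor>2 ^ n * t\<rfloor>)" for n
      have eq: "E y n (s + t) = E y n s \<otimes> E y n t \<otimes> d n" for n
      proof -
        have "\<lfloor>2 ^ n * (s + t)\<rfloor> = \<lfloor>2 ^ n * s\<rfloor> + \<lfloor>2 ^ n * t\<rfloor> + (\<lfloor>2 ^ n * (s + t)\<rfloor> - \<lfloor>2 ^ n * s\<rfloor> - \<lfloor>2 ^ n * t\<rfloor>)"
          by simp
        then have "E y n (s + t) = rts y n [^] (\<lfloor>2 ^ n * s\<rfloor> + \<lfloor>2 ^ n * t\<rfloor> + (\<lfloor>2 ^ n * (s + t)\<rfloor> - \<lfloor>2 ^ n * s\<rfloor> - \<lfloor>2 ^ n * t\<rfloor>))"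
          unfolding E_def by (rule arg_cong)
        then show ?thesis unfolding d_def E_def by (simp only: int_pow_mult[OF c])
      qed
      have "\<lfloor>2 ^ n * (s + t)\<rfloor> - \<lfloor>2 ^ n * s\<rfloor> - \<lfloor>2 ^ n * t\<rfloor> = 0 \<or>
         \<lfloor>2 ^ n * (s + t)\<rfloor> - \<lfloor>2 ^ n * s\<rfloor> - \<lfloor>2 ^ n * t\<rfloor> = 1" for n
      proof -
        have "2 ^ n * (s + t) = 2 ^ n * s + 2 ^ n * t" by (simp add: algebra_simps)
        then show ?thesis by linarith
      qed
      then have "d n = \<one> \<or> d n = rts y n" for n
        unfolding d_def using c[of n] by (metis int_pow_0 int_pow_1)
      then have "limitin T d \<one> sequentially" by (rule limitin_rts[OF yr])
      from limitin_mult[OF limitin_mult[OF lim lim] this, of s t]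
      have "limitin T (\<lambda>n. E y n (s + t)) (\<eta> s \<otimes> \<eta> t \<otimes> \<one>) sequentially" unfolding eq .
      from limitin_unique[OF lim this] show ?thesis using car by simp
    qed
    have z0: "\<eta> 0 = \<one>" using add[of 0 0] car[of 0] by (metis add.right_neutral l_cancel_one)
    have neg: "\<eta> (- t) = inv (\<eta> t)" for t
      using add[of "- t" t] z0 car inv_equality[of "\<eta> (- t)" "\<eta> t"] by simp
    have cont: "continuous_map euclideanreal T \<eta>"
      unfolding continuous_map_eq_topcontinuous_at topcontinuous_at_def
    proof (intro ballI conjI allI impI)
      fix t0 W assume W: "openin T W \<and> \<eta> t0 \<in> W"
      define W1 where "W1 = {g \<in> topspace T. \<eta> t0 \<otimes> g \<in> W}"
      define W2 where "W2 = {g \<in> topspace T. inv g \<in> W1}"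
      have W1: "openin T W1" unfolding W1_def
        by (rule openin_continuous_map_preimage[of T T])
          (use W car in \<open>auto intro!: cont_mult_comp cont_const continuous_map_id[unfolded id_def]\<close>)
      have W2: "openin T W2" unfolding W2_def by (rule openin_continuous_map_preimage[OF cont_inv W1])
      have one: "\<one> \<in> W1" "\<one> \<in> W2" using W car topspace_T by (auto simp: W1_def W2_def)
      obtain e where e: "0 < e" "e \<le> \<rho>" "B e \<subseteq> W1 \<inter> W2"
        by (rule B_nbhd[OF openin_Int[OF W1 W2]]) (use one in auto)
      obtain k where k: "4 * norm (\<psi> y) / e < 2 ^ k" using real_arch_pow[of 2] by auto
      then have k': "4 * norm (\<psi> y) / 2 ^ k < e" using e(1) by (simp add: field_simps)
      have Be: "\<eta> h \<in> B e" if "0 \<le> h" "h < 1 / 2 ^ k" for h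
        using small[OF that] k' by (simp add: B_def)
      have "\<eta> t \<in> W" if t: "t \<in> ball t0 (1 / 2 ^ k)" for t
      proof -
        define h where "h = t - t0"
        have h: "\<bar>h\<bar> < 1 / 2 ^ k" using t by (simp add: h_def dist_real_def)
        have "\<eta> h \<in> W1"
        proof (cases "h \<ge> 0")
          case True
          then show ?thesis using Be[of h] h e(3) by auto
        next
          case False
          then have "\<eta> (- h) \<in> W2" using Be[of "- h"] h e(3) by auto
          then show ?thesis using neg[of "- h"] by (simp add: W2_def)
        qed
        then have "\<eta> t0 \<otimes> \<eta> h \<in> W" by (simp add: W1_def)
        then show ?thesis using add[of t0 h] by (simp add: h_def)
      qed
      then show "\<exists>V. openin euclideanreal V \<and> t0 \<in> V \<and> (\<forall>t\<in>V. \<eta> t \<in> W)"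
        by (intro exI[of _ "ball t0 (1 / 2 ^ k)"]) auto
    qed (use car topspace_T in auto)
    have one: "\<eta> 1 = y"
    proof -
      have "E y n 1 = y" for n
        using rts_pow[OF yr, of n 1] B_closed[OF yr] by (simp add: E_def floor_power)
      then have "limitin T (\<lambda>n. y) (\<eta> 1) sequentially" using lim[of 1] by simp
      moreover have "limitin T (\<lambda>n::nat. y) y sequentially" using B_closed[OF yr] topspace_T by simp
      ultimately show ?thesis by (rule limitin_unique)
    qed
    have comm: "z \<otimes> \<eta> t = \<eta> t \<otimes> z" if z: "z \<in> carrier G" "z \<otimes> y = y \<otimes> z" for z t
    proof -
      have zr: "z \<otimes> rts y n = rts y n \<otimes> z" for n
      proof (induction n)
        case 0
        then show ?case using z(2) by simp
      next
        case (Suc n)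
        let ?w = "rts y (Suc n)"
        have "2 * norm (\<psi> y) < e1" using ye by (simp add: B_def e0_def)
        moreover have "norm (\<psi> ?w) \<le> 2 * norm (\<psi> y)"
        proof -
          have "2 * norm (\<psi> y) / 2 ^ Suc n \<le> 2 * norm (\<psi> y) / 1"
            by (intro divide_left_mono) (auto intro!: one_le_power simp del: power_Suc)
          then show ?thesis using dyadic_norm[OF dyadic_rts[OF yr], of "Suc n"] by simp
        qed
        ultimately have "?w \<in> B e1" using rts_B[OF yr, of "Suc n"] by (auto simp: B_def)
        then have cw: "z \<otimes> ?w \<otimes> inv z \<in> B r1" by (rule e1(3)[OF z(1)])
        have "(z \<otimes> ?w \<otimes> inv z) \<otimes> (z \<otimes> ?w \<otimes> inv z) = z \<otimes> (?w \<otimes> ?w) \<otimes> inv z"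
        proof -
          have "(z \<otimes> ?w \<otimes> inv z) \<otimes> (z \<otimes> ?w \<otimes> inv z) = z \<otimes> ?w \<otimes> (inv z \<otimes> (z \<otimes> (?w \<otimes> inv z)))"
            using z(1) c by (simp add: m_assoc)
          also have "inv z \<otimes> (z \<otimes> (?w \<otimes> inv z)) = ?w \<otimes> inv z"
            using z(1) c by (simp add: m_assoc[symmetric])
          finally show ?thesis using z(1) c by (simp add: m_assoc)
        qed
        also have "\<dots> = z \<otimes> rts y n \<otimes> inv z" using rts_Suc[OF yr, of n] by simp
        also have "\<dots> = rts y n" unfolding Suc.IH using z(1) c by (simp add: m_assoc)
        also have "\<dots> = ?w \<otimes> ?w" using rts_Suc[OF yr, of n] by simp
        finally have "z \<otimes> ?w \<otimes> inv z = ?w" by (rule square_unique[OF cw rts_B[OF yr]])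
        then have "z \<otimes> ?w \<otimes> inv z \<otimes> z = ?w \<otimes> z" by simp
        then show ?case using z(1) c by (simp add: m_assoc)
      qed
      have zp: "z \<otimes> x [^] (k::int) = x [^] k \<otimes> z" if x: "x \<in> carrier G" "z \<otimes> x = x \<otimes> z" for x k
      proof -
        have nat: "z \<otimes> x [^] (j::nat) = x [^] j \<otimes> z" for j
        proof (induction j)
          case (Suc j)
          have "z \<otimes> (x [^] j \<otimes> x) = (z \<otimes> x [^] j) \<otimes> x" using z(1) x(1) by (simp add: m_assoc)
          also have "\<dots> = x [^] j \<otimes> (z \<otimes> x)" unfolding Suc using z(1) x(1) by (simp add: m_assoc)
          also have "\<dots> = x [^] j \<otimes> x \<otimes> z" unfolding x(2) using z(1) x(1) by (simp add: m_assoc)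
          finally show ?case by simp
        qed (use z(1) in simp)
        show ?thesis
        proof (cases "k \<ge> 0")
          case True
          then obtain j where "k = int j" using nonneg_int_cases by blast
          then show ?thesis using nat[of j] by (simp add: int_pow_int)
        next
          case False
          then obtain j where k: "k = - int j" by (metis int_cases2 neg_equal_0_iff_equal of_nat_0 linorder_not_le of_nat_0_le_iff)
          let ?p = "x [^] j"
          have p: "?p \<in> carrier G" using x(1) by simp
          have "inv ?p \<otimes> z = inv ?p \<otimes> (z \<otimes> ?p) \<otimes> inv ?p" using z(1) p by (simp add: m_assoc)
          also have "\<dots> = inv ?p \<otimes> (?p \<otimes> z) \<otimes> inv ?p" using nat[of j] by simp
          also have "inv ?p \<otimes> (?p \<otimes> z) = z" using z(1) p by (simp add: m_assoc[symmetric])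
          finally have "inv ?p \<otimes> z = z \<otimes> inv ?p" .
          then show ?thesis using k int_pow_neg_int[OF x(1), of j] by simp
        qed
      qed
      have zc: "limitin T (\<lambda>n. z) z sequentially" using z(1) topspace_T by simp
      have "limitin T (\<lambda>n. z \<otimes> E y n t) (z \<otimes> \<eta> t) sequentially" by (rule limitin_mult[OF zc lim])
      moreover have "limitin T (\<lambda>n. E y n t \<otimes> z) (\<eta> t \<otimes> z) sequentially" by (rule limitin_mult[OF lim zc])
      moreover have "z \<otimes> E y n t = E y n t \<otimes> z" for n unfolding E_def by (rule zp[OF c zr])
      ultimately show ?thesis using limitin_unique by simp
    qed
    have "one_param \<eta>" using add cont by (simp add: one_param_def)
    then show ?thesis using one small[of _ 0] comm by (intro exI[of _ \<eta>]) auto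
  qed
  moreover have "0 < e0" using e1(1) r1(1) by (simp add: e0_def)
  ultimately show ?thesis using that by blast
qed

text \<open>A one-parameter subgroup \<open>\<gamma>\<close> is recurrent by compactness: \<open>\<gamma> k\<close> is close to \<open>\<one>\<close> for some
  \<open>k\<close>. Multiplying by the commuting short one-parameter subgroup through \<open>\<gamma> k\<close> closes it up.\<close>

lemma ex_periodic_one_param:
  obtains \<delta> t where "one_param \<delta>" "\<delta> 1 = \<one>" "\<delta> t \<noteq> \<one>"
proof -
  obtain e0 where e0: "0 < e0" and thr: "\<And>y. y \<in> B e0 \<Longrightarrow> \<exists>\<eta>. one_param \<eta> \<and> \<eta> 1 = y \<and>
    (\<forall>t. 0 \<le> t \<and> t < 1 \<longrightarrow> \<eta> t \<in> U \<and> norm (\<psi> (\<eta> t)) \<le> 4 * norm (\<psi> y)) \<and>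
    (\<forall>z\<in>carrier G. z \<otimes> y = y \<otimes> z \<longrightarrow> (\<forall>t. z \<otimes> \<eta> t = \<eta> t \<otimes> z))"
    by (rule one_param_through) (rule that)
  obtain b :: 'e where b: "b \<in> Basis" using nonempty_Basis by blast
  define w where "w = (min e0 \<rho> / 2) *\<^sub>R b"
  have w: "w \<noteq> 0" "norm w < e0" "norm w < \<rho>" using b e0 rho_pos by (auto simp: w_def nonzero_Basis)
  define y0 where "y0 = \<theta> w"
  have y0: "y0 \<in> B e0" "\<psi> y0 = w" "y0 \<in> U"
    using theta_in_U[OF w(3)] psi_theta[OF w(3)] w(2) by (auto simp: y0_def B_def)
  obtain \<gamma> where g: "one_param \<gamma>" "\<gamma> 1 = y0" using thr[OF y0(1)] by blast
  note gD = one_paramD[OF g(1)]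
  \<comment> \<open>The quarter matches the factor 4 in the bound of
    \<open>one_param_through\<close>: for times in [0, 1) the subgroup through a point of
    \<open>B e\<close> stays strictly closer to \<open>\<one>\<close> than
    \<open>y0\<close>.\<close>
  define e where "e = min e0 (norm w / 4)"
  have e: "e > 0" using w e0 by (simp add: e_def)
  obtain e' where e': "0 < e'" "e' \<le> r1" "\<And>x y. x \<in> B e' \<Longrightarrow> y \<in> B e' \<Longrightarrow> inv x \<otimes> y \<in> B e"
    by (rule inv_mult_nbhd[OF e]) (rule that)
  obtain F where F: "finite F" "F \<subseteq> carrier G" "\<And>g. g \<in> carrier G \<Longrightarrow> \<exists>f\<in>F. inv f \<otimes> g \<in> B e'"
    by (rule finite_cover[OF e'(1)]) (rule that)
  have "\<forall>n::nat. \<exists>f\<in>F. inv f \<otimes> \<gamma> (real n) \<in> B e'" using F(3) gD(3) by blast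
  then obtain f where f: "\<And>n::nat. f n \<in> F" "\<And>n. inv (f n) \<otimes> \<gamma> (real n) \<in> B e'" by metis
  \<comment> \<open>Pigeonhole on the finite cover: if \<open>\<gamma> n\<close> and
    \<open>\<gamma> m\<close> lie in the same piece, their quotient \<open>\<gamma> (m - n)\<close>
    is close to \<open>\<one>\<close>.\<close>
  have "\<not> inj f" using f(1) F(1) by (meson finite_imageD finite_subset image_subsetI infinite_UNIV_nat)
  then obtain n m where "f n = f m" "n \<noteq> m" by (auto simp: inj_def)
  then obtain n m where nm: "f n = f m" "n < m" by (metis nat_neq_iff)
  define k where "k = m - n"
  define y where "y = \<gamma> (real k)"
  have k: "k \<ge> 1" using nm by (simp add: k_def)
  have "y \<in> B e"
  proof -
    have fc: "f n \<in> carrier G" using f(1) F(2) by blast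
    have "inv (inv (f n) \<otimes> \<gamma> (real n)) \<otimes> (inv (f n) \<otimes> \<gamma> (real m)) \<in> B e"
      using e'(3)[OF f(2)[of n]] f(2)[of m] nm(1) by simp
    moreover have "inv (inv (f n) \<otimes> \<gamma> (real n)) \<otimes> (inv (f n) \<otimes> \<gamma> (real m)) = inv (\<gamma> (real n)) \<otimes> \<gamma> (real m)"
    proof -
      have "f n \<otimes> (inv (f n) \<otimes> \<gamma> (real m)) = \<gamma> (real m)" using fc gD(3) by (simp add: m_assoc[symmetric])
      then show ?thesis using fc gD(3) by (simp add: inv_mult_group m_assoc)
    qed
    moreover have "\<dots> = \<gamma> (- real n + real m)" using gD(1)[of "- real n" "real m"] gD(5) by simp
    ultimately show ?thesis using nm by (simp add: y_def k_def of_nat_diff)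
  qed
  then have yB: "y \<in> B e0" "norm (\<psi> y) < norm w / 4" using B_mono[of e e0] by (auto simp: e_def B_def)
  obtain \<eta> where h: "one_param \<eta>" "\<eta> 1 = y"
    "\<And>t. 0 \<le> t \<Longrightarrow> t < 1 \<Longrightarrow> \<eta> t \<in> U \<and> norm (\<psi> (\<eta> t)) \<le> 4 * norm (\<psi> y)"
    "\<And>z t. z \<in> carrier G \<Longrightarrow> z \<otimes> y = y \<otimes> z \<Longrightarrow> z \<otimes> \<eta> t = \<eta> t \<otimes> z"
    using thr[OF yB(1)] by blast
  note hD = one_paramD[OF h(1)]
  have comm: "\<gamma> s \<otimes> \<eta> t = \<eta> t \<otimes> \<gamma> s" for s t
  proof (rule h(4)[OF gD(3)])
    show "\<gamma> s \<otimes> y = y \<otimes> \<gamma> s" unfolding y_def using gD(1)[of s "real k"] gD(1)[of "real k" s] by (simp add: add.commute)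
  qed
  define \<delta> where "\<delta> u = \<gamma> (real k * u) \<otimes> \<eta> (- u)" for u
  have "one_param \<delta>"
    unfolding one_param_def
  proof (intro conjI allI)
    fix s t
    have "\<delta> (s + t) = (\<gamma> (real k * s) \<otimes> \<gamma> (real k * t)) \<otimes> (\<eta> (- s) \<otimes> \<eta> (- t))"
      using gD(1)[of "real k * s" "real k * t"] hD(1)[of "- s" "- t"] by (simp add: \<delta>_def algebra_simps)
    also have "\<dots> = \<gamma> (real k * s) \<otimes> (\<gamma> (real k * t) \<otimes> \<eta> (- s)) \<otimes> \<eta> (- t)"
      using gD(3) hD(3) by (simp add: m_assoc)
    also have "\<dots> = \<delta> s \<otimes> \<delta> t" unfolding comm[of "real k * t" "- s"] \<delta>_def using gD(3) hD(3) by (simp add: m_assoc)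
    finally show "\<delta> (s + t) = \<delta> s \<otimes> \<delta> t" .
    show "continuous_map euclideanreal T \<delta>" unfolding \<delta>_def
      by (intro cont_mult_comp continuous_map_compose[OF _ gD(2), unfolded o_def]
          continuous_map_compose[OF _ hD(2), unfolded o_def]) (auto intro!: continuous_intros)
  qed
  moreover have "\<delta> 1 = \<one>"
    using h(2) hD(3)[of 1] hD(5)[of 1] by (simp add: \<delta>_def y_def[symmetric])
  \<comment> \<open>At this time the first factor is \<open>\<gamma> 1 = y0\<close>, while the
    second is too close to \<open>\<one>\<close> to cancel it. The bound covers times below 1 only,
    so \<open>k = 1\<close> is excluded separately.\<close>
  moreover have "\<delta> (1 / real k) \<noteq> \<one>"
  proof
    assume "\<delta> (1 / real k) = \<one>"
    then have "y0 \<otimes> inv (\<eta> (1 / real k)) = \<one>" using k g(2) hD(5) by (simp add: \<delta>_def)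
    then have eq: "y0 = \<eta> (1 / real k)"
      using gD(3)[of 1] g(2) hD(3) by (metis inv_closed inv_equality inv_inv)
    have "k \<noteq> 1"
    proof
      assume "k = 1"
      then have "y = y0" using g(2) by (simp add: y_def)
      then show False using yB(2) y0(2) w by simp
    qed
    then have "1 / real k < 1" using k by simp
    then have "norm (\<psi> y0) \<le> 4 * norm (\<psi> y)" using h(3)[of "1 / real k"] eq by simp
    then show False using yB(2) y0(2) by simp
  qed
  ultimately show ?thesis using that by blast
qed

text \<open>The kernel of \<open>\<delta>\<close> is a closed subgroup of the reals that contains 1
  and is not dense, hence it is generated by a least positive period \<open>p\<close>. The induced
  map on the circle is a continuous injection of a compact space into a Hausdorff space.\<close>

lemma circle_in_G:
  assumes d: "one_param \<delta>" and d1: "\<delta> 1 = \<one>" and t1: "\<delta> t1 \<noteq> \<one>"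
  shows "\<exists>H. torus_in G T 1 H \<and> H \<noteq> {\<one>}"
proof -
  note dD = one_paramD[OF d]
  have dint: "\<delta> (s * of_int k) = \<one>" if s: "\<delta> s = \<one>" for s and k :: int
  proof -
    have nat: "\<delta> (s * real j) = \<one>" for j :: nat
    proof (induction j)
      case (Suc j)
      then show ?case using dD(1)[of "s * real j" s] s by (simp add: algebra_simps)
    qed (simp add: dD(4))
    show ?thesis
    proof (cases k rule: int_cases2)
      case (nonneg n)
      then show ?thesis using nat[of n] by simp
    next
      case (nonpos n)
      then show ?thesis using nat[of n] dD(5)[of "s * real n"] by simp
    qed
  qed
  have clo: "closedin T {\<one>}" using Hausdorff_T topspace_T
    by (simp add: closedin_Hausdorff_sing_eq)
  then have W: "openin T (topspace T - {\<delta> t1})"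
    using Hausdorff_T topspace_T dD(3) closedin_Hausdorff_sing_eq[of T "\<delta> t1"] by blast
  obtain t0 where t0: "t0 > 0" "\<And>t. \<bar>t\<bar> \<le> t0 \<Longrightarrow> \<delta> t \<in> topspace T - {\<delta> t1}"
    by (rule one_param_near[OF d W]) (use t1 topspace_T in auto)
  \<comment> \<open>If a period were at most \<open>t0\<close>, reducing \<open>t1\<close> modulo it
    would give a time in the range where \<open>\<delta>\<close> avoids the value
    \<open>\<delta> t1\<close>.\<close>
  have big: "t0 < s" if s: "s > 0" "\<delta> s = \<one>" for s
  proof (rule ccontr)
    assume "\<not> t0 < s"
    define q where "q = t1 - s * of_int \<lfloor>t1 / s\<rfloor>"
    have q: "0 \<le> q" "q < s" using floor_divide_lower[OF s(1), of t1] floor_divide_upper[OF s(1), of t1]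
      by (auto simp: q_def algebra_simps)
    have "\<delta> t1 = \<delta> q \<otimes> \<delta> (s * of_int \<lfloor>t1 / s\<rfloor>)" using dD(1)[of q "s * of_int \<lfloor>t1 / s\<rfloor>"] by (simp add: q_def)
    then have "\<delta> q = \<delta> t1" using dint[OF s(2)] dD(3) by simp
    then show False using t0(2)[of q] q \<open>\<not> t0 < s\<close> by auto
  qed
  define S where "S = {t. t0 \<le> t \<and> \<delta> t = \<one>}"
  have "closedin euclideanreal {t \<in> topspace euclideanreal. \<delta> t \<in> {\<one>}}"
    by (rule closedin_continuous_map_preimage[OF dD(2) clo])
  then have "closed {t. \<delta> t = \<one>}" by simp
  moreover have "S = {t0..} \<inter> {t. \<delta> t = \<one>}" by (auto simp: S_def)
  ultimately have S: "closed S" by auto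
  have bdd: "bdd_below S" by (rule bdd_belowI[of _ t0]) (auto simp: S_def)
  have S1: "1 \<in> S" using big[of 1] d1 by (simp add: S_def)
  define p where "p = Inf S"
  have pS: "p \<in> S" unfolding p_def using closed_contains_Inf[OF _ bdd S] S1 by auto
  then have p: "p > 0" "\<delta> p = \<one>" using t0(1) by (auto simp: S_def)
  have ker: "\<exists>k::int. t = p * of_int k" if t: "\<delta> t = \<one>" for t
  proof -
    define q where "q = t - p * of_int \<lfloor>t / p\<rfloor>"
    have q: "0 \<le> q" "q < p" using floor_divide_lower[OF p(1), of t] floor_divide_upper[OF p(1), of t]
      by (auto simp: q_def algebra_simps)
    have "\<delta> t = \<delta> q \<otimes> \<delta> (p * of_int \<lfloor>t / p\<rfloor>)" using dD(1)[of q "p * of_int \<lfloor>t / p\<rfloor>"] by (simp add: q_def)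
    then have dq: "\<delta> q = \<one>" using dint[OF p(2)] dD(3) t by simp
    have "q = 0"
    proof (rule ccontr)
      assume "q \<noteq> 0"
      then have "q \<in> S" using big[of q] q dq by (simp add: S_def)
      then have "p \<le> q" unfolding p_def using bdd by (rule cInf_lower)
      then show False using q by simp
    qed
    then show ?thesis by (auto simp: q_def)
  qed
  define \<kappa> where "\<kappa> x = \<delta> (p * x / (2 * pi))" for x
  have kadd: "\<kappa> (x + y) = \<kappa> x \<otimes> \<kappa> y" for x y
    using dD(1)[of "p * x / (2 * pi)" "p * y / (2 * pi)"] by (simp add: \<kappa>_def field_simps)
  have kc: "\<kappa> x \<in> carrier G" for x using dD(3) by (simp add: \<kappa>_def)
  have kcont: "continuous_map euclideanreal T \<kappa>" unfolding \<kappa>_def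
    by (intro continuous_map_compose[OF _ dD(2), unfolded o_def]) (auto intro!: continuous_intros)
  have kneg: "\<kappa> (- x) = inv (\<kappa> x)" for x using dD(5)[of "p * x / (2 * pi)"] by (simp add: \<kappa>_def)
  have k2pi: "\<kappa> (2 * pi * of_int n) = \<one>" for n :: int using dint[OF p(2), of n] by (simp add: \<kappa>_def)
  have keq: "\<kappa> x = \<kappa> y \<longleftrightarrow> cis x = cis y" for x y
  proof
    assume "cis x = cis y"
    then have "sin x = sin y \<and> cos x = cos y" by (simp add: complex_eq_iff)
    then obtain n :: int where "x = y + 2 * pi * n" using sin_cos_eq_iff by blast
    then show "\<kappa> x = \<kappa> y" using kadd[of y "2 * pi * n"] k2pi[of n] kc by simp
  next
    assume "\<kappa> x = \<kappa> y"
    then have "\<kappa> (x - y) = \<one>" using kadd[of x "- y"] kneg[of y] kc by simp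
    then obtain k :: int where "p * (x - y) / (2 * pi) = p * of_int k" using ker by (auto simp: \<kappa>_def)
    then have "p * ((x - y) / (2 * pi)) = p * of_int k" by simp
    then have "(x - y) / (2 * pi) = of_int k" using p(1) by (simp del: times_divide_eq_right)
    then have "x - y = 2 * pi * of_int k" by (simp add: divide_eq_eq mult.commute)
    then have "x = y + 2 * pi * of_int k" by simp
    then have "sin x = sin y \<and> cos x = cos y" using sin_cos_eq_iff by blast
    then show "cis x = cis y" by (simp add: complex_eq_iff)
  qed
  define gg where "gg w = \<kappa> (Arg w)" for w
  have cisA: "cis (Arg w) = w" if "w \<in> sphere 0 1" for w
  proof -
    have "w \<noteq> 0" using that by auto
    then show ?thesis using that cis_Arg[of w] by (simp add: sgn_div_norm)
  qed
  \<comment> \<open>\<open>Arg\<close> jumps at the negative real axis. Near \<open>w0\<close> it is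
    replaced by \<open>Arg w0 + Arg (w / w0)\<close>, which is continuous where
    \<open>w / w0\<close> has positive real part and differs from \<open>Arg w\<close> by a multiple
    of 2 pi.\<close>
  have gcont: "continuous_map (top_of_set (sphere 0 1)) T gg"
  proof (rule pasting_lemma[where I = "sphere (0::complex) 1"
        and T = "\<lambda>w0. {w \<in> sphere 0 1. 0 < Re (w / w0)}" and f = "\<lambda>w0 w. \<kappa> (Arg w0 + Arg (w / w0))"])
    fix w0 :: complex assume w0: "w0 \<in> sphere 0 1"
    have w00: "w0 \<noteq> 0" using w0 by auto
    have "open {w. 0 < Re (w / w0)}"
      by (intro open_Collect_less continuous_intros) (use w00 in auto)
    then show "openin (top_of_set (sphere 0 1)) {w \<in> sphere 0 1. 0 < Re (w / w0)}"
      by (auto simp: openin_open intro!: exI[of _ "{w. 0 < Re (w / w0)}"])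
    have "continuous_on {w \<in> sphere 0 1. 0 < Re (w / w0)} (\<lambda>w. Arg w0 + Arg (w / w0))"
      by (intro continuous_intros) (use w00 in \<open>auto simp: complex_nonpos_Reals_iff\<close>)
    then have "continuous_map (subtopology (top_of_set (sphere 0 1)) {w \<in> sphere 0 1. 0 < Re (w / w0)}) euclideanreal
        (\<lambda>w. Arg w0 + Arg (w / w0))"
      by (simp add: subtopology_subtopology Int_absorb1 Int_def conj_commute)
    then show "continuous_map (subtopology (top_of_set (sphere 0 1)) {w \<in> sphere 0 1. 0 < Re (w / w0)}) T
        (\<lambda>w. \<kappa> (Arg w0 + Arg (w / w0)))"
      using continuous_map_compose[OF _ kcont] by (simp add: o_def)
  next
    have *: "\<kappa> (Arg w0 + Arg (w / w0)) = gg w" if "w0 \<in> sphere 0 1" "w \<in> sphere 0 1" for w w0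
    proof -
      have "w / w0 \<in> sphere 0 1" "w0 \<noteq> 0" using that by (auto simp: norm_divide)
      then have "cis (Arg w0 + Arg (w / w0)) = w" using cisA that by (simp flip: cis_mult)
      then show ?thesis unfolding gg_def keq using cisA that by simp
    qed
    show "\<kappa> (Arg i + Arg (x / i)) = \<kappa> (Arg j + Arg (x / j))"
      if "i \<in> sphere 0 1" "j \<in> sphere 0 1" "x \<in> topspace (top_of_set (sphere 0 1)) \<inter> {w \<in> sphere 0 1. 0 < Re (w / i)} \<inter> {w \<in> sphere 0 1. 0 < Re (w / j)}" for i j x
      using *[of i x] *[of j x] that by simp
    show "\<exists>j. j \<in> sphere 0 1 \<and> x \<in> {w \<in> sphere 0 1. 0 < Re (w / j)} \<and> gg x = \<kappa> (Arg j + Arg (x / j))"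
      if "x \<in> topspace (top_of_set (sphere 0 1))" for x
      using that *[of x x] by (intro exI[of _ x]) auto
  qed
  define f where "f z = gg (z (0::nat))" for z
  define H where "H = range \<kappa>"
  have H: "subgroup H G"
  proof (rule subgroup.intro)
    show "H \<subseteq> carrier G" using kc by (auto simp: H_def)
    show "x \<otimes> y \<in> H" if "x \<in> H" "y \<in> H" for x y using that kadd by (auto simp: H_def) (metis rangeI)
    show "\<one> \<in> H" using k2pi[of 0] by (auto simp: H_def) (metis rangeI)
    show "inv x \<in> H" if "x \<in> H" for x using that kneg by (auto simp: H_def) (metis rangeI)
  qed
  let ?P = "product_group {..<1::nat} (\<lambda>_. circle_group)"
  have carP: "carrier ?P = (\<Pi>\<^sub>E i\<in>{..<1}. sphere 0 1)" by (simp add: circle_group_def)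
  have fmult: "f (x \<otimes>\<^bsub>?P\<^esub> y) = f x \<otimes> f y" if "x \<in> carrier ?P" "y \<in> carrier ?P" for x y
  proof -
    have s: "x 0 \<in> sphere 0 1" "y 0 \<in> sphere 0 1" using that unfolding carP by (auto simp: PiE_def Pi_def)
    then have "x 0 * y 0 \<in> sphere 0 1" by (auto simp: norm_mult)
    then have "cis (Arg (x 0 * y 0)) = cis (Arg (x 0) + Arg (y 0))" using cisA s by (simp flip: cis_mult)
    then have "\<kappa> (Arg (x 0 * y 0)) = \<kappa> (Arg (x 0) + Arg (y 0))" using keq by blast
    then show ?thesis using kadd by (simp add: f_def gg_def circle_group_def)
  qed
  have finj: "inj_on f (carrier ?P)"
  proof (rule inj_onI)
    fix x y assume xy: "x \<in> carrier ?P" "y \<in> carrier ?P" "f x = f y"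
    have s: "x 0 \<in> sphere 0 1" "y 0 \<in> sphere 0 1" using xy unfolding carP by (auto simp: PiE_def Pi_def)
    have "x 0 = y 0" using xy(3) cisA s unfolding f_def gg_def keq by metis
    then show "x = y" using xy(1,2) unfolding carP by (intro PiE_ext[of x "{..<1}" _ y]) auto
  qed
  have fim: "f ` carrier ?P = H"
  proof (intro subset_antisym subsetI)
    fix h assume "h \<in> H"
    then obtain x where x: "h = \<kappa> x" by (auto simp: H_def)
    have "cis (Arg (cis x)) = cis x" by (rule cisA) simp
    then have "gg (cis x) = h" unfolding gg_def x keq .
    then have "f (\<lambda>i\<in>{..<1}. cis x) = h" by (simp add: f_def)
    moreover have "(\<lambda>i\<in>{..<1}. cis x) \<in> carrier ?P" unfolding carP by auto
    ultimately show "h \<in> f ` carrier ?P" by blast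
  qed (auto simp: f_def gg_def H_def)
  have fiso: "f \<in> iso ?P (G\<lparr>carrier := H\<rparr>)"
    unfolding iso_def hom_def bij_betw_def using fmult finj fim by auto
  have fhom: "homeomorphic_map (product_topology (\<lambda>_. top_of_set (sphere 0 1)) {..<1}) (subtopology T H) f"
  proof (rule continuous_imp_homeomorphic_map)
    have top: "topspace (product_topology (\<lambda>_::nat. top_of_set (sphere (0::complex) 1)) {..<1}) = carrier ?P"
      unfolding carP by simp
    have "continuous_map (product_topology (\<lambda>_::nat. top_of_set (sphere (0::complex) 1)) {..<1}) (top_of_set (sphere 0 1)) (\<lambda>z. z 0)"
      by (rule continuous_map_product_projection) simp
    from continuous_map_compose[OF this gcont]
    have "continuous_map (product_topology (\<lambda>_::nat. top_of_set (sphere (0::complex) 1)) {..<1}) T f"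
      by (simp add: o_def f_def[abs_def])
    then show "continuous_map (product_topology (\<lambda>_. top_of_set (sphere 0 1)) {..<1}) (subtopology T H) f"
      unfolding continuous_map_in_subtopology using fim top by auto
    show "compact_space (product_topology (\<lambda>_::nat. top_of_set (sphere (0::complex) 1)) {..<1})"
      by (simp add: compact_space_product_topology compact_space_subtopology)
    show "Hausdorff_space (subtopology T H)" by (rule Hausdorff_space_subtopology[OF Hausdorff_T])
    show "f ` topspace (product_topology (\<lambda>_. top_of_set (sphere 0 1)) {..<1}) = topspace (subtopology T H)"
      unfolding top fim using subgroup.subset[OF H] topspace_T by auto
    show "inj_on f (topspace (product_topology (\<lambda>_. top_of_set (sphere 0 1)) {..<1}))"
      unfolding top by (rule finj)
  qed
  have "\<kappa> pi \<noteq> \<kappa> 0" unfolding keq by (simp add: complex_eq_iff)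
  then have "H \<noteq> {\<one>}" unfolding H_def by (metis rangeI singletonD)
  then show ?thesis using H fiso fhom unfolding torus_in_def by blast
qed

text \<open>A torus of dimension 0 is trivial, hence properly contained in a circle, and so not
  maximal. For r = 0 the truncated \<open>r - 1\<close> would be 0 and the rank of \<xi> would
  exceed that of ad(P) by one.\<close>

theorem lie_rank_pos:
  assumes "lie_rank G T r"
  shows "r \<ge> 1"
proof (rule ccontr)
  assume "\<not> r \<ge> 1"
  then have "r = 0" by simp
  then obtain H where H: "torus_in G T 0 H"
    and max: "\<And>k' H'. torus_in G T k' H' \<Longrightarrow> H \<subseteq> H' \<Longrightarrow> H' = H"
    using assms unfolding lie_rank_def maximal_torus_in_def by auto
  have Hs: "subgroup H G" using H by (simp add: torus_in_def)
  have "H = {\<one>}"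
  proof -
    obtain f where "f \<in> iso (product_group {..<0::nat} (\<lambda>_. circle_group)) (G\<lparr>carrier := H\<rparr>)"
      using H by (auto simp: torus_in_def)
    then have "f ` carrier (product_group {..<0::nat} (\<lambda>_. circle_group)) = H"
      by (simp add: iso_def bij_betw_def)
    moreover have "carrier (product_group {..<0::nat} (\<lambda>_. circle_group)) = {\<lambda>_. undefined}" by simp
    ultimately have "H = {f (\<lambda>_. undefined)}" by auto
    then show ?thesis using subgroup.one_closed[OF Hs] by auto
  qed
  moreover obtain \<delta> t where "one_param \<delta>" "\<delta> 1 = \<one>" "\<delta> t \<noteq> \<one>" by (rule ex_periodic_one_param)
  then obtain H' where "torus_in G T 1 H'" "H' \<noteq> {\<one>}" using circle_in_G by blast
  ultimately show False using max[of 1 H'] subgroup.one_closed[of H' G] by (auto simp: torus_in_def)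
qed

end

section \<open>Generic frames along the orbit of a torus\<close>

text \<open>A ball of radius proportional to 1/N has volume of order \<open>N ^ -d\<close>; if there
  are of order \<open>N ^ (d - 1)\<close> of them, the total is of order 1/N. The spare factor
  \<open>real N\<close> on the left avoids the exponent d - 1.\<close>

lemma negligible_covering:
  fixes S :: "'e::euclidean_space set"
  assumes K: "K > 0" and cov: "\<And>N::nat. N \<ge> 1 \<Longrightarrow> \<exists>Cs. finite Cs \<and>
      real (card Cs) * real N \<le> K * real N ^ DIM('e) \<and> S \<subseteq> (\<Union>c\<in>Cs. cball c (K / real N))"
  shows "negligible S"
  unfolding negligible_outer_le
proof (intro allI impI)
  fix e :: real assume e: "e > 0"
  let ?d = "DIM('e)"
  obtain N :: nat where N0: "max 1 (K * (2 * K) ^ ?d / e) < real N"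
    using reals_Archimedean2 by blast
  then have N: "N > 0" "K * (2 * K) ^ ?d / e < real N" by auto
  obtain Cs where Cs: "finite Cs" "real (card Cs) * real N \<le> K * real N ^ ?d"
      "S \<subseteq> (\<Union>c\<in>Cs. cball c (K / real N))"
    using cov[of N] N(1) by auto
  let ?T = "\<Union>c\<in>Cs. cball c (K / real N)"
  have T: "?T \<in> lmeasurable" by (intro fmeasurable.finite_UN Cs(1)) (simp add: lmeasurable_cball)
  have ball: "measure lebesgue (cball c (K / real N)) \<le> (2 * K / real N) ^ ?d" for c :: 'e
  proof -
    let ?r = "K / real N"
    have "cball c ?r \<subseteq> cbox (c - ?r *\<^sub>R One) (c + ?r *\<^sub>R One)"
    proof
      fix x assume x: "x \<in> cball c ?r"
      show "x \<in> cbox (c - ?r *\<^sub>R One) (c + ?r *\<^sub>R One)"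
        unfolding mem_box
      proof
        fix b :: 'e assume b: "b \<in> Basis"
        have "\<bar>(x - c) \<bullet> b\<bar> \<le> ?r" using Basis_le_norm[OF b, of "x - c"] x by (simp add: dist_norm norm_minus_commute)
        then show "(c - ?r *\<^sub>R One) \<bullet> b \<le> x \<bullet> b \<and> x \<bullet> b \<le> (c + ?r *\<^sub>R One) \<bullet> b"
          using b by (simp add: inner_diff_left inner_add_left abs_le_iff)
      qed
    qed
    then have "measure lebesgue (cball c ?r) \<le> measure lebesgue (cbox (c - ?r *\<^sub>R One) (c + ?r *\<^sub>R One))"
      by (intro measure_mono_fmeasurable) auto
    also have "\<dots> = measure lborel (cbox (c - ?r *\<^sub>R One) (c + ?r *\<^sub>R One))" by (simp add: measure_completion)
    also have "\<dots> = (\<Prod>b\<in>Basis. ((c + ?r *\<^sub>R One) \<bullet> b - (c - ?r *\<^sub>R One) \<bullet> b))"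
      using K N(1) by (intro content_cbox) (auto simp: inner_diff_left inner_add_left)
    also have "\<dots> = (\<Prod>b\<in>(Basis::'e set). 2 * K / real N)"
      by (intro prod.cong) (auto simp: inner_diff_left inner_add_left)
    finally show ?thesis by simp
  qed
  have "measure lebesgue ?T \<le> (\<Sum>c\<in>Cs. measure lebesgue (cball c (K / real N)))"
    by (rule measure_UNION_le[OF Cs(1)]) auto
  also have "\<dots> \<le> (\<Sum>c\<in>Cs. (2 * K / real N) ^ ?d)" by (intro sum_mono ball)
  also have "\<dots> = (real (card Cs) * real N) * (2 * K / real N) ^ ?d / real N" using N(1) by simp
  also have "\<dots> \<le> (K * real N ^ ?d) * (2 * K / real N) ^ ?d / real N"
    using Cs(2) K by (intro divide_right_mono mult_right_mono) auto
  also have "\<dots> = K * (2 * K) ^ ?d / real N" using N(1) by (simp add: power_divide)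
  also have "\<dots> \<le> e" using N e by (simp add: field_simps)
  finally show "\<exists>T. S \<subseteq> T \<and> T \<in> lmeasurable \<and> measure lebesgue T \<le> e" using Cs(3) T by blast
qed

text \<open>Each \<open>v j\<close> has a positive distance to the closed subspace spanned by the
  other vectors; by scaling, this bounds the coefficient at \<open>j\<close>.\<close>

lemma independent_family_lower:
  fixes v :: "nat \<Rightarrow> 'e::euclidean_space"
  assumes ind: "\<And>c. (\<Sum>i<r. c i *\<^sub>R v i) = 0 \<Longrightarrow> \<forall>i<r. c i = 0"
  obtains c0 where "c0 > 0" "\<And>h j. j < r \<Longrightarrow> c0 * \<bar>h j\<bar> \<le> norm (\<Sum>i<r. h i *\<^sub>R v i)"
proof -
  have "\<exists>d>0. \<forall>h. d * \<bar>h j\<bar> \<le> norm (\<Sum>i<r. h i *\<^sub>R v i)" if j: "j < r" for j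
  proof -
    define W where "W = range (\<lambda>u. \<Sum>i\<in>{..<r} - {j}. u i *\<^sub>R v i)"
    have "subspace W"
      unfolding subspace_def
    proof (intro conjI ballI allI)
      show "0 \<in> W" unfolding W_def by (rule range_eqI[of _ _ "\<lambda>_. 0"]) simp
      show "x + y \<in> W" if xy: "x \<in> W" "y \<in> W" for x y
      proof -
        obtain u where u: "x = (\<Sum>i\<in>{..<r} - {j}. u i *\<^sub>R v i)" using xy(1) unfolding W_def by blast
        obtain w where w: "y = (\<Sum>i\<in>{..<r} - {j}. w i *\<^sub>R v i)" using xy(2) unfolding W_def by blast
        from u w have "x + y = (\<Sum>i\<in>{..<r} - {j}. (u i + w i) *\<^sub>R v i)" by (simp add: sum.distrib scaleR_add_left)
        then show ?thesis unfolding W_def by (rule range_eqI[of _ _ "\<lambda>i. u i + w i"])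
      qed
      show "c *\<^sub>R x \<in> W" if xW: "x \<in> W" for c x
      proof -
        obtain u where "x = (\<Sum>i\<in>{..<r} - {j}. u i *\<^sub>R v i)" using xW unfolding W_def by blast
        then have "c *\<^sub>R x = (\<Sum>i\<in>{..<r} - {j}. (c * u i) *\<^sub>R v i)" by (simp add: scaleR_sum_right)
        then show ?thesis unfolding W_def by (rule range_eqI[of _ _ "\<lambda>i. c * u i"])
      qed
    qed
    then have cW: "closed W" by (rule closed_subspace)
    have split: "(\<Sum>i<r. u i *\<^sub>R v i) = u j *\<^sub>R v j + (\<Sum>i\<in>{..<r} - {j}. u i *\<^sub>R v i)" for u
      using j by (simp add: sum.remove[of "{..<r}" j])
    have vW: "v j \<notin> W"
    proof
      assume "v j \<in> W"
      then obtain u where u: "v j = (\<Sum>i\<in>{..<r} - {j}. u i *\<^sub>R v i)" unfolding W_def by blast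
      have "(\<Sum>i<r. (u(j := - 1)) i *\<^sub>R v i) = - v j + (\<Sum>i\<in>{..<r} - {j}. u i *\<^sub>R v i)"
        unfolding split by (auto intro: sum.cong)
      then have "(\<Sum>i<r. (u(j := - 1)) i *\<^sub>R v i) = 0" using u by simp
      from ind[OF this] have "(u(j := - 1)) j = 0" using j by blast
      then show False by simp
    qed
    have "open (- W)" "v j \<in> - W" using cW vW by (simp_all add: open_Compl)
    then obtain d where d: "d > 0" "ball (v j) d \<subseteq> - W" using open_contains_ball by blast
    have "d * \<bar>h j\<bar> \<le> norm (\<Sum>i<r. h i *\<^sub>R v i)" for h
    proof (cases "h j = 0")
      case False
      define w where "w = (\<Sum>i\<in>{..<r} - {j}. (- h i / h j) *\<^sub>R v i)"
      have "w \<in> W" unfolding W_def w_def by (rule range_eqI[of _ _ "\<lambda>i. - h i / h j"]) simp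
      then have "w \<notin> ball (v j) d" using d(2) by blast
      then have "d \<le> norm (v j - w)" by (simp add: dist_norm)
      then have "d * \<bar>h j\<bar> \<le> norm (v j - w) * \<bar>h j\<bar>" by (rule mult_right_mono) simp
      moreover have "h j *\<^sub>R w = - (\<Sum>i\<in>{..<r} - {j}. h i *\<^sub>R v i)"
        unfolding w_def scaleR_sum_right sum_negf[symmetric] using False by (intro sum.cong) auto
      then have "(\<Sum>i<r. h i *\<^sub>R v i) = h j *\<^sub>R (v j - w)"
        unfolding split by (simp add: scaleR_diff_right)
      ultimately show ?thesis by (simp add: mult.commute)
    qed simp
    then show ?thesis using d(1) by blast
  qed
  then obtain d where d: "\<And>j. j < r \<Longrightarrow> d j > 0" "\<And>j h. j < r \<Longrightarrow> d j * \<bar>h j\<bar> \<le> norm (\<Sum>i<r. h i *\<^sub>R v i)"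
    by metis
  define c0 where "c0 = Min (insert 1 (d ` {..<r}))"
  show ?thesis
  proof (rule that[of c0])
    show "c0 > 0" unfolding c0_def using d(1) by (subst Min_gr_iff) auto
    fix h j assume j: "j < r"
    have "c0 \<le> d j" unfolding c0_def using j by (intro Min_le) auto
    then have "c0 * \<bar>h j\<bar> \<le> d j * \<bar>h j\<bar>" by (intro mult_right_mono) auto
    then show "c0 * \<bar>h j\<bar> \<le> norm (\<Sum>i<r. h i *\<^sub>R v i)" using d(2)[OF j, of h] by linarith
  qed
qed

section \<open>Angle coordinates of a torus\<close>

context lie_chart
begin

definition tangent :: "(real \<Rightarrow> 'g) \<Rightarrow> 'e \<Rightarrow> real \<Rightarrow> real \<Rightarrow> bool" where
  "tangent x v t0 K \<longleftrightarrow> t0 > 0 \<and> K \<ge> 0 \<and> (\<forall>t. \<bar>t\<bar> \<le> t0 \<longrightarrow>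
     x t \<in> B r1 \<and> norm (\<psi> (x t) - t *\<^sub>R v) \<le> K * t\<^sup>2 \<and> norm (\<psi> (x t)) \<le> 2 * \<bar>t\<bar> * norm v)"

lemma ex_tangent: "one_param x \<Longrightarrow> \<exists>v t0 K. tangent x v t0 K"
  by (rule one_param_derivative, assumption) (auto simp: tangent_def)

text \<open>Conjugation by \<open>g\<close> fixes every point of the curve, so its differential
  fixes the velocity at 0.\<close>

lemma tangent_fixed:
  assumes x: "one_param x" and tan: "tangent x v t0 K" and g: "g \<in> carrier G"
    and comm: "\<And>t. g \<otimes> x t = x t \<otimes> g"
  shows "a g v = v"
proof -
  have t0: "t0 > 0" "K \<ge> 0" and near: "\<And>t. \<bar>t\<bar> \<le> t0 \<Longrightarrow> x t \<in> B r1 \<and> norm (\<psi> (x t) - t *\<^sub>R v) \<le> K * t\<^sup>2"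
    using tan by (auto simp: tangent_def)
  define p where "p t = \<psi> (x t)" for t
  have p0: "p 0 = 0" using one_paramD(4)[OF x] psi_one by (simp add: p_def)
  have "((\<lambda>t. K * \<bar>t\<bar>) \<longlongrightarrow> K * \<bar>0\<bar>) (at 0)" by (intro tendsto_intros)
  then have lim: "((\<lambda>t. K * \<bar>t\<bar>) \<longlongrightarrow> 0) (at 0)" by simp
  have dp: "(p has_derivative (\<lambda>t. t *\<^sub>R v)) (at 0)"
  proof (rule has_derivativeI_sandwich[OF t0(1) _ _ lim])
    show "bounded_linear (\<lambda>t. t *\<^sub>R v)" by (rule bounded_linear_scaleR_left)
    fix t :: real assume t: "t \<noteq> 0" "dist t 0 < t0"
    have "norm (p t - t *\<^sub>R v) \<le> K * t\<^sup>2" using near[of t] t by (simp add: p_def dist_real_def)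
    then have "norm (p t - t *\<^sub>R v) / \<bar>t\<bar> \<le> (K * t\<^sup>2) / \<bar>t\<bar>" by (intro divide_right_mono) auto
    also have "\<dots> = K * \<bar>t\<bar>" using t(1) by (simp add: power2_eq_square abs_if)
    finally show "norm ((p t - p 0) - (t - 0) *\<^sub>R v) / norm (t - 0) \<le> K * \<bar>t\<bar>" using p0 by simp
  qed
  have "((\<lambda>u. \<psi> (g \<otimes> \<theta> u \<otimes> inv g)) has_derivative a g) (at (p 0))" using a_deriv[OF g] p0 by simp
  from has_derivative_compose[OF dp this]
  have "((\<lambda>t. \<psi> (g \<otimes> \<theta> (p t) \<otimes> inv g)) has_derivative (\<lambda>t. a g (t *\<^sub>R v))) (at 0)" .
  then have "(p has_derivative (\<lambda>t. a g (t *\<^sub>R v))) (at 0)"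
  proof (rule has_derivative_transform_within_open[of _ _ _ UNIV "ball 0 t0"])
    fix t :: real assume "t \<in> ball 0 t0"
    then have xt: "x t \<in> B r1" using near[of t] by (simp add: dist_real_def)
    then have "\<theta> (p t) = x t" using theta_psi by (simp add: p_def B_def)
    moreover have "g \<otimes> x t \<otimes> inv g = x t" unfolding comm using g B_closed[OF xt] by (simp add: m_assoc)
    ultimately show "\<psi> (g \<otimes> \<theta> (p t) \<otimes> inv g) = p t" by (simp add: p_def)
  qed (use t0 in auto)
  from has_derivative_unique[OF this dp] have "a g (1 *\<^sub>R v) = 1 *\<^sub>R v" by meson
  then show ?thesis by simp
qed

text \<open>\<open>\<tau>\<close> stands for a torus in angle coordinates, that is, composed with
  its universal covering. The last clause is infinitesimal injectivity in quantitative form; it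
  keeps the points of a grid of small angles apart in G.\<close>

definition torus_frame ::
  "nat \<Rightarrow> (nat \<Rightarrow> 'e) \<Rightarrow> ((nat \<Rightarrow> real) \<Rightarrow> 'g) \<Rightarrow> real \<Rightarrow> real \<Rightarrow> bool" where
  "torus_frame r v \<tau> h0 c0 \<longleftrightarrow> h0 > 0 \<and> c0 > 0 \<and>
    (\<forall>h. \<tau> h \<in> carrier G) \<and> (\<forall>h h'. \<tau> (\<lambda>i. h i + h' i) = \<tau> h \<otimes> \<tau> h') \<and>
    (\<forall>h. \<forall>i<r. a (\<tau> h) (v i) = v i) \<and>
    (\<forall>c. (\<Sum>i<r. c i *\<^sub>R v i) = 0 \<longrightarrow> (\<forall>i<r. c i = 0)) \<and>
    (\<forall>h. (\<forall>i<r. \<bar>h i\<bar> \<le> h0) \<longrightarrow> \<tau> h \<in> B r1 \<and> (\<forall>j<r. c0 * \<bar>h j\<bar> \<le> norm (\<psi> (\<tau> h))))"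

text \<open>In the chart, \<open>\<tau> h\<close> is the combination of the \<open>v i\<close> with
  coefficients \<open>h i\<close> up to a quadratic error, as one sees by adding one angle at a
  time. A linear relation with coefficients \<open>c\<close> would give the subgroup with angles
  \<open>t * c i\<close> the tangent vector 0, so it would be constant near 0, contrary to the
  injectivity of the isomorphism from (S^1)^r.\<close>

lemma ex_torus_frame:
  assumes "torus_in G T r H"
  shows "\<exists>v \<tau> h0 c0. torus_frame r v \<tau> h0 c0"
proof -
  let ?P = "product_group {..<r} (\<lambda>_. circle_group)"
  have Hs: "subgroup H G" using assms by (simp add: torus_in_def)
  obtain f where f: "f \<in> iso ?P (G\<lparr>carrier := H\<rparr>)"
    and fh: "homeomorphic_map (product_topology (\<lambda>_. top_of_set (sphere 0 1)) {..<r}) (subtopology T H) f"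
    using assms by (auto simp: torus_in_def)
  have carP: "carrier ?P = (\<Pi>\<^sub>E i\<in>{..<r}. sphere 0 1)" by (simp add: circle_group_def)
  have fmult: "f (x \<otimes>\<^bsub>?P\<^esub> y) = f x \<otimes> f y" if "x \<in> carrier ?P" "y \<in> carrier ?P" for x y
    using f that by (simp add: iso_def hom_def del: mult_product_group carrier_product_group)
  have finj: "inj_on f (carrier ?P)" and fim: "f ` carrier ?P = H"
    using f by (simp_all add: iso_def bij_betw_def del: carrier_product_group)
  define z where "z h = (\<lambda>i\<in>{..<r}. cis (h i))" for h :: "nat \<Rightarrow> real"
  define \<tau> where "\<tau> h = f (z h)" for h
  have zP: "z h \<in> carrier ?P" for h unfolding carP z_def by auto
  have car: "\<tau> h \<in> carrier G" for h
    using fim zP[of h] subgroup.subset[OF Hs] unfolding \<tau>_def by blast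
  have add: "\<tau> (\<lambda>i. h i + h' i) = \<tau> h \<otimes> \<tau> h'" for h h'
  proof -
    have "z (\<lambda>i. h i + h' i) = z h \<otimes>\<^bsub>?P\<^esub> z h'"
      by (auto simp: z_def circle_group_def cis_mult)
    then show ?thesis unfolding \<tau>_def using fmult[OF zP zP] by simp
  qed
  have comm: "\<tau> h \<otimes> \<tau> h' = \<tau> h' \<otimes> \<tau> h" for h h'
    using add[of h h'] add[of h' h] by (simp add: add.commute)
  have cong: "\<tau> h = \<tau> h'" if "\<And>i. i < r \<Longrightarrow> h i = h' i" for h h'
  proof -
    have "z h = z h'" using that by (auto simp: z_def)
    then show ?thesis by (simp add: \<tau>_def)
  qed
  have zero: "\<tau> (\<lambda>i. 0) = \<one>"
    using add[of "\<lambda>i. 0" "\<lambda>i. 0"] car[of "\<lambda>i. 0"] by (metis add_0 l_cancel_one)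
  have op: "one_param (\<lambda>t. \<tau> (\<lambda>i. t * c i))" for c
    unfolding one_param_def
  proof (intro conjI allI)
    show "\<tau> (\<lambda>i. (s + t) * c i) = \<tau> (\<lambda>i. s * c i) \<otimes> \<tau> (\<lambda>i. t * c i)" for s t
      using add[of "\<lambda>i. s * c i" "\<lambda>i. t * c i"] by (simp add: algebra_simps)
    have "continuous_map euclideanreal (product_topology (\<lambda>_. top_of_set (sphere 0 1)) {..<r}) (\<lambda>t. z (\<lambda>i. t * c i))"
      unfolding continuous_map_componentwise
      by (auto simp: z_def continuous_map_in_subtopology intro!: continuous_intros)
    from continuous_map_compose[OF this homeomorphic_imp_continuous_map[OF fh]]
    show "continuous_map euclideanreal T (\<lambda>t. \<tau> (\<lambda>i. t * c i))"
      by (simp add: o_def \<tau>_def continuous_map_in_subtopology)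
  qed
  define \<delta> :: "nat \<Rightarrow> nat \<Rightarrow> real" where "\<delta> k i = (if i = k then 1 else 0)" for k i
  define x where "x k t = \<tau> (\<lambda>i. t * \<delta> k i)" for k t
  have xop: "one_param (x k)" for k unfolding x_def by (rule op)
  obtain v t0 K where tan: "\<And>k. tangent (x k) (v k) (t0 k) (K k)"
    using ex_tangent[OF xop] by metis
  have fixed: "a (\<tau> h) (v k) = v k" for h k
    by (rule tangent_fixed[OF xop tan car]) (simp add: x_def comm)
  have est: "\<exists>s0>0. \<exists>L\<ge>0. \<forall>h s. 0 \<le> s \<and> s \<le> s0 \<and> (\<forall>i<k. \<bar>h i\<bar> \<le> s) \<longrightarrow>
      \<tau> (\<lambda>i. if i < k then h i else 0) \<in> B r1 \<and>
      norm (\<psi> (\<tau> (\<lambda>i. if i < k then h i else 0)) - (\<Sum>i<k. h i *\<^sub>R v i)) \<le> L * s\<^sup>2" for k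
  proof (induction k)
    case 0
    then show ?case using zero one_in_B[OF r1(1)] psi_one by (intro exI[of _ 1] conjI exI[of _ 0]) auto
  next
    case (Suc k)
    then obtain s0 L where s0: "s0 > 0" "L \<ge> 0" and IH: "\<And>h s. 0 \<le> s \<Longrightarrow> s \<le> s0 \<Longrightarrow> (\<forall>i<k. \<bar>h i\<bar> \<le> s) \<Longrightarrow>
      \<tau> (\<lambda>i. if i < k then h i else 0) \<in> B r1 \<and>
      norm (\<psi> (\<tau> (\<lambda>i. if i < k then h i else 0)) - (\<Sum>i<k. h i *\<^sub>R v i)) \<le> L * s\<^sup>2" by blast
    have tk: "t0 k > 0" "K k \<ge> 0" "\<And>t. \<bar>t\<bar> \<le> t0 k \<Longrightarrow> x k t \<in> B r1 \<and> norm (\<psi> (x k t) - t *\<^sub>R v k) \<le> K k * t\<^sup>2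
        \<and> norm (\<psi> (x k t)) \<le> 2 * \<bar>t\<bar> * norm (v k)"
      using tan[of k] by (auto simp: tangent_def)
    define \<sigma> where "\<sigma> = (\<Sum>i<k. norm (v i))"
    have \<sigma>: "\<sigma> \<ge> 0" unfolding \<sigma>_def by (intro sum_nonneg) auto
    define Q where "Q = \<sigma> + L + 4 * norm (v k) + 1"
    have Q: "Q > 0" using \<sigma> s0 by (simp add: Q_def add_nonneg_pos)
    \<comment> \<open>\<open>s0\<close> and \<open>t0 k\<close> are the ranges of the two
      expansions, 1 allows to bound s^2 by s, and the last term keeps the product in
      \<open>B r1\<close>.\<close>
    define s1 where "s1 = Min {s0, t0 k, 1, r1 / (2 * Q)}"
    have s1: "s1 > 0" "s1 \<le> s0" "s1 \<le> t0 k" "s1 \<le> 1" "s1 \<le> r1 / (2 * Q)"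
      using s0 tk(1) Q r1(1) by (auto simp: s1_def)
    define L' where "L' = L + K k + C * (\<sigma> + L) * (2 * norm (v k))"
    have L': "L' \<ge> 0" using s0 tk(2) \<sigma> C_pos by (simp add: L'_def)
    have "\<tau> (\<lambda>i. if i < Suc k then h i else 0) \<in> B r1 \<and>
      norm (\<psi> (\<tau> (\<lambda>i. if i < Suc k then h i else 0)) - (\<Sum>i<Suc k. h i *\<^sub>R v i)) \<le> L' * s\<^sup>2"
      if s: "0 \<le> s" "s \<le> s1" and h: "\<forall>i<Suc k. \<bar>h i\<bar> \<le> s" for h s
    proof -
      define p where "p = \<tau> (\<lambda>i. if i < k then h i else 0)"
      define q where "q = x k (h k)"
      have "(\<lambda>i. if i < Suc k then h i else 0) = (\<lambda>i. (if i < k then h i else 0) + h k * \<delta> k i)"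
        by (auto simp: \<delta>_def less_Suc_eq)
      then have eq: "\<tau> (\<lambda>i. if i < Suc k then h i else 0) = p \<otimes> q"
        using add[of "\<lambda>i. if i < k then h i else 0" "\<lambda>i. h k * \<delta> k i"] by (simp add: p_def q_def x_def)
      have p: "p \<in> B r1" "norm (\<psi> p - (\<Sum>i<k. h i *\<^sub>R v i)) \<le> L * s\<^sup>2"
        using IH[of s h] s s1 h by (auto simp: p_def)
      have hk: "\<bar>h k\<bar> \<le> s" using h by simp
      have q: "q \<in> B r1" "norm (\<psi> q - h k *\<^sub>R v k) \<le> K k * (h k)\<^sup>2" "norm (\<psi> q) \<le> 2 * \<bar>h k\<bar> * norm (v k)"
        using tk(3)[of "h k"] hk s s1 by (auto simp: q_def)
      have q2: "norm (\<psi> q) \<le> 2 * norm (v k) * s"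
        using q(3) mult_right_mono[OF hk, of "2 * norm (v k)"] by (simp add: mult_ac)
      have "(h k)\<^sup>2 \<le> s\<^sup>2" using hk s(1) by (simp add: abs_le_square_iff[symmetric])
      then have q1: "norm (\<psi> q - h k *\<^sub>R v k) \<le> K k * s\<^sup>2" using q(2) tk(2) mult_left_mono by fastforce
      have "norm (\<Sum>i<k. h i *\<^sub>R v i) \<le> (\<Sum>i<k. s * norm (v i))"
        using h by (intro sum_norm_le) (auto intro!: mult_right_mono)
      then have "norm (\<Sum>i<k. h i *\<^sub>R v i) \<le> \<sigma> * s" by (simp add: \<sigma>_def sum_distrib_left mult.commute)
      moreover have "norm (\<psi> p) \<le> norm (\<Sum>i<k. h i *\<^sub>R v i) + norm (\<psi> p - (\<Sum>i<k. h i *\<^sub>R v i))"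
        using norm_triangle_ineq[of "\<Sum>i<k. h i *\<^sub>R v i" "\<psi> p - (\<Sum>i<k. h i *\<^sub>R v i)"] by simp
      moreover have "L * s\<^sup>2 \<le> L * s"
        using s s1 s0 by (intro mult_left_mono) (auto simp: power2_eq_square mult_left_le_one_le)
      ultimately have pn: "norm (\<psi> p) \<le> (\<sigma> + L) * s" using p(2) by (simp add: algebra_simps)
      have "norm (\<psi> (p \<otimes> q)) \<le> norm (\<psi> p) + 2 * norm (\<psi> q)" by (rule norm_mult_le[OF p(1) q(1)])
      also have "\<dots> \<le> Q * s" using pn q2 s(1) by (simp add: Q_def algebra_simps)
      also have "\<dots> \<le> Q * (r1 / (2 * Q))" using s s1 Q by (intro mult_left_mono) auto
      also have "\<dots> < r1" using Q r1(1) by simp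
      finally have "norm (\<psi> (p \<otimes> q)) < r1" .
      then have B: "p \<otimes> q \<in> B r1" using mult_B_U[OF Br1_rho[OF p(1)] Br1_rho[OF q(1)]] by (simp add: B_def)
      have "norm (\<psi> (p \<otimes> q) - \<psi> p - \<psi> q) \<le> C * norm (\<psi> p) * norm (\<psi> q)"
        by (rule mult_est[OF Br1_rho[OF p(1)] Br1_rho[OF q(1)]])
      also have "\<dots> \<le> C * ((\<sigma> + L) * s) * (2 * norm (v k) * s)"
        using pn q2 C_pos \<sigma> s0 s by (intro mult_mono) auto
      finally have pq: "norm (\<psi> (p \<otimes> q) - \<psi> p - \<psi> q) \<le> C * (\<sigma> + L) * (2 * norm (v k)) * s\<^sup>2"
        by (simp add: power2_eq_square mult_ac)
      have "\<psi> (p \<otimes> q) - (\<Sum>i<Suc k. h i *\<^sub>R v i) =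
        (\<psi> (p \<otimes> q) - \<psi> p - \<psi> q) + ((\<psi> p - (\<Sum>i<k. h i *\<^sub>R v i)) + (\<psi> q - h k *\<^sub>R v k))" by simp
      then have "norm (\<psi> (p \<otimes> q) - (\<Sum>i<Suc k. h i *\<^sub>R v i)) \<le>
        C * (\<sigma> + L) * (2 * norm (v k)) * s\<^sup>2 + (L * s\<^sup>2 + K k * s\<^sup>2)"
        using pq p(2) q1 by (metis (no_types, lifting) add_mono norm_triangle_le)
      then show ?thesis using B unfolding eq by (simp add: L'_def algebra_simps)
    qed
    then show ?case using s1(1) L' by blast
  qed
  obtain s0 L where s0: "s0 > 0" "L \<ge> 0" and est': "\<And>h s. 0 \<le> s \<Longrightarrow> s \<le> s0 \<Longrightarrow> (\<forall>i<r. \<bar>h i\<bar> \<le> s) \<Longrightarrow>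
      \<tau> (\<lambda>i. if i < r then h i else 0) \<in> B r1 \<and>
      norm (\<psi> (\<tau> (\<lambda>i. if i < r then h i else 0)) - (\<Sum>i<r. h i *\<^sub>R v i)) \<le> L * s\<^sup>2"
    using est[of r] by blast
  have tr: "\<tau> (\<lambda>i. if i < r then h i else 0) = \<tau> h" for h by (rule cong) simp
  have ind: "\<forall>i<r. c i = 0" if c: "(\<Sum>i<r. c i *\<^sub>R v i) = 0" for c
  proof (rule ccontr)
    assume "\<not> (\<forall>i<r. c i = 0)"
    then obtain j where j: "j < r" "c j \<noteq> 0" by auto
    obtain w u0 M where tc: "tangent (\<lambda>t. \<tau> (\<lambda>i. t * c i)) w u0 M" using ex_tangent[OF op] by blast
    have u0: "u0 > 0" "M \<ge> 0" and near: "\<And>t. \<bar>t\<bar> \<le> u0 \<Longrightarrow> \<tau> (\<lambda>i. t * c i) \<in> B r1 \<and>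
        norm (\<psi> (\<tau> (\<lambda>i. t * c i)) - t *\<^sub>R w) \<le> M * t\<^sup>2 \<and> norm (\<psi> (\<tau> (\<lambda>i. t * c i))) \<le> 2 * \<bar>t\<bar> * norm w"
      using tc by (auto simp: tangent_def)
    define m where "m = (\<Sum>i<r. \<bar>c i\<bar>) + 1"
    have m: "m > 0" unfolding m_def by (intro add_nonneg_pos sum_nonneg) auto
    have cm: "\<bar>c i\<bar> \<le> m" if "i < r" for i
      using member_le_sum[of i "{..<r}" "\<lambda>i. \<bar>c i\<bar>"] that by (simp add: m_def)
    have wt: "norm w \<le> (M + L * m\<^sup>2) * t" if t: "0 < t" "t \<le> u0" "t * m \<le> s0" for t
    proof -
      let ?p = "\<psi> (\<tau> (\<lambda>i. t * c i))"
      have "\<forall>i<r. \<bar>t * c i\<bar> \<le> t * m" using cm t(1) by (simp add: abs_mult)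
      then have "norm (?p - (\<Sum>i<r. (t * c i) *\<^sub>R v i)) \<le> L * (t * m)\<^sup>2"
        using est'[of "t * m" "\<lambda>i. t * c i"] t m unfolding tr by simp
      moreover have "(\<Sum>i<r. (t * c i) *\<^sub>R v i) = t *\<^sub>R (\<Sum>i<r. c i *\<^sub>R v i)" by (simp add: scaleR_sum_right)
      ultimately have 1: "norm ?p \<le> L * (t * m)\<^sup>2" using c by simp
      have 2: "norm (?p - t *\<^sub>R w) \<le> M * t\<^sup>2" using near[of t] t by simp
      have "norm (t *\<^sub>R w) \<le> norm ?p + norm (?p - t *\<^sub>R w)" using norm_triangle_ineq4[of ?p "?p - t *\<^sub>R w"] by simp
      then have "t * norm w \<le> t * ((M + L * m\<^sup>2) * t)"
        using 1 2 t by (simp add: power2_eq_square algebra_simps)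
      then show ?thesis using t(1) by simp
    qed
    have "norm w = 0"
    proof (rule ccontr)
      assume "norm w \<noteq> 0"
      then have wp: "norm w > 0" by simp
      define D where "D = M + L * m\<^sup>2 + 1"
      have D: "D > 0" using u0 s0 by (simp add: D_def add_nonneg_pos)
      define t where "t = Min {u0, s0 / m, norm w / (2 * D)}"
      have t: "0 < t" "t \<le> u0" "t \<le> s0 / m" "t \<le> norm w / (2 * D)"
        using u0 s0 m wp D by (auto simp: t_def)
      then have "t * m \<le> s0" using m by (simp add: field_simps)
      then have "norm w \<le> (M + L * m\<^sup>2) * t" by (rule wt[OF t(1,2)])
      also have "\<dots> \<le> D * t" using t(1) by (intro mult_right_mono) (auto simp: D_def)
      also have "\<dots> \<le> D * (norm w / (2 * D))" using t(4) D by (intro mult_left_mono) auto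
      also have "\<dots> < norm w" using D wp by simp
      finally show False by simp
    qed
    then have triv: "\<tau> (\<lambda>i. t * c i) = \<one>" if "\<bar>t\<bar> \<le> u0" for t
      using near[OF that] psi_one one_in_U by (intro B_eqI) (auto simp: B_def)
    \<comment> \<open>The angle \<open>t * c j\<close> is non-zero and at most 1 in absolute value,
      so its sine is not 0, whereas triviality of the subgroup makes it a multiple of 2 pi.\<close>
    define t where "t = min u0 (1 / \<bar>c j\<bar>)"
    have t: "t > 0" "t \<le> u0" "t * \<bar>c j\<bar> \<le> 1" using u0 j(2) by (auto simp: t_def min_def field_simps)
    have "f (z (\<lambda>i. t * c i)) = f (z (\<lambda>i. 0))" using triv[of t] t zero by (simp add: \<tau>_def)
    then have "z (\<lambda>i. t * c i) = z (\<lambda>i. 0)" by (rule inj_onD[OF finj _ zP zP])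
    then have "z (\<lambda>i. t * c i) j = z (\<lambda>i. 0) j" by simp
    then have "cis (t * c j) = 1" using j(1) by (simp add: z_def)
    then have s: "sin (t * c j) = 0" by (simp add: complex_eq_iff)
    have "sin \<bar>t * c j\<bar> > 0" using t j(2) pi_gt3 by (intro sin_gt_zero) (auto simp: abs_mult)
    then show False using s by (cases "t * c j \<ge> 0") auto
  qed
  obtain c1 where c1: "c1 > 0" "\<And>h j. j < r \<Longrightarrow> c1 * \<bar>h j\<bar> \<le> norm (\<Sum>i<r. h i *\<^sub>R v i)"
    by (rule independent_family_lower[where r = r and v = v]) (use ind in auto)
  \<comment> \<open>For angles below this bound the quadratic error takes away at most half of the
    linear lower bound, hence \<open>c1 / 2\<close>.\<close>
  define h0 where "h0 = min s0 (c1 / (2 * (L + 1)))"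
  have h0: "h0 > 0" "h0 \<le> s0" "h0 \<le> c1 / (2 * (L + 1))" using s0 c1(1) by (auto simp: h0_def)
  have lower: "\<tau> h \<in> B r1 \<and> (\<forall>j<r. c1 / 2 * \<bar>h j\<bar> \<le> norm (\<psi> (\<tau> h)))" if h: "\<forall>i<r. \<bar>h i\<bar> \<le> h0" for h
  proof (intro conjI allI impI)
    show "\<tau> h \<in> B r1" using est'[of h0 h] h h0 unfolding tr by auto
    fix j assume j: "j < r"
    define s where "s = Max ((\<lambda>i. \<bar>h i\<bar>) ` {..<r})"
    have "s \<in> (\<lambda>i. \<bar>h i\<bar>) ` {..<r}" unfolding s_def using j by (intro Max_in) auto
    then obtain i where i: "i < r" "s = \<bar>h i\<bar>" by auto
    have si: "\<forall>k<r. \<bar>h k\<bar> \<le> s" unfolding s_def by auto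
    have s0': "0 \<le> s" "s \<le> h0" using i h by auto
    have 1: "norm (\<psi> (\<tau> h) - (\<Sum>i<r. h i *\<^sub>R v i)) \<le> L * s\<^sup>2"
      using est'[of s h] s0' h0 si unfolding tr by simp
    have "L * s \<le> (L + 1) * (c1 / (2 * (L + 1)))" using s0' h0 s0 by (intro mult_mono) auto
    also have "\<dots> = c1 / 2" using s0 by (simp add: field_simps)
    finally have "L * s * s \<le> c1 / 2 * s" using s0'(1) by (intro mult_right_mono) auto
    then have "norm (\<psi> (\<tau> h) - (\<Sum>i<r. h i *\<^sub>R v i)) \<le> c1 / 2 * s" using 1 by (simp add: power2_eq_square mult.assoc)
    moreover have "c1 * s \<le> norm (\<Sum>i<r. h i *\<^sub>R v i)" using c1(2)[OF i(1), of h] i(2) by simp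
    moreover have "norm (\<Sum>i<r. h i *\<^sub>R v i) \<le> norm (\<psi> (\<tau> h)) + norm (\<psi> (\<tau> h) - (\<Sum>i<r. h i *\<^sub>R v i))"
      using norm_triangle_ineq4[of "\<psi> (\<tau> h)" "\<psi> (\<tau> h) - (\<Sum>i<r. h i *\<^sub>R v i)"] by simp
    ultimately have "c1 / 2 * s \<le> norm (\<psi> (\<tau> h))" by simp
    moreover have "c1 / 2 * \<bar>h j\<bar> \<le> c1 / 2 * s" using si j c1(1) by (intro mult_left_mono) auto
    ultimately show "c1 / 2 * \<bar>h j\<bar> \<le> norm (\<psi> (\<tau> h))" by simp
  qed
  have "torus_frame r v \<tau> h0 (c1 / 2)"
    unfolding torus_frame_def using h0(1) c1(1) car add fixed ind lower by auto
  then show ?thesis by blast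
qed

text \<open>G is covered by finitely many translates of a neighbourhood in the chart. In each of
  them the coordinates are rounded to a grid of mesh 1/(N L), of which at most of order
  \<open>N ^ d\<close> cells occur; two points in the same cell would be closer than
  \<open>\<delta> / N\<close>.\<close>

lemma separated_bound:
  assumes \<delta>: "\<delta> > 0"
  shows "\<exists>K>0. \<forall>N E. (N::nat) \<ge> 1 \<longrightarrow> finite E \<longrightarrow> E \<subseteq> carrier G \<longrightarrow>
     (\<forall>p\<in>E. \<forall>q\<in>E. p \<noteq> q \<longrightarrow> inv p \<otimes> q \<notin> B (\<delta> / real N)) \<longrightarrow>
     real (card E) \<le> K * real N ^ DIM('e)"
proof -
  let ?d = "DIM('e)"
  obtain e where e: "0 < e" "e \<le> r1" "\<And>x y. x \<in> B e \<Longrightarrow> y \<in> B e \<Longrightarrow> inv x \<otimes> y \<in> B r1"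
    by (rule inv_mult_nbhd[OF r1(1)]) (rule that)
  obtain F where F: "finite F" "F \<subseteq> carrier G" "\<And>g. g \<in> carrier G \<Longrightarrow> \<exists>f\<in>F. inv f \<otimes> g \<in> B e"
    by (rule finite_cover[OF e(1)]) (rule that)
  \<comment> \<open>The diameter of a cell is at most d/(N L), and \<open>inv_mult_est\<close> costs
    a factor 2. The added 1 makes the resulting bound strictly smaller than
    \<open>\<delta> / N\<close>.\<close>
  define L where "L = (2 * real ?d + 1) / \<delta>"
  have L: "L > 0" using \<delta> by (simp add: L_def add_nonneg_pos)
  define M where "M = nat \<lceil>L * e\<rceil> + 1"
  have M: "L * e \<le> real M" "M \<ge> 1" unfolding M_def by linarith+
  define K where "K = real (card F) * (3 * real M) ^ ?d + 1"
  have K: "K > 0" by (simp add: K_def add_nonneg_pos)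
  show ?thesis
  proof (intro exI[of _ K] conjI K allI impI)
    fix N :: nat and E assume N: "N \<ge> 1" and E: "finite E" "E \<subseteq> carrier G"
      and sep: "\<forall>p\<in>E. \<forall>q\<in>E. p \<noteq> q \<longrightarrow> inv p \<otimes> q \<notin> B (\<delta> / real N)"
    obtain f where f: "\<And>g. g \<in> carrier G \<Longrightarrow> f g \<in> F \<and> inv (f g) \<otimes> g \<in> B e" using F(3) by metis
    define u where "u p = \<psi> (inv (f p) \<otimes> p)" for p
    define cell where "cell p = (f p, \<lambda>b\<in>Basis. \<lfloor>(u p \<bullet> b) * (real N * L)\<rfloor>)" for p
    have NL: "real N * L > 0" using N L by simp
    have "inj_on cell E"
    proof (rule inj_onI)
      fix p q assume pq: "p \<in> E" "q \<in> E" "cell p = cell q"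
      have pqc: "p \<in> carrier G" "q \<in> carrier G" using pq E by auto
      have ff: "f p = f q" using pq(3) by (simp add: cell_def)
      have fc: "f q \<in> carrier G" using f[OF pqc(2)] F(2) by auto
      have fl: "\<lfloor>(u p \<bullet> b) * (real N * L)\<rfloor> = \<lfloor>(u q \<bullet> b) * (real N * L)\<rfloor>" if "b \<in> Basis" for b
        using pq(3) that unfolding cell_def by (metis (no_types, lifting) restrict_apply snd_conv)
      have "\<bar>(u p - u q) \<bullet> b\<bar> \<le> 1 / (real N * L)" if b: "b \<in> Basis" for b
      proof -
        have "\<bar>(u p \<bullet> b) * (real N * L) - (u q \<bullet> b) * (real N * L)\<bar> \<le> 1" using fl[OF b] by linarith
        then have "\<bar>(u p - u q) \<bullet> b\<bar> * (real N * L) \<le> 1"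
          using NL L by (simp add: inner_diff_left left_diff_distrib[symmetric] abs_mult)
        then show ?thesis using NL by (simp add: field_simps)
      qed
      then have "(\<Sum>b\<in>Basis. \<bar>(u p - u q) \<bullet> b\<bar>) \<le> (\<Sum>b\<in>(Basis::'e set). 1 / (real N * L))" by (intro sum_mono)
      then have un: "norm (u p - u q) \<le> real ?d / (real N * L)" using norm_le_l1[of "u p - u q"] by simp
      let ?x = "inv (f q) \<otimes> p" and ?y = "inv (f q) \<otimes> q"
      have xy: "?x \<in> B e" "?y \<in> B e" using f[OF pqc(1)] f[OF pqc(2)] ff by auto
      then have xyr: "?x \<in> B r1" "?y \<in> B r1" using B_mono[OF e(2)] by auto
      have eq: "inv ?x \<otimes> ?y = inv p \<otimes> q"
      proof -
        have "f q \<otimes> (inv (f q) \<otimes> q) = q" using fc pqc by (simp add: m_assoc[symmetric])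
        then show ?thesis using fc pqc by (simp add: inv_mult_group m_assoc)
      qed
      have qB: "inv p \<otimes> q \<in> B r1" using e(3)[OF xy] eq by simp
      have "norm (\<psi> (inv p \<otimes> q)) \<le> 2 * norm (u p - u q)"
        using inv_mult_est[OF xyr e(3)[OF xy]] eq ff by (simp add: u_def)
      also have "\<dots> \<le> 2 * (real ?d / (real N * L))" using un by simp
      also have "\<dots> < \<delta> / real N"
      proof -
        have "2 * real ?d < (2 * real ?d + 1)" by simp
        then have "2 * real ?d / L < \<delta>" using L \<delta> by (simp add: L_def field_simps)
        then have "(2 * real ?d / L) / real N < \<delta> / real N" using N by (intro divide_strict_right_mono) auto
        then show ?thesis by (simp add: field_simps)
      qed
      finally have "inv p \<otimes> q \<in> B (\<delta> / real N)" using qB by (simp add: B_def)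
      then show "p = q" using sep pq(1,2) by blast
    qed
    moreover have sub: "cell ` E \<subseteq> F \<times> (\<Pi>\<^sub>E b\<in>(Basis::'e set). {- int (N * M)..int (N * M)})"
    proof
      fix c assume "c \<in> cell ` E"
      then obtain p where p: "p \<in> E" "c = cell p" by auto
      have pc: "p \<in> carrier G" using p E by auto
      have "\<lfloor>(u p \<bullet> b) * (real N * L)\<rfloor> \<in> {- int (N * M)..int (N * M)}" if b: "b \<in> Basis" for b
      proof -
        have "\<bar>u p \<bullet> b\<bar> \<le> e" using Basis_le_norm[OF b, of "u p"] f[OF pc] by (auto simp: u_def B_def)
        then have "\<bar>(u p \<bullet> b) * (real N * L)\<bar> \<le> e * (real N * L)"
          using NL L by (auto simp: abs_mult intro!: mult_right_mono)
        also have "\<dots> = real N * (L * e)" by (simp add: mult_ac)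
        also have "\<dots> \<le> real N * real M" using M(1) by (intro mult_left_mono) auto
        finally have "\<bar>(u p \<bullet> b) * (real N * L)\<bar> \<le> of_int (int (N * M))" by simp
        then show ?thesis by (auto simp: le_floor_iff floor_le_iff abs_le_iff)
      qed
      then show "c \<in> F \<times> (\<Pi>\<^sub>E b\<in>(Basis::'e set). {- int (N * M)..int (N * M)})"
        using p(2) f[OF pc] by (auto simp: cell_def)
    qed
    ultimately have "card E \<le> card (F \<times> (\<Pi>\<^sub>E b\<in>(Basis::'e set). {- int (N * M)..int (N * M)}))"
      by (intro card_inj_on_le[of cell]) (auto intro!: finite_cartesian_product F(1) finite_PiE)
    also have "\<dots> = card F * (2 * (N * M) + 1) ^ ?d"
    proof -
      have "card {- int k..int k} = 2 * k + 1" for k by simp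
      from this[of "N * M"] show ?thesis by (simp only: card_cartesian_product card_PiE[OF finite_Basis] prod_constant)
    qed
    also have "\<dots> \<le> card F * (3 * M * N) ^ ?d"
    proof -
      have "1 \<le> N * M" using N M(2) by simp
      then have "2 * (N * M) + 1 \<le> 3 * M * N" by (simp add: mult.commute)
      then show ?thesis by (intro mult_left_mono power_mono) auto
    qed
    finally have "real (card E) \<le> real (card F * (3 * M * N) ^ ?d)" by (rule of_nat_mono)
    also have "\<dots> = real (card F) * (3 * real M) ^ ?d * real N ^ ?d" by (simp add: power_mult_distrib)
    also have "\<dots> \<le> K * real N ^ ?d" by (intro mult_right_mono) (auto simp: K_def)
    finally show "real (card E) \<le> K * real N ^ ?d" .
  qed
qed

text \<open>The orbit map \<open>g \<mapsto> (a g (v i))\<close> is invariant under right translation by the torus. If \<open>E\<close> has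
  \<open>1/N\<close>-separated images, then the \<open>N\<^sup>r\<close> translates of each point of \<open>E\<close> by a grid in the torus are
  \<open>\<delta>/N\<close>-separated in \<open>G\<close>, so \<open>E\<close> has at most about \<open>N\<close> to the power \<open>d - r\<close> elements.\<close>

lemma orbit_packing:
  assumes fr: "torus_frame r v \<tau> h0 c0"
  shows "\<exists>K>0. \<forall>N E. (N::nat) \<ge> 1 \<longrightarrow> finite E \<longrightarrow> E \<subseteq> carrier G \<longrightarrow>
     (\<forall>p\<in>E. \<forall>q\<in>E. p \<noteq> q \<longrightarrow> (\<exists>i<r. norm (a p (v i) - a q (v i)) > 1 / real N)) \<longrightarrow>
     real (card E) * real N ^ r \<le> K * real N ^ DIM('e)"
proof -
  let ?d = "DIM('e)"
  have h0: "h0 > 0" "c0 > 0" and car: "\<And>h. \<tau> h \<in> carrier G"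
    and add: "\<And>h h'. \<tau> (\<lambda>i. h i + h' i) = \<tau> h \<otimes> \<tau> h'"
    and fixed: "\<And>h i. i < r \<Longrightarrow> a (\<tau> h) (v i) = v i"
    and lower: "\<And>h j. (\<forall>i<r. \<bar>h i\<bar> \<le> h0) \<Longrightarrow> j < r \<Longrightarrow> c0 * \<bar>h j\<bar> \<le> norm (\<psi> (\<tau> h))"
    using fr by (auto simp: torus_frame_def)
  have zero: "\<tau> (\<lambda>i. 0) = \<one>"
    using add[of "\<lambda>i. 0" "\<lambda>i. 0"] car[of "\<lambda>i. 0"] by (metis add_0 l_cancel_one)
  have neg: "inv (\<tau> h) = \<tau> (\<lambda>i. - h i)" for h
    using add[of "\<lambda>i. - h i" h] zero car inv_equality[of "\<tau> (\<lambda>i. - h i)" "\<tau> h"] by simp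
  obtain M where M: "M > 0" "\<And>g v. g \<in> carrier G \<Longrightarrow> norm (a g v) \<le> M * norm v"
    by (rule a_bounded) (rule that)
  define V where "V = (\<Sum>i<r. norm (v i)) + 1"
  have V: "V > 0" unfolding V_def by (intro add_nonneg_pos sum_nonneg) auto
  have vV: "norm (v i) \<le> V" if "i < r" for i
    using member_le_sum[of i "{..<r}" "\<lambda>i. norm (v i)"] that by (simp add: V_def)
  \<comment> \<open>\<open>c0 * h0\<close> separates grid points of the torus, whose angles differ
    by multiples of \<open>h0 / N\<close>. With the last term, multiplication on the right by an
    element of \<open>B (\<delta> / N)\<close> moves each image of \<open>v i\<close> by at most
    1/N.\<close>
  define \<delta> where "\<delta> = Min {r1, c0 * h0, 1 / (M * (3 * C * V))}"
  have \<delta>: "\<delta> > 0" "\<delta> \<le> r1" "\<delta> \<le> c0 * h0" "\<delta> \<le> 1 / (M * (3 * C * V))"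
    using r1(1) h0 M(1) C_pos V by (auto simp: \<delta>_def)
  obtain K where K: "K > 0" "\<forall>N E. (N::nat) \<ge> 1 \<longrightarrow> finite E \<longrightarrow> E \<subseteq> carrier G \<longrightarrow>
     (\<forall>p\<in>E. \<forall>q\<in>E. p \<noteq> q \<longrightarrow> inv p \<otimes> q \<notin> B (\<delta> / real N)) \<longrightarrow>
     real (card E) \<le> K * real N ^ ?d"
    using separated_bound[OF \<delta>(1)] by blast
  show ?thesis
  proof (intro exI[of _ K] conjI K(1) allI impI)
    fix N :: nat and E assume N: "N \<ge> 1" and E: "finite E" "E \<subseteq> carrier G"
      and sep: "\<forall>p\<in>E. \<forall>q\<in>E. p \<noteq> q \<longrightarrow> (\<exists>i<r. norm (a p (v i) - a q (v i)) > 1 / real N)"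
    define I where "I = (\<Pi>\<^sub>E i\<in>{..<r}. {..<N})"
    define t where "t k = (\<lambda>i. h0 * real (k i) / real N)" for k :: "nat \<Rightarrow> nat"
    define m where "m p = fst p \<otimes> \<tau> (t (snd p))" for p
    have mc: "m p \<in> carrier G" if "p \<in> E \<times> I" for p using that E car by (auto simp: m_def)
    have key: "inv (m p) \<otimes> m q \<notin> B (\<delta> / real N)" if pq: "p \<in> E \<times> I" "q \<in> E \<times> I" "p \<noteq> q" for p q
    proof
      assume B: "inv (m p) \<otimes> m q \<in> B (\<delta> / real N)"
      obtain g k where p: "p = (g, k)" by fastforce
      obtain g' k' where q: "q = (g', k')" by fastforce
      have gc: "g \<in> carrier G" "g' \<in> carrier G" using pq p q E by auto
      let ?x = "inv (m p) \<otimes> m q"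
      have "r1 * 1 \<le> r1 * real N" using N r1(1) by (intro mult_left_mono) auto
      then have "\<delta> / real N \<le> r1" using \<delta>(2) N by (simp add: divide_le_eq)
      then have xr: "?x \<in> B r1" using B B_mono by blast
      have xn: "norm (\<psi> ?x) < \<delta> / real N" using B by (simp add: B_def)
      show False
      proof (cases "g = g'")
        case True
        then have kk: "k \<noteq> k'" using pq(3) p q by simp
        have "k \<in> I" "k' \<in> I" using pq p q by auto
        then obtain j where j: "j < r" "k j \<noteq> k' j"
          using kk unfolding I_def by (metis PiE_ext lessThan_iff)
        have kN: "k i < N" "k' i < N" if "i < r" for i
          using \<open>k \<in> I\<close> \<open>k' \<in> I\<close> that by (auto simp: I_def)
        define h where "h = (\<lambda>i. - t k i + t k' i)"
        have hk: "h i = h0 * (real (k' i) - real (k i)) / real N" for i by (simp add: h_def t_def diff_divide_distrib right_diff_distrib)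
        have "?x = inv (\<tau> (t k)) \<otimes> \<tau> (t k')"
        proof -
          have "inv g \<otimes> (g \<otimes> \<tau> (t k')) = \<tau> (t k')" using gc car by (simp add: m_assoc[symmetric])
          then show ?thesis unfolding m_def p q using True gc car by (simp add: inv_mult_group m_assoc)
        qed
        then have x: "?x = \<tau> h" unfolding neg h_def using add[of "\<lambda>i. - t k i" "t k'"] by simp
        have "\<forall>i<r. \<bar>h i\<bar> \<le> h0"
        proof (intro allI impI)
          fix i assume "i < r"
          then have "\<bar>real (k' i) - real (k i)\<bar> \<le> real N" using kN[of i] by linarith
          then have "h0 * \<bar>real (k' i) - real (k i)\<bar> \<le> h0 * real N" using h0 by (intro mult_left_mono) auto
          then show "\<bar>h i\<bar> \<le> h0" using N h0 by (simp add: hk abs_mult divide_le_eq)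
        qed
        from lower[OF this j(1)] have "c0 * \<bar>h j\<bar> \<le> norm (\<psi> ?x)" using x by simp
        moreover have "h0 / real N \<le> \<bar>h j\<bar>"
        proof -
          have "1 \<le> \<bar>real (k' j) - real (k j)\<bar>" using j(2) by linarith
          then have "h0 * 1 \<le> h0 * \<bar>real (k' j) - real (k j)\<bar>" using h0 by (intro mult_left_mono) auto
          then show ?thesis using h0 N by (simp add: hk abs_mult divide_right_mono)
        qed
        then have "c0 * (h0 / real N) \<le> c0 * \<bar>h j\<bar>" using h0 by (intro mult_left_mono) auto
        ultimately have "c0 * h0 / real N < \<delta> / real N" using xn by simp
        then show False using \<delta>(3) N by (simp add: divide_less_cancel)
      next
        case False
        then obtain i where i: "i < r" "norm (a g (v i) - a g' (v i)) > 1 / real N"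
          using sep pq p q by auto
        have "m q = m p \<otimes> ?x" using mc[OF pq(1)] mc[OF pq(2)] by (simp add: m_assoc[symmetric])
        then have "a (m q) (v i) = a (m p) (a ?x (v i))"
          using a_mult[OF mc[OF pq(1)], of ?x] B_closed[OF xr] by simp
        moreover have "a (m p) (v i) = a g (v i)" "a (m q) (v i) = a g' (v i)"
          using a_mult gc car fixed[OF i(1)] by (simp_all add: m_def p q)
        ultimately have "a g (v i) - a g' (v i) = - a (m p) (a ?x (v i) - v i)"
          using linear_diff[OF a_linear[OF mc[OF pq(1)]]] by simp
        then have "norm (a g (v i) - a g' (v i)) \<le> M * norm (a ?x (v i) - v i)"
          using M(2)[OF mc[OF pq(1)]] by simp
        also have "\<dots> \<le> M * (3 * C * norm (\<psi> ?x) * norm (v i))"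
          using a_est[OF xr] M(1) by (intro mult_left_mono) auto
        also have "\<dots> \<le> M * (3 * C * (\<delta> / real N) * V)"
          using xn vV[OF i(1)] M(1) C_pos V \<delta>(1) by (intro mult_left_mono mult_mono) auto
        also have "\<dots> = \<delta> * (M * (3 * C * V)) / real N" by (simp add: mult_ac)
        also have "\<dots> \<le> 1 / real N"
          using \<delta>(4) M(1) C_pos V by (intro divide_right_mono) (auto simp: field_simps)
        finally show False using i(2) by simp
      qed
    qed
    have inj: "inj_on m (E \<times> I)"
    proof (rule inj_onI, rule ccontr)
      fix p q assume pq: "p \<in> E \<times> I" "q \<in> E \<times> I" "m p = m q" "p \<noteq> q"
      then have "inv (m p) \<otimes> m q = \<one>" using mc[OF pq(1)] by simp
      then show False using key[OF pq(1,2,4)] one_in_B[of "\<delta> / real N"] \<delta>(1) N by simp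
    qed
    have "real (card (m ` (E \<times> I))) \<le> K * real N ^ ?d"
    proof (rule K(2)[rule_format, OF N])
      show "finite (m ` (E \<times> I))" unfolding I_def by (intro finite_imageI finite_cartesian_product E(1) finite_PiE) auto
      show "m ` (E \<times> I) \<subseteq> carrier G" using mc by blast
      show "inv p \<otimes> q \<notin> B (\<delta> / real N)" if pq: "p \<in> m ` (E \<times> I)" "q \<in> m ` (E \<times> I)" "p \<noteq> q" for p q
      proof -
        obtain p' q' where "p' \<in> E \<times> I" "p = m p'" "q' \<in> E \<times> I" "q = m q'" using pq by blast
        then show ?thesis using key[of p' q'] pq(3) by blast
      qed
    qed
    moreover have "card (m ` (E \<times> I)) = card E * N ^ r"
      unfolding card_image[OF inj] card_cartesian_product by (simp add: I_def card_PiE)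
    ultimately show "real (card E) * real N ^ r \<le> K * real N ^ ?d" by simp
  qed
qed

text \<open>Already a single point in \<open>orbit_packing\<close> yields
  \<open>N ^ r \<le> K * N ^ d\<close> for all N.\<close>

lemma torus_dim_le:
  assumes "torus_frame r v \<tau> h0 c0"
  shows "r \<le> DIM('e)"
proof (rule ccontr)
  assume r: "\<not> r \<le> DIM('e)"
  let ?d = "DIM('e)"
  obtain K where K: "K > 0" "\<forall>N E. (N::nat) \<ge> 1 \<longrightarrow> finite E \<longrightarrow> E \<subseteq> carrier G \<longrightarrow>
     (\<forall>p\<in>E. \<forall>q\<in>E. p \<noteq> q \<longrightarrow> (\<exists>i<r. norm (a p (v i) - a q (v i)) > 1 / real N)) \<longrightarrow>
     real (card E) * real N ^ r \<le> K * real N ^ ?d"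
    by (rule exE[OF orbit_packing[OF assms]], elim conjE) (rule that)
  obtain N :: nat where N0: "max 1 K < real N" using reals_Archimedean2 by blast
  then have N: "K < real N" "N \<ge> 1" by auto
  have "real (card {\<one>}) * real N ^ r \<le> K * real N ^ ?d" by (rule K(2)[rule_format, OF N(2)]) auto
  then have "real N ^ r \<le> K * real N ^ ?d" by simp
  moreover have "real N ^ Suc ?d \<le> real N ^ r" using r N(2) by (intro power_increasing) auto
  ultimately have "real N * real N ^ ?d \<le> K * real N ^ ?d" by simp
  then show False using N by simp
qed

text \<open>A separated set of maximal size is also a cover, since a point that it misses could be
  added. The bound of \<open>orbit_packing\<close> makes a set of maximal size exist.\<close>

lemma orbit_cover:
  assumes fr: "torus_frame r v \<tau> h0 c0"
  shows "\<exists>K>0. \<forall>N. (N::nat) \<ge> 1 \<longrightarrow> (\<exists>F. finite F \<and> F \<subseteq> carrier G \<and>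
     real (card F) * real N ^ r \<le> K * real N ^ DIM('e) \<and>
     (\<forall>g\<in>carrier G. \<exists>g'\<in>F. \<forall>i<r. norm (a g (v i) - a g' (v i)) \<le> 1 / real N))"
proof -
  let ?d = "DIM('e)"
  obtain K where K: "K > 0" "\<forall>N E. (N::nat) \<ge> 1 \<longrightarrow> finite E \<longrightarrow> E \<subseteq> carrier G \<longrightarrow>
     (\<forall>p\<in>E. \<forall>q\<in>E. p \<noteq> q \<longrightarrow> (\<exists>i<r. norm (a p (v i) - a q (v i)) > 1 / real N)) \<longrightarrow>
     real (card E) * real N ^ r \<le> K * real N ^ ?d"
    by (rule exE[OF orbit_packing[OF fr]], elim conjE) (rule that)
  show ?thesis
  proof (intro exI[of _ K] conjI K(1) allI impI)
    fix N :: nat assume N: "N \<ge> 1"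
    define Sep where "Sep E \<longleftrightarrow> finite E \<and> E \<subseteq> carrier G \<and>
      (\<forall>p\<in>E. \<forall>q\<in>E. p \<noteq> q \<longrightarrow> (\<exists>i<r. norm (a p (v i) - a q (v i)) > 1 / real N))" for E
    have bound: "real (card E) * real N ^ r \<le> K * real N ^ ?d" if "Sep E" for E
      using that N by (intro K(2)[rule_format]) (auto simp: Sep_def)
    have cb: "card E < Suc (nat \<lceil>K * real N ^ ?d\<rceil>)" if "Sep E" for E
    proof -
      have "real (card E) * 1 \<le> real (card E) * real N ^ r" using N by (intro mult_left_mono one_le_power) auto
      then show ?thesis using bound[OF that] by linarith
    qed
    have "Sep {}" by (simp add: Sep_def)
    from ex_has_greatest_nat[of Sep, OF this, of card "Suc (nat \<lceil>K * real N ^ ?d\<rceil>)"]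
    have "\<exists>E. Sep E \<and> (\<forall>E'. Sep E' \<longrightarrow> card E' \<le> card E)" using cb by blast
    then obtain E where E: "Sep E" "\<And>E'. Sep E' \<Longrightarrow> card E' \<le> card E" by auto
    have "\<exists>g'\<in>E. \<forall>i<r. norm (a g (v i) - a g' (v i)) \<le> 1 / real N" if g: "g \<in> carrier G" for g
    proof (rule ccontr)
      assume "\<not> ?thesis"
      then have far: "\<And>g'. g' \<in> E \<Longrightarrow> \<exists>i<r. norm (a g (v i) - a g' (v i)) > 1 / real N" by force
      have "g \<notin> E"
      proof
        assume "g \<in> E"
        then obtain i where "norm (a g (v i) - a g (v i)) > 1 / real N" using far by blast
        then show False by simp
      qed
      moreover have "Sep (insert g E)"
        unfolding Sep_def
      proof (intro conjI ballI impI)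
        fix p q assume "p \<in> insert g E" "q \<in> insert g E" "p \<noteq> q"
        then consider "p \<in> E" "q \<in> E" | "p = g" "q \<in> E" | "p \<in> E" "q = g" by auto
        then show "\<exists>i<r. norm (a p (v i) - a q (v i)) > 1 / real N"
        proof cases
          case 1
          then show ?thesis using E(1) \<open>p \<noteq> q\<close> by (auto simp: Sep_def)
        next
          case 2
          then show ?thesis using far by auto
        next
          case 3
          then show ?thesis using far[of p] by (auto simp: norm_minus_commute)
        qed
      qed (use E(1) g in \<open>auto simp: Sep_def\<close>)
      ultimately have "card (insert g E) \<le> card E" using E(2) by blast
      then show False using \<open>g \<notin> E\<close> E(1) by (simp add: Sep_def)
    qed
    then show "\<exists>F. finite F \<and> F \<subseteq> carrier G \<and> real (card F) * real N ^ r \<le> K * real N ^ ?d \<and>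
       (\<forall>g\<in>carrier G. \<exists>g'\<in>F. \<forall>i<r. norm (a g (v i) - a g' (v i)) \<le> 1 / real N)"
      using E(1) bound[OF E(1)] by (intro exI[of _ E]) (simp add: Sep_def)
  qed
qed

section \<open>Generic choice of the next vector\<close>

lemma norm_weighted_sum_le:
  fixes S :: "nat \<Rightarrow> 'b::real_normed_vector"
  assumes "\<And>j. j < k \<Longrightarrow> \<bar>x j\<bar> \<le> e"
  shows "norm (\<Sum>j<k. x j *\<^sub>R S j) \<le> e * (\<Sum>j<k. norm (S j))"
  unfolding sum_distrib_left
  by (rule order_trans[OF norm_sum]) (auto intro!: sum_mono mult_right_mono assms)

text \<open>The choices of the next vector \<open>S k\<close> that create a linear relation with coefficient \<open>1\<close> at index
  \<open>k\<close>, after division by \<open>t\<close>; here \<open>s\<close> stands for \<open>(1 - t) / t\<close>.\<close>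

definition bad_set ::
  "nat \<Rightarrow> (nat \<Rightarrow> 'e) \<Rightarrow> (nat \<Rightarrow> 'e) \<Rightarrow> nat \<Rightarrow> 'e set" where
  "bad_set k v S n = {- (\<Sum>j<k. x j *\<^sub>R S j) - s *\<^sub>R a g (v k + (\<Sum>j<k. x j *\<^sub>R v j)) | x s g.
     (\<forall>j<k. \<bar>x j\<bar> \<le> real n) \<and> 0 \<le> s \<and> s \<le> real n \<and> g \<in> carrier G}"

text \<open>Rounding at scale 1/N leaves of order \<open>N ^ k\<close> coefficient families, N
  values of \<open>s\<close> and \<open>N ^ (d - r)\<close> points of the orbit, in total at most of
  order \<open>N ^ (d - 1)\<close> because \<open>k + 2 \<le> r\<close>. On bounded parameters the
  expression is Lipschitz, so rounding moves it by order 1/N.\<close>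

lemma negligible_bad_set:
  assumes fr: "torus_frame r v \<tau> h0 c0" and k: "k + 2 \<le> r" and n: "n \<ge> 1"
  shows "negligible (bad_set k v S n)"
proof -
  let ?d = "DIM('e)"
  obtain K where K: "K > 0" "\<forall>N. (N::nat) \<ge> 1 \<longrightarrow> (\<exists>F. finite F \<and> F \<subseteq> carrier G \<and>
     real (card F) * real N ^ r \<le> K * real N ^ ?d \<and>
     (\<forall>g\<in>carrier G. \<exists>g'\<in>F. \<forall>i<r. norm (a g (v i) - a g' (v i)) \<le> 1 / real N))"
    by (rule exE[OF orbit_cover[OF fr]], elim conjE) (rule that)
  obtain M where M: "M > 0" "\<And>g v. g \<in> carrier G \<Longrightarrow> norm (a g v) \<le> M * norm v"
    by (rule a_bounded) (rule that)
  define V where "V = (\<Sum>j<k. norm (v j))"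
  \<comment> \<open>The Lipschitz constants for the rounding, in this order: \<open>x\<close> in
    front of \<open>S\<close>, \<open>x\<close> inside \<open>a g\<close>, then \<open>s\<close>,
    then the point of the orbit.\<close>
  define K1 where "K1 = (\<Sum>j<k. norm (S j)) + (real n * (M * V) + M * (norm (v k) + real n * V)
    + real n * (1 + real n * real k))"
  define K2 where "K2 = (3 * real n) ^ k * (2 * real n) * K"
  have V: "V \<ge> 0" unfolding V_def by (intro sum_nonneg) auto
  have K1: "K1 \<ge> 0" unfolding K1_def using V M(1) by (intro add_nonneg_nonneg sum_nonneg mult_nonneg_nonneg) auto
  have K2: "K2 > 0" unfolding K2_def using K(1) n by simp
  show ?thesis
  proof (rule negligible_covering)
    show "K1 + K2 > 0" using K1 K2 by simp
    fix N :: nat assume N: "N \<ge> 1"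
    obtain F where F: "finite F" "F \<subseteq> carrier G" "real (card F) * real N ^ r \<le> K * real N ^ ?d"
      and app: "\<forall>g\<in>carrier G. \<exists>g'\<in>F. \<forall>i<r. norm (a g (v i) - a g' (v i)) \<le> 1 / real N"
      by (rule exE[OF K(2)[rule_format, OF N]], elim conjE) (rule that; simp)
    define ctr :: "(nat \<Rightarrow> int) \<times> int \<times> 'g \<Rightarrow> 'e" where
      "ctr = (\<lambda>(y, \<sigma>, g). - (\<Sum>j<k. (real_of_int (y j) / real N) *\<^sub>R S j) -
         (real_of_int \<sigma> / real N) *\<^sub>R a g (v k + (\<Sum>j<k. (real_of_int (y j) / real N) *\<^sub>R v j)))"
    define I where "I = (\<Pi>\<^sub>E j\<in>{..<k}. {- int (n * N)..int (n * N)}) \<times> {0..int (n * N)} \<times> F"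
    have finI: "finite I" unfolding I_def by (intro finite_cartesian_product finite_PiE F(1)) auto
    have cardI: "card I = (2 * (n * N) + 1) ^ k * ((n * N + 1) * card F)"
    proof -
      have "card {- int p..int p} = 2 * p + 1" "card {0..int p} = p + 1" for p by simp_all
      from this[of "n * N"] show ?thesis unfolding I_def
        by (simp only: card_cartesian_product card_PiE[OF finite_lessThan] prod_constant card_lessThan)
    qed
    have nN: "1 \<le> n * N" using n N by simp
    have "card (ctr ` I) \<le> card I" by (rule card_image_le[OF finI])
    also have "card I \<le> (3 * (n * N)) ^ k * ((2 * (n * N)) * card F)"
      unfolding cardI using nN by (intro mult_le_mono power_mono) auto
    finally have "real (card (ctr ` I)) \<le> real ((3 * (n * N)) ^ k * ((2 * (n * N)) * card F))"
      by (rule of_nat_mono)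
    then have "real (card (ctr ` I)) * real N \<le> real ((3 * (n * N)) ^ k * ((2 * (n * N)) * card F)) * real N"
      by (rule mult_right_mono) simp
    also have "\<dots> = (3 * real n) ^ k * (2 * real n) * (real (card F) * real N ^ (k + 2))"
      by (simp add: power_mult_distrib power_add power2_eq_square mult_ac)
    also have "\<dots> \<le> (3 * real n) ^ k * (2 * real n) * (real (card F) * real N ^ r)"
      using k N by (intro mult_left_mono power_increasing) auto
    also have "\<dots> \<le> (3 * real n) ^ k * (2 * real n) * (K * real N ^ ?d)"
      using F(3) by (intro mult_left_mono) auto
    also have "\<dots> = K2 * real N ^ ?d" by (simp add: K2_def mult_ac)
    also have "\<dots> \<le> (K1 + K2) * real N ^ ?d" using K1 by (intro mult_right_mono) auto
    finally have count: "real (card (ctr ` I)) * real N \<le> (K1 + K2) * real N ^ ?d" .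
    have "bad_set k v S n \<subseteq> (\<Union>c\<in>ctr ` I. cball c ((K1 + K2) / real N))"
    proof
      fix w assume "w \<in> bad_set k v S n"
      then obtain x s g where w: "w = - (\<Sum>j<k. x j *\<^sub>R S j) - s *\<^sub>R a g (v k + (\<Sum>j<k. x j *\<^sub>R v j))"
        and x: "\<forall>j<k. \<bar>x j\<bar> \<le> real n" and s: "0 \<le> s" "s \<le> real n" and g: "g \<in> carrier G"
        unfolding bad_set_def by blast
      obtain g' where g': "g' \<in> F" "\<forall>i<r. norm (a g (v i) - a g' (v i)) \<le> 1 / real N" using app g by blast
      have g'c: "g' \<in> carrier G" using g' F by blast
      define y where "y = (\<lambda>j\<in>{..<k}. \<lfloor>x j * real N\<rfloor>)"
      define \<sigma> where "\<sigma> = \<lfloor>s * real N\<rfloor>"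
      define x' where "x' j = real_of_int (y j) / real N" for j
      define s' where "s' = real_of_int \<sigma> / real N"
      have Np: "0 < real N" using N by simp
      have fl: "\<bar>u - real_of_int \<lfloor>u * real N\<rfloor> / real N\<bar> \<le> 1 / real N" for u
      proof -
        have "\<bar>u * real N - real_of_int \<lfloor>u * real N\<rfloor>\<bar> \<le> 1" by linarith
        then have "\<bar>u * real N - real_of_int \<lfloor>u * real N\<rfloor>\<bar> / real N \<le> 1 / real N"
          by (rule divide_right_mono) simp
        moreover have "\<bar>u - real_of_int \<lfloor>u * real N\<rfloor> / real N\<bar> = \<bar>u * real N - real_of_int \<lfloor>u * real N\<rfloor>\<bar> / real N"
        proof -
          have "u - real_of_int \<lfloor>u * real N\<rfloor> / real N = (u * real N - real_of_int \<lfloor>u * real N\<rfloor>) / real N"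
            using Np by (simp add: diff_divide_distrib)
          then show ?thesis using Np by simp
        qed
        ultimately show ?thesis by simp
      qed
      have xx: "\<bar>x j - x' j\<bar> \<le> 1 / real N" if "j < k" for j
        using fl[of "x j"] that by (simp add: x'_def y_def)
      have ss: "\<bar>s - s'\<bar> \<le> 1 / real N" using fl[of s] by (simp add: s'_def \<sigma>_def)
      have yr: "- int (n * N) \<le> y j \<and> y j \<le> int (n * N)" if j: "j < k" for j
      proof -
        have "\<bar>x j\<bar> * real N \<le> real n * real N" using x j Np by (intro mult_right_mono) auto
        then have "\<bar>x j * real N\<bar> \<le> real (n * N)" by (simp add: abs_mult)
        then have b: "- real (n * N) \<le> x j * real N" "x j * real N \<le> real (n * N)" by linarith+
        have "- int (n * N) \<le> \<lfloor>x j * real N\<rfloor>" using b(1) by (simp only: le_floor_iff of_int_minus of_int_of_nat_eq)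
        moreover have "\<lfloor>x j * real N\<rfloor> \<le> int (n * N)" using b(2) by linarith
        ultimately show ?thesis using j by (simp add: y_def)
      qed
      have x'n: "\<bar>x' j\<bar> \<le> real n" if j: "j < k" for j
      proof -
        have "\<bar>real_of_int (y j)\<bar> \<le> real n * real N"
          using yr[OF j] by (metis abs_le_iff minus_le_iff of_int_abs of_int_le_iff of_int_of_nat_eq of_nat_mult)
        then show ?thesis using Np by (simp add: x'_def divide_le_eq)
      qed
      have \<sigma>r: "0 \<le> \<sigma>" "\<sigma> \<le> int (n * N)"
      proof -
        have "s * real N \<le> real n * real N" using s Np by (intro mult_right_mono) auto
        then have b: "s * real N \<le> real (n * N)" by simp
        show "0 \<le> \<sigma>" using s Np by (simp add: \<sigma>_def)
        show "\<sigma> \<le> int (n * N)" unfolding \<sigma>_def using b by linarith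
      qed
      have s'r: "0 \<le> s'" "s' \<le> real n"
      proof -
        show "0 \<le> s'" using \<sigma>r(1) Np by (simp add: s'_def)
        have "real_of_int \<sigma> \<le> real n * real N" using \<sigma>r(2) by (metis of_int_le_iff of_int_of_nat_eq of_nat_mult)
        then show "s' \<le> real n" using Np by (simp add: s'_def divide_le_eq)
      qed
      have "(y, \<sigma>, g') \<in> I" unfolding I_def using yr \<sigma>r g'(1) by (auto simp: y_def)
      then have cI: "ctr (y, \<sigma>, g') \<in> ctr ` I" by (rule imageI)
      define p where "p = v k + (\<Sum>j<k. x j *\<^sub>R v j)"
      define p' where "p' = v k + (\<Sum>j<k. x' j *\<^sub>R v j)"
      note lin = a_linear[OF g] and lin' = a_linear[OF g'c]
      have e1: "norm (\<Sum>j<k. (x j - x' j) *\<^sub>R S j) \<le> 1 / real N * (\<Sum>j<k. norm (S j))"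
        by (rule norm_weighted_sum_le) (rule xx)
      have e2: "norm (p - p') \<le> 1 / real N * V"
      proof -
        have "p - p' = (\<Sum>j<k. (x j - x' j) *\<^sub>R v j)"
          by (simp add: p_def p'_def sum_subtractf scaleR_diff_left)
        then show ?thesis unfolding V_def using norm_weighted_sum_le[of k "\<lambda>j. x j - x' j" "1 / real N" v] xx by simp
      qed
      have e3: "norm p' \<le> norm (v k) + real n * V"
      proof -
        have "norm p' \<le> norm (v k) + norm (\<Sum>j<k. x' j *\<^sub>R v j)" unfolding p'_def by (rule norm_triangle_ineq)
        also have "norm (\<Sum>j<k. x' j *\<^sub>R v j) \<le> real n * V"
          unfolding V_def by (rule norm_weighted_sum_le) (rule x'n)
        finally show ?thesis by simp
      qed
      have e4: "norm (a g p' - a g' p') \<le> 1 / real N * (1 + real n * real k)"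
      proof -
        have "a g p' - a g' p' = (a g (v k) - a g' (v k)) + (\<Sum>j<k. x' j *\<^sub>R (a g (v j) - a g' (v j)))"
          unfolding p'_def linear_add[OF lin] linear_add[OF lin'] linear_sum[OF lin] linear_sum[OF lin']
            linear_scale[OF lin] linear_scale[OF lin'] by (simp add: scaleR_diff_right sum_subtractf)
        then have "norm (a g p' - a g' p') \<le> norm (a g (v k) - a g' (v k)) + norm (\<Sum>j<k. x' j *\<^sub>R (a g (v j) - a g' (v j)))"
          using norm_triangle_ineq by simp
        also have "norm (a g (v k) - a g' (v k)) \<le> 1 / real N" using g'(2) k by simp
        also have "norm (\<Sum>j<k. x' j *\<^sub>R (a g (v j) - a g' (v j))) \<le> real n * (\<Sum>j<k. norm (a g (v j) - a g' (v j)))"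
          by (rule norm_weighted_sum_le) (rule x'n)
        also have "(\<Sum>j<k. norm (a g (v j) - a g' (v j))) \<le> (\<Sum>j<k. 1 / real N)"
          using g'(2) k by (intro sum_mono) auto
        finally have "norm (a g p' - a g' p') \<le> 1 / real N + real n * (\<Sum>j<k. 1 / real N)"
          by (simp add: mult_left_mono)
        also have "\<dots> = 1 / real N * (1 + real n * real k)" by (simp add: algebra_simps)
        finally show ?thesis .
      qed
      have "w - ctr (y, \<sigma>, g') = - (\<Sum>j<k. (x j - x' j) *\<^sub>R S j) -
          (s *\<^sub>R a g (p - p') + ((s - s') *\<^sub>R a g p' + s' *\<^sub>R (a g p' - a g' p')))"
        unfolding w ctr_def linear_diff[OF lin] p_def[symmetric]
        by (simp add: x'_def[symmetric] s'_def[symmetric] p'_def[symmetric] algebra_simps sum_subtractf)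
      then have "norm (w - ctr (y, \<sigma>, g')) \<le> norm (\<Sum>j<k. (x j - x' j) *\<^sub>R S j) +
          (norm (s *\<^sub>R a g (p - p')) + (norm ((s - s') *\<^sub>R a g p') + norm (s' *\<^sub>R (a g p' - a g' p'))))"
        using norm_triangle_ineq4[of "- (\<Sum>j<k. (x j - x' j) *\<^sub>R S j)"
            "s *\<^sub>R a g (p - p') + ((s - s') *\<^sub>R a g p' + s' *\<^sub>R (a g p' - a g' p'))"]
          norm_triangle_ineq[of "s *\<^sub>R a g (p - p')" "(s - s') *\<^sub>R a g p' + s' *\<^sub>R (a g p' - a g' p')"]
          norm_triangle_ineq[of "(s - s') *\<^sub>R a g p'" "s' *\<^sub>R (a g p' - a g' p')"]
        by (simp only: norm_minus_cancel)
      also have "norm (s *\<^sub>R a g (p - p')) \<le> real n * (M * (1 / real N * V))"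
      proof -
        have "norm (a g (p - p')) \<le> M * (1 / real N * V)"
          using M(2)[OF g, of "p - p'"] mult_left_mono[OF e2, of M] M(1) by linarith
        then show ?thesis using s by (simp only: norm_scaleR) (intro mult_mono; simp)
      qed
      also have "norm ((s - s') *\<^sub>R a g p') \<le> 1 / real N * (M * (norm (v k) + real n * V))"
      proof -
        have "norm (a g p') \<le> M * (norm (v k) + real n * V)"
          using M(2)[OF g, of p'] mult_left_mono[OF e3, of M] M(1) by linarith
        then show ?thesis using ss by (simp only: norm_scaleR) (intro mult_mono; simp)
      qed
      also have "norm (s' *\<^sub>R (a g p' - a g' p')) \<le> real n * (1 / real N * (1 + real n * real k))"
        using e4 s'r by (simp only: norm_scaleR) (intro mult_mono; simp)
      also note e1
      finally have "norm (w - ctr (y, \<sigma>, g')) \<le> 1 / real N * (\<Sum>j<k. norm (S j)) +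
          (real n * (M * (1 / real N * V)) + (1 / real N * (M * (norm (v k) + real n * V)) +
          real n * (1 / real N * (1 + real n * real k))))" by simp
      also have "\<dots> = K1 / real N" by (simp add: K1_def algebra_simps add_divide_distrib)
      also have "\<dots> \<le> (K1 + K2) / real N" using K2 by (intro divide_right_mono) auto
      finally have "w \<in> cball (ctr (y, \<sigma>, g')) ((K1 + K2) / real N)"
        by (simp add: dist_norm norm_minus_commute)
      then show "w \<in> (\<Union>c\<in>ctr ` I. cball c ((K1 + K2) / real N))" using cI by blast
    qed
    then show "\<exists>Cs. finite Cs \<and> real (card Cs) * real N \<le> (K1 + K2) * real N ^ ?d \<and>
        bad_set k v S n \<subseteq> (\<Union>c\<in>Cs. cball c ((K1 + K2) / real N))"
      using finI count by (intro exI[of _ "ctr ` I"]) simp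
  qed
qed

definition line_frame :: "nat \<Rightarrow> (nat \<Rightarrow> 'e) \<Rightarrow> (nat \<Rightarrow> 'e) \<Rightarrow> bool" where
  "line_frame k v S \<longleftrightarrow> (\<forall>g\<in>carrier G. \<forall>t\<in>{0..1}. \<forall>x.
     (\<Sum>i<k. x i *\<^sub>R ((1 - t) *\<^sub>R a g (v i) + t *\<^sub>R S i)) = 0 \<longrightarrow> (\<forall>i<k. x i = 0))"

text \<open>A relation whose last coefficient is 0 concerns the first \<open>k\<close> vectors only.
  Otherwise this coefficient is scaled to 1. At t = 0 the relation contradicts the independence of
  the \<open>v i\<close>, since \<open>a g\<close> is injective; for t > 0 it puts \<open>w\<close>
  into some \<open>bad_set\<close>, and countably many negligible sets do not fill the
  space.\<close>

lemma line_frame_step: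
  assumes fr: "torus_frame r v \<tau> h0 c0" and k: "k + 2 \<le> r" and S: "line_frame k v S"
  shows "\<exists>w. line_frame (Suc k) v (S(k := w))"
proof -
  have "negligible (\<Union>n. bad_set k v S (Suc n))"
    by (intro negligible_countable_Union) (auto intro!: negligible_bad_set[OF fr k])
  then have "(\<Union>n. bad_set k v S (Suc n)) \<noteq> UNIV" using non_negligible_UNIV by metis
  then obtain w where w: "\<And>n. w \<notin> bad_set k v S (Suc n)" by blast
  have ind: "\<forall>c. (\<Sum>i<r. c i *\<^sub>R v i) = 0 \<longrightarrow> (\<forall>i<r. c i = 0)" using fr by (simp add: torus_frame_def)
  have "line_frame (Suc k) v (S(k := w))"
    unfolding line_frame_def
  proof (intro ballI allI impI)
    fix g t x i assume g: "g \<in> carrier G" and t: "t \<in> {0..1::real}" and i: "i < Suc k"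
      and z: "(\<Sum>i<Suc k. x i *\<^sub>R ((1 - t) *\<^sub>R a g (v i) + t *\<^sub>R (S(k := w)) i)) = 0"
    note lin = a_linear[OF g]
    have z': "(\<Sum>i<k. x i *\<^sub>R ((1 - t) *\<^sub>R a g (v i) + t *\<^sub>R S i)) + x k *\<^sub>R ((1 - t) *\<^sub>R a g (v k) + t *\<^sub>R w) = 0"
      using z by simp
    have xk: "x k = 0"
    proof (rule ccontr)
      assume nz: "x k \<noteq> 0"
      define y where "y j = x j / x k" for j
      have "(\<Sum>i<k. y i *\<^sub>R ((1 - t) *\<^sub>R a g (v i) + t *\<^sub>R S i)) + ((1 - t) *\<^sub>R a g (v k) + t *\<^sub>R w)
          = (1 / x k) *\<^sub>R ((\<Sum>i<k. x i *\<^sub>R ((1 - t) *\<^sub>R a g (v i) + t *\<^sub>R S i)) + x k *\<^sub>R ((1 - t) *\<^sub>R a g (v k) + t *\<^sub>R w))"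
        using nz by (simp add: y_def scaleR_right_distrib scaleR_sum_right sum.distrib)
      also have "\<dots> = 0" unfolding z' by simp
      finally have y0: "(\<Sum>i<k. y i *\<^sub>R ((1 - t) *\<^sub>R a g (v i) + t *\<^sub>R S i)) + ((1 - t) *\<^sub>R a g (v k) + t *\<^sub>R w) = 0" .
      define p where "p = v k + (\<Sum>j<k. y j *\<^sub>R v j)"
      have "a g p = a g (v k) + (\<Sum>j<k. y j *\<^sub>R a g (v j))"
        unfolding p_def linear_add[OF lin] linear_sum[OF lin] linear_scale[OF lin] ..
      then have yp: "(1 - t) *\<^sub>R a g p + t *\<^sub>R ((\<Sum>j<k. y j *\<^sub>R S j) + w) = 0"
        using y0 by (simp add: scaleR_right_distrib scaleR_sum_right sum.distrib mult.commute add_ac)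
      show False
      proof (cases "t = 0")
        case True
        then have "a g p = 0" using yp by simp
        then have "a (inv g) (a g p) = 0" using linear_0[OF a_linear, of "inv g"] g by simp
        then have p0: "p = 0" using a_inv[OF g, of p] by simp
        define c where "c j = (if j = k then 1 else if j < k then y j else 0)" for j
        have "(\<Sum>j<r. c j *\<^sub>R v j) = (\<Sum>j<Suc k. c j *\<^sub>R v j)"
          using k by (intro sum.mono_neutral_right) (auto simp: c_def)
        also have "\<dots> = p" by (simp add: p_def c_def)
        finally have "c k = 0" using ind p0 k by simp
        then show False by (simp add: c_def)
      next
        case False
        then have tp: "t > 0" "t \<le> 1" using t by auto
        define s where "s = (1 - t) / t"
        have s: "s \<ge> 0" using tp by (simp add: s_def)
        have "(1 / t) *\<^sub>R ((1 - t) *\<^sub>R a g p + t *\<^sub>R ((\<Sum>j<k. y j *\<^sub>R S j) + w)) = s *\<^sub>R a g p + ((\<Sum>j<k. y j *\<^sub>R S j) + w)"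
          using tp by (simp add: s_def scaleR_right_distrib)
        then have e: "s *\<^sub>R a g p + ((\<Sum>j<k. y j *\<^sub>R S j) + w) = 0" unfolding yp by simp
        have "w = (s *\<^sub>R a g p + ((\<Sum>j<k. y j *\<^sub>R S j) + w)) - (\<Sum>j<k. y j *\<^sub>R S j) - s *\<^sub>R a g p" by simp
        also have "\<dots> = - (\<Sum>j<k. y j *\<^sub>R S j) - s *\<^sub>R a g (v k + (\<Sum>j<k. y j *\<^sub>R v j))"
          unfolding e p_def[symmetric] by simp
        finally have we: "w = - (\<Sum>j<k. y j *\<^sub>R S j) - s *\<^sub>R a g (v k + (\<Sum>j<k. y j *\<^sub>R v j))" .
        obtain n :: nat where n: "s + (\<Sum>j<k. \<bar>y j\<bar>) < real n" using reals_Archimedean2 by blast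
        have nn: "0 \<le> (\<Sum>j<k. \<bar>y j\<bar>)" by (rule sum_nonneg) simp
        have "\<bar>y j\<bar> \<le> real (Suc n)" if "j < k" for j
          using member_le_sum[of j "{..<k}" "\<lambda>j. \<bar>y j\<bar>"] that n s by simp
        moreover have "s \<le> real (Suc n)" using n nn by linarith
        ultimately have "w \<in> bad_set k v S (Suc n)"
          unfolding bad_set_def using we s g by blast
        then show False using w by blast
      qed
    qed
    then have "(\<Sum>i<k. x i *\<^sub>R ((1 - t) *\<^sub>R a g (v i) + t *\<^sub>R S i)) = 0" using z' by simp
    then have "\<forall>i<k. x i = 0" using S g t unfolding line_frame_def by blast
    then show "x i = 0" using xk i by (auto simp: less_Suc_eq)
  qed
  then show ?thesis by blast
qed

text \<open>The recursion ends with r - 1 vectors: for one more, the number of parameters of the bad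
  choices would reach the dimension.\<close>

lemma ex_line_frame:
  assumes fr: "torus_frame r v \<tau> h0 c0" and k: "k + 1 \<le> r"
  shows "\<exists>S. line_frame k v S"
  using k
proof (induction k)
  case 0
  show ?case by (rule exI[of _ v]) (simp add: line_frame_def)
next
  case (Suc k)
  then obtain S where "line_frame k v S" by auto
  then show ?case using line_frame_step[OF fr, of k S] Suc.prems by auto
qed

end

section \<open>Principal bundles over a sphere\<close>

lemma continuous_map_locally:
  assumes "\<And>x. x \<in> topspace X \<Longrightarrow> \<exists>U. openin X U \<and> x \<in> U \<and> continuous_map (subtopology X U) Y f"
  shows "continuous_map X Y f"
proof (rule pasting_lemma[where I = "{U. openin X U \<and> continuous_map (subtopology X U) Y f}"
      and T = "\<lambda>U. U" and f = "\<lambda>_. f"])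
  fix x assume "x \<in> topspace X"
  from assms[OF this] show "\<exists>j. j \<in> {U. openin X U \<and> continuous_map (subtopology X U) Y f} \<and> x \<in> j \<and> f x = f x"
    by auto
qed auto

locale principal_G_bundle = lie_chart G T \<psi> \<theta> U \<rho> C a
  for G :: "('g, 'u) monoid_scheme" (structure) and T :: "'g topology"
    and \<psi> :: "'g \<Rightarrow> 'e::euclidean_space" and \<theta> U \<rho> C a +
  fixes X :: "'b topology" and P :: "'p topology" and \<pi> :: "'p \<Rightarrow> 'b" and act :: "'p \<Rightarrow> 'g \<Rightarrow> 'p"
  assumes pb: "principal_bundle G T X P \<pi> act"
begin

lemma cont_proj: "continuous_map P X \<pi>"
  and cont_act: "continuous_map (prod_topology P T) P (\<lambda>(p, g). act p g)"
  and act_one [simp]: "p \<in> topspace P \<Longrightarrow> act p \<one> = p"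
  and proj_act [simp]: "p \<in> topspace P \<Longrightarrow> g \<in> carrier G \<Longrightarrow> \<pi> (act p g) = \<pi> p"
  and act_act: "p \<in> topspace P \<Longrightarrow> g \<in> carrier G \<Longrightarrow> h \<in> carrier G \<Longrightarrow> act (act p g) h = act p (g \<otimes> h)"
  using pb by (auto simp: principal_bundle_def)

lemma proj_closed: "p \<in> topspace P \<Longrightarrow> \<pi> p \<in> topspace X"
  using continuous_map_image_subset_topspace[OF cont_proj] by auto

lemma act_closed [simp]: "p \<in> topspace P \<Longrightarrow> g \<in> carrier G \<Longrightarrow> act p g \<in> topspace P"
  using continuous_map_image_subset_topspace[OF cont_act] topspace_T by auto

lemma cont_act_comp:
  assumes "continuous_map Z P f" "continuous_map Z T g"
  shows "continuous_map Z P (\<lambda>x. act (f x) (g x))"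
proof -
  have "continuous_map Z (prod_topology P T) (\<lambda>x. (f x, g x))" using assms by (simp add: continuous_map_pairwise o_def)
  from continuous_map_compose[OF this cont_act] show ?thesis by (simp add: o_def)
qed

text \<open>The working form of a trivialization: \<open>s\<close> is the section with group
  coordinate \<open>\<one>\<close>, and \<open>k\<close> is the group coordinate relative to
  \<open>s\<close>. Its continuity is the source of all continuity statements about comparing points
  of a fibre.\<close>

lemma local_section:
  assumes "x \<in> topspace X"
  shows "\<exists>V s k. x \<in> V \<and> openin X V \<and> continuous_map (subtopology X V) P s \<and>
    continuous_map (subtopology P {p \<in> topspace P. \<pi> p \<in> V}) T k \<and>
    (\<forall>y\<in>V. \<pi> (s y) = y) \<and>
    (\<forall>p\<in>topspace P. \<pi> p \<in> V \<longrightarrow> k p \<in> carrier G \<and> act (s (\<pi> p)) (k p) = p \<and>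
      (\<forall>g\<in>carrier G. k (act p g) = k p \<otimes> g))"
proof -
  obtain V \<phi> where V: "x \<in> V" "openin X V"
    and h: "homeomorphic_map (prod_topology (subtopology X V) T) (subtopology P {p \<in> topspace P. \<pi> p \<in> V}) \<phi>"
    and \<phi>': "\<forall>y\<in>V. \<forall>g\<in>carrier G. \<pi> (\<phi> (y, g)) = y \<and>
           (\<forall>h\<in>carrier G. \<phi> (y, g \<otimes> h) = act (\<phi> (y, g)) h)"
  proof -
    from pb assms have "\<exists>U \<phi>. x \<in> U \<and> openin X U \<and>
        homeomorphic_map (prod_topology (subtopology X U) T)
          (subtopology P {p \<in> topspace P. \<pi> p \<in> U}) \<phi> \<and>
        (\<forall>y\<in>U. \<forall>g\<in>carrier G. \<pi> (\<phi> (y, g)) = y \<and>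
           (\<forall>h\<in>carrier G. \<phi> (y, g \<otimes> h) = act (\<phi> (y, g)) h))"
      by (simp add: principal_bundle_def)
    then show ?thesis by (elim exE conjE) (rule that)
  qed
  have \<phi>: "\<And>y g. y \<in> V \<Longrightarrow> g \<in> carrier G \<Longrightarrow> \<pi> (\<phi> (y, g)) = y"
      "\<And>y g h. y \<in> V \<Longrightarrow> g \<in> carrier G \<Longrightarrow> h \<in> carrier G \<Longrightarrow> \<phi> (y, g \<otimes> h) = act (\<phi> (y, g)) h"
    using \<phi>' by blast+
  have VX: "V \<subseteq> topspace X" using V(2) by (rule openin_subset)
  obtain \<kappa> where k: "homeomorphic_maps (prod_topology (subtopology X V) T) (subtopology P {p \<in> topspace P. \<pi> p \<in> V}) \<phi> \<kappa>"
    using h by (auto simp: homeomorphic_map_maps)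
  have c\<phi>: "continuous_map (prod_topology (subtopology X V) T) P \<phi>"
    and ck: "continuous_map (subtopology P {p \<in> topspace P. \<pi> p \<in> V}) (prod_topology (subtopology X V) T) \<kappa>"
    and k\<phi>: "\<And>q. q \<in> V \<times> carrier G \<Longrightarrow> \<kappa> (\<phi> q) = q"
    and \<phi>k: "\<And>p. p \<in> topspace P \<Longrightarrow> \<pi> p \<in> V \<Longrightarrow> \<phi> (\<kappa> p) = p"
    using k VX by (auto simp: homeomorphic_maps_def continuous_map_in_subtopology topspace_T)
  have \<phi>P: "\<phi> (y, g) \<in> topspace P" if "y \<in> V" "g \<in> carrier G" for y g
    using continuous_map_image_subset_topspace[OF c\<phi>] that VX topspace_T by auto
  have kV: "\<kappa> p \<in> V \<times> carrier G" if "p \<in> topspace P" "\<pi> p \<in> V" for p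
    using continuous_map_image_subset_topspace[OF ck] that topspace_T by auto
  show ?thesis
  proof (intro exI[of _ V] exI[of _ "\<lambda>y. \<phi> (y, \<one>)"] exI[of _ "\<lambda>p. snd (\<kappa> p)"] conjI ballI impI V)
    have "continuous_map (subtopology X V) (prod_topology (subtopology X V) T) (\<lambda>y. (y, \<one>))"
      by (simp add: continuous_map_pairwise o_def cont_const topspace_T)
    from continuous_map_compose[OF this c\<phi>] show "continuous_map (subtopology X V) P (\<lambda>y. \<phi> (y, \<one>))"
      by (simp add: o_def)
    show "continuous_map (subtopology P {p \<in> topspace P. \<pi> p \<in> V}) T (\<lambda>p. snd (\<kappa> p))"
      using continuous_map_compose[OF ck continuous_map_snd] by (simp add: o_def)
    show "\<pi> (\<phi> (y, \<one>)) = y" if "y \<in> V" for y using \<phi>(1) that by simp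
    fix p assume p: "p \<in> topspace P" "\<pi> p \<in> V"
    obtain y g where yg: "\<kappa> p = (y, g)" "y \<in> V" "g \<in> carrier G" using kV[OF p] by auto
    have pe: "p = \<phi> (y, g)" using \<phi>k[OF p] yg by simp
    show "snd (\<kappa> p) \<in> carrier G" using yg by simp
    show "act (\<phi> (\<pi> p, \<one>)) (snd (\<kappa> p)) = p"
      using \<phi>(2)[of y \<one> g] \<phi>(1)[of y g] yg pe by simp
    fix h assume h: "h \<in> carrier G"
    have "act p h = \<phi> (y, g \<otimes> h)" using \<phi>(2) yg pe h by simp
    then show "snd (\<kappa> (act p h)) = snd (\<kappa> p) \<otimes> h" using k\<phi>[of "(y, g \<otimes> h)"] yg h by simp
  qed
qed

text \<open>The translation function of the principal bundle. The choice is unique because the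
  action is free.\<close>

definition tr :: "'p \<Rightarrow> 'p \<Rightarrow> 'g" where
  "tr p q = (SOME g. g \<in> carrier G \<and> act p g = q)"

lemma act_inject:
  assumes p: "p \<in> topspace P" and g: "g \<in> carrier G" "h \<in> carrier G" and eq: "act p g = act p h"
  shows "g = h"
proof -
  obtain V s k where V: "\<pi> p \<in> V"
    and k: "\<forall>p\<in>topspace P. \<pi> p \<in> V \<longrightarrow> k p \<in> carrier G \<and> act (s (\<pi> p)) (k p) = p \<and>
      (\<forall>g\<in>carrier G. k (act p g) = k p \<otimes> g)"
    using local_section[OF proj_closed[OF p]] by (elim exE conjE) (rule that)
  have "k p \<in> carrier G" "k p \<otimes> g = k p \<otimes> h" using k p g V eq by metis+
  then show ?thesis using g by simp
qed

lemma tr: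
  assumes p: "p \<in> topspace P" and q: "q \<in> topspace P" and pq: "\<pi> p = \<pi> q"
  shows "tr p q \<in> carrier G" "act p (tr p q) = q"
proof -
  obtain V s k where V: "\<pi> p \<in> V"
    and k: "\<forall>p\<in>topspace P. \<pi> p \<in> V \<longrightarrow> k p \<in> carrier G \<and> act (s (\<pi> p)) (k p) = p \<and>
      (\<forall>g\<in>carrier G. k (act p g) = k p \<otimes> g)"
    and s: "continuous_map (subtopology X V) P s"
    using local_section[OF proj_closed[OF p]] by (elim exE conjE) (rule that)
  have kp: "k p \<in> carrier G" "act (s (\<pi> p)) (k p) = p" and kq: "k q \<in> carrier G" "act (s (\<pi> p)) (k q) = q"
    using k p q pq V by auto
  have sP: "s (\<pi> p) \<in> topspace P"
    using continuous_map_image_subset_topspace[OF s] V proj_closed[OF p] by auto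
  have "act p (inv (k p) \<otimes> k q) = act (act (s (\<pi> p)) (k p)) (inv (k p) \<otimes> k q)" using kp by simp
  also have "\<dots> = act (s (\<pi> p)) (k p \<otimes> (inv (k p) \<otimes> k q))" by (rule act_act[OF sP kp(1)]) (use kp kq in simp)
  also have "\<dots> = q" using kp kq by (simp add: m_assoc[symmetric])
  finally have "inv (k p) \<otimes> k q \<in> carrier G \<and> act p (inv (k p) \<otimes> k q) = q" using kp kq by simp
  then have "tr p q \<in> carrier G \<and> act p (tr p q) = q" unfolding tr_def by (rule someI)
  then show "tr p q \<in> carrier G" "act p (tr p q) = q" by auto
qed

lemma tr_eqI: "p \<in> topspace P \<Longrightarrow> g \<in> carrier G \<Longrightarrow> act p g = q \<Longrightarrow> tr p q = g"
  using tr[of p q] act_inject[of p "tr p q" g] by (metis act_closed proj_act)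

text \<open>In a local trivialization the translation function is a quotient of group
  coordinates.\<close>

lemma cont_tr:
  assumes f: "continuous_map Z P f" and g: "continuous_map Z P g"
    and fg: "\<And>x. x \<in> topspace Z \<Longrightarrow> \<pi> (f x) = \<pi> (g x)"
  shows "continuous_map Z T (\<lambda>x. tr (f x) (g x))"
proof (rule continuous_map_locally)
  fix x assume x: "x \<in> topspace Z"
  have fP: "f y \<in> topspace P" and gP: "g y \<in> topspace P" if "y \<in> topspace Z" for y
    using continuous_map_image_subset_topspace[OF f] continuous_map_image_subset_topspace[OF g] that by auto
  obtain V s k where V: "\<pi> (f x) \<in> V" "openin X V"
    and kc: "continuous_map (subtopology P {p \<in> topspace P. \<pi> p \<in> V}) T k"
    and k: "\<forall>p\<in>topspace P. \<pi> p \<in> V \<longrightarrow> k p \<in> carrier G \<and> act (s (\<pi> p)) (k p) = p \<and>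
      (\<forall>g\<in>carrier G. k (act p g) = k p \<otimes> g)"
    using local_section[OF proj_closed[OF fP[OF x]]] by (elim exE conjE) (rule that)
  define W where "W = {y \<in> topspace Z. \<pi> (f y) \<in> V}"
  have W: "openin Z W"
    using openin_continuous_map_preimage[OF continuous_map_compose[OF f cont_proj] V(2)] by (simp add: W_def o_def)
  have "continuous_map (subtopology Z W) (subtopology P {p \<in> topspace P. \<pi> p \<in> V}) f"
    using f fP by (auto simp: continuous_map_in_subtopology continuous_map_from_subtopology W_def)
  from continuous_map_compose[OF this kc] have kf: "continuous_map (subtopology Z W) T (\<lambda>y. k (f y))" by (simp add: o_def)
  have "continuous_map (subtopology Z W) (subtopology P {p \<in> topspace P. \<pi> p \<in> V}) g"
    using g gP fg by (auto simp: continuous_map_in_subtopology continuous_map_from_subtopology W_def)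
  from continuous_map_compose[OF this kc] have kg: "continuous_map (subtopology Z W) T (\<lambda>y. k (g y))" by (simp add: o_def)
  have "continuous_map (subtopology Z W) T (\<lambda>y. inv (k (f y)) \<otimes> k (g y))"
    by (rule cont_mult_comp[OF cont_inv_comp[OF kf] kg])
  then have "continuous_map (subtopology Z W) T (\<lambda>y. tr (f y) (g y))"
  proof (rule continuous_map_eq)
    fix y assume "y \<in> topspace (subtopology Z W)"
    then have y: "y \<in> topspace Z" "\<pi> (f y) \<in> V" "\<pi> (g y) \<in> V" using fg by (auto simp: W_def)
    have t: "tr (f y) (g y) \<in> carrier G" "act (f y) (tr (f y) (g y)) = g y" using tr[OF fP gP fg] y by auto
    then have "k (g y) = k (f y) \<otimes> tr (f y) (g y)" using k fP y by metis
    moreover have "k (f y) \<in> carrier G" using k fP y by blast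
    ultimately show "inv (k (f y)) \<otimes> k (g y) = tr (f y) (g y)" using t by (simp add: m_assoc[symmetric])
  qed
  then show "\<exists>U. openin Z U \<and> x \<in> U \<and> continuous_map (subtopology Z U) T (\<lambda>y. tr (f y) (g y))"
    using W V(1) x by (intro exI[of _ W]) (simp add: W_def)
qed

section \<open>Sections of the bundle pulled back to a cube\<close>

definition liftable :: "((nat \<Rightarrow> real) \<Rightarrow> 'b) \<Rightarrow> (nat \<Rightarrow> real) set \<Rightarrow> bool" where
  "liftable q S \<longleftrightarrow> (\<exists>s. continuous_map (top_of_set S) P s \<and> (\<forall>x\<in>S. \<pi> (s x) = q x))"

lemma liftable_subset: "liftable q S \<Longrightarrow> S' \<subseteq> S \<Longrightarrow> liftable q S'"
  unfolding liftable_def by (meson continuous_map_from_subtopology_mono subset_iff)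

text \<open>The two lifts are compared on the common face \<open>x i = c\<close>; the comparison is extended to the
  second half by retracting onto the face.\<close>

lemma liftable_glue:
  assumes l: "liftable q (S \<inter> {x. x i \<le> c})" and r: "liftable q (S \<inter> {x. c \<le> x i})"
    and S: "\<And>x. x \<in> S \<Longrightarrow> x(i := c) \<in> S"
  shows "liftable q S"
proof -
  obtain s1 where s1: "continuous_map (top_of_set (S \<inter> {x. x i \<le> c})) P s1" "\<forall>x\<in>S \<inter> {x. x i \<le> c}. \<pi> (s1 x) = q x"
    using l by (auto simp: liftable_def)
  obtain s2 where s2: "continuous_map (top_of_set (S \<inter> {x. c \<le> x i})) P s2" "\<forall>x\<in>S \<inter> {x. c \<le> x i}. \<pi> (s2 x) = q x"
    using r by (auto simp: liftable_def)
  have P1: "s1 x \<in> topspace P" if "x \<in> S" "x i \<le> c" for x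
    using continuous_map_image_subset_topspace[OF s1(1)] that by auto
  have P2: "s2 x \<in> topspace P" if "x \<in> S" "c \<le> x i" for x
    using continuous_map_image_subset_topspace[OF s2(1)] that by auto
  have upd: "continuous_on S' (\<lambda>x::nat \<Rightarrow> real. x(i := c))" for S'
  proof (rule continuous_on_coordinatewise_then_product)
    fix j show "continuous_on S' (\<lambda>x::nat \<Rightarrow> real. (x(i := c)) j)"
      by (cases "j = i") (auto intro: continuous_on_product_coordinates[THEN continuous_on_subset])
  qed
  have ci: "continuous_on S' (\<lambda>x::nat \<Rightarrow> real. x i)" for S'
    using continuous_on_product_coordinates[of i] by (rule continuous_on_subset) auto
  let ?R = "S \<inter> {x. c \<le> x i}"
  have m1: "continuous_map (top_of_set ?R) P (\<lambda>x. s1 (x(i := c)))"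
  proof -
    have "continuous_map (top_of_set ?R) (top_of_set (S \<inter> {x. x i \<le> c})) (\<lambda>x. x(i := c))"
      using S upd by auto
    from continuous_map_compose[OF this s1(1)] show ?thesis by (simp add: o_def)
  qed
  have m2: "continuous_map (top_of_set ?R) P (\<lambda>x. s2 (x(i := c)))"
  proof -
    have "continuous_map (top_of_set ?R) (top_of_set ?R) (\<lambda>x. x(i := c))"
      using S upd by auto
    from continuous_map_compose[OF this s2(1)] show ?thesis by (simp add: o_def)
  qed
  have same: "\<pi> (s2 (x(i := c))) = \<pi> (s1 (x(i := c)))" if "x \<in> S" for x
    using s1(2) s2(2) S[OF that] by simp
  define s2' where "s2' x = act (s2 x) (tr (s2 (x(i := c))) (s1 (x(i := c))))" for x
  have trc: "tr (s2 (x(i := c))) (s1 (x(i := c))) \<in> carrier G"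
    "act (s2 (x(i := c))) (tr (s2 (x(i := c))) (s1 (x(i := c)))) = s1 (x(i := c))" if "x \<in> S" for x
    using tr[OF P2 P1 same[OF that]] S[OF that] by auto
  have c2: "continuous_map (top_of_set ?R) P s2'"
    unfolding s2'_def by (intro cont_act_comp s2(1) cont_tr m1 m2) (use same in auto)
  have "continuous_map (top_of_set S) P (\<lambda>x. if x i \<le> c then s1 x else s2' x)"
  proof (rule continuous_map_cases_le)
    show "continuous_map (top_of_set S) euclideanreal (\<lambda>x. x i)" using ci by simp
    show "continuous_map (subtopology (top_of_set S) {x \<in> topspace (top_of_set S). x i \<le> c}) P s1"
      using s1(1) by (simp add: subtopology_subtopology Int_def)
    show "continuous_map (subtopology (top_of_set S) {x \<in> topspace (top_of_set S). c \<le> x i}) P s2'"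
      using c2 by (simp add: subtopology_subtopology Int_def)
    fix x assume "x \<in> topspace (top_of_set S)" "x i = c"
    moreover from this have "x(i := c) = x" by auto
    ultimately show "s1 x = s2' x" using trc(2)[of x] by (simp add: s2'_def)
  qed auto
  moreover have "\<pi> (if x i \<le> c then s1 x else s2' x) = q x" if x: "x \<in> S" for x
    using s1(2) s2(2) x trc(1)[OF x] P2 by (auto simp: s2'_def)
  ultimately show ?thesis unfolding liftable_def by blast
qed

text \<open>Full range in the first \<open>k\<close> coordinates and small around \<open>z\<close>
  in the others: this interpolates between a neighbourhood of a point (\<open>k = 0\<close>) and the
  whole cube (\<open>k = m\<close>).\<close>

definition cube :: "nat \<Rightarrow> nat \<Rightarrow> (nat \<Rightarrow> real) \<Rightarrow> real \<Rightarrow> (nat \<Rightarrow> real) set" where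
  "cube m k z e = {x. (\<forall>i<k. \<bar>x i\<bar> \<le> 2) \<and> (\<forall>i. k \<le> i \<and> i < m \<longrightarrow> \<bar>x i - z i\<bar> \<le> e) \<and> (\<forall>i\<ge>m. x i = 0)}"

lemma (in -) small_cube:
  fixes W :: "(nat \<Rightarrow> real) set"
  assumes W: "open W" and z: "z \<in> W" "\<forall>i\<ge>m. z i = (0::real)"
  shows "\<exists>e>0. \<forall>x. (\<forall>i<m. \<bar>x i - z i\<bar> \<le> e) \<and> (\<forall>i\<ge>m. x i = 0) \<longrightarrow> x \<in> W"
proof -
  have "openin (product_topology (\<lambda>i::nat. euclideanreal) UNIV) W"
    using W by (simp add: open_fun_def)
  from product_topology_open_contains_basis[OF this z(1)] obtain Y :: "nat \<Rightarrow> real set" where Y: "z \<in> (\<Pi>\<^sub>E i\<in>UNIV. Y i)"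
      "\<forall>i. openin euclideanreal (Y i)" "finite {i. Y i \<noteq> topspace euclideanreal}" "(\<Pi>\<^sub>E i\<in>UNIV. Y i) \<subseteq> W"
    by blast
  have "\<exists>e>0. \<forall>t. \<bar>t - z i\<bar> \<le> e \<longrightarrow> t \<in> Y i" for i
  proof -
    have "open (Y i)" "z i \<in> Y i" using Y by auto
    then obtain e where "e > 0" "cball (z i) e \<subseteq> Y i" using open_contains_cball by blast
    then show ?thesis by (intro exI[of _ e]) (auto simp: dist_real_def abs_minus_commute subset_iff)
  qed
  then obtain e where e: "\<And>i. e i > 0" "\<And>i t. \<bar>t - z i\<bar> \<le> e i \<Longrightarrow> t \<in> Y i" by metis
  define e0 where "e0 = Min (insert 1 (e ` {..<m}))"
  show ?thesis
  proof (intro exI[of _ e0] conjI allI impI)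
    show "e0 > 0" unfolding e0_def using e(1) by (subst Min_gr_iff) auto
    fix x assume x: "(\<forall>i<m. \<bar>x i - z i\<bar> \<le> e0) \<and> (\<forall>i\<ge>m. x i = 0)"
    have "x i \<in> Y i" for i
    proof (cases "i < m")
      case True
      then have "e0 \<le> e i" unfolding e0_def by (intro Min_le) auto
      then show ?thesis using x True e(2)[of "x i" i] by auto
    next
      case False
      then show ?thesis using x z(2) e(2)[of "x i" i] less_imp_le[OF e(1)[of i]] by auto
    qed
    then show "x \<in> W" using Y(4) by auto
  qed
qed

text \<open>Induction on the number of coordinates with full range. For the next coordinate, the
  hypothesis provides lifts over thin slabs around each of its values; the bisection principle
  \<open>Bolzano\<close> joins them over [-2, 2], gluing two lifts along a common face. The width in
  the remaining coordinates shrinks at each gluing, so it has to stay existential.\<close>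

lemma cube_liftable:
  assumes q: "continuous_map (Euclidean_space m) X q" and "k \<le> m" and z: "\<forall>i\<ge>m. z i = 0"
  shows "\<exists>e>0. liftable q (cube m k z e)"
  using assms(2) z
proof (induction k arbitrary: z)
  case 0
  have zE: "z \<in> topspace (Euclidean_space m)" using 0 by (simp add: topspace_Euclidean_space)
  then have "q z \<in> topspace X" using continuous_map_image_subset_topspace[OF q] by auto
  from local_section[OF this] obtain V s where V: "q z \<in> V" "openin X V"
    and s: "continuous_map (subtopology X V) P s" "\<forall>y\<in>V. \<pi> (s y) = y"
    by (elim exE conjE) (rule that)
  have "openin (Euclidean_space m) {x \<in> topspace (Euclidean_space m). q x \<in> V}"
    by (rule openin_continuous_map_preimage[OF q V(2)])
  then obtain W where W: "open W" "{x \<in> topspace (Euclidean_space m). q x \<in> V} = W \<inter> topspace (Euclidean_space m)"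
    unfolding Euclidean_space_def openin_subtopology by (auto simp: euclidean_product_topology)
  have "z \<in> W" using W(2) V(1) zE by blast
  from small_cube[OF W(1) this 0(2)] obtain e where e: "e > 0"
      "\<forall>x. (\<forall>i<m. \<bar>x i - z i\<bar> \<le> e) \<and> (\<forall>i\<ge>m. x i = 0) \<longrightarrow> x \<in> W" by auto
  have sub: "cube m 0 z e \<subseteq> {x \<in> topspace (Euclidean_space m). q x \<in> V}"
    unfolding W(2) using e(2) by (auto simp: cube_def topspace_Euclidean_space)
  have "continuous_map (subtopology (Euclidean_space m) (cube m 0 z e)) (subtopology X V) q"
    using q sub by (auto simp: continuous_map_in_subtopology continuous_map_from_subtopology)
  moreover have "subtopology (Euclidean_space m) (cube m 0 z e) = top_of_set (cube m 0 z e)"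
    using sub by (simp add: Euclidean_space_def subtopology_subtopology euclidean_product_topology
        topspace_Euclidean_space inf.absorb2 subset_iff cube_def Int_absorb1)
  ultimately have "continuous_map (top_of_set (cube m 0 z e)) P (\<lambda>x. s (q x))"
    using continuous_map_compose[OF _ s(1)] by (simp add: o_def)
  then have "liftable q (cube m 0 z e)"
    unfolding liftable_def using s(2) sub by (intro exI[of _ "\<lambda>x. s (q x)"]) auto
  then show ?case using e(1) by blast
next
  case (Suc k)
  define Q where "Q a b e = {x. (\<forall>i<k. \<bar>x i\<bar> \<le> 2) \<and> a \<le> x k \<and> x k \<le> b \<and>
      (\<forall>i. Suc k \<le> i \<and> i < m \<longrightarrow> \<bar>x i - z i\<bar> \<le> e) \<and> (\<forall>i\<ge>m. x i = 0)}" for a b e :: real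
  define R where "R a b \<longleftrightarrow> (\<exists>e>0. liftable q (Q a b e))" for a b
  have "R (-2) 2"
  proof (rule Bolzano)
    show "R a c" if ab: "R a b" "R b c" "a \<le> b" "b \<le> c" for a b c
    proof -
      obtain e1 e2 where e: "e1 > 0" "liftable q (Q a b e1)" "e2 > 0" "liftable q (Q b c e2)"
        using ab by (auto simp: R_def)
      let ?e = "min e1 e2"
      have "liftable q (Q a c ?e)"
      proof (rule liftable_glue[where i = k and c = b])
        show "liftable q (Q a c ?e \<inter> {x. x k \<le> b})" by (rule liftable_subset[OF e(2)]) (auto simp: Q_def)
        show "liftable q (Q a c ?e \<inter> {x. b \<le> x k})" by (rule liftable_subset[OF e(4)]) (auto simp: Q_def)
        show "x(k := b) \<in> Q a c ?e" if "x \<in> Q a c ?e" for x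
          using that ab Suc.prems(1) by (auto simp: Q_def)
      qed
      then show ?thesis using e unfolding R_def by (intro exI[of _ ?e]) auto
    qed
    show "\<exists>d>0. \<forall>a b. a \<le> t \<and> t \<le> b \<and> b - a < d \<longrightarrow> R a b" for t
    proof -
      have "\<exists>e>0. liftable q (cube m k (z(k := t)) e)"
        by (rule Suc.IH) (use Suc.prems in auto)
      then obtain e where e: "e > 0" "liftable q (cube m k (z(k := t)) e)" by blast
      have "R a b" if "a \<le> t" "t \<le> b" "b - a < e" for a b
      proof -
        have "Q a b e \<subseteq> cube m k (z(k := t)) e"
        proof
          fix x assume x: "x \<in> Q a b e"
          then have "\<bar>x k - t\<bar> \<le> e" using that by (auto simp: Q_def)
          then show "x \<in> cube m k (z(k := t)) e" using x by (auto simp: Q_def cube_def)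
        qed
        then show ?thesis unfolding R_def using e liftable_subset by blast
      qed
      then show ?thesis using e(1) by blast
    qed
  qed simp
  moreover have "Q (-2) 2 e = cube m (Suc k) z e" for e
    by (auto simp: Q_def cube_def less_Suc_eq abs_le_iff)
  ultimately show ?case by (simp add: R_def)
qed

text \<open>The half side 2 is what the stereographic projection requires: where the height is above
  -1/2, its coordinates are at most 1/(1 - 1/2) in absolute value.\<close>

lemma cube_lift:
  assumes q: "continuous_map (Euclidean_space m) X q"
  shows "liftable q {x. (\<forall>i<m. \<bar>x i\<bar> \<le> 2) \<and> (\<forall>i\<ge>m. x i = 0)}"
proof -
  obtain e where "liftable q (cube m m (\<lambda>_. 0) e)" using cube_liftable[OF q order_refl, of "\<lambda>_. 0"] by auto
  then show ?thesis by (rule liftable_subset) (auto simp: cube_def)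
qed

end

section \<open>Sections over enlarged hemispheres\<close>

locale sphere_bundle = principal_G_bundle G T \<psi> \<theta> U \<rho> C a "nsphere m" P \<pi> act
  for G :: "('g, 'u) monoid_scheme" (structure) and T :: "'g topology"
    and \<psi> :: "'g \<Rightarrow> 'e::euclidean_space" and \<theta> U \<rho> C a m
    and P :: "'p topology" and \<pi> :: "'p \<Rightarrow> nat \<Rightarrow> real" and act
begin

lemma nsphere_norm:
  assumes "x \<in> topspace (nsphere m)"
  shows "(\<Sum>i<m. (x i)\<^sup>2) + (x m)\<^sup>2 = 1" "i > m \<Longrightarrow> x i = 0" "\<bar>x i\<bar> \<le> 1"
proof -
  have s: "(\<Sum>i\<le>m. (x i)\<^sup>2) = 1" and o: "\<And>i. i > m \<Longrightarrow> x i = 0" using assms by (auto simp: nsphere)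
  show "i > m \<Longrightarrow> x i = 0" by (rule o)
  show "(\<Sum>i<m. (x i)\<^sup>2) + (x m)\<^sup>2 = 1" using s by (simp add: lessThan_Suc_atMost[symmetric])
  show "\<bar>x i\<bar> \<le> 1"
  proof (cases "i \<le> m")
    case True
    then have "(x i)\<^sup>2 \<le> 1" using member_le_sum[of i "{..m}" "\<lambda>i. (x i)\<^sup>2"] s by simp
    then show ?thesis by (simp add: abs_square_le_1)
  qed (simp add: o)
qed

text \<open>Stereographic projection from the pole \<open>x m = - e\<close>.\<close>

lemma sphere_section:
  assumes e: "e = 1 \<or> e = (- 1 :: real)"
  shows "\<exists>s. continuous_map (subtopology (nsphere m) {x. e * x m > - 1 / 2}) P s \<and>
    (\<forall>x\<in>topspace (nsphere m). e * x m > - 1 / 2 \<longrightarrow> \<pi> (s x) = x)"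
proof -
  define q :: "(nat \<Rightarrow> real) \<Rightarrow> nat \<Rightarrow> real" where "q y i = (if i < m then 2 * y i / (1 + (\<Sum>j<m. (y j)\<^sup>2))
    else if i = m then e * (1 - (\<Sum>j<m. (y j)\<^sup>2)) / (1 + (\<Sum>j<m. (y j)\<^sup>2)) else 0)" for y i
  have ee: "e * e = 1" using e by auto
  have nz: "1 + (\<Sum>j<m. (y j)\<^sup>2) \<noteq> 0" for y :: "nat \<Rightarrow> real"
    using sum_nonneg[of "{..<m}" "\<lambda>j. (y j)\<^sup>2"] by (auto simp: add_nonneg_eq_0_iff)
  have proj: "continuous_map (Euclidean_space m) euclideanreal (\<lambda>y. y j)" for j
    unfolding Euclidean_space_def by (intro continuous_map_from_subtopology continuous_map_product_projection) simp
  have cq: "continuous_map (Euclidean_space m) (nsphere m) q"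
    unfolding nsphere continuous_map_in_subtopology continuous_map_componentwise_UNIV
  proof (intro conjI allI)
    fix i
    have "continuous_map (Euclidean_space m) euclideanreal (\<lambda>y. 2 * y i / (1 + (\<Sum>j<m. (y j)\<^sup>2)))"
      "continuous_map (Euclidean_space m) euclideanreal (\<lambda>y. e * (1 - (\<Sum>j<m. (y j)\<^sup>2)) / (1 + (\<Sum>j<m. (y j)\<^sup>2)))"
      using nz by (intro continuous_intros proj; simp)+
    then show "continuous_map (Euclidean_space m) euclideanreal (\<lambda>y. q y i)"
      unfolding q_def by (cases "i < m"; cases "i = m") auto
  next
    show "q \<in> topspace (Euclidean_space m) \<rightarrow> {x. (\<Sum>i\<le>m. (x i)\<^sup>2) = 1 \<and> (\<forall>i>m. x i = 0)}"
    proof (intro Pi_I CollectI conjI allI impI)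
      fix y :: "nat \<Rightarrow> real"
      let ?s = "\<Sum>j<m. (y j)\<^sup>2"
      have "(\<Sum>i<m. (q y i)\<^sup>2) = (\<Sum>i<m. 4 / (1 + ?s)\<^sup>2 * (y i)\<^sup>2)"
        by (intro sum.cong) (auto simp: q_def power_divide power_mult_distrib)
      also have "\<dots> = 4 * ?s / (1 + ?s)\<^sup>2" by (simp add: sum_distrib_left sum_divide_distrib)
      finally have "(\<Sum>i\<le>m. (q y i)\<^sup>2) = 4 * ?s / (1 + ?s)\<^sup>2 + (e * e) * (1 - ?s)\<^sup>2 / (1 + ?s)\<^sup>2"
        by (simp add: lessThan_Suc_atMost[symmetric] q_def power_divide power_mult_distrib power2_eq_square[of e])
      also have "\<dots> = (4 * ?s + (1 - ?s)\<^sup>2) / (1 + ?s)\<^sup>2" unfolding ee by (simp add: add_divide_distrib)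
      also have "4 * ?s + (1 - ?s)\<^sup>2 = (1 + ?s)\<^sup>2" by (simp add: power2_eq_square algebra_simps)
      finally show "(\<Sum>i\<le>m. (q y i)\<^sup>2) = 1" using nz[of y] by simp
    qed (auto simp: q_def)
  qed
  let ?D = "{x. (\<forall>i<m. \<bar>x i\<bar> \<le> 2) \<and> (\<forall>i\<ge>m. x i = (0::real))}"
  from cube_lift[OF cq] obtain s where s: "continuous_map (top_of_set ?D) P s" "\<forall>y\<in>?D. \<pi> (s y) = q y"
    unfolding liftable_def by blast
  define f :: "(nat \<Rightarrow> real) \<Rightarrow> nat \<Rightarrow> real" where "f x i = (if i < m then x i / (1 + e * x m) else 0)" for x i
  let ?W = "{x. e * x m > - 1 / 2}"
  have fD: "f x \<in> ?D" if "x \<in> topspace (nsphere m)" "e * x m > - 1 / 2" for x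
  proof -
    have "\<bar>f x i\<bar> \<le> 2" if i: "i < m" for i
    proof -
      define z where "z = e * x m"
      have z: "z > - 1 / 2" using \<open>e * x m > _\<close> by (simp add: z_def)
      then have "1 \<le> 2 * (1 + z)" by simp
      then have "\<bar>x i\<bar> \<le> 2 * (1 + z)" using nsphere_norm(3)[OF \<open>x \<in> _\<close>, of i] by linarith
      moreover have "0 < 1 + z" using z by simp
      ultimately show ?thesis using i by (simp add: f_def z_def[symmetric] divide_le_eq)
    qed
    then show ?thesis by (simp add: f_def)
  qed
  have qf: "q (f x) = x" if x: "x \<in> topspace (nsphere m)" "e * x m > - 1 / 2" for x
  proof -
    define z where "z = e * x m"
    have z: "1 + z > 0" using x(2) by (simp add: z_def)
    have zz: "z\<^sup>2 = (x m)\<^sup>2" using ee by (simp add: z_def power2_eq_square algebra_simps)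
    have "(\<Sum>j<m. (f x j)\<^sup>2) = (\<Sum>j<m. 1 / (1 + z)\<^sup>2 * (x j)\<^sup>2)"
      by (intro sum.cong) (auto simp: f_def z_def power_divide)
    also have "\<dots> = (\<Sum>j<m. (x j)\<^sup>2) / (1 + z)\<^sup>2" by (simp add: sum_divide_distrib)
    also have "(\<Sum>j<m. (x j)\<^sup>2) = (1 - z) * (1 + z)"
      using nsphere_norm(1)[OF x(1)] zz by (simp add: algebra_simps power2_eq_square)
    also have "(1 - z) * (1 + z) / (1 + z)\<^sup>2 = (1 - z) / (1 + z)" using z by (simp add: power2_eq_square)
    finally have s: "(\<Sum>j<m. (f x j)\<^sup>2) = (1 - z) / (1 + z)" .
    have s1: "1 + (1 - z) / (1 + z) = 2 / (1 + z)" and s2: "1 - (1 - z) / (1 + z) = 2 * z / (1 + z)"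
      using z by (simp_all add: field_simps)
    show ?thesis
    proof
      fix i
      consider "i < m" | "i = m" | "i > m" by linarith
      then show "q (f x) i = x i"
      proof cases
        case 1
        then show ?thesis using z unfolding q_def s s1 by (simp add: f_def z_def)
      next
        case 2
        have "e * (2 * z / (1 + z)) / (2 / (1 + z)) = e * z" using z by simp
        also have "\<dots> = x m" using ee by (simp add: z_def mult.assoc[symmetric])
        finally show ?thesis using 2 unfolding q_def s s1 s2 by simp
      next
        case 3
        then show ?thesis using nsphere_norm(2)[OF x(1)] by (simp add: q_def)
      qed
    qed
  qed
  have "continuous_map (subtopology (nsphere m) ?W) (top_of_set ?D) f"
    unfolding continuous_map_in_subtopology euclidean_product_topology[symmetric] continuous_map_componentwise_UNIV
  proof (intro conjI allI)
    fix i
    have "continuous_map (subtopology (nsphere m) ?W) euclideanreal (\<lambda>x. x i / (1 + e * x m))"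
      by (intro continuous_intros continuous_map_from_subtopology continuous_map_nsphere_projection) auto
    then show "continuous_map (subtopology (nsphere m) ?W) euclideanreal (\<lambda>x. f x i)"
      by (cases "i < m") (auto simp: f_def)
  qed (use fD in auto)
  from continuous_map_compose[OF this s(1)]
  have "continuous_map (subtopology (nsphere m) ?W) P (\<lambda>x. s (f x))" by (simp add: o_def)
  moreover have "\<pi> (s (f x)) = x" if "x \<in> topspace (nsphere m)" "e * x m > - 1 / 2" for x
    using s(2) fD[OF that] qf[OF that] by simp
  ultimately show ?thesis by (intro exI[of _ "\<lambda>x. s (f x)"]) blast
qed

end

section \<open>Complements of orthonormal sections\<close>

text \<open>Determinants are taken of index functions, so that values out of range do not matter and
  no carrier conditions on matrices have to be carried along.\<close>

definition dt :: "nat \<Rightarrow> (nat \<Rightarrow> nat \<Rightarrow> real) \<Rightarrow> real" where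
  "dt n A = Determinant.det (Matrix.mat n n (\<lambda>(i, j). A i j))"

lemma dt_cong: "(\<And>i j. i < n \<Longrightarrow> j < n \<Longrightarrow> A i j = B i j) \<Longrightarrow> dt n A = dt n B"
  unfolding dt_def by (intro arg_cong[of _ _ Determinant.det] eq_matI) auto

lemma dt_mult: "dt n (\<lambda>i j. \<Sum>l<n. A i l * B l j) = dt n A * dt n B"
proof -
  have "Matrix.mat n n (\<lambda>(i, j). \<Sum>l<n. A i l * B l j)
      = Matrix.mat n n (\<lambda>(i, j). A i j) * Matrix.mat n n (\<lambda>(i, j). B i j)"
    by (intro eq_matI) (auto simp: scalar_prod_def atLeast0LessThan)
  then show ?thesis unfolding dt_def by (simp add: det_mult[of _ n])
qed

lemma dt_transpose: "dt n (\<lambda>i j. A j i) = dt n A"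
proof -
  have "Matrix.mat n n (\<lambda>(i, j). A j i) = transpose_mat (Matrix.mat n n (\<lambda>(i, j). A i j))"
    by (intro eq_matI) auto
  then show ?thesis unfolding dt_def by (simp add: det_transpose[of _ n])
qed

lemma dt_one: "(\<And>i j. i < n \<Longrightarrow> j < n \<Longrightarrow> A i j = (if i = j then 1 else 0)) \<Longrightarrow> dt n A = 1"
proof -
  assume A: "\<And>i j. i < n \<Longrightarrow> j < n \<Longrightarrow> A i j = (if i = j then 1 else 0)"
  have "Matrix.mat n n (\<lambda>(i, j). A i j) = 1\<^sub>m n" using A by (intro eq_matI) auto
  then show ?thesis by (simp add: dt_def)
qed

lemma dt_expand: "dt n A = (\<Sum>p\<in>{p. p permutes {0..<n}}. signof p * (\<Prod>i = 0..<n. A i (p i)))"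
proof -
  have "dt n A = (\<Sum>p\<in>{p. p permutes {0..<n}}. signof p * (\<Prod>i = 0..<n. Matrix.mat n n (\<lambda>(i, j). A i j) $$ (i, p i)))"
    unfolding dt_def by (rule det_def') simp
  also have "\<dots> = (\<Sum>p\<in>{p. p permutes {0..<n}}. signof p * (\<Prod>i = 0..<n. A i (p i)))"
  proof (intro sum.cong refl arg_cong2[of _ _ _ _ "(*)"] prod.cong)
    fix p i assume "p \<in> {p. p permutes {0..<n}}" "i \<in> {0..<n}"
    then show "Matrix.mat n n (\<lambda>(i, j). A i j) $$ (i, p i) = A i (p i)" using permutes_in_image[of p "{0..<n}" i] by auto
  qed
  finally show ?thesis .
qed

lemma dt_scale_rows: "dt n (\<lambda>i j. c i * A i j) = (\<Prod>i<n. c i) * dt n A"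
  unfolding dt_expand prod.distrib by (simp add: sum_distrib_left mult_ac atLeast0LessThan)

text \<open>Meant for two frames that share their first \<open>k\<close> vectors: the base change
  between the remaining vectors has the determinant of the full base change.\<close>

lemma dt_block:
  assumes "\<And>i j. i < k \<Longrightarrow> j < k + n \<Longrightarrow> A i j = (if i = j then 1 else 0)"
  shows "dt (k + n) A = dt n (\<lambda>i j. A (k + i) (k + j))"
proof -
  let ?F = "four_block_mat (1\<^sub>m k) (0\<^sub>m k n) (Matrix.mat n k (\<lambda>(i, j). A (k + i) j))
      (Matrix.mat n n (\<lambda>(i, j). A (k + i) (k + j)))"
  have "Matrix.mat (k + n) (k + n) (\<lambda>(i, j). A i j) = ?F"
    using assms by (intro eq_matI) (auto simp: index_mat_four_block)
  then show ?thesis unfolding dt_def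
    by (simp add: det_four_block_mat_upper_right_zero[of _ k _ n])
qed

lemma continuous_map_dt:
  assumes "\<And>i j. i < n \<Longrightarrow> j < n \<Longrightarrow> continuous_map X euclideanreal (\<lambda>x. A x i j)"
  shows "continuous_map X euclideanreal (\<lambda>x. dt n (A x))"
  unfolding dt_expand
proof (intro continuous_map_sum continuous_map_real_mult continuous_map_prod)
  fix p i assume "p \<in> {p. p permutes {0..<n}}" "i \<in> {0..<n}"
  then show "continuous_map X euclideanreal (\<lambda>x. A x i (p i))"
    using permutes_in_image[of p "{0..<n}" i] assms by auto
qed (auto simp: finite_permutations)

section \<open>Independent and orthonormal families\<close>

definition lin_indep :: "nat \<Rightarrow> (nat \<Rightarrow> 'v::real_vector) \<Rightarrow> bool" where
  "lin_indep n e \<longleftrightarrow> (\<forall>c. (\<Sum>i<n. c i *\<^sub>R e i) = 0 \<longrightarrow> (\<forall>i<n. c i = 0))"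

definition fspan :: "nat \<Rightarrow> (nat \<Rightarrow> 'v::real_vector) \<Rightarrow> 'v set" where
  "fspan n e = span (e ` {..<n})"

definition orthonormal :: "nat \<Rightarrow> (nat \<Rightarrow> 'v::real_inner) \<Rightarrow> bool" where
  "orthonormal n w \<longleftrightarrow> (\<forall>i<n. \<forall>j<n. w i \<bullet> w j = (if i = j then 1 else 0))"

lemma orthonormalD: "orthonormal n w \<Longrightarrow> i < n \<Longrightarrow> j < n \<Longrightarrow> w i \<bullet> w j = (if i = j then 1 else 0)"
  by (simp add: orthonormal_def)

lemma fspan_sum: "(\<Sum>i<n. c i *\<^sub>R e i) \<in> fspan n e"
  unfolding fspan_def by (intro span_sum span_scale span_base) auto

lemma fspan_base: "i < n \<Longrightarrow> e i \<in> fspan n e"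
  unfolding fspan_def by (intro span_base) auto

lemma fspan_subspace: "subspace (fspan n e)"
  unfolding fspan_def by simp

lemma fspanE:
  assumes "w \<in> fspan n e"
  obtains c where "w = (\<Sum>i<n. c i *\<^sub>R e i)"
proof -
  have "\<exists>c. w = (\<Sum>i<n. c i *\<^sub>R e i)"
    using assms unfolding fspan_def
  proof (induction rule: span_induct_alt)
    case base
    show ?case by (rule exI[of _ "\<lambda>_. 0"]) simp
  next
    case (step t x y)
    then obtain i c where i: "i < n" "x = e i" "y = (\<Sum>i<n. c i *\<^sub>R e i)" by auto
    have "(\<Sum>j<n. (c j + (if j = i then t else 0)) *\<^sub>R e j) = y + (\<Sum>j<n. (if j = i then t *\<^sub>R e i else 0))"
      unfolding i(3) sum.distrib[symmetric] by (intro sum.cong) (auto simp: scaleR_add_left)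
    also have "\<dots> = t *\<^sub>R x + y" using i by simp
    finally show ?case by (intro exI[of _ "\<lambda>j. c j + (if j = i then t else 0)"]) simp
  qed
  then show ?thesis using that by blast
qed

text \<open>Independence of a family, unlike that of a set, excludes repetitions. The family can
  thus be replaced by its image without loss of size, and the exchange bound for independent sets
  applies.\<close>

lemma lin_indep_le:
  assumes ind: "lin_indep n e" and sub: "\<And>i. i < n \<Longrightarrow> e i \<in> fspan d f"
  shows "n \<le> d"
proof -
  have inj: "inj_on e {..<n}"
  proof (rule inj_onI, rule ccontr)
    fix i j assume ij: "i \<in> {..<n}" "j \<in> {..<n}" "e i = e j" "i \<noteq> j"
    let ?c = "\<lambda>l. (if l = i then 1 else 0) - (if l = j then 1 else (0::real))"
    have "(\<Sum>l<n. ?c l *\<^sub>R e l) = (\<Sum>l<n. (if l = i then e i else 0) - (if l = j then e j else 0))"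
      by (intro sum.cong) auto
    also have "\<dots> = 0" using ij by (simp add: sum_subtractf)
    finally have "\<forall>l<n. ?c l = 0" using ind unfolding lin_indep_def by (elim allE[of _ ?c]) (rule mp)
    then have "?c i = 0" using ij(1) by (elim allE[of _ i]) simp
    then show False using ij by simp
  qed
  have "independent (e ` {..<n})"
    unfolding independent_explicit_finite_subsets
  proof (intro allI impI ballI)
    fix S u v assume S: "S \<subseteq> e ` {..<n}" "finite S" "(\<Sum>v\<in>S. u v *\<^sub>R v) = 0" "v \<in> S"
    define c where "c i = (if e i \<in> S then u (e i) else 0)" for i
    have "(\<Sum>i<n. c i *\<^sub>R e i) = (\<Sum>w\<in>e ` {..<n}. (if w \<in> S then u w else 0) *\<^sub>R w)"
      by (simp add: sum.reindex[OF inj] c_def o_def)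
    also have "\<dots> = (\<Sum>v\<in>S. u v *\<^sub>R v)" using S(1) by (intro sum.mono_neutral_cong_right) auto
    finally have c: "\<forall>i<n. c i = 0" using S(3) ind by (simp add: lin_indep_def)
    obtain i where "i < n" "v = e i" using S by auto
    then show "u v = 0" using c S(4) by (auto simp: c_def)
  qed
  moreover have "e ` {..<n} \<subseteq> span (f ` {..<d})" using sub by (auto simp: fspan_def)
  ultimately have "card (e ` {..<n}) \<le> card (f ` {..<d})"
    using independent_span_bound[of "f ` {..<d}" "e ` {..<n}"] by simp
  also have "\<dots> \<le> d" using card_image_le[of "{..<d}" f] by simp
  finally show ?thesis using card_image[OF inj] by simp
qed

lemma inner_sum_orthonormal:
  assumes "orthonormal n w" "j < n"
  shows "(\<Sum>i<n. c i *\<^sub>R w i) \<bullet> w j = c j"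
proof -
  have "(\<Sum>i<n. c i *\<^sub>R w i) \<bullet> w j = (\<Sum>i<n. if i = j then c j else 0)"
    unfolding inner_sum_left using assms by (intro sum.cong) (auto simp: orthonormalD)
  then show ?thesis using assms(2) by simp
qed

lemma orthonormal_lin_indep: "orthonormal n w \<Longrightarrow> lin_indep n w"
  unfolding lin_indep_def using inner_sum_orthonormal[of n w] by (metis inner_zero_left)

lemma orthonormal_extend:
  assumes w: "orthonormal n w" and r: "r \<noteq> 0" "\<And>i. i < n \<Longrightarrow> r \<bullet> w i = 0"
  shows "orthonormal (Suc n) (w(n := r /\<^sub>R norm r))"
  using w r by (auto simp: orthonormal_def less_Suc_eq inner_commute power2_norm_eq_inner[symmetric] power2_eq_square field_simps)

lemma residual_orthogonal:
  assumes "orthonormal n w" "i < n"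
  shows "(v - (\<Sum>i<n. (v \<bullet> w i) *\<^sub>R w i)) \<bullet> w i = 0"
  by (simp add: inner_diff_left inner_sum_orthonormal[OF assms])

text \<open>A non-zero residual would extend \<open>w\<close> to d + 1 orthonormal vectors in a span
  of d vectors.\<close>

lemma orthonormal_spans:
  assumes w: "orthonormal d w" "\<And>i. i < d \<Longrightarrow> w i \<in> fspan d f" and x: "x \<in> fspan d f"
  shows "x = (\<Sum>i<d. (x \<bullet> w i) *\<^sub>R w i)"
proof (rule ccontr)
  define r where "r = x - (\<Sum>i<d. (x \<bullet> w i) *\<^sub>R w i)"
  assume "x \<noteq> (\<Sum>i<d. (x \<bullet> w i) *\<^sub>R w i)"
  then have r: "r \<noteq> 0" by (simp add: r_def)
  have rf: "r \<in> fspan d f"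
    unfolding r_def by (intro subspace_diff[OF fspan_subspace] x subspace_sum[OF fspan_subspace]
        subspace_scale[OF fspan_subspace] w(2)) simp
  have "orthonormal (Suc d) (w(d := r /\<^sub>R norm r))"
    by (rule orthonormal_extend[OF w(1) r]) (simp add: r_def residual_orthogonal[OF w(1)])
  then have "lin_indep (Suc d) (w(d := r /\<^sub>R norm r))" by (rule orthonormal_lin_indep)
  then have "Suc d \<le> d"
    by (rule lin_indep_le) (use w(2) rf subspace_scale[OF fspan_subspace] in \<open>auto simp: less_Suc_eq\<close>)
  then show False by simp
qed

text \<open>Otherwise d independent vectors would lie in the span of p < d vectors. For continuous
  families the index found at one point remains good nearby, which is how local frames are
  extended.\<close>

lemma orthonormal_complete:
  assumes e: "lin_indep d e" and w: "orthonormal p w" and "p < d"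
  shows "\<exists>j<d. e j - (\<Sum>i<p. (e j \<bullet> w i) *\<^sub>R w i) \<noteq> 0"
proof (rule ccontr)
  assume "\<not> ?thesis"
  then have "e j = (\<Sum>i<p. (e j \<bullet> w i) *\<^sub>R w i)" if "j < d" for j using that by auto
  then have "e j \<in> fspan p w" if "j < d" for j using that fspan_sum[of "\<lambda>i. e j \<bullet> w i" w p] by metis
  from lin_indep_le[OF e this] show False using \<open>p < d\<close> by simp
qed

lemma continuous_map_inner [continuous_intros]:
  fixes f :: "'a \<Rightarrow> 'b::real_inner"
  shows "continuous_map X euclidean f \<Longrightarrow> continuous_map X euclidean g \<Longrightarrow> continuous_map X euclideanreal (\<lambda>x. f x \<bullet> g x)"
  by (simp add: continuous_map_atin tendsto_inner)

lemma continuous_map_normalize: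
  fixes f :: "'a \<Rightarrow> 'b::real_normed_vector"
  assumes "continuous_map X euclidean f" "\<And>x. x \<in> topspace X \<Longrightarrow> f x \<noteq> 0"
  shows "continuous_map X euclidean (\<lambda>x. f x /\<^sub>R norm (f x))"
proof -
  have "continuous_map X euclideanreal (\<lambda>x. 1 / norm (f x))"
    using assms by (intro continuous_intros) auto
  from continuous_map_scaleR[OF this assms(1)] show ?thesis by (simp add: inverse_eq_divide)
qed

lemma continuous_map_residual:
  fixes v :: "'a \<Rightarrow> 'b::real_inner" and n :: nat
  assumes "continuous_map X euclidean v" "\<And>i. i < n \<Longrightarrow> continuous_map X euclidean (w i)"
  shows "continuous_map X euclidean (\<lambda>x. v x - (\<Sum>i<n. (v x \<bullet> w i x) *\<^sub>R w i x))"
  using assms by (intro continuous_intros continuous_map_scaleR) auto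

text \<open>By pointwise independence the residuals never vanish, so the orthonormalization is
  continuous on the whole of \<open>X\<close> without local choices. The span condition keeps the
  new sections in a subbundle that contains the old ones.\<close>

lemma gram_schmidt:
  fixes s :: "nat \<Rightarrow> 'a \<Rightarrow> 'b::real_inner"
  assumes "\<And>i. i < k \<Longrightarrow> continuous_map X euclidean (s i)"
    and "\<And>x. x \<in> topspace X \<Longrightarrow> lin_indep k (\<lambda>i. s i x)"
  shows "\<exists>w. (\<forall>i<k. continuous_map X euclidean (w i)) \<and>
    (\<forall>x\<in>topspace X. orthonormal k (\<lambda>i. w i x) \<and> (\<forall>i<k. w i x \<in> fspan k (\<lambda>i. s i x)))"
  using assms
proof (induction k)
  case 0
  show ?case by (auto simp: orthonormal_def)
next
  case (Suc k)
  have ind: "lin_indep k (\<lambda>i. s i x)" if x: "x \<in> topspace X" for x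
    unfolding lin_indep_def
  proof (intro allI impI)
    fix c i assume c: "(\<Sum>i<k. c i *\<^sub>R s i x) = 0" and i: "i < k"
    have "(\<Sum>i<Suc k. (c(k := 0)) i *\<^sub>R s i x) = 0" using c by simp
    then have "(c(k := 0)) i = 0" using Suc.prems(2)[OF x] i unfolding lin_indep_def by (meson less_SucI)
    then show "c i = 0" using i by simp
  qed
  obtain w where w: "\<forall>i<k. continuous_map X euclidean (w i)"
    "\<forall>x\<in>topspace X. orthonormal k (\<lambda>i. w i x) \<and> (\<forall>i<k. w i x \<in> fspan k (\<lambda>i. s i x))"
    using Suc.IH[OF _ ind] Suc.prems(1) by auto
  define r where "r x = s k x - (\<Sum>i<k. (s k x \<bullet> w i x) *\<^sub>R w i x)" for x
  have r0: "r x \<noteq> 0" if x: "x \<in> topspace X" for x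
  proof
    assume "r x = 0"
    then have "s k x = (\<Sum>i<k. (s k x \<bullet> w i x) *\<^sub>R w i x)" by (simp add: r_def)
    moreover have "(\<Sum>i<k. (s k x \<bullet> w i x) *\<^sub>R w i x) \<in> fspan k (\<lambda>i. s i x)"
      using w(2) x by (intro subspace_sum[OF fspan_subspace] subspace_scale[OF fspan_subspace]) auto
    ultimately obtain c where c: "s k x = (\<Sum>i<k. c i *\<^sub>R s i x)" by (metis fspanE)
    have "(\<Sum>i<Suc k. (c(k := - 1)) i *\<^sub>R s i x) = 0" by (simp add: c[symmetric])
    then have "(c(k := - 1)) k = 0" using Suc.prems(2)[OF x] unfolding lin_indep_def by blast
    then show False by simp
  qed
  have cr: "continuous_map X euclidean r"
    unfolding r_def using w(1) Suc.prems(1)[of k] by (intro continuous_map_residual) auto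
  let ?w = "w(k := \<lambda>x. r x /\<^sub>R norm (r x))"
  have mono: "fspan k (\<lambda>i. s i x) \<subseteq> fspan (Suc k) (\<lambda>i. s i x)" for x
    unfolding fspan_def by (intro span_mono) auto
  show ?case
  proof (intro exI[of _ ?w] conjI allI impI ballI)
    show "continuous_map X euclidean (?w i)" if "i < Suc k" for i
      using that w(1) continuous_map_normalize[OF cr r0] by (auto simp: less_Suc_eq)
    fix x assume x: "x \<in> topspace X"
    have ow: "orthonormal k (\<lambda>i. w i x)" using w(2) x by blast
    have "orthonormal (Suc k) ((\<lambda>i. w i x)(k := r x /\<^sub>R norm (r x)))"
      by (rule orthonormal_extend[OF ow r0[OF x]]) (simp add: r_def residual_orthogonal[OF ow])
    moreover have "(\<lambda>i. ?w i x) = (\<lambda>i. w i x)(k := r x /\<^sub>R norm (r x))" by auto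
    ultimately show "orthonormal (Suc k) (\<lambda>i. ?w i x)" by simp
    have wf: "w i x \<in> fspan (Suc k) (\<lambda>i. s i x)" if "i < k" for i using w(2) x that mono by blast
    have "r x \<in> fspan (Suc k) (\<lambda>i. s i x)"
      unfolding r_def using wf by (intro subspace_diff[OF fspan_subspace] subspace_sum[OF fspan_subspace]
          subspace_scale[OF fspan_subspace] fspan_base) auto
    then show "?w i x \<in> fspan (Suc k) (\<lambda>i. s i x)" if "i < Suc k" for i
      using that wf subspace_scale[OF fspan_subspace] by (auto simp: less_Suc_eq)
  qed
qed

text \<open>An oriented subbundle of the trivial bundle \<open>X \<times> 'v\<close>, given by local frames.\<close>

locale framed_family =
  fixes X :: "'x topology" and d :: nat
    and Fr :: "('x set \<times> (nat \<Rightarrow> 'x \<Rightarrow> 'v::euclidean_space)) set"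
  assumes Fr_open: "(U, e) \<in> Fr \<Longrightarrow> openin X U"
    and Fr_cover: "x \<in> topspace X \<Longrightarrow> \<exists>U e. (U, e) \<in> Fr \<and> x \<in> U"
    and Fr_cont: "(U, e) \<in> Fr \<Longrightarrow> j < d \<Longrightarrow> continuous_map (subtopology X U) euclidean (e j)"
    and Fr_indep: "(U, e) \<in> Fr \<Longrightarrow> x \<in> U \<Longrightarrow> lin_indep d (\<lambda>j. e j x)"
    and Fr_change: "(U, e) \<in> Fr \<Longrightarrow> (U', e') \<in> Fr \<Longrightarrow> x \<in> U \<Longrightarrow> x \<in> U' \<Longrightarrow>
      \<exists>R. dt d R > 0 \<and> (\<forall>j<d. e' j x = (\<Sum>l<d. R l j *\<^sub>R e l x))"
begin

definition fib :: "'x \<Rightarrow> 'v set" where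
  "fib x = (\<Union>(U, e)\<in>{(U, e)\<in>Fr. x \<in> U}. fspan d (\<lambda>j. e j x))"

lemma fib_eq:
  assumes "(U, e) \<in> Fr" "x \<in> U"
  shows "fib x = fspan d (\<lambda>j. e j x)"
proof -
  have "fspan d (\<lambda>j. e' j x) \<subseteq> fspan d (\<lambda>j. e j x)" if e': "(U', e') \<in> Fr" "x \<in> U'" for U' e'
  proof -
    obtain R where "\<forall>j<d. e' j x = (\<Sum>l<d. R l j *\<^sub>R e l x)" using Fr_change[OF assms(1) e'(1) assms(2) e'(2)] by blast
    then have "e' j x \<in> fspan d (\<lambda>j. e j x)" if "j < d" for j using that fspan_sum[of "\<lambda>l. R l j"] by simp
    then show ?thesis unfolding fspan_def[of d "\<lambda>j. e' j x"]
      by (intro span_minimal) (auto simp: fspan_subspace)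
  qed
  then show ?thesis unfolding fib_def using assms by auto
qed

lemma fib_subspace: "x \<in> topspace X \<Longrightarrow> subspace (fib x)"
  using Fr_cover[of x] fib_eq fspan_subspace by metis

lemma fib_orthonormal_spans:
  assumes "x \<in> topspace X" "orthonormal d w" "\<And>i. i < d \<Longrightarrow> w i \<in> fib x" "v \<in> fib x"
  shows "v = (\<Sum>i<d. (v \<bullet> w i) *\<^sub>R w i)"
proof -
  obtain U e where e: "(U, e) \<in> Fr" "x \<in> U" using Fr_cover[OF assms(1)] by blast
  show ?thesis by (rule orthonormal_spans[OF assms(2)]) (use assms(3,4) fib_eq[OF e] in auto)
qed

text \<open>For orthonormal \<open>w\<close>, the sign of this determinant is that of the base change between \<open>w\<close> and
  the frame \<open>e\<close>.\<close>

definition pos :: "'x \<Rightarrow> (nat \<Rightarrow> 'v) \<Rightarrow> bool" where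
  "pos x w \<longleftrightarrow> (\<forall>(U, e)\<in>Fr. x \<in> U \<longrightarrow> dt d (\<lambda>i j. e i x \<bullet> w j) > 0)"

lemma posI:
  assumes e: "(U, e) \<in> Fr" "x \<in> U" and p: "dt d (\<lambda>i j. e i x \<bullet> w j) > 0"
  shows "pos x w"
  unfolding pos_def
proof (clarify)
  fix U' e' assume e': "(U', e') \<in> Fr" "x \<in> U'"
  obtain R where R: "dt d R > 0" "\<forall>j<d. e' j x = (\<Sum>l<d. R l j *\<^sub>R e l x)"
    using Fr_change[OF e(1) e'(1) e(2) e'(2)] by blast
  have "dt d (\<lambda>i j. e' i x \<bullet> w j) = dt d (\<lambda>i j. \<Sum>l<d. R l i * (e l x \<bullet> w j))"
    by (rule dt_cong) (use R(2) in \<open>simp add: inner_sum_left\<close>)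
  also have "\<dots> = dt d (\<lambda>i l. R l i) * dt d (\<lambda>i j. e i x \<bullet> w j)" by (rule dt_mult)
  also have "\<dots> > 0" unfolding dt_transpose[of d R] using R(1) p by simp
  finally show "dt d (\<lambda>i j. e' i x \<bullet> w j) > 0" .
qed

text \<open>The coefficients of \<open>w\<close> in the frame form an inverse of the matrix in
  question, by orthonormality of \<open>w\<close>.\<close>

lemma dt_frame_nonzero:
  assumes e: "(U, e) \<in> Fr" "x \<in> U" and w: "orthonormal d w" "\<And>i. i < d \<Longrightarrow> w i \<in> fib x"
  shows "dt d (\<lambda>i j. e i x \<bullet> w j) \<noteq> 0"
proof -
  define c where "c i = (SOME c. w i = (\<Sum>j<d. c j *\<^sub>R e j x))" for i
  have c: "w i = (\<Sum>j<d. c i j *\<^sub>R e j x)" if i: "i < d" for i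
  proof -
    have "w i \<in> fspan d (\<lambda>j. e j x)" using w(2)[OF i] fib_eq[OF e] by simp
    then obtain c' where "w i = (\<Sum>j<d. c' j *\<^sub>R e j x)" by (rule fspanE)
    then show ?thesis unfolding c_def by (rule someI[where P = "\<lambda>c. w i = (\<Sum>j<d. c j *\<^sub>R e j x)"])
  qed
  have "dt d c * dt d (\<lambda>i j. e i x \<bullet> w j) = dt d (\<lambda>i j. \<Sum>l<d. c i l * (e l x \<bullet> w j))" by (rule dt_mult[symmetric])
  also have "\<dots> = 1"
  proof (rule dt_one)
    fix i j assume ij: "i < d" "j < d"
    have "(\<Sum>l<d. c i l * (e l x \<bullet> w j)) = w i \<bullet> w j" by (subst c[OF ij(1)]) (simp add: inner_sum_left)
    then show "(\<Sum>l<d. c i l * (e l x \<bullet> w j)) = (if i = j then 1 else 0)" using orthonormalD[OF w(1) ij] by simp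
  qed
  finally show ?thesis by auto
qed

text \<open>Expanding the frame vectors in \<open>w'\<close> factors the determinant for
  \<open>w\<close> into the one for \<open>w'\<close> and the one in question.\<close>

lemma pos_change:
  assumes x: "x \<in> topspace X" and w: "orthonormal d w" "\<And>i. i < d \<Longrightarrow> w i \<in> fib x" "pos x w"
    and w': "orthonormal d w'" "\<And>i. i < d \<Longrightarrow> w' i \<in> fib x" "pos x w'"
  shows "dt d (\<lambda>i j. w' i \<bullet> w j) > 0"
proof -
  obtain U e where e: "(U, e) \<in> Fr" "x \<in> U" using Fr_cover[OF x] by blast
  have "dt d (\<lambda>i j. e i x \<bullet> w j) = dt d (\<lambda>i j. \<Sum>l<d. (e i x \<bullet> w' l) * (w' l \<bullet> w j))"
  proof (rule dt_cong)
    fix i j assume ij: "i < d" "j < d"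
    have "e i x \<in> fib x" unfolding fib_eq[OF e] by (rule fspan_base[OF ij(1), of "\<lambda>j. e j x"])
    from fib_orthonormal_spans[OF x w'(1,2) this]
    have "e i x \<bullet> w j = (\<Sum>l<d. (e i x \<bullet> w' l) *\<^sub>R w' l) \<bullet> w j" by simp
    then show "e i x \<bullet> w j = (\<Sum>l<d. (e i x \<bullet> w' l) * (w' l \<bullet> w j))" by (simp add: inner_sum_left)
  qed
  also have "\<dots> = dt d (\<lambda>i j. e i x \<bullet> w' j) * dt d (\<lambda>i j. w' i \<bullet> w j)" by (rule dt_mult)
  finally have eq: "dt d (\<lambda>i j. e i x \<bullet> w j) = dt d (\<lambda>i j. e i x \<bullet> w' j) * dt d (\<lambda>i j. w' i \<bullet> w j)" .
  have "dt d (\<lambda>i j. e i x \<bullet> w j) > 0" "dt d (\<lambda>i j. e i x \<bullet> w' j) > 0"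
    using w(3) w'(3) e unfolding pos_def by blast+
  then show ?thesis unfolding eq by (simp add: zero_less_mult_iff)
qed

end

section \<open>Oriented orthonormal frames that begin with prescribed sections\<close>

locale framed_subfamily = framed_family X d Fr
  for X :: "'x topology" and d and Fr :: "('x set \<times> (nat \<Rightarrow> 'x \<Rightarrow> 'v::euclidean_space)) set" +
  fixes k :: nat and s :: "nat \<Rightarrow> 'x \<Rightarrow> 'v"
  assumes kd: "k < d"
    and s_cont: "i < k \<Longrightarrow> continuous_map X euclidean (s i)"
    and s_fib: "x \<in> topspace X \<Longrightarrow> i < k \<Longrightarrow> s i x \<in> fib x"
    and s_orth: "x \<in> topspace X \<Longrightarrow> orthonormal k (\<lambda>i. s i x)"
begin

definition oframe :: "nat \<Rightarrow> 'x set \<Rightarrow> (nat \<Rightarrow> 'x \<Rightarrow> 'v) \<Rightarrow> bool" where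
  "oframe p U w \<longleftrightarrow> openin X U \<and> (\<forall>i<p. continuous_map (subtopology X U) euclidean (w i)) \<and>
     (\<forall>x\<in>U. orthonormal p (\<lambda>i. w i x) \<and> (\<forall>i<p. w i x \<in> fib x)) \<and> (\<forall>i<k. w i = s i)"

text \<open>Starting from the global sections \<open>s\<close>, one vector is added at a time: some
  vector of a frame has a non-zero residual at \<open>x0\<close>, hence on a neighbourhood, where
  the residual can be normalized.\<close>

lemma ex_oframe:
  assumes x0: "x0 \<in> topspace X" and p: "k \<le> p" "p \<le> d"
  shows "\<exists>U w. x0 \<in> U \<and> oframe p U w"
  using p
proof (induction p rule: dec_induct)
  case base
  show ?case
    by (rule exI[of _ "topspace X"], rule exI[of _ s]) (use x0 s_cont s_fib s_orth in \<open>auto simp: oframe_def\<close>)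
next
  case (step p)
  then obtain U w where U: "x0 \<in> U" and fr: "oframe p U w" by auto
  have w: "openin X U" "\<forall>i<p. continuous_map (subtopology X U) euclidean (w i)"
    "\<forall>x\<in>U. orthonormal p (\<lambda>i. w i x) \<and> (\<forall>i<p. w i x \<in> fib x)" "\<forall>i<k. w i = s i" using fr by (auto simp: oframe_def)
  have UX: "U \<subseteq> topspace X" using w(1) by (rule openin_subset)
  obtain Ue e where e: "(Ue, e) \<in> Fr" "x0 \<in> Ue" using Fr_cover[OF x0] by blast
  obtain j where j: "j < d" "e j x0 - (\<Sum>i<p. (e j x0 \<bullet> w i x0) *\<^sub>R w i x0) \<noteq> 0"
    using orthonormal_complete[OF Fr_indep[OF e], of p "\<lambda>i. w i x0"] w(3) U step.prems by auto
  define r where "r x = e j x - (\<Sum>i<p. (e j x \<bullet> w i x) *\<^sub>R w i x)" for x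
  have UU: "openin X (U \<inter> Ue)" using w(1) Fr_open[OF e(1)] by (rule openin_Int)
  have cr: "continuous_map (subtopology X (U \<inter> Ue)) euclidean r"
    unfolding r_def using w(2) Fr_cont[OF e(1) j(1)]
    by (intro continuous_map_residual) (auto intro: continuous_map_from_subtopology_mono)
  define V where "V = {x \<in> topspace (subtopology X (U \<inter> Ue)). r x \<in> - {0}}"
  have "openin (subtopology X (U \<inter> Ue)) V"
    unfolding V_def by (rule openin_continuous_map_preimage[OF cr]) (simp add: open_Compl)
  then have V: "openin X V" using UU openin_trans_full by blast
  have VU: "V \<subseteq> U \<inter> Ue" and rV: "\<And>x. x \<in> V \<Longrightarrow> r x \<noteq> 0" by (auto simp: V_def)
  have "x0 \<in> V" using j(2) U e(2) x0 by (simp add: V_def r_def)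
  moreover have "oframe (Suc p) V (w(p := \<lambda>x. r x /\<^sub>R norm (r x)))"
    unfolding oframe_def
  proof (intro conjI V allI impI ballI)
    fix i assume "i < Suc p"
    then show "continuous_map (subtopology X V) euclidean ((w(p := \<lambda>x. r x /\<^sub>R norm (r x))) i)"
    proof (cases "i = p")
      case True
      have "continuous_map (subtopology X V) euclidean r" using cr VU by (rule continuous_map_from_subtopology_mono)
      then have "continuous_map (subtopology X V) euclidean (\<lambda>x. r x /\<^sub>R norm (r x))"
        by (rule continuous_map_normalize) (use rV in auto)
      then show ?thesis using True by simp
    next
      case False
      then have "continuous_map (subtopology X U) euclidean (w i)" using w(2) \<open>i < Suc p\<close> by auto
      then show ?thesis using False VU by (auto intro: continuous_map_from_subtopology_mono[of X U])
    qed
  next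
    fix x assume x: "x \<in> V"
    then have xU: "x \<in> U" "x \<in> Ue" "x \<in> topspace X" using VU UX by auto
    have ow: "orthonormal p (\<lambda>i. w i x)" using w(3) xU by blast
    have "orthonormal (Suc p) ((\<lambda>i. w i x)(p := r x /\<^sub>R norm (r x)))"
      by (rule orthonormal_extend[OF ow rV[OF x]]) (simp add: r_def residual_orthogonal[OF ow])
    moreover have "(\<lambda>i. (w(p := \<lambda>x. r x /\<^sub>R norm (r x))) i x) = (\<lambda>i. w i x)(p := r x /\<^sub>R norm (r x))" by auto
    ultimately show "orthonormal (Suc p) (\<lambda>i. (w(p := \<lambda>x. r x /\<^sub>R norm (r x))) i x)" by simp
    have "e j x \<in> fib x" unfolding fib_eq[OF e(1) xU(2)] by (rule fspan_base[OF j(1), of "\<lambda>j. e j x"])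
    then have "r x \<in> fib x" unfolding r_def using w(3) xU
      by (intro subspace_diff[OF fib_subspace] subspace_sum[OF fib_subspace] subspace_scale[OF fib_subspace]) auto
    then show "(w(p := \<lambda>x. r x /\<^sub>R norm (r x))) i x \<in> fib x" if "i < Suc p" for i
      using that w(3) xU subspace_scale[OF fib_subspace] by (auto simp: less_Suc_eq)
  next
    fix i assume "i < k"
    then show "(w(p := \<lambda>x. r x /\<^sub>R norm (r x))) i = s i" using w(4) step.hyps by auto
  qed
  ultimately show ?case by blast
qed

text \<open>If the sign is wrong, the last vector is reversed. Since \<open>k < d\<close>, its index
  \<open>d - 1\<close> is not among those of the prescribed sections. By continuity of the
  determinant the sign is then right on a neighbourhood.\<close>

lemma ex_pos_oframe:
  assumes x0: "x0 \<in> topspace X"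
  shows "\<exists>U w. x0 \<in> U \<and> oframe d U w \<and> (\<forall>x\<in>U. pos x (\<lambda>i. w i x))"
proof -
  obtain U w where U: "x0 \<in> U" and fr: "oframe d U w" using ex_oframe[OF x0, of d] kd by auto
  have w: "openin X U" "\<forall>i<d. continuous_map (subtopology X U) euclidean (w i)"
    "\<forall>x\<in>U. orthonormal d (\<lambda>i. w i x) \<and> (\<forall>i<d. w i x \<in> fib x)" "\<forall>i<k. w i = s i" using fr by (auto simp: oframe_def)
  have UX: "U \<subseteq> topspace X" using w(1) by (rule openin_subset)
  obtain Ue e where e: "(Ue, e) \<in> Fr" "x0 \<in> Ue" using Fr_cover[OF x0] by blast
  define D where "D x = dt d (\<lambda>i j. e i x \<bullet> w j x)" for x
  have D0: "D x0 \<noteq> 0" unfolding D_def using w(3) U by (intro dt_frame_nonzero[OF e]) auto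
  define \<sigma> where "\<sigma> = sgn (D x0)"
  have \<sigma>: "\<sigma> * D x0 > 0" "\<sigma> * \<sigma> = 1" using D0 by (auto simp: \<sigma>_def sgn_if)
  define w' where "w' = w(d - 1 := \<lambda>x. \<sigma> *\<^sub>R w (d - 1) x)"
  have w'x: "w' i x = (if i = d - 1 then \<sigma> else 1) *\<^sub>R w i x" for i x by (simp add: w'_def)
  have UU: "openin X (U \<inter> Ue)" using w(1) Fr_open[OF e(1)] by (rule openin_Int)
  have "continuous_map (subtopology X (U \<inter> Ue)) euclideanreal D"
    unfolding D_def
    by (intro continuous_map_dt continuous_map_inner; rule continuous_map_from_subtopology_mono)
      (use w(2) Fr_cont[OF e(1)] in auto)
  then have cD: "continuous_map (subtopology X (U \<inter> Ue)) euclideanreal (\<lambda>x. \<sigma> * D x)" by (intro continuous_intros)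
  define V where "V = {x \<in> topspace (subtopology X (U \<inter> Ue)). \<sigma> * D x \<in> {0<..}}"
  have "openin (subtopology X (U \<inter> Ue)) V"
    unfolding V_def by (rule openin_continuous_map_preimage[OF cD]) simp
  then have V: "openin X V" using UU openin_trans_full by blast
  have VU: "V \<subseteq> U \<inter> Ue" by (auto simp: V_def)
  have "x0 \<in> V" using \<sigma>(1) U e(2) x0 by (simp add: V_def)
  moreover have "oframe d V w'"
    unfolding oframe_def
  proof (intro conjI V allI impI ballI)
    fix i assume i: "i < d"
    have "continuous_map (subtopology X V) euclidean (w i)" using w(2) i VU by (auto intro: continuous_map_from_subtopology_mono[of X U])
    then have "continuous_map (subtopology X V) euclidean (\<lambda>x. (if i = d - 1 then \<sigma> else 1) *\<^sub>R w i x)"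
      by (intro continuous_map_scaleR) auto
    then show "continuous_map (subtopology X V) euclidean (w' i)" by (simp add: w'x[abs_def])
  next
    fix x assume x: "x \<in> V"
    have "orthonormal d (\<lambda>i. w i x)" using w(3) x VU by blast
    then show "orthonormal d (\<lambda>i. w' i x)" using \<sigma>(2) by (auto simp: orthonormal_def w'x)
    show "w' i x \<in> fib x" if "i < d" for i
      using w(3) x VU UX that by (auto simp: w'x intro!: subspace_scale[OF fib_subspace])
  next
    fix i assume "i < k"
    then show "w' i = s i" using w(4) kd by (auto simp: w'_def)
  qed
  moreover have "pos x (\<lambda>i. w' i x)" if x: "x \<in> V" for x
  proof (rule posI[OF e(1)])
    show "x \<in> Ue" using x VU by blast
    have "dt d (\<lambda>i j. e i x \<bullet> w' j x) = dt d (\<lambda>j i. (if j = d - 1 then \<sigma> else 1) * (e i x \<bullet> w j x))"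
      by (subst dt_transpose[symmetric], rule dt_cong) (auto simp: w'x)
    also have "\<dots> = (\<Prod>j<d. if j = d - 1 then \<sigma> else 1) * dt d (\<lambda>j i. e i x \<bullet> w j x)" by (rule dt_scale_rows)
    also have "dt d (\<lambda>j i. e i x \<bullet> w j x) = D x" unfolding D_def by (rule dt_transpose)
    also have "(\<Prod>j<d. if j = d - 1 then \<sigma> else 1) = \<sigma>" using kd by (simp add: prod.delta)
    finally show "dt d (\<lambda>i j. e i x \<bullet> w' j x) > 0" using x by (simp add: V_def)
  qed
  ultimately show ?thesis by blast
qed

end

section \<open>Coordinates of the ambient fibre\<close>

definition bas :: "nat \<Rightarrow> 'v::euclidean_space" where
  "bas = (SOME f. bij_betw f {..<DIM('v)} Basis)"

definition enc :: "'v::euclidean_space \<Rightarrow> nat \<Rightarrow> real" where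
  "enc v i = (if i < DIM('v) then v \<bullet> bas i else 0)"

definition dec :: "(nat \<Rightarrow> real) \<Rightarrow> 'v::euclidean_space" where
  "dec y = (\<Sum>i<DIM('v). y i *\<^sub>R bas i)"

lemma bij_bas: "bij_betw (bas :: nat \<Rightarrow> 'v) {..<DIM('v)} (Basis :: 'v::euclidean_space set)"
proof -
  have "\<exists>f. bij_betw f {..<DIM('v)} (Basis :: 'v set)"
    using ex_bij_betw_nat_finite[of "Basis :: 'v set"] by (simp add: atLeast0LessThan)
  then show ?thesis unfolding bas_def by (rule someI_ex)
qed

lemma dec_enc [simp]: "dec (enc v) = (v :: 'v::euclidean_space)"
proof -
  have "dec (enc v) = (\<Sum>i<DIM('v). (v \<bullet> bas i) *\<^sub>R (bas i :: 'v))" by (simp add: dec_def enc_def)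
  also have "\<dots> = (\<Sum>b\<in>Basis. (v \<bullet> b) *\<^sub>R b)" by (rule sum.reindex_bij_betw[OF bij_bas])
  finally show ?thesis by (simp add: euclidean_representation)
qed

lemma enc_add: "enc (v + w) = (\<lambda>i. enc v i + enc w i)"
  and enc_scale: "enc (c *\<^sub>R v) = (\<lambda>i. c * enc v i)"
  and enc_zero: "enc 0 = (\<lambda>_. 0)"
  by (auto simp: enc_def inner_add_left)

lemma continuous_map_enc:
  fixes f :: "'x \<Rightarrow> 'v::euclidean_space"
  assumes f: "continuous_map X euclidean f"
  shows "continuous_map X (powertop_real UNIV) (\<lambda>x. enc (f x))"
  unfolding continuous_map_componentwise_UNIV enc_def
proof
  fix i
  show "continuous_map X euclideanreal (\<lambda>x. if i < DIM('v) then f x \<bullet> bas i else 0)"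
    by (cases "i < DIM('v)") (simp_all add: continuous_map_inner[OF f])
qed

lemma continuous_map_dec:
  assumes "continuous_map X (powertop_real UNIV) f"
  shows "continuous_map X euclidean (\<lambda>x. dec (f x) :: 'v::euclidean_space)"
  unfolding dec_def using assms
  by (intro continuous_map_sum continuous_map_scaleR) (auto simp: continuous_map_componentwise_UNIV)

lemma sum_lessThan_add: "(\<Sum>i<k + n. f i) = (\<Sum>i<k. f i) + (\<Sum>i<n. f (k + i :: nat) :: 'a::comm_monoid_add)"
  by (induction n) (auto simp: add.assoc)

section \<open>The complementary bundle and its orientation\<close>

context framed_subfamily
begin

definition compl_fib :: "'x \<Rightarrow> 'v set" where
  "compl_fib x = {v \<in> fib x. \<forall>i<k. v \<bullet> s i x = 0}"

text \<open>The type of the total space does not mention \<open>'v\<close>, hence the encoding by coordinates.\<close>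

definition xi :: "('x, 'x \<times> (nat \<Rightarrow> real)) vector_bundle" where
  "xi = \<lparr>
     total = subtopology (prod_topology X (powertop_real UNIV)) {(x, y). \<exists>v\<in>compl_fib x. y = enc v},
     bproj = fst,
     fadd = (\<lambda>(x, v) (y, w). (x, \<lambda>i. v i + w i)),
     fscale = (\<lambda>c (x, v). (x, \<lambda>i. c * v i)),
     fzero = (\<lambda>x. (x, \<lambda>_. 0))\<rparr>"

definition chart :: "(nat \<Rightarrow> 'x \<Rightarrow> 'v) \<Rightarrow> 'x \<times> (nat \<Rightarrow> real) \<Rightarrow> 'x \<times> (nat \<Rightarrow> real)" where
  "chart w p = (fst p, enc (\<Sum>i<d - k. snd p i *\<^sub>R w (k + i) (fst p)))"

definition coord :: "(nat \<Rightarrow> 'x \<Rightarrow> 'v) \<Rightarrow> 'x \<times> (nat \<Rightarrow> real) \<Rightarrow> 'x \<times> (nat \<Rightarrow> real)" where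
  "coord w p = (fst p, \<lambda>i. if i < d - k then dec (snd p) \<bullet> w (k + i) (fst p) else 0)"

lemma topspace_xi: "topspace (total xi) = {(x, enc v) | x v. x \<in> topspace X \<and> v \<in> compl_fib x}"
  by (auto simp: xi_def)

lemma oframeD:
  assumes "oframe d U w"
  shows "openin X U" "\<And>i. i < d \<Longrightarrow> continuous_map (subtopology X U) euclidean (w i)"
    "\<And>x. x \<in> U \<Longrightarrow> orthonormal d (\<lambda>i. w i x)" "\<And>x i. x \<in> U \<Longrightarrow> i < d \<Longrightarrow> w i x \<in> fib x"
    "\<And>i. i < k \<Longrightarrow> w i = s i" "\<And>x. x \<in> U \<Longrightarrow> x \<in> topspace X"
  using assms openin_subset by (auto simp: oframe_def)

lemma coord_chart:
  assumes w: "oframe d U w" and x: "x \<in> U" and y: "y \<in> topspace (Euclidean_space (d - k))"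
  shows "coord w (chart w (x, y)) = (x, y)"
proof -
  have "(\<Sum>j<d - k. y j *\<^sub>R w (k + j) x) \<bullet> w (k + i) x = y i" if i: "i < d - k" for i
    by (rule inner_sum_orthonormal[of "d - k" "\<lambda>i. w (k + i) x"])
      (use oframeD(3)[OF w x] i in \<open>auto simp: orthonormal_def\<close>)
  then show ?thesis using y by (auto simp: coord_def chart_def topspace_Euclidean_space)
qed

lemma chart_coord:
  assumes w: "oframe d U w" and x: "x \<in> U" and v: "v \<in> compl_fib x"
  shows "chart w (coord w (x, enc v)) = (x, enc v)"
proof -
  have "v = (\<Sum>i<d. (v \<bullet> w i x) *\<^sub>R w i x)"
    using oframeD[OF w] x v by (intro fib_orthonormal_spans) (auto simp: compl_fib_def)
  also have "\<dots> = (\<Sum>i<k. (v \<bullet> w i x) *\<^sub>R w i x) + (\<Sum>i<d - k. (v \<bullet> w (k + i) x) *\<^sub>R w (k + i) x)"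
    using sum_lessThan_add[of _ k "d - k"] kd by simp
  also have "(\<Sum>i<k. (v \<bullet> w i x) *\<^sub>R w i x) = 0"
    using v oframeD(5)[OF w] by (intro sum.neutral) (auto simp: compl_fib_def)
  finally show ?thesis by (simp add: chart_def coord_def)
qed

lemma chart_in:
  assumes w: "oframe d U w" and x: "x \<in> U"
  shows "(\<Sum>i<d - k. y i *\<^sub>R w (k + i) x) \<in> compl_fib x"
  unfolding compl_fib_def
proof (intro CollectI conjI allI impI)
  show "(\<Sum>i<d - k. y i *\<^sub>R w (k + i) x) \<in> fib x"
    using oframeD[OF w] x by (intro subspace_sum[OF fib_subspace] subspace_scale[OF fib_subspace]) auto
  fix j assume j: "j < k"
  have "w (k + i) x \<bullet> s j x = 0" if "i < d - k" for i
    using orthonormalD[OF oframeD(3)[OF w x], of "k + i" j] oframeD(5)[OF w j] that j kd by simp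
  then show "(\<Sum>i<d - k. y i *\<^sub>R w (k + i) x) \<bullet> s j x = 0" by (simp add: inner_sum_left)
qed

lemma homeomorphic_chart:
  assumes w: "oframe d U w"
  shows "homeomorphic_maps (prod_topology (subtopology X U) (Euclidean_space (d - k)))
     (subtopology (total xi) {e \<in> topspace (total xi). bproj xi e \<in> U}) (chart w) (coord w)"
  unfolding homeomorphic_maps_def
proof (intro conjI ballI)
  let ?D = "prod_topology (subtopology X U) (Euclidean_space (d - k))"
  let ?R = "subtopology (total xi) {e \<in> topspace (total xi). bproj xi e \<in> U}"
  have UX: "U \<subseteq> topspace X" using oframeD(6)[OF w] by blast
  have cw: "continuous_map ?D euclidean (\<lambda>p. w (k + i) (fst p))" if "i < d - k" for i
    using continuous_map_compose[OF continuous_map_fst[of "subtopology X U" "Euclidean_space (d - k)"] oframeD(2)[OF w, of "k + i"]] that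
    by (simp add: o_def)
  have "continuous_map (Euclidean_space (d - k)) euclideanreal (\<lambda>y. y i)" for i
    unfolding Euclidean_space_def by (intro continuous_map_from_subtopology continuous_map_product_projection) simp
  from continuous_map_compose[OF continuous_map_snd this]
  have cy: "continuous_map ?D euclideanreal (\<lambda>p. snd p i)" for i by (simp add: o_def)
  have "continuous_map ?D X fst"
    using continuous_map_fst[of "subtopology X U" "Euclidean_space (d - k)"] by (simp add: continuous_map_in_subtopology)
  moreover have "continuous_map ?D (powertop_real UNIV) (\<lambda>p. enc (\<Sum>i<d - k. snd p i *\<^sub>R w (k + i) (fst p)))"
    by (intro continuous_map_enc continuous_map_sum continuous_map_scaleR cw cy) auto
  ultimately have "continuous_map ?D (prod_topology X (powertop_real UNIV)) (chart w)"
    unfolding chart_def[abs_def] by (intro continuous_map_pairedI)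
  moreover have "chart w p \<in> {(x, y). \<exists>v\<in>compl_fib x. y = enc v} \<and> bproj xi (chart w p) \<in> U \<and> fst (chart w p) \<in> topspace X"
    if "p \<in> topspace ?D" for p
    using that chart_in[OF w, of "fst p" "snd p"] UX by (auto simp: chart_def xi_def)
  ultimately show "continuous_map ?D ?R (chart w)"
    by (auto simp: continuous_map_in_subtopology xi_def Pi_iff mem_Times_iff)
  have R: "?R = subtopology (prod_topology X (powertop_real UNIV)) ({(x, y). \<exists>v\<in>compl_fib x. y = enc v} \<inter> {e. fst e \<in> U \<and> fst e \<in> topspace X})"
    by (simp add: xi_def subtopology_subtopology) (intro arg_cong2[of _ _ _ _ subtopology] refl; auto)
  have f: "continuous_map ?R (subtopology X U) fst"
    unfolding R continuous_map_in_subtopology by (auto intro: continuous_map_from_subtopology continuous_map_fst)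
  have g: "continuous_map ?R (powertop_real UNIV) snd"
    unfolding R by (intro continuous_map_from_subtopology continuous_map_snd)
  have wf: "continuous_map ?R euclidean (\<lambda>p. w (k + i) (fst p))" if "i < d - k" for i
    using continuous_map_compose[OF f oframeD(2)[OF w, of "k + i"]] that by (simp add: o_def)
  have "continuous_map ?R euclideanreal (\<lambda>p. dec (snd p) \<bullet> w (k + i) (fst p))" if "i < d - k" for i
    by (intro continuous_map_inner continuous_map_dec g wf that)
  then have "continuous_map ?R (Euclidean_space (d - k)) (\<lambda>p i. if i < d - k then dec (snd p) \<bullet> w (k + i) (fst p) else 0)"
    by (simp add: continuous_map_componentwise_Euclidean_space)
  then show "continuous_map ?R ?D (coord w)"
    unfolding coord_def[abs_def] by (intro continuous_map_pairedI f)
  show "coord w (chart w p) = p" if "p \<in> topspace ?D" for p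
    using coord_chart[OF w, of "fst p" "snd p"] that by auto
  show "chart w (coord w p) = p" if p: "p \<in> topspace ?R" for p
  proof -
    obtain x v where "p = (x, enc v)" "v \<in> compl_fib x" "x \<in> U" using p by (auto simp: xi_def)
    then show ?thesis using chart_coord[OF w] by simp
  qed
qed

lemma local_triv_chart:
  assumes w: "oframe d U w"
  shows "local_triv X xi (d - k) U (chart w)"
  unfolding local_triv_def
proof (intro conjI ballI allI)
  show "openin X U" by (rule oframeD(1)[OF w])
  show "homeomorphic_map (prod_topology (subtopology X U) (Euclidean_space (d - k)))
     (subtopology (total xi) {e \<in> topspace (total xi). bproj xi e \<in> U}) (chart w)"
    using homeomorphic_chart[OF w] homeomorphic_maps_map by blast
qed (auto simp: chart_def xi_def enc_zero enc_add[symmetric] enc_scale[symmetric] scaleR_add_left sum.distrib scaleR_sum_right)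

definition xi_or :: "('x set \<times> ('x \<times> (nat \<Rightarrow> real) \<Rightarrow> 'x \<times> (nat \<Rightarrow> real))) set" where
  "xi_or = {(U, chart w) | U w. oframe d U w \<and> (\<forall>x\<in>U. pos x (\<lambda>i. w i x))}"

text \<open>The entries of the transition matrix are inner products of the frame vectors from index
  \<open>k\<close> on. Adjoining the common first \<open>k\<close> vectors gives a block triangular
  matrix with the same determinant, to which \<open>pos_change\<close> applies.\<close>

lemma transition_positive:
  assumes w: "oframe d U w" "x \<in> U" "pos x (\<lambda>i. w i x)" and w': "oframe d V w'" "x \<in> V" "pos x (\<lambda>i. w' i x)"
  shows "Determinant.det (transition_matrix (d - k) V (chart w') (chart w) x) > 0"
proof -
  let ?n = "d - k"
  have inj: "inj_on (chart w') (V \<times> topspace (Euclidean_space ?n))"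
  proof (rule inj_on_inverseI)
    fix p assume "p \<in> V \<times> topspace (Euclidean_space ?n)"
    then show "coord w' (chart w' p) = p" using coord_chart[OF w'(1), of "fst p" "snd p"] by (cases p) simp
  qed
  have e: "inv_into (V \<times> topspace (Euclidean_space ?n)) (chart w') (chart w (x, \<lambda>l. if l = j then 1 else 0))
      = (x, \<lambda>i. if i < ?n then w (k + j) x \<bullet> w' (k + i) x else 0)" if j: "j < ?n" for j
  proof (rule inv_into_f_eq[OF inj])
    have c: "chart w (x, \<lambda>l. if l = j then 1 else 0) = (x, enc (w (k + j) x))"
      using j by (simp add: chart_def if_distrib[of "\<lambda>c. c *\<^sub>R _"] cong: if_cong)
    have "w (k + j) x \<in> compl_fib x" using chart_in[OF w(1,2), of "\<lambda>l. if l = j then 1 else 0"] j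
      by (simp add: if_distrib[of "\<lambda>c. c *\<^sub>R _"] cong: if_cong)
    from chart_coord[OF w'(1,2) this]
    show "chart w' (x, \<lambda>i. if i < ?n then w (k + j) x \<bullet> w' (k + i) x else 0) = chart w (x, \<lambda>l. if l = j then 1 else 0)"
      by (simp add: c coord_def cong: if_cong)
  qed (use w'(2) in \<open>auto simp: topspace_Euclidean_space\<close>)
  have "Determinant.det (transition_matrix ?n V (chart w') (chart w) x)
      = dt ?n (\<lambda>i j. snd (inv_into (V \<times> topspace (Euclidean_space ?n)) (chart w') (chart w (x, \<lambda>l. if l = j then 1 else 0))) i)"
    by (simp add: transition_matrix_def dt_def)
  also have "\<dots> = dt ?n (\<lambda>i j. w' (k + i) x \<bullet> w (k + j) x)"
    by (rule dt_cong) (simp add: e inner_commute)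
  also have "\<dots> = dt (k + ?n) (\<lambda>i j. w' i x \<bullet> w j x)"
  proof (rule dt_block[symmetric])
    fix i j assume "i < k" "j < k + ?n"
    then show "w' i x \<bullet> w j x = (if i = j then 1 else 0)"
      using orthonormalD[OF oframeD(3)[OF w(1,2)], of i j] oframeD(5)[OF w(1)] oframeD(5)[OF w'(1)] kd by simp
  qed
  also have "k + ?n = d" using kd by simp
  also have "dt d (\<lambda>i j. w' i x \<bullet> w j x) > 0"
    using oframeD[OF w(1)] oframeD[OF w'(1)] w w' by (intro pos_change[of x]) auto
  finally show ?thesis .
qed

lemma oriented_xi: "oriented_vector_bundle X xi (d - k) xi_or"
  unfolding oriented_vector_bundle_def real_vector_bundle_def bundle_orientation_def
proof (intro conjI ballI)
  show "continuous_map (total xi) X (bproj xi)"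
    by (simp add: xi_def continuous_map_from_subtopology continuous_map_fst)
  show "\<exists>U \<phi>. x \<in> U \<and> local_triv X xi (d - k) U \<phi>" if "x \<in> topspace X" for x
    using ex_pos_oframe[OF that] local_triv_chart by blast
  show "case p of (U, \<phi>) \<Rightarrow> local_triv X xi (d - k) U \<phi>" if "p \<in> xi_or" for p
    using that local_triv_chart by (auto simp: xi_or_def)
  show "(\<Union>(U, \<phi>)\<in>xi_or. U) = topspace X"
  proof
    show "(\<Union>(U, \<phi>)\<in>xi_or. U) \<subseteq> topspace X" using oframeD(6) by (auto simp: xi_or_def)
    show "topspace X \<subseteq> (\<Union>(U, \<phi>)\<in>xi_or. U)"
    proof
      fix x assume "x \<in> topspace X"
      from ex_pos_oframe[OF this] obtain U w where "x \<in> U" "oframe d U w" "\<forall>x\<in>U. pos x (\<lambda>i. w i x)" by blast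
      then have "(U, chart w) \<in> xi_or" "x \<in> U" by (auto simp: xi_or_def)
      then show "x \<in> (\<Union>(U, \<phi>)\<in>xi_or. U)" by blast
    qed
  qed
  fix p assume "p \<in> xi_or"
  then obtain U w where p: "p = (U, chart w)" "oframe d U w" "\<forall>x\<in>U. pos x (\<lambda>i. w i x)" by (auto simp: xi_or_def)
  show "case p of (U, \<phi>) \<Rightarrow> \<forall>(V, \<psi>)\<in>xi_or. \<forall>x\<in>U \<inter> V. 0 < Determinant.det (transition_matrix (d - k) V \<psi> \<phi> x)"
  proof (simp only: p(1) prod.case, intro ballI, clarify)
    fix V \<psi> x assume "(V, \<psi>) \<in> xi_or" and x: "x \<in> U" "x \<in> V"
    then obtain w' where w': "\<psi> = chart w'" "oframe d V w'" "\<forall>x\<in>V. pos x (\<lambda>i. w' i x)" by (auto simp: xi_or_def)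
    show "0 < Determinant.det (transition_matrix (d - k) V \<psi> (chart w) x)"
      unfolding w'(1) using p w' x by (intro transition_positive) auto
  qed
qed

section \<open>The orthogonal splitting\<close>

definition Etop :: "('x \<times> 'v) topology" where
  "Etop = subtopology (prod_topology X euclidean) {(x, v). v \<in> fib x}"

definition split :: "'x \<times> 'v \<Rightarrow> ('x \<times> (nat \<Rightarrow> real)) \<times> 'x \<times> (nat \<Rightarrow> real)" where
  "split p = ((fst p, enc (snd p - (\<Sum>i<k. (snd p \<bullet> s i (fst p)) *\<^sub>R s i (fst p)))),
     (fst p, \<lambda>i. if i < k then snd p \<bullet> s i (fst p) else 0))"

definition unsplit :: "('x \<times> (nat \<Rightarrow> real)) \<times> 'x \<times> (nat \<Rightarrow> real) \<Rightarrow> 'x \<times> 'v" where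
  "unsplit q = (fst (fst q), dec (snd (fst q)) + (\<Sum>i<k. snd (snd q) i *\<^sub>R s i (fst (fst q))))"

lemma topspace_Etop: "topspace Etop = {(x, v). x \<in> topspace X \<and> v \<in> fib x}"
  by (auto simp: Etop_def)

lemma homeomorphic_split:
  "homeomorphic_maps Etop (total (whitney_sum xi (trivial_bundle X k))) split unsplit"
  unfolding homeomorphic_maps_def
proof (intro conjI ballI)
  let ?W = "total (whitney_sum xi (trivial_bundle X k))"
  have W: "?W = subtopology (prod_topology (total xi) (prod_topology X (Euclidean_space k))) {(e, f). fst e = fst f}"
    by (simp add: whitney_sum_def trivial_bundle_def xi_def)
  have f: "continuous_map Etop X fst" and g: "continuous_map Etop euclidean snd"
    unfolding Etop_def by (intro continuous_map_from_subtopology continuous_map_fst continuous_map_snd)+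
  have sf: "continuous_map Etop euclidean (\<lambda>p. s i (fst p))" if "i < k" for i
    using continuous_map_compose[OF f s_cont[OF that]] by (simp add: o_def)
  have c1: "continuous_map Etop (powertop_real UNIV) (\<lambda>p. enc (snd p - (\<Sum>i<k. (snd p \<bullet> s i (fst p)) *\<^sub>R s i (fst p))))"
    by (intro continuous_map_enc continuous_map_residual g sf)
  have "continuous_map Etop euclideanreal (\<lambda>p. snd p \<bullet> s i (fst p))" if "i < k" for i
    by (intro continuous_map_inner g sf that)
  then have c2: "continuous_map Etop (Euclidean_space k) (\<lambda>p i. if i < k then snd p \<bullet> s i (fst p) else 0)"
    by (simp add: continuous_map_componentwise_Euclidean_space)
  have res: "v - (\<Sum>i<k. (v \<bullet> s i x) *\<^sub>R s i x) \<in> compl_fib x" if "x \<in> topspace X" "v \<in> fib x" for x v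
    unfolding compl_fib_def using that s_fib residual_orthogonal[OF s_orth[OF that(1)]]
    by (auto intro!: subspace_diff[OF fib_subspace] subspace_sum[OF fib_subspace] subspace_scale[OF fib_subspace])
  have "continuous_map Etop (total xi) (\<lambda>p. (fst p, enc (snd p - (\<Sum>i<k. (snd p \<bullet> s i (fst p)) *\<^sub>R s i (fst p)))))"
    using continuous_map_pairedI[OF f c1] res
    by (auto simp: xi_def continuous_map_in_subtopology Pi_iff topspace_Etop)
  then have "continuous_map Etop (prod_topology (total xi) (prod_topology X (Euclidean_space k))) split"
    unfolding split_def[abs_def] by (intro continuous_map_pairedI f c2)
  then show "continuous_map Etop ?W split"
    unfolding W by (simp add: continuous_map_in_subtopology split_def)
  let ?A = "prod_topology (total xi) (prod_topology X (Euclidean_space k))"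
  have t: "continuous_map (total xi) X fst" "continuous_map (total xi) (powertop_real UNIV) snd"
    by (simp_all add: xi_def continuous_map_from_subtopology continuous_map_fst continuous_map_snd)
  have a1: "continuous_map ?A X (\<lambda>q. fst (fst q))"
    using continuous_map_compose[OF continuous_map_fst t(1)] by (simp add: o_def)
  have a2: "continuous_map ?A (powertop_real UNIV) (\<lambda>q. snd (fst q))"
    using continuous_map_compose[OF continuous_map_fst t(2)] by (simp add: o_def)
  have "continuous_map (Euclidean_space k) euclideanreal (\<lambda>y. y i)" for i
    unfolding Euclidean_space_def by (intro continuous_map_from_subtopology continuous_map_product_projection) simp
  then have "continuous_map ?A euclideanreal ((\<lambda>y. y i) \<circ> (snd \<circ> snd))" for i
    by (intro continuous_map_compose[of _ "Euclidean_space k"] continuous_map_compose[of _ "prod_topology X (Euclidean_space k)"]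
        continuous_map_snd)
  then have a3: "continuous_map ?A euclideanreal (\<lambda>q. snd (snd q) i)" for i by (simp add: o_def)
  have a4: "continuous_map ?A euclidean (\<lambda>q. s i (fst (fst q)))" if "i < k" for i
    using continuous_map_compose[OF a1 s_cont[OF that]] by (simp add: o_def)
  have "continuous_map ?A euclidean (\<lambda>q. dec (snd (fst q)) + (\<Sum>i<k. snd (snd q) i *\<^sub>R s i (fst (fst q))))"
    by (intro continuous_map_add continuous_map_dec continuous_map_sum continuous_map_scaleR a2 a3 a4) auto
  then have "continuous_map ?A (prod_topology X euclidean) unsplit"
    unfolding unsplit_def[abs_def] by (intro continuous_map_pairedI a1)
  then have "continuous_map ?W (prod_topology X euclidean) unsplit"
    unfolding W by (rule continuous_map_from_subtopology)
  moreover have "snd (unsplit q) \<in> fib (fst (unsplit q))" if q: "q \<in> topspace ?W" for q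
  proof -
    obtain x v where "fst q = (x, enc v)" "x \<in> topspace X" "v \<in> compl_fib x"
      using q by (cases q) (auto simp: W topspace_xi)
    then show ?thesis using s_fib
      by (auto simp: unsplit_def compl_fib_def intro!: subspace_add[OF fib_subspace] subspace_sum[OF fib_subspace] subspace_scale[OF fib_subspace])
  qed
  ultimately show "continuous_map ?W Etop unsplit"
    unfolding Etop_def by (simp add: continuous_map_in_subtopology Pi_iff case_prod_beta)
  show "unsplit (split p) = p" if "p \<in> topspace Etop" for p
    by (simp add: split_def unsplit_def)
  show "split (unsplit q) = q" if q: "q \<in> topspace ?W" for q
  proof -
    obtain x v u where e: "q = ((x, enc v), (x, u))" "x \<in> topspace X" "v \<in> compl_fib x" "u \<in> topspace (Euclidean_space k)"
      using q by (cases q) (auto simp: W topspace_xi)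
    have "(v + (\<Sum>i<k. u i *\<^sub>R s i x)) \<bullet> s j x = u j" if "j < k" for j
      using e(3) that inner_sum_orthonormal[OF s_orth[OF e(2)] that] by (simp add: inner_add_left compl_fib_def)
    then show ?thesis using e(4) by (auto simp: e(1) split_def unsplit_def topspace_Euclidean_space)
  qed
qed

lemma split_add: "split (x, v + w) = fadd (whitney_sum xi (trivial_bundle X k)) (split (x, v)) (split (x, w))"
proof -
  have "v + w - (\<Sum>i<k. ((v + w) \<bullet> s i x) *\<^sub>R s i x) =
    (v - (\<Sum>i<k. (v \<bullet> s i x) *\<^sub>R s i x)) + (w - (\<Sum>i<k. (w \<bullet> s i x) *\<^sub>R s i x))"
    by (simp add: inner_add_left scaleR_add_left sum.distrib)
  then have "split (x, v + w) = ((x, \<lambda>i. enc (v - (\<Sum>i<k. (v \<bullet> s i x) *\<^sub>R s i x)) i + enc (w - (\<Sum>i<k. (w \<bullet> s i x) *\<^sub>R s i x)) i),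
      (x, \<lambda>i. if i < k then v \<bullet> s i x + w \<bullet> s i x else 0))"
    by (simp only: split_def fst_conv snd_conv enc_add inner_add_left)
  then show ?thesis
    by (auto simp: split_def whitney_sum_def xi_def trivial_bundle_def)
qed

lemma split_scale: "split (x, c *\<^sub>R v) = fscale (whitney_sum xi (trivial_bundle X k)) c (split (x, v))"
proof -
  have "c *\<^sub>R v - (\<Sum>i<k. ((c *\<^sub>R v) \<bullet> s i x) *\<^sub>R s i x) = c *\<^sub>R (v - (\<Sum>i<k. (v \<bullet> s i x) *\<^sub>R s i x))"
    by (simp add: scaleR_diff_right scaleR_sum_right)
  then have "split (x, c *\<^sub>R v) = ((x, \<lambda>i. c * enc (v - (\<Sum>i<k. (v \<bullet> s i x) *\<^sub>R s i x)) i),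
      (x, \<lambda>i. if i < k then c * (v \<bullet> s i x) else 0))"
    by (simp only: split_def fst_conv snd_conv enc_scale inner_scaleR_left)
  then show ?thesis
    by (auto simp: split_def whitney_sum_def xi_def trivial_bundle_def)
qed

text \<open>\<open>F\<close> enters only through a fibrewise linear homeomorphism from
  \<open>Etop\<close>. Along it the orthogonal splitting and the sections \<open>s\<close> are
  transported to \<open>F\<close>; orthonormality makes the latter independent.\<close>

lemma split_conclusion:
  assumes h: "homeomorphic_maps Etop (total F) h h'"
    and proj: "\<And>x v. (x, v) \<in> topspace Etop \<Longrightarrow> bproj F (h (x, v)) = x"
    and add: "\<And>x v w. (x, v) \<in> topspace Etop \<Longrightarrow> (x, w) \<in> topspace Etop \<Longrightarrow> fadd F (h (x, v)) (h (x, w)) = h (x, v + w)"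
    and scale: "\<And>x v c. (x, v) \<in> topspace Etop \<Longrightarrow> fscale F c (h (x, v)) = h (x, c *\<^sub>R v)"
    and zero: "\<And>x. x \<in> topspace X \<Longrightarrow> fzero F x = h (x, 0)"
  shows "bundle_isomorphic F (whitney_sum xi (trivial_bundle X k))"
    and "\<exists>\<sigma>. (\<forall>i<k. bundle_section X F (\<sigma> i)) \<and> (\<forall>x\<in>topspace X. fibre_lin_indep F x (\<lambda>i. \<sigma> i x) k)"
proof -
  let ?W = "whitney_sum xi (trivial_bundle X k)"
  have ch: "continuous_map Etop (total F) h" and ch': "continuous_map (total F) Etop h'"
    and hh_all: "\<forall>p\<in>topspace Etop. h' (h p) = p" "\<forall>e\<in>topspace (total F). h (h' e) = e"
    using h by (simp_all add: homeomorphic_maps_def)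
  have hh: "h' (h p) = p" if "p \<in> topspace Etop" for p using hh_all(1) that by (rule bspec)
  have hh': "h (h' e) = e" "h' e \<in> topspace Etop" if "e \<in> topspace (total F)" for e
    using bspec[OF hh_all(2) that] continuous_map_image_subset_topspace[OF ch'] that by (simp, blast)
  have Eadd: "(x, v + w) \<in> topspace Etop" if "(x, v) \<in> topspace Etop" "(x, w) \<in> topspace Etop" for x v w
    using that subspace_add[OF fib_subspace] by (auto simp: topspace_Etop)
  have Escale: "(x, c *\<^sub>R v) \<in> topspace Etop" if "(x, v) \<in> topspace Etop" for x c v
    using that subspace_scale[OF fib_subspace] by (auto simp: topspace_Etop)
  have "homeomorphic_maps (total F) (total ?W) (split \<circ> h') (h \<circ> unsplit)"
    by (rule homeomorphic_maps_compose, rule conjI[OF iffD1[OF homeomorphic_maps_sym h] homeomorphic_split])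
  then have "homeomorphic_map (total F) (total ?W) (split \<circ> h')" using homeomorphic_maps_map by blast
  moreover have "bproj ?W ((split \<circ> h') e) = bproj F e \<and>
        (\<forall>c. (split \<circ> h') (fscale F c e) = fscale ?W c ((split \<circ> h') e)) \<and>
        (\<forall>e'\<in>topspace (total F). bproj F e' = bproj F e \<longrightarrow>
           (split \<circ> h') (fadd F e e') = fadd ?W ((split \<circ> h') e) ((split \<circ> h') e'))"
    if e: "e \<in> topspace (total F)" for e
  proof (intro conjI allI ballI impI)
    obtain x v where xv: "h' e = (x, v)" by (cases "h' e")
    have E: "(x, v) \<in> topspace Etop" and he: "e = h (x, v)"
      using hh'[OF e] unfolding xv by simp_all
    show "bproj ?W ((split \<circ> h') e) = bproj F e"
      using proj[OF E] by (simp add: xv he[symmetric] whitney_sum_def split_def xi_def)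
    show "(split \<circ> h') (fscale F c e) = fscale ?W c ((split \<circ> h') e)" for c
      using scale[OF E] hh[OF Escale[OF E, of c]] xv by (simp add: he[symmetric] split_scale)
    fix e' assume e': "e' \<in> topspace (total F)" "bproj F e' = bproj F e"
    obtain y w where yw: "h' e' = (y, w)" by (cases "h' e'")
    have E': "(y, w) \<in> topspace Etop" and he': "e' = h (y, w)"
      using hh'[OF e'(1)] unfolding yw by simp_all
    have yx: "y = x" using proj[OF E] proj[OF E'] e'(2) he he' by simp
    show "(split \<circ> h') (fadd F e e') = fadd ?W ((split \<circ> h') e) ((split \<circ> h') e')"
      using add[OF E E'[unfolded yx]] hh[OF Eadd[OF E E'[unfolded yx]]] xv yw
      by (simp add: he[symmetric] he'[unfolded yx, symmetric] yx split_add)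
  qed
  ultimately show "bundle_isomorphic F ?W" unfolding bundle_isomorphic_def by blast
  define \<sigma> where "\<sigma> i x = h (x, s i x)" for i x
  have sE: "(x, s i x) \<in> topspace Etop" if "x \<in> topspace X" "i < k" for x i
    using that s_fib by (simp add: topspace_Etop)
  have "bundle_section X F (\<sigma> i)" if i: "i < k" for i
    unfolding bundle_section_def
  proof (intro conjI ballI)
    have "continuous_map X (prod_topology X euclidean) (\<lambda>x. (x, s i x))"
      using s_cont[OF i] by (intro continuous_map_pairedI) auto
    then have "continuous_map X Etop (\<lambda>x. (x, s i x))"
      using s_fib i by (auto simp: Etop_def continuous_map_in_subtopology)
    from continuous_map_compose[OF this ch] show "continuous_map X (total F) (\<sigma> i)"
      by (simp add: o_def \<sigma>_def[abs_def])
    show "bproj F (\<sigma> i x) = x" if "x \<in> topspace X" for x using proj[OF sE[OF that i]] by (simp add: \<sigma>_def)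
  qed
  moreover have "fibre_lin_indep F x (\<lambda>i. \<sigma> i x) k" if x: "x \<in> topspace X" for x
    unfolding fibre_lin_indep_def
  proof (intro allI impI)
    fix c j assume z: "fibre_lincomb F x c (\<lambda>i. \<sigma> i x) k = fzero F x" and j: "j < k"
    have E0: "(x, 0) \<in> topspace Etop" using subspace_0[OF fib_subspace[OF x]] x by (simp add: topspace_Etop)
    have "fibre_lincomb F x c (\<lambda>i. \<sigma> i x) n = h (x, \<Sum>i<n. c i *\<^sub>R s i x) \<and> (x, \<Sum>i<n. c i *\<^sub>R s i x) \<in> topspace Etop"
      if "n \<le> k" for n
      using that
    proof (induction n)
      case 0
      then show ?case using zero[OF x] E0 by simp
    next
      case (Suc n)
      have E: "(x, c n *\<^sub>R s n x) \<in> topspace Etop" using Escale[OF sE[OF x, of n]] Suc.prems by simp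
      have "(x, \<Sum>i<n. c i *\<^sub>R s i x) \<in> topspace Etop" using Suc by simp
      then show ?case using Suc scale[OF sE[OF x, of n], of "c n"] add[OF _ E] Eadd[OF _ E] by (simp add: \<sigma>_def)
    qed
    from this[OF order_refl] have "h (x, \<Sum>i<k. c i *\<^sub>R s i x) = h (x, 0)" "(x, \<Sum>i<k. c i *\<^sub>R s i x) \<in> topspace Etop"
      using z zero[OF x] by auto
    then have "(\<Sum>i<k. c i *\<^sub>R s i x) = 0" using hh E0 by (metis prod.inject)
    then show "c j = 0" using orthonormal_lin_indep[OF s_orth[OF x]] j unfolding lin_indep_def by blast
  qed
  ultimately show "\<exists>\<sigma>. (\<forall>i<k. bundle_section X F (\<sigma> i)) \<and> (\<forall>x\<in>topspace X. fibre_lin_indep F x (\<lambda>i. \<sigma> i x) k)" by blast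
qed

end

section \<open>The adjoint bundle over a sphere\<close>

lemma continuous_map_Pair:
  fixes f :: "'a \<Rightarrow> 'b::real_normed_vector" and g :: "'a \<Rightarrow> 'c::real_normed_vector"
  shows "continuous_map X euclidean f \<Longrightarrow> continuous_map X euclidean g \<Longrightarrow> continuous_map X euclidean (\<lambda>x. (f x, g x))"
  by (simp add: continuous_map_atin tendsto_Pair)

text \<open>\<open>g\<close> may be arbitrary outside \<open>V\<close>. It suffices that
  \<open>\<beta>\<close> vanishes on an open set which covers the space together with
  \<open>V\<close>.\<close>

lemma continuous_map_cutoff:
  fixes g :: "'a \<Rightarrow> 'b::real_normed_vector"
  assumes V: "openin Z V" and W: "openin Z W" and cover: "topspace Z \<subseteq> V \<union> W"
    and g: "continuous_map (subtopology Z V) euclidean g" and \<beta>: "continuous_map Z euclideanreal \<beta>"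
    and zero: "\<And>y. y \<in> W \<Longrightarrow> \<beta> y = 0"
  shows "continuous_map Z euclidean (\<lambda>y. \<beta> y *\<^sub>R g y)"
proof (rule continuous_map_locally)
  fix y assume y: "y \<in> topspace Z"
  have "continuous_map (subtopology Z V) euclidean (\<lambda>y. \<beta> y *\<^sub>R g y)"
    by (intro continuous_map_scaleR g continuous_map_from_subtopology \<beta>)
  moreover have "continuous_map (subtopology Z W) euclidean (\<lambda>y. \<beta> y *\<^sub>R g y)"
    by (rule continuous_map_eq[of _ _ "\<lambda>_. 0"]) (auto simp: zero)
  ultimately show "\<exists>U. openin Z U \<and> y \<in> U \<and> continuous_map (subtopology Z U) euclidean (\<lambda>y. \<beta> y *\<^sub>R g y)"
    using V W cover y by blast
qed

lemma inner_bas: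
  assumes "i < DIM('v)" "j < DIM('v)"
  shows "bas i \<bullet> (bas j :: 'v::euclidean_space) = (if i = j then 1 else 0)"
proof -
  have "bas i = (bas j :: 'v) \<longleftrightarrow> i = j" using bij_bas assms by (auto simp: bij_betw_def inj_on_def)
  moreover have "(bas i :: 'v) \<in> Basis" "(bas j :: 'v) \<in> Basis" using bij_bas assms by (auto simp: bij_betw_def)
  ultimately show ?thesis by (simp add: inner_Basis)
qed

lemma lin_indep_bas: "lin_indep DIM('v) (bas :: nat \<Rightarrow> 'v::euclidean_space)"
  by (rule orthonormal_lin_indep) (simp add: orthonormal_def inner_bas)

lemma sum_bas: "(\<Sum>i<DIM('v). (v \<bullet> bas i) *\<^sub>R bas i) = (v :: 'v::euclidean_space)"
  using dec_enc[of v] by (simp add: dec_def enc_def)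

text \<open>The determinant is multiplicative in \<open>g\<close>, hence never 0, and it is 1 at
  \<open>\<one>\<close>. A continuous function without zeros on a connected space keeps its
  sign.\<close>

lemma (in lie_chart) dt_a_pos:
  assumes conn: "connected_space T" and g: "g \<in> carrier G"
  shows "dt DIM('e) (\<lambda>i j. a g (bas j) \<bullet> bas i) > 0"
proof -
  define f where "f g = dt DIM('e) (\<lambda>i j. a g (bas j) \<bullet> bas i)" for g
  have f1: "f \<one> = 1"
    unfolding f_def by (rule dt_one) (simp add: a_one inner_bas eq_commute)
  have mult: "f (g \<otimes> h) = f g * f h" if g: "g \<in> carrier G" and h: "h \<in> carrier G" for g h
  proof -
    have "a (g \<otimes> h) (bas j) \<bullet> bas i = (\<Sum>l<DIM('e). (a g (bas l) \<bullet> bas i) * (a h (bas j) \<bullet> bas l))" for i j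
    proof -
      have "a (g \<otimes> h) (bas j) = a g (\<Sum>l<DIM('e). (a h (bas j) \<bullet> bas l) *\<^sub>R bas l)"
        unfolding sum_bas by (rule a_mult[OF g h])
      also have "\<dots> = (\<Sum>l<DIM('e). (a h (bas j) \<bullet> bas l) *\<^sub>R a g (bas l))"
        by (simp add: linear_sum[OF a_linear[OF g]] linear_scale[OF a_linear[OF g]])
      finally show ?thesis by (simp add: inner_sum_left mult.commute)
    qed
    then show ?thesis unfolding f_def dt_mult[symmetric] by simp
  qed
  have nz: "f g \<noteq> 0" if g: "g \<in> carrier G" for g
    using mult[OF g inv_closed[OF g]] f1 g by auto
  have cf: "continuous_map T euclideanreal f"
    unfolding f_def by (intro continuous_map_dt continuous_map_inner cont_a) simp
  let ?E1 = "{g \<in> topspace T. f g \<in> {0<..}}" and ?E2 = "{g \<in> topspace T. f g \<in> {..<0}}"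
  have o: "openin T ?E1" "openin T ?E2" by (rule openin_continuous_map_preimage[OF cf], simp)+
  have "\<one> \<in> ?E1" using f1 topspace_T by simp
  moreover have "topspace T \<subseteq> ?E1 \<union> ?E2" using nz topspace_T by (auto simp: linorder_neq_iff)
  moreover have "?E1 \<inter> ?E2 = {}" by auto
  ultimately have "?E2 = {}" using conn o unfolding connected_space_def by blast
  then have "\<not> f g < 0" using g topspace_T by auto
  then show ?thesis using nz[OF g] by (simp add: f_def linorder_neq_iff)
qed

section \<open>Gluing the two trivializations and the sections\<close>

locale adjoint_sphere = sphere_bundle G T \<psi> \<theta> U \<rho> C a m P \<pi> act
  for G :: "('g, 'u) monoid_scheme" (structure) and T :: "'g topology"
    and \<psi> :: "'g \<Rightarrow> 'e::euclidean_space" and \<theta> U \<rho> C a m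
    and P :: "'p topology" and \<pi> :: "'p \<Rightarrow> nat \<Rightarrow> real" and act +
  fixes A :: "('g, 'e) atlas" and J :: "'e \<Rightarrow> ('g \<Rightarrow> real) \<Rightarrow> real" and J'
    and sp sm :: "(nat \<Rightarrow> real) \<Rightarrow> 'p" and k :: nat and v S :: "nat \<Rightarrow> 'e"
  assumes connected_T: "connected_space T"
    and JJ': "homeomorphic_maps euclidean (lie_algebra_topology G T A) J J'"
    and J_add: "J (u + w) = (\<lambda>f. J u f + J w f)" and J_scale: "J (b *\<^sub>R u) = (\<lambda>f. b * J u f)"
    and Ad_J: "g \<in> carrier G \<Longrightarrow> Ad G g (J u) = J (a g u)"
    and sp: "continuous_map (subtopology (nsphere m) {x. - 1 / 2 < x m}) P sp"
    and sp_proj: "x \<in> topspace (nsphere m) \<Longrightarrow> - 1 / 2 < x m \<Longrightarrow> \<pi> (sp x) = x"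
    and sm: "continuous_map (subtopology (nsphere m) {x. x m < 1 / 2}) P sm"
    and sm_proj: "x \<in> topspace (nsphere m) \<Longrightarrow> x m < 1 / 2 \<Longrightarrow> \<pi> (sm x) = x"
    and k: "k < DIM('e)" and line: "line_frame k v S"
begin

abbreviation X :: "(nat \<Rightarrow> real) topology" where "X \<equiv> nsphere m"

text \<open>The sections \<open>sp\<close> and \<open>sm\<close> of \<open>P\<close> trivialize \<open>ad(P)\<close> over \<open>Up\<close> and \<open>Um\<close>. The cut-off functions
  \<open>b1\<close> and \<open>b2\<close> glue the two trivializations to an embedding of \<open>ad(P)\<close> into the trivial bundle with
  fibre \<open>'e \<times> 'e\<close>, which is \<open>ip\<close> or \<open>im\<close> in terms of the one or the other trivialization. They vanish
  before the boundary of the domain of \<open>c\<close> is reached.\<close>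

definition c :: "(nat \<Rightarrow> real) \<Rightarrow> 'g" where "c x = tr (sp x) (sm x)"
definition b1 :: "(nat \<Rightarrow> real) \<Rightarrow> real" where "b1 x = min 1 (max 0 (1 + 4 * x m))"
definition b2 :: "(nat \<Rightarrow> real) \<Rightarrow> real" where "b2 x = min 1 (max 0 (1 - 4 * x m))"
definition tt :: "(nat \<Rightarrow> real) \<Rightarrow> real" where "tt x = min 1 (max 0 (4 * x m))"
definition ip :: "(nat \<Rightarrow> real) \<Rightarrow> 'e \<Rightarrow> 'e \<times> 'e" where "ip x u = (b1 x *\<^sub>R u, b2 x *\<^sub>R a (inv (c x)) u)"
definition im :: "(nat \<Rightarrow> real) \<Rightarrow> 'e \<Rightarrow> 'e \<times> 'e" where "im x u = (b1 x *\<^sub>R a (c x) u, b2 x *\<^sub>R u)"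
definition Up where "Up = {x \<in> topspace X. - 1 / 4 < x m}"
definition Um where "Um = {x \<in> topspace X. x m < 1 / 4}"

lemma sp_closed: "x \<in> topspace X \<Longrightarrow> - 1 / 2 < x m \<Longrightarrow> sp x \<in> topspace P"
  using continuous_map_image_subset_topspace[OF sp] by auto

lemma sm_closed: "x \<in> topspace X \<Longrightarrow> x m < 1 / 2 \<Longrightarrow> sm x \<in> topspace P"
  using continuous_map_image_subset_topspace[OF sm] by auto

lemma c:
  assumes "x \<in> topspace X" "- 1 / 2 < x m" "x m < 1 / 2"
  shows "c x \<in> carrier G" "act (sp x) (c x) = sm x"
  unfolding c_def using tr[OF sp_closed sm_closed] assms by (simp_all add: sp_proj sm_proj)

lemma coord_cont: "continuous_map Z X f \<Longrightarrow> continuous_map Z euclideanreal (\<lambda>y. f y m)"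
  using continuous_map_compose[OF _ continuous_map_nsphere_projection[of m m], of Z f] by (simp add: o_def)

lemma coord_open:
  assumes f: "continuous_map Z X f" and "open W"
  shows "openin Z {y \<in> topspace Z. f y m \<in> W}"
  using openin_continuous_map_preimage[OF coord_cont[OF f], of W] assms(2) by simp

lemma fX: "continuous_map Z X f \<Longrightarrow> y \<in> topspace Z \<Longrightarrow> f y \<in> topspace X"
  using continuous_map_image_subset_topspace[of Z X f] by blast

lemma b_cont:
  assumes f: "continuous_map Z X f"
  shows "continuous_map Z euclideanreal (\<lambda>y. b1 (f y))" "continuous_map Z euclideanreal (\<lambda>y. b2 (f y))"
    "continuous_map Z euclideanreal (\<lambda>y. tt (f y))"
  unfolding b1_def b2_def tt_def
  by (intro continuous_map_real_min continuous_map_real_max continuous_intros coord_cont[OF f])+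

lemma sp_cont:
  assumes f: "continuous_map Z X f" "\<And>y. y \<in> topspace Z \<Longrightarrow> - 1 / 2 < f y m"
  shows "continuous_map Z P (\<lambda>y. sp (f y))"
proof -
  have "continuous_map Z (subtopology X {x. - 1 / 2 < x m}) f" using f by (auto simp: continuous_map_in_subtopology)
  from continuous_map_compose[OF this sp] show ?thesis by (simp add: o_def)
qed

lemma sm_cont:
  assumes f: "continuous_map Z X f" "\<And>y. y \<in> topspace Z \<Longrightarrow> f y m < 1 / 2"
  shows "continuous_map Z P (\<lambda>y. sm (f y))"
proof -
  have "continuous_map Z (subtopology X {x. x m < 1 / 2}) f" using f by (auto simp: continuous_map_in_subtopology)
  from continuous_map_compose[OF this sm] show ?thesis by (simp add: o_def)
qed

lemma c_cont:
  assumes f: "continuous_map Z X f" "\<And>y. y \<in> topspace Z \<Longrightarrow> - 1 / 2 < f y m \<and> f y m < 1 / 2"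
  shows "continuous_map Z T (\<lambda>y. c (f y))"
  unfolding c_def
  by (intro cont_tr sp_cont sm_cont f(1)) (use f fX[OF f(1)] sp_proj sm_proj in auto)

lemma cutoff_high:
  assumes f: "continuous_map Z X f" "\<And>y. y \<in> topspace Z \<Longrightarrow> - 1 / 4 < f y m"
    and u: "continuous_map Z euclidean u" and \<beta>: "continuous_map Z euclideanreal \<beta>"
    and zero: "\<And>y. y \<in> topspace Z \<Longrightarrow> 1 / 4 < f y m \<Longrightarrow> \<beta> y = 0"
  shows "continuous_map Z euclidean (\<lambda>y. \<beta> y *\<^sub>R a (c (f y)) (u y))"
    "continuous_map Z euclidean (\<lambda>y. \<beta> y *\<^sub>R a (inv (c (f y))) (u y))"
proof -
  let ?V = "{y \<in> topspace Z. f y m \<in> {..<1 / 2}}" and ?W = "{y \<in> topspace Z. f y m \<in> {1 / 4<..}}"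
  have VW: "openin Z ?V" "openin Z ?W" by (rule coord_open[OF f(1)], simp)+
  have cov: "topspace Z \<subseteq> ?V \<union> ?W" by auto
  have cc: "continuous_map (subtopology Z ?V) T (\<lambda>y. c (f y))"
    by (rule c_cont) (use f in \<open>force intro: continuous_map_from_subtopology\<close>)+
  have cu: "continuous_map (subtopology Z ?V) euclidean u" by (rule continuous_map_from_subtopology[OF u])
  show "continuous_map Z euclidean (\<lambda>y. \<beta> y *\<^sub>R a (c (f y)) (u y))"
    by (rule continuous_map_cutoff[OF VW cov cont_a_comp[OF cc cu] \<beta>]) (use zero in auto)
  show "continuous_map Z euclidean (\<lambda>y. \<beta> y *\<^sub>R a (inv (c (f y))) (u y))"
    by (rule continuous_map_cutoff[OF VW cov cont_a_comp[OF cont_inv_comp[OF cc] cu] \<beta>]) (use zero in auto)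
qed

lemma ip_cont:
  assumes f: "continuous_map Z X f" "\<And>y. y \<in> topspace Z \<Longrightarrow> - 1 / 4 < f y m" and u: "continuous_map Z euclidean u"
  shows "continuous_map Z euclidean (\<lambda>y. ip (f y) (u y))"
proof -
  have "continuous_map Z euclidean (\<lambda>y. b1 (f y) *\<^sub>R u y)" by (intro continuous_map_scaleR b_cont f(1) u)
  moreover have "continuous_map Z euclidean (\<lambda>y. b2 (f y) *\<^sub>R a (inv (c (f y))) (u y))"
    by (rule cutoff_high(2)[OF f u b_cont(2)[OF f(1)]]) (simp_all add: b2_def)
  ultimately show ?thesis unfolding ip_def by (rule continuous_map_Pair)
qed

lemma im_cont:
  assumes f: "continuous_map Z X f" "\<And>y. y \<in> topspace Z \<Longrightarrow> f y m < 1 / 4" and u: "continuous_map Z euclidean u"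
  shows "continuous_map Z euclidean (\<lambda>y. im (f y) (u y))"
proof -
  let ?V = "{y \<in> topspace Z. f y m \<in> {- 1 / 2<..}}" and ?W = "{y \<in> topspace Z. f y m \<in> {..<- 1 / 4}}"
  have VW: "openin Z ?V" "openin Z ?W" by (rule coord_open[OF f(1)], simp)+
  have cov: "topspace Z \<subseteq> ?V \<union> ?W" by auto
  have cc: "continuous_map (subtopology Z ?V) T (\<lambda>y. c (f y))"
    by (rule c_cont) (use f in \<open>force intro: continuous_map_from_subtopology\<close>)+
  have cu: "continuous_map (subtopology Z ?V) euclidean u" by (rule continuous_map_from_subtopology[OF u])
  have 1: "continuous_map Z euclidean (\<lambda>y. b1 (f y) *\<^sub>R a (c (f y)) (u y))"
    by (rule continuous_map_cutoff[OF VW cov cont_a_comp[OF cc cu] b_cont(1)[OF f(1)]]) (auto simp: b1_def)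
  have "continuous_map Z euclidean (\<lambda>y. b2 (f y) *\<^sub>R u y)" by (intro continuous_map_scaleR b_cont f(1) u)
  with 1 show ?thesis unfolding im_def by (rule continuous_map_Pair)
qed

lemma b1_pos: "x \<in> Up \<Longrightarrow> b1 x > 0" and b2_pos: "x \<in> Um \<Longrightarrow> b2 x > 0"
  by (auto simp: b1_def b2_def Up_def Um_def)

lemma Up_c: "x \<in> Up \<Longrightarrow> b2 x = 0 \<or> c x \<in> carrier G"
  using c(1)[of x] by (cases "x m < 1 / 2") (auto simp: Up_def b2_def)

lemma Um_c: "x \<in> Um \<Longrightarrow> b1 x = 0 \<or> c x \<in> carrier G"
  using c(1)[of x] by (cases "- 1 / 2 < x m") (auto simp: Um_def b1_def)

lemma ip_linear: assumes "x \<in> Up" shows "linear (ip x)"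
proof -
  have L: "linear (\<lambda>u. b2 x *\<^sub>R a (inv (c x)) u)"
    using Up_c[OF assms] linear_compose_scale_right[OF a_linear[OF inv_closed, of "c x"], of "b2 x"]
    by (auto simp: linear_zero)
  show ?thesis unfolding ip_def[abs_def]
    by (intro linearI) (use linear_add[OF L] linear_scale[OF L] in \<open>simp_all add: scaleR_add_right\<close>)
qed

lemma im_linear: assumes "x \<in> Um" shows "linear (im x)"
proof -
  have L: "linear (\<lambda>u. b1 x *\<^sub>R a (c x) u)"
    using Um_c[OF assms] linear_compose_scale_right[OF a_linear, of "c x" "b1 x"]
    by (auto simp: linear_zero)
  show ?thesis unfolding im_def[abs_def]
    by (intro linearI) (use linear_add[OF L] linear_scale[OF L] in \<open>simp_all add: scaleR_add_right\<close>)
qed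

lemma ip_zero: "x \<in> Up \<Longrightarrow> ip x u = 0 \<Longrightarrow> u = 0"
  using b1_pos[of x] by (simp add: ip_def zero_prod_def)

lemma im_zero: "x \<in> Um \<Longrightarrow> im x u = 0 \<Longrightarrow> u = 0"
  using b2_pos[of x] by (simp add: im_def zero_prod_def)

lemma overlap:
  assumes "x \<in> Up" "x \<in> Um"
  shows "c x \<in> carrier G" "act (sp x) (c x) = sm x" "im x u = ip x (a (c x) u)" "ip x u = im x (a (inv (c x)) u)"
proof -
  show cx: "c x \<in> carrier G" "act (sp x) (c x) = sm x" using c[of x] assms by (auto simp: Up_def Um_def)
  show "im x u = ip x (a (c x) u)" "ip x u = im x (a (inv (c x)) u)"
    using a_inv[OF cx(1)] by (simp_all add: im_def ip_def)
qed

definition Fr :: "((nat \<Rightarrow> real) set \<times> (nat \<Rightarrow> (nat \<Rightarrow> real) \<Rightarrow> 'e \<times> 'e)) set" where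
  "Fr = {(Up, \<lambda>j x. ip x (bas j)), (Um, \<lambda>j x. im x (bas j))}"

lemma lin_indep_image:
  assumes L: "linear L" "\<And>u. L u = 0 \<Longrightarrow> u = 0" and w: "lin_indep n w"
  shows "lin_indep n (\<lambda>j. L (w j))"
  unfolding lin_indep_def
proof (intro allI impI)
  fix y i assume z: "(\<Sum>j<n. y j *\<^sub>R L (w j)) = 0" and i: "i < n"
  have "L (\<Sum>j<n. y j *\<^sub>R w j) = 0" using z by (simp add: linear_sum[OF L(1)] linear_scale[OF L(1)])
  then have "(\<Sum>j<n. y j *\<^sub>R w j) = 0" by (rule L(2))
  then show "y i = 0" using w i unfolding lin_indep_def by blast
qed

lemma X_sub: "Up \<subseteq> topspace X" "Um \<subseteq> topspace X" "topspace X \<subseteq> Up \<union> Um"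
  by (auto simp: Up_def Um_def)

lemma open_U: "openin X Up" "openin X Um"
proof -
  have "openin X {x \<in> topspace X. x m \<in> {- 1 / 4<..}}" "openin X {x \<in> topspace X. x m \<in> {..<1 / 4}}"
    by (rule coord_open; simp)+
  then show "openin X Up" "openin X Um" by (simp_all add: Up_def Um_def)
qed

text \<open>On the overlap the two frames differ by the matrix of \<open>a (c x)\<close> or of its
  inverse, whose determinant is positive by \<open>dt_a_pos\<close>.\<close>

lemma framed: "framed_family X DIM('e) Fr"
proof
  show "openin X V" if "(V, e) \<in> Fr" for V e using that open_U by (auto simp: Fr_def)
  show "\<exists>V e. (V, e) \<in> Fr \<and> x \<in> V" if "x \<in> topspace X" for x using that X_sub(3) by (auto simp: Fr_def)
  show "continuous_map (subtopology X V) euclidean (e j)" if "(V, e) \<in> Fr" for V e j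
  proof -
    have "continuous_map (subtopology X Up) euclidean (\<lambda>x. ip x (bas j))"
      by (rule ip_cont) (auto simp: Up_def continuous_map_from_subtopology)
    moreover have "continuous_map (subtopology X Um) euclidean (\<lambda>x. im x (bas j))"
      by (rule im_cont) (auto simp: Um_def continuous_map_from_subtopology)
    ultimately show ?thesis using that by (auto simp: Fr_def)
  qed
  show "lin_indep DIM('e) (\<lambda>j. e j x)" if V: "(V, e) \<in> Fr" "x \<in> V" for V e x
  proof -
    have "x \<in> Up \<Longrightarrow> lin_indep DIM('e) (\<lambda>j. ip x (bas j))"
      by (rule lin_indep_image[OF ip_linear _ lin_indep_bas]) (auto dest: ip_zero)
    moreover have "x \<in> Um \<Longrightarrow> lin_indep DIM('e) (\<lambda>j. im x (bas j))"
      by (rule lin_indep_image[OF im_linear _ lin_indep_bas]) (auto dest: im_zero)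
    ultimately show ?thesis using V by (auto simp: Fr_def)
  qed
  fix V e V' e' x assume e: "(V, e) \<in> Fr" "(V', e') \<in> Fr" "x \<in> V" "x \<in> V'"
  have same: "\<exists>R. dt DIM('e) R > 0 \<and> (\<forall>j<DIM('e). w j x = (\<Sum>l<DIM('e). R l j *\<^sub>R w l x))" for w :: "nat \<Rightarrow> (nat \<Rightarrow> real) \<Rightarrow> 'e \<times> 'e"
    by (rule exI[of _ "\<lambda>l j. if l = j then 1 else 0"])
      (auto simp: dt_one if_distrib[of "\<lambda>c. c *\<^sub>R _"] cong: if_cong)
  have exp: "L (a g (bas j)) = (\<Sum>l<DIM('e). (a g (bas j) \<bullet> bas l) *\<^sub>R L (bas l))" if "linear L" for L :: "'e \<Rightarrow> 'e \<times> 'e" and g j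
    by (subst sum_bas[symmetric, of "a g (bas j)"]) (simp add: linear_sum[OF that] linear_scale[OF that])
  consider "e = e'" | "x \<in> Up" "x \<in> Um" "e = (\<lambda>j x. ip x (bas j))" "e' = (\<lambda>j x. im x (bas j))"
    | "x \<in> Up" "x \<in> Um" "e' = (\<lambda>j x. ip x (bas j))" "e = (\<lambda>j x. im x (bas j))"
    using e by (auto simp: Fr_def)
  then show "\<exists>R. dt DIM('e) R > 0 \<and> (\<forall>j<DIM('e). e' j x = (\<Sum>l<DIM('e). R l j *\<^sub>R e l x))"
  proof cases
    case 1
    then show ?thesis using same by simp
  next
    case 2
    have "e' j x = (\<Sum>l<DIM('e). (a (c x) (bas j) \<bullet> bas l) *\<^sub>R e l x)" for j
      unfolding 2(3,4) overlap(3)[OF 2(1,2)] by (rule exp[OF ip_linear[OF 2(1)]])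
    then show ?thesis using dt_a_pos[OF connected_T overlap(1)[OF 2(1,2)]]
      by (intro exI[of _ "\<lambda>l j. a (c x) (bas j) \<bullet> bas l"]) simp
  next
    case 3
    have "e' j x = (\<Sum>l<DIM('e). (a (inv (c x)) (bas j) \<bullet> bas l) *\<^sub>R e l x)" for j
      unfolding 3(3,4) overlap(4)[OF 3(1,2)] by (rule exp[OF im_linear[OF 3(2)]])
    then show ?thesis using dt_a_pos[OF connected_T inv_closed[OF overlap(1)[OF 3(1,2)]]]
      by (intro exI[of _ "\<lambda>l j. a (inv (c x)) (bas j) \<bullet> bas l"]) simp
  qed
qed

sublocale fr: framed_family X "DIM('e)" Fr by (rule framed)

lemma fspan_image: "linear L \<Longrightarrow> fspan DIM('e) (\<lambda>j. L (bas j :: 'e)) = range L"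
proof (intro equalityI subsetI)
  fix w assume L: "linear L"
  show "w \<in> range L" if "w \<in> fspan DIM('e) (\<lambda>j. L (bas j))"
  proof -
    obtain y where "w = (\<Sum>j<DIM('e). y j *\<^sub>R L (bas j))" by (rule fspanE[OF \<open>w \<in> fspan _ _\<close>])
    then have "w = L (\<Sum>j<DIM('e). y j *\<^sub>R bas j)" by (simp add: linear_sum[OF L] linear_scale[OF L])
    then show ?thesis by simp
  qed
  show "w \<in> fspan DIM('e) (\<lambda>j. L (bas j))" if w: "w \<in> range L"
  proof -
    obtain u where "w = L u" using w by blast
    also have "L u = L (\<Sum>j<DIM('e). (u \<bullet> bas j) *\<^sub>R bas j)" by (simp add: sum_bas)
    also have "\<dots> = (\<Sum>j<DIM('e). (u \<bullet> bas j) *\<^sub>R L (bas j))" by (simp add: linear_sum[OF L] linear_scale[OF L])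
    finally show ?thesis using fspan_sum[of "\<lambda>j. u \<bullet> bas j" "\<lambda>j. L (bas j)"] by simp
  qed
qed

lemma fib_Up: "x \<in> Up \<Longrightarrow> fr.fib x = range (ip x)"
  using fr.fib_eq[of Up "\<lambda>j x. ip x (bas j)" x] fspan_image[OF ip_linear] by (simp add: Fr_def)

lemma fib_Um: "x \<in> Um \<Longrightarrow> fr.fib x = range (im x)"
  using fr.fib_eq[of Um "\<lambda>j x. im x (bas j)" x] fspan_image[OF im_linear] by (simp add: Fr_def)

text \<open>On the lower half the frame is constant in the trivialization \<open>im\<close>, which
  reads \<open>a (c x) (v i)\<close> in \<open>ip\<close>. Going up, \<open>tt\<close> moves it
  along the segment; it has arrived at the constant \<open>S i\<close> at height 1/4, before the
  height 1/2 at which \<open>c\<close> loses its meaning.\<close>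

definition sec :: "nat \<Rightarrow> (nat \<Rightarrow> real) \<Rightarrow> 'e \<times> 'e" where
  "sec i x = (if 0 < x m then ip x ((1 - tt x) *\<^sub>R a (c x) (v i) + tt x *\<^sub>R S i) else im x (v i))"

lemma sec_Up: "x \<in> Up \<Longrightarrow> sec i x = ip x ((1 - tt x) *\<^sub>R a (c x) (v i) + tt x *\<^sub>R S i)"
  using overlap(3)[of x "v i"] by (cases "0 < x m") (auto simp: sec_def tt_def Up_def Um_def)

lemma sec_cont: "continuous_map X euclidean (sec i)"
proof (rule continuous_map_locally)
  fix x assume x: "x \<in> topspace X"
  have f: "continuous_map (subtopology X Up) X (\<lambda>x. x)" by (rule continuous_map_from_subtopology) simp
  have g: "\<And>y. y \<in> topspace (subtopology X Up) \<Longrightarrow> - 1 / 4 < y m" by (auto simp: Up_def)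
  have h1: "continuous_map (subtopology X Up) euclidean (\<lambda>x. (1 - tt x) *\<^sub>R a (c x) (v i))"
    by (rule cutoff_high(1)[of "subtopology X Up" "\<lambda>x. x" "\<lambda>_. v i" "\<lambda>x. 1 - tt x"], rule f, erule g)
      (auto simp: tt_def intro!: continuous_intros b_cont(3)[OF f, unfolded tt_def])
  have h2: "continuous_map (subtopology X Up) euclidean (\<lambda>x. tt x *\<^sub>R S i)"
    by (intro continuous_map_scaleR b_cont(3)[OF f]) simp
  have "continuous_map (subtopology X Up) euclidean (\<lambda>x. ip x ((1 - tt x) *\<^sub>R a (c x) (v i) + tt x *\<^sub>R S i))"
    by (rule ip_cont[of "subtopology X Up" "\<lambda>x. x"], rule f, erule g, rule continuous_map_add[OF h1 h2])
  then have 1: "continuous_map (subtopology X Up) euclidean (sec i)"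
    by (rule continuous_map_eq) (simp add: sec_Up)
  let ?N = "{y \<in> topspace X. y m \<in> {..<0}}"
  have N: "openin X ?N" by (rule coord_open[of X "\<lambda>x. x"]) auto
  have "continuous_map (subtopology X ?N) euclidean (\<lambda>x. im x (v i))"
    by (rule im_cont) (auto simp: continuous_map_from_subtopology)
  then have 2: "continuous_map (subtopology X ?N) euclidean (sec i)"
    by (rule continuous_map_eq) (simp add: sec_def)
  have "x \<in> Up \<or> x \<in> ?N" using x by (auto simp: Up_def)
  then show "\<exists>V. openin X V \<and> x \<in> V \<and> continuous_map (subtopology X V) euclidean (sec i)"
    using 1 2 N open_U(1) by blast
qed

lemma sec_fib: "x \<in> topspace X \<Longrightarrow> sec i x \<in> fr.fib x"
  using fib_Up[of x] fib_Um[of x] sec_Up[of x i] by (cases "x \<in> Up") (auto simp: sec_def Up_def Um_def)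

lemma line_lin_indep:
  assumes g: "g \<in> carrier G" and t: "t \<in> {0..1}"
  shows "lin_indep k (\<lambda>i. (1 - t) *\<^sub>R a g (v i) + t *\<^sub>R S i)"
  using bspec[OF bspec[OF line[unfolded line_frame_def] g] t] unfolding lin_indep_def .

lemma sec_indep:
  assumes x: "x \<in> topspace X"
  shows "lin_indep k (\<lambda>i. sec i x)"
proof (cases "x \<in> Up")
  case True
  \<comment> \<open>Where \<open>c x\<close> may fail to be a group element, the weight
    \<open>1 - tt x\<close> is 0, so any element can stand in for it in
    \<open>line_lin_indep\<close>.\<close>
  define g where "g = (if x m < 1 / 2 then c x else \<one>)"
  have g: "g \<in> carrier G" using c(1)[OF x] True by (auto simp: g_def Up_def)
  have gc: "(1 - tt x) *\<^sub>R a (c x) (v i) = (1 - tt x) *\<^sub>R a g (v i)" for i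
    by (auto simp: g_def tt_def)
  have "lin_indep k (\<lambda>i. (1 - tt x) *\<^sub>R a g (v i) + tt x *\<^sub>R S i)"
    by (rule line_lin_indep[OF g]) (auto simp: tt_def)
  from lin_indep_image[OF ip_linear[OF True] ip_zero[OF True] this] show ?thesis
    by (simp add: sec_Up[OF True] gc)
next
  case False
  then have U: "x \<in> Um" "x m \<le> 0" using x by (auto simp: Up_def Um_def)
  have "lin_indep k (\<lambda>i. (1 - 0) *\<^sub>R a \<one> (v i) + 0 *\<^sub>R S i)"
    by (rule line_lin_indep) auto
  then have "lin_indep k v" by (simp add: a_one)
  from lin_indep_image[OF im_linear[OF U(1)] im_zero[OF U(1)] this] show ?thesis
    using U(2) by (simp add: sec_def)
qed

section \<open>The adjoint bundle as a subbundle of a trivial bundle\<close>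

abbreviation adP where "adP \<equiv> adjoint_bundle G T A P \<pi> act"

text \<open>The class [p, u] with the fibre read in the model space, where the adjoint action
  becomes \<open>a\<close>.\<close>

definition Q :: "'p \<Rightarrow> 'e \<Rightarrow> ('p \<times> (('g \<Rightarrow> real) \<Rightarrow> real)) set" where
  "Q p u = adjoint_class G act (p, J u)"

lemma Q_eq: "Q p u = {(act p g, J (a (inv g) u)) | g. g \<in> carrier G}"
  by (auto simp: Q_def adjoint_class_def Ad_J)

lemma Q_act:
  assumes p: "p \<in> topspace P" and g: "g \<in> carrier G"
  shows "Q (act p g) u = Q p (a g u)"
proof (intro equalityI subsetI)
  fix z assume "z \<in> Q (act p g) u"
  then obtain h where h: "h \<in> carrier G" "z = (act (act p g) h, J (a (inv h) u))" by (auto simp: Q_eq)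
  have "z = (act p (g \<otimes> h), J (a (inv (g \<otimes> h)) (a g u)))"
    using h p g a_mult[of "inv h" "inv g"] a_inv(1)[OF g] by (simp add: act_act inv_mult_group)
  then show "z \<in> Q p (a g u)" unfolding Q_eq using h g by blast
next
  fix z assume "z \<in> Q p (a g u)"
  then obtain h where h: "h \<in> carrier G" "z = (act p h, J (a (inv h) (a g u)))" by (auto simp: Q_eq)
  have "g \<otimes> (inv g \<otimes> h) = h" using g h(1) by (simp add: m_assoc[symmetric])
  then have "z = (act (act p g) (inv g \<otimes> h), J (a (inv (inv g \<otimes> h)) u))"
    using h p g a_mult[of "inv h" g] by (simp add: act_act inv_mult_group)
  then show "z \<in> Q (act p g) u" unfolding Q_eq using h g by blast
qed

lemma Q_proj:
  assumes "p \<in> topspace P"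
  shows "bproj adP (Q p u) = \<pi> p"
proof -
  have "(\<lambda>(p, D). \<pi> p) ` Q p u = {\<pi> p}" unfolding Q_eq using assms by (auto intro!: image_eqI[of _ _ "(act p \<one>, J (a (inv \<one>) u))"])
  then show ?thesis by (simp add: adjoint_bundle_def)
qed

lemma Q_add:
  assumes p: "p \<in> topspace P"
  shows "fadd adP (Q p u) (Q p w) = Q p (u + w)"
proof -
  have "fadd adP (Q p u) (Q p w) = {(q, \<lambda>f. D f + D' f) | q D D'. (q, D) \<in> Q p u \<and> (q, D') \<in> Q p w}"
    by (simp add: adjoint_bundle_def)
  also have "\<dots> = Q p (u + w)"
  proof (intro equalityI subsetI)
    fix z assume "z \<in> {(q, \<lambda>f. D f + D' f) | q D D'. (q, D) \<in> Q p u \<and> (q, D') \<in> Q p w}"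
    then obtain q D D' where z: "z = (q, \<lambda>f. D f + D' f)" "(q, D) \<in> Q p u" "(q, D') \<in> Q p w" by blast
    obtain g where g: "g \<in> carrier G" "q = act p g" "D = J (a (inv g) u)" using z(2) by (auto simp: Q_eq)
    obtain g' where g': "g' \<in> carrier G" "q = act p g'" "D' = J (a (inv g') w)" using z(3) by (auto simp: Q_eq)
    \<comment> \<open>The action is free, so a common first component forces the same group element,
      and the two representatives can be added.\<close>
    have "g' = g" using act_inject[OF p g'(1) g(1)] g(2) g'(2) by simp
    then have "z = (act p g, J (a (inv g) (u + w)))"
      using z(1) g g' linear_add[OF a_linear[OF inv_closed[OF g(1)]], of u w] by (simp add: J_add)
    then show "z \<in> Q p (u + w)" unfolding Q_eq using g(1) by blast
  next
    fix z assume "z \<in> Q p (u + w)"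
    then obtain g where g: "g \<in> carrier G" "z = (act p g, J (a (inv g) (u + w)))" by (auto simp: Q_eq)
    have "z = (act p g, \<lambda>f. J (a (inv g) u) f + J (a (inv g) w) f)"
      using g linear_add[OF a_linear[OF inv_closed[OF g(1)]], of u w] by (simp add: J_add)
    moreover have "(act p g, J (a (inv g) u)) \<in> Q p u" "(act p g, J (a (inv g) w)) \<in> Q p w" using g(1) by (auto simp: Q_eq)
    ultimately show "z \<in> {(q, \<lambda>f. D f + D' f) | q D D'. (q, D) \<in> Q p u \<and> (q, D') \<in> Q p w}" by blast
  qed
  finally show ?thesis .
qed

lemma Q_scale: "fscale adP b (Q p u) = Q p (b *\<^sub>R u)"
proof -
  have s: "J (a (inv g) (b *\<^sub>R u)) = (\<lambda>f. b * J (a (inv g) u) f)" if "g \<in> carrier G" for g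
    using linear_scale[OF a_linear[OF inv_closed[OF that]], of b u] by (simp add: J_scale)
  have "fscale adP b (Q p u) = {(q, \<lambda>f. b * D f) | q D. (q, D) \<in> Q p u}" by (simp add: adjoint_bundle_def)
  also have "\<dots> = {(act p g, \<lambda>f. b * J (a (inv g) u) f) | g. g \<in> carrier G}" unfolding Q_eq by blast
  also have "\<dots> = Q p (b *\<^sub>R u)" unfolding Q_eq using s by (intro Collect_cong ex_cong1) auto
  finally show ?thesis .
qed

lemma Q_zero:
  assumes p: "p \<in> topspace P"
  shows "fzero adP (\<pi> p) = Q p 0"
proof -
  have J0: "J 0 = (\<lambda>f. 0)" using J_scale[of 0 0] by simp
  have "a (inv g) 0 = 0" if "g \<in> carrier G" for g using linear_0[OF a_linear[OF inv_closed[OF that]]] .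
  then have "Q p 0 = {(act p g, \<lambda>f. 0) | g. g \<in> carrier G}" unfolding Q_eq using J0 by force
  moreover have "\<dots> = {(q, \<lambda>f. 0) | q. q \<in> topspace P \<and> \<pi> q = \<pi> p}"
  proof (intro equalityI subsetI)
    fix z :: "'p \<times> (('g \<Rightarrow> real) \<Rightarrow> real)" assume "z \<in> {(q, \<lambda>f. 0) | q. q \<in> topspace P \<and> \<pi> q = \<pi> p}"
    then obtain q where q: "z = (q, \<lambda>f. 0)" "q \<in> topspace P" "\<pi> p = \<pi> q" by auto
    from tr[OF p q(2,3)] q(1) show "z \<in> {(act p g, \<lambda>f. 0) | g. g \<in> carrier G}" by (auto intro!: exI[of _ "tr p q"])
  qed (use p in auto)
  ultimately show ?thesis by (simp add: adjoint_bundle_def)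
qed

definition gp :: "'p \<Rightarrow> 'g" where "gp p = tr (sp (\<pi> p)) p"
definition gm :: "'p \<Rightarrow> 'g" where "gm p = tr (sm (\<pi> p)) p"

definition toE :: "'p \<times> (('g \<Rightarrow> real) \<Rightarrow> real) \<Rightarrow> (nat \<Rightarrow> real) \<times> 'e \<times> 'e" where
  "toE = (\<lambda>(p, D). (\<pi> p, if 0 \<le> \<pi> p m then ip (\<pi> p) (a (gp p) (J' D)) else im (\<pi> p) (a (gm p) (J' D))))"

lemma gp:
  assumes "p \<in> topspace P" "\<pi> p \<in> Up"
  shows "gp p \<in> carrier G" "act (sp (\<pi> p)) (gp p) = p"
  unfolding gp_def using tr[OF sp_closed assms(1)] assms by (auto simp: Up_def sp_proj)

lemma gm:
  assumes "p \<in> topspace P" "\<pi> p \<in> Um"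
  shows "gm p \<in> carrier G" "act (sm (\<pi> p)) (gm p) = p"
  unfolding gm_def using tr[OF sm_closed assms(1)] assms by (auto simp: Um_def sm_proj)

lemma UpD: "x \<in> Up \<Longrightarrow> x \<in> topspace X \<and> - 1 / 2 < x m \<and> sp x \<in> topspace P \<and> \<pi> (sp x) = x"
  using sp_closed sp_proj by (auto simp: Up_def)

lemma UmD: "x \<in> Um \<Longrightarrow> x \<in> topspace X \<and> x m < 1 / 2 \<and> sm x \<in> topspace P \<and> \<pi> (sm x) = x"
  using sm_closed sm_proj by (auto simp: Um_def)

lemma toE_Up:
  assumes p: "p \<in> topspace P" "\<pi> p \<in> Up"
  shows "toE (p, D) = (\<pi> p, ip (\<pi> p) (a (gp p) (J' D)))"
proof (cases "0 \<le> \<pi> p m")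
  case False
  then have m: "\<pi> p \<in> Um" using p by (auto simp: Up_def Um_def)
  note o = overlap[OF p(2) m]
  have "act (sp (\<pi> p)) (c (\<pi> p) \<otimes> gm p) = p"
    using act_act[of "sp (\<pi> p)" "c (\<pi> p)" "gm p"] o gm[OF p(1) m] UpD[OF p(2)] by simp
  then have "gp p = c (\<pi> p) \<otimes> gm p"
    unfolding gp_def using o gm[OF p(1) m] UpD[OF p(2)] by (intro tr_eqI) auto
  then show ?thesis using False o(3) a_mult[OF o(1) gm(1)[OF p(1) m]] by (simp add: toE_def)
qed (simp add: toE_def)

lemma toE_Um:
  assumes p: "p \<in> topspace P" "\<pi> p \<in> Um"
  shows "toE (p, D) = (\<pi> p, im (\<pi> p) (a (gm p) (J' D)))"
proof (cases "0 \<le> \<pi> p m")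
  case True
  then have m: "\<pi> p \<in> Up" using p by (auto simp: Up_def Um_def)
  note o = overlap[OF m p(2)]
  have "act (sp (\<pi> p)) (c (\<pi> p) \<otimes> gm p) = p"
    using act_act[of "sp (\<pi> p)" "c (\<pi> p)" "gm p"] o gm[OF p] UpD[OF m] by simp
  then have "gp p = c (\<pi> p) \<otimes> gm p"
    unfolding gp_def using o gm[OF p] UpD[OF m] by (intro tr_eqI) auto
  then show ?thesis using True o(3) a_mult[OF o(1) gm(1)[OF p]] by (simp add: toE_def)
qed (simp add: toE_def)

definition Et :: "((nat \<Rightarrow> real) \<times> 'e \<times> 'e) topology" where
  "Et = subtopology (prod_topology X euclidean) {(x, w). w \<in> fr.fib x}"

abbreviation LT where "LT \<equiv> lie_algebra_topology G T A"

lemma J'_cont: "continuous_map LT euclidean J'" and J_cont: "continuous_map euclidean LT J"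
  and J'J: "J' (J u) = u" and JJ'_id: "D \<in> topspace LT \<Longrightarrow> J (J' D) = D"
  using JJ' by (auto simp: homeomorphic_maps_def)

lemma toE_fib:
  assumes p: "p \<in> topspace P"
  shows "snd (toE (p, D)) \<in> fr.fib (\<pi> p)"
proof -
  have "\<pi> p \<in> Up \<union> Um" using proj_closed[OF p] X_sub(3) by blast
  then show ?thesis using toE_Up[OF p] toE_Um[OF p] fib_Up fib_Um by auto
qed

lemma toE_cont: "continuous_map (prod_topology P LT) Et toE"
  unfolding Et_def continuous_map_in_subtopology
proof (intro conjI)
  let ?Z = "prod_topology P LT"
  have pr: "continuous_map ?Z X (\<lambda>q. \<pi> (fst q))"
    using continuous_map_compose[OF continuous_map_fst cont_proj] by (simp add: o_def)
  have Jc: "continuous_map ?Z euclidean (\<lambda>q. J' (snd q))"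
    using continuous_map_compose[OF continuous_map_snd J'_cont] by (simp add: o_def)
  have fst_c: "continuous_map ?Z P fst" by (rule continuous_map_fst)
  show "continuous_map ?Z (prod_topology X euclidean) toE"
  proof (rule continuous_map_locally)
    fix q assume q: "q \<in> topspace ?Z"
    let ?V = "{q \<in> topspace ?Z. \<pi> (fst q) \<in> Up}" and ?W = "{q \<in> topspace ?Z. \<pi> (fst q) \<in> Um}"
    have o: "openin ?Z ?V" "openin ?Z ?W" by (rule openin_continuous_map_preimage[OF pr] open_U)+
    have sub: "continuous_map (subtopology ?Z N) X (\<lambda>q. \<pi> (fst q))" "continuous_map (subtopology ?Z N) euclidean (\<lambda>q. J' (snd q))"
      "continuous_map (subtopology ?Z N) P fst" for N
      by (rule continuous_map_from_subtopology; fact)+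
    have "continuous_map (subtopology ?Z ?V) T (\<lambda>q. gp (fst q))"
      unfolding gp_def by (intro cont_tr sp_cont sub) (auto simp: Up_def sp_proj)
    from cont_a_comp[OF this sub(2)]
    have "continuous_map (subtopology ?Z ?V) euclidean (\<lambda>q. ip (\<pi> (fst q)) (a (gp (fst q)) (J' (snd q))))"
      by (intro ip_cont[OF sub(1)]) (auto simp: Up_def)
    from continuous_map_pairedI[OF sub(1) this]
    have 1: "continuous_map (subtopology ?Z ?V) (prod_topology X euclidean) toE"
      by (rule continuous_map_eq) (auto simp: toE_Up)
    have "continuous_map (subtopology ?Z ?W) T (\<lambda>q. gm (fst q))"
      unfolding gm_def by (intro cont_tr sm_cont sub) (auto simp: Um_def sm_proj)
    from cont_a_comp[OF this sub(2)]
    have "continuous_map (subtopology ?Z ?W) euclidean (\<lambda>q. im (\<pi> (fst q)) (a (gm (fst q)) (J' (snd q))))"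
      by (intro im_cont[OF sub(1)]) (auto simp: Um_def)
    from continuous_map_pairedI[OF sub(1) this]
    have 2: "continuous_map (subtopology ?Z ?W) (prod_topology X euclidean) toE"
      by (rule continuous_map_eq) (auto simp: toE_Um)
    have "q \<in> ?V \<or> q \<in> ?W" using q X_sub(3) proj_closed[of "fst q"] by auto
    then show "\<exists>V. openin ?Z V \<and> q \<in> V \<and> continuous_map (subtopology ?Z V) (prod_topology X euclidean) toE"
      using o 1 2 by blast
  qed
  show "toE \<in> topspace ?Z \<rightarrow> {(x, w). w \<in> fr.fib x}"
  proof
    fix q assume "q \<in> topspace ?Z"
    then obtain p D where q: "q = (p, D)" "p \<in> topspace P" by auto
    have "fst (toE (p, D)) = \<pi> p" by (simp add: toE_def)
    then show "toE q \<in> {(x, w). w \<in> fr.fib x}" using toE_fib[OF q(2), of D] q(1) by (simp add: case_prod_beta)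
  qed
qed

lemma toE_act:
  assumes p: "p \<in> topspace P" and g: "g \<in> carrier G"
  shows "toE (act p g, J (a (inv g) u)) = toE (p, J u)"
proof -
  have "\<pi> p \<in> Up \<union> Um" using proj_closed[OF p] X_sub(3) by blast
  then show ?thesis
  proof
    assume U: "\<pi> p \<in> Up"
    have "gp (act p g) = gp p \<otimes> g"
      unfolding gp_def[of "act p g"] using gp[OF p U] p g UpD[OF U] by (intro tr_eqI) (auto simp: act_act[symmetric])
    then show ?thesis using U p g gp[OF p U] a_inv(2)[OF g] by (simp add: toE_Up J'J a_mult)
  next
    assume U: "\<pi> p \<in> Um"
    have "gm (act p g) = gm p \<otimes> g"
      unfolding gm_def[of "act p g"] using gm[OF p U] p g UmD[OF U] by (intro tr_eqI) (auto simp: act_act[symmetric])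
    then show ?thesis using U p g gm[OF p U] a_inv(2)[OF g] by (simp add: toE_Um J'J a_mult)
  qed
qed

text \<open>Inverts the embedding: the first component of \<open>ip\<close> over \<open>Up\<close>,
  and the second component of \<open>im\<close> over \<open>Um\<close>, is the vector times a
  positive cut-off, by which it is divided.\<close>

definition fromE :: "(nat \<Rightarrow> real) \<times> 'e \<times> 'e \<Rightarrow> ('p \<times> (('g \<Rightarrow> real) \<Rightarrow> real)) set" where
  "fromE = (\<lambda>(x, w). if 0 \<le> x m then Q (sp x) ((1 / b1 x) *\<^sub>R fst w) else Q (sm x) ((1 / b2 x) *\<^sub>R snd w))"

lemma recover: "x \<in> Up \<Longrightarrow> (1 / b1 x) *\<^sub>R fst (ip x u) = u" "x \<in> Um \<Longrightarrow> (1 / b2 x) *\<^sub>R snd (im x u) = u"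
  using b1_pos[of x] b2_pos[of x] by (simp_all add: ip_def im_def)

lemma Q_overlap: "x \<in> Up \<Longrightarrow> x \<in> Um \<Longrightarrow> Q (sm x) u = Q (sp x) (a (c x) u)"
  using Q_act[of "sp x" "c x" u] overlap(1,2)[of x] UpD[of x] by simp

lemma fromE_Up:
  assumes x: "x \<in> Up"
  shows "fromE (x, ip x u) = Q (sp x) u"
proof (cases "0 \<le> x m")
  case False
  then have m: "x \<in> Um" using x by (auto simp: Up_def Um_def)
  have "fromE (x, ip x u) = Q (sm x) ((1 / b2 x) *\<^sub>R snd (im x (a (inv (c x)) u)))"
    using False overlap(4)[OF x m] by (simp add: fromE_def)
  also have "\<dots> = Q (sp x) u"
    unfolding recover(2)[OF m] Q_overlap[OF x m] using a_inv(2)[OF overlap(1)[OF x m]] by simp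
  finally show ?thesis .
qed (simp add: fromE_def recover(1)[OF x])

lemma fromE_Um:
  assumes x: "x \<in> Um"
  shows "fromE (x, im x u) = Q (sm x) u"
proof (cases "0 \<le> x m")
  case True
  then have p: "x \<in> Up" using x by (auto simp: Up_def Um_def)
  have "fromE (x, im x u) = fromE (x, ip x (a (c x) u))" using overlap(3)[OF p x] by simp
  then show ?thesis using fromE_Up[OF p] Q_overlap[OF p x] by simp
qed (simp add: fromE_def recover(2)[OF x])

lemma Et_cases:
  assumes "q \<in> topspace Et"
  obtains x u where "x \<in> Up" "q = (x, ip x u)" | x u where "x \<in> Um" "q = (x, im x u)"
proof -
  obtain x w where q: "q = (x, w)" "x \<in> topspace X" "w \<in> fr.fib x" using assms by (auto simp: Et_def)
  show ?thesis
  proof (cases "x \<in> Up")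
    case True
    then obtain u where "w = ip x u" using q(3) fib_Up by blast
    then show ?thesis using that(1) True q(1) by blast
  next
    case False
    then have U: "x \<in> Um" using X_sub(3) q(2) by blast
    then obtain u where "w = im x u" using q(3) fib_Um by blast
    then show ?thesis using that(2) U q(1) by blast
  qed
qed

lemma quotient: "quotient_map (prod_topology P LT) (total adP) (adjoint_class G act)"
  using quotient_map_quotient_topology by (simp add: adjoint_bundle_def)

lemma fromE_cont: "continuous_map Et (total adP) fromE"
proof (rule continuous_map_locally)
  fix q assume q: "q \<in> topspace Et"
  let ?V = "{q \<in> topspace Et. fst q \<in> Up}" and ?W = "{q \<in> topspace Et. fst q \<in> Um}"
  have f: "continuous_map Et X fst" and s: "continuous_map Et euclidean snd"
    unfolding Et_def by (intro continuous_map_from_subtopology continuous_map_fst continuous_map_snd)+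
  have s2: "continuous_map Et euclidean (\<lambda>q. fst (snd q))" "continuous_map Et euclidean (\<lambda>q. snd (snd q))"
    using s by (auto simp: continuous_map_atin intro: tendsto_fst tendsto_snd)
  have o: "openin Et ?V" "openin Et ?W" by (rule openin_continuous_map_preimage[OF f] open_U)+
  have sub: "continuous_map (subtopology Et N) X fst" "continuous_map (subtopology Et N) euclidean (\<lambda>q. fst (snd q))"
      "continuous_map (subtopology Et N) euclidean (\<lambda>q. snd (snd q))" for N
    by (rule continuous_map_from_subtopology; fact)+
  have Qc: "continuous_map Z (total adP) (\<lambda>q. Q (\<sigma> q) (u q))"
    if "continuous_map Z P \<sigma>" "continuous_map Z euclidean u" for Z :: "((nat \<Rightarrow> real) \<times> 'e \<times> 'e) topology" and \<sigma> u
  proof -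
    have "continuous_map Z LT (\<lambda>q. J (u q))" using continuous_map_compose[OF that(2) J_cont] by (simp add: o_def)
    from continuous_map_compose[OF continuous_map_pairedI[OF that(1) this] quotient_imp_continuous_map[OF quotient]]
    show ?thesis by (simp add: o_def Q_def)
  qed
  have "continuous_map (subtopology Et ?V) (total adP) (\<lambda>q. Q (sp (fst q)) ((1 / b1 (fst q)) *\<^sub>R fst (snd q)))"
    by (intro Qc sp_cont sub continuous_map_scaleR continuous_map_real_divide b_cont)
      (auto simp: Up_def b1_def)
  then have 1: "continuous_map (subtopology Et ?V) (total adP) fromE"
  proof (rule continuous_map_eq)
    fix q assume "q \<in> topspace (subtopology Et ?V)"
    then have q: "q \<in> topspace Et" "fst q \<in> Up" by auto
    then obtain u where "snd q = ip (fst q) u" using fib_Up[OF q(2)] by (auto simp: Et_def)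
    then have "q = (fst q, ip (fst q) u)" by (metis prod.collapse)
    then show "Q (sp (fst q)) ((1 / b1 (fst q)) *\<^sub>R fst (snd q)) = fromE q"
      using fromE_Up[OF q(2), of u] recover(1)[OF q(2), of u] by (metis snd_conv)
  qed
  have "continuous_map (subtopology Et ?W) (total adP) (\<lambda>q. Q (sm (fst q)) ((1 / b2 (fst q)) *\<^sub>R snd (snd q)))"
    by (intro Qc sm_cont sub continuous_map_scaleR continuous_map_real_divide b_cont)
      (auto simp: Um_def b2_def)
  then have 2: "continuous_map (subtopology Et ?W) (total adP) fromE"
  proof (rule continuous_map_eq)
    fix q assume "q \<in> topspace (subtopology Et ?W)"
    then have q: "q \<in> topspace Et" "fst q \<in> Um" by auto
    then obtain u where "snd q = im (fst q) u" using fib_Um[OF q(2)] by (auto simp: Et_def)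
    then have "q = (fst q, im (fst q) u)" by (metis prod.collapse)
    then show "Q (sm (fst q)) ((1 / b2 (fst q)) *\<^sub>R snd (snd q)) = fromE q"
      using fromE_Um[OF q(2), of u] recover(2)[OF q(2), of u] by (metis snd_conv)
  qed
  have "q \<in> ?V \<or> q \<in> ?W" using q X_sub(3) by (auto simp: Et_def)
  then show "\<exists>V. openin Et V \<and> q \<in> V \<and> continuous_map (subtopology Et V) (total adP) fromE"
    using o 1 2 by blast
qed

lemma tr_self: "p \<in> topspace P \<Longrightarrow> tr p p = \<one>"
  by (rule tr_eqI) auto

text \<open>\<open>toE\<close> is constant on the classes and descends to the quotient; the map
  obtained in this way is the continuous inverse of \<open>fromE\<close>.\<close>

lemma ex_homeomorphic_fromE: "\<exists>h'. homeomorphic_maps Et (total adP) fromE h'"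
proof -
  have inv: "toE q = toE q'" if q: "q \<in> topspace (prod_topology P LT)" and q': "q' \<in> topspace (prod_topology P LT)"
    and eq: "adjoint_class G act q = adjoint_class G act q'" for q q'
  proof -
    obtain p D where pD: "q = (p, D)" "p \<in> topspace P" "D \<in> topspace LT" using q by auto
    obtain p' D' where pD': "q' = (p', D')" "p' \<in> topspace P" "D' \<in> topspace LT" using q' by auto
    have e: "Q p (J' D) = Q p' (J' D')" using eq by (simp add: Q_def pD pD' JJ'_id)
    have "(p', J (J' D')) \<in> Q p' (J' D')" unfolding Q_eq using pD'(2) a_one by (auto intro!: exI[of _ \<one>])
    then have "\<exists>g. g \<in> carrier G \<and> p' = act p g \<and> J (J' D') = J (a (inv g) (J' D))"
      unfolding e[symmetric] unfolding Q_eq by blast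
    then obtain g where g: "g \<in> carrier G" "p' = act p g" "J (J' D') = J (a (inv g) (J' D))" by blast
    have "toE (p', J (J' D')) = toE (p, J (J' D))" unfolding g(2,3) by (rule toE_act[OF pD(2) g(1)])
    then show ?thesis by (simp add: pD pD' JJ'_id)
  qed
  have "\<exists>h'. continuous_map (total adP) Et h' \<and>
    (\<forall>q\<in>topspace (prod_topology P LT). h' (adjoint_class G act q) = toE q)"
  proof (rule quotient_map_lift_exists[OF quotient toE_cont])
    fix q q' assume "q \<in> topspace (prod_topology P LT)" "q' \<in> topspace (prod_topology P LT)"
      "adjoint_class G act q = adjoint_class G act q'"
    then show "toE q = toE q'" by (rule inv)
  next
    fix h' assume h': "continuous_map (total adP) Et h'"
      "\<And>q. q \<in> topspace (prod_topology P LT) \<Longrightarrow> h' (adjoint_class G act q) = toE q"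
    show "\<exists>h'. continuous_map (total adP) Et h' \<and>
      (\<forall>q\<in>topspace (prod_topology P LT). h' (adjoint_class G act q) = toE q)"
      by (rule exI[of _ h'], rule conjI[OF h'(1)], rule ballI, rule h'(2))
  qed
  then obtain h' where h': "continuous_map (total adP) Et h'"
    and h'q: "\<forall>q\<in>topspace (prod_topology P LT). h' (adjoint_class G act q) = toE q"
    by (elim exE conjE) (rule that)
  have JL: "J u \<in> topspace LT" for u using continuous_map_image_subset_topspace[OF J_cont] by auto
  have hQ: "h' (Q p u) = toE (p, J u)" if "p \<in> topspace P" for p u
    using bspec[OF h'q, of "(p, J u)"] that JL by (simp add: Q_def)
  have "homeomorphic_maps Et (total adP) fromE h'"
    unfolding homeomorphic_maps_def
  proof (intro conjI ballI fromE_cont h'(1))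
    fix q assume "q \<in> topspace Et"
    then show "h' (fromE q) = q"
    proof (cases rule: Et_cases)
      case (1 x u)
      have x: "sp x \<in> topspace P" "\<pi> (sp x) = x" using UpD[OF 1(1)] by auto
      have "gp (sp x) = \<one>" using tr_self[OF x(1)] by (simp add: gp_def x(2))
      then show ?thesis using 1 x by (simp add: fromE_Up hQ toE_Up J'J a_one)
    next
      case (2 x u)
      have x: "sm x \<in> topspace P" "\<pi> (sm x) = x" using UmD[OF 2(1)] by auto
      have "gm (sm x) = \<one>" using tr_self[OF x(1)] by (simp add: gm_def x(2))
      then show ?thesis using 2 x by (simp add: fromE_Um hQ toE_Um J'J a_one)
    qed
  next
    fix C assume "C \<in> topspace (total adP)"
    then obtain p D where pD: "p \<in> topspace P" "D \<in> topspace LT" "C = adjoint_class G act (p, D)"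
      unfolding quotient_imp_surjective_map[OF quotient, symmetric] by auto
    then have C: "C = Q p (J' D)" by (simp add: Q_def JJ'_id)
    have "\<pi> p \<in> Up \<union> Um" using proj_closed[OF pD(1)] X_sub(3) by blast
    then show "fromE (h' C) = C"
    proof
      assume U: "\<pi> p \<in> Up"
      have "fromE (h' C) = Q (sp (\<pi> p)) (a (gp p) (J' D))"
        using hQ[OF pD(1)] U pD(1) by (simp add: C toE_Up fromE_Up J'J)
      then show ?thesis using Q_act[of "sp (\<pi> p)" "gp p"] gp[OF pD(1) U] UpD[OF U] by (simp add: C)
    next
      assume U: "\<pi> p \<in> Um"
      have "fromE (h' C) = Q (sm (\<pi> p)) (a (gm p) (J' D))"
        using hQ[OF pD(1)] U pD(1) by (simp add: C toE_Um fromE_Um J'J)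
      then show ?thesis using Q_act[of "sm (\<pi> p)" "gm p"] gm[OF pD(1) U] UmD[OF U] by (simp add: C)
    qed
  qed
  then show ?thesis by blast
qed

text \<open>Brings both trivializations into one form: over each point the fibre has a linear
  parametrization in which \<open>fromE\<close> is u \<mapsto> [p, u]. Compatibility with the
  fibrewise operations then reduces to the rules for \<open>Q\<close>.\<close>

lemma fromE_fibrewise:
  assumes "(x, w) \<in> topspace Et"
  shows "\<exists>p L. p \<in> topspace P \<and> \<pi> p = x \<and> linear L \<and> fr.fib x = range L \<and> (\<forall>u. fromE (x, L u) = Q p u)"
proof -
  have "x \<in> Up \<or> x \<in> Um" using assms X_sub(3) by (auto simp: Et_def)
  then show ?thesis
  proof
    assume "x \<in> Up"
    then show ?thesis using UpD ip_linear fib_Up fromE_Up by (intro exI[of _ "sp x"] exI[of _ "ip x"]) auto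
  next
    assume "x \<in> Um"
    then show ?thesis using UmD im_linear fib_Um fromE_Um by (intro exI[of _ "sm x"] exI[of _ "im x"]) auto
  qed
qed

lemma adjoint_splitting:
  shows "(\<exists>(\<xi> :: (nat \<Rightarrow> real, (nat \<Rightarrow> real) \<times> (nat \<Rightarrow> real)) vector_bundle) \<Phi>.
            oriented_vector_bundle X \<xi> (DIM('e) - k) \<Phi> \<and>
            bundle_isomorphic adP (whitney_sum \<xi> (trivial_bundle X k))) \<and>
         (\<exists>\<sigma>. (\<forall>i<k. bundle_section X adP (\<sigma> i)) \<and>
            (\<forall>x\<in>topspace X. fibre_lin_indep adP x (\<lambda>i. \<sigma> i x) k))"
proof -
  obtain w where w: "\<forall>i<k. continuous_map X euclidean (w i)"
    "\<forall>x\<in>topspace X. orthonormal k (\<lambda>i. w i x) \<and> (\<forall>i<k. w i x \<in> fspan k (\<lambda>i. sec i x))"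
    using gram_schmidt[of k X sec] sec_cont sec_indep by auto
  have wf: "w i x \<in> fr.fib x" if "x \<in> topspace X" "i < k" for x i
  proof -
    have "fspan k (\<lambda>i. sec i x) \<subseteq> fr.fib x"
      unfolding fspan_def using sec_fib[OF that(1)] by (intro span_minimal fr.fib_subspace[OF that(1)]) auto
    then show ?thesis using w(2) that by blast
  qed
  interpret sf: framed_subfamily X "DIM('e)" Fr k w
    by unfold_locales (use k w wf in auto)
  have Et: "sf.Etop = Et" by (simp add: sf.Etop_def Et_def)
  obtain h' where h': "homeomorphic_maps Et (total adP) fromE h'" using ex_homeomorphic_fromE by blast
  have zE: "(x, 0) \<in> topspace Et" if "x \<in> topspace X" for x
    using that subspace_0[OF fr.fib_subspace[OF that]] by (simp add: Et_def)
  have p: "bproj adP (fromE (x, u)) = x" if xu: "(x, u) \<in> topspace Et" for x u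
  proof -
    obtain p L where pL: "p \<in> topspace P" "\<pi> p = x" "fr.fib x = range L" "\<forall>u. fromE (x, L u) = Q p u"
      using fromE_fibrewise[OF xu] by blast
    have "u \<in> range L" using xu pL(3) by (simp add: Et_def)
    then show ?thesis using pL Q_proj by auto
  qed
  have s: "fscale adP b (fromE (x, u)) = fromE (x, b *\<^sub>R u)" if xu: "(x, u) \<in> topspace Et" for x u b
  proof -
    obtain p L where pL: "linear L" "fr.fib x = range L" "\<forall>u. fromE (x, L u) = Q p u"
      using fromE_fibrewise[OF xu] by blast
    have "u \<in> range L" using xu pL(2) by (simp add: Et_def)
    then obtain y where y: "u = L y" by blast
    show ?thesis unfolding y linear_scale[OF pL(1), symmetric] using pL(3) Q_scale by simp
  qed
  have a: "fadd adP (fromE (x, u)) (fromE (x, u')) = fromE (x, u + u')"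
    if xu: "(x, u) \<in> topspace Et" "(x, u') \<in> topspace Et" for x u u'
  proof -
    obtain p L where pL: "p \<in> topspace P" "linear L" "fr.fib x = range L" "\<forall>u. fromE (x, L u) = Q p u"
      using fromE_fibrewise[OF xu(1)] by blast
    have "u \<in> range L" "u' \<in> range L" using xu pL(3) by (simp_all add: Et_def)
    then obtain y y' where y: "u = L y" "u' = L y'" by blast
    show ?thesis unfolding y linear_add[OF pL(2), symmetric] using pL(4) Q_add[OF pL(1)] by simp
  qed
  have z: "fzero adP x = fromE (x, 0)" if x: "x \<in> topspace X" for x
  proof -
    obtain p L where pL: "p \<in> topspace P" "\<pi> p = x" "linear L" "\<forall>u. fromE (x, L u) = Q p u"
      using fromE_fibrewise[OF zE[OF x]] by blast
    have "fromE (x, 0) = Q p 0" using spec[OF pL(4), of 0] linear_0[OF pL(3)] by simp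
    then show ?thesis using Q_zero[OF pL(1)] pL(2) by simp
  qed
  note concl = sf.split_conclusion[of adP fromE h', unfolded Et, OF h' p a s z]
  show ?thesis
    using sf.oriented_xi concl by blast
qed

end

theorem corollary4p1:
  fixes G :: "'g monoid" and T :: "'g topology" and A :: "('g, 'e::euclidean_space) atlas"
    and P :: "'p topology" and \<pi> :: "'p \<Rightarrow> (nat \<Rightarrow> real)" and act :: "'p \<Rightarrow> 'g \<Rightarrow> 'p"
    and d r m :: nat
  assumes "lie_group G T A" and "d = DIM('e)"
    and "compact_space T" and "connected_space T"
    and "lie_rank G T r"
    and "m \<ge> 1"
    and "principal_bundle G T (nsphere m) P \<pi> act"
  shows "(\<exists>(\<xi> :: (nat \<Rightarrow> real, (nat \<Rightarrow> real) \<times> (nat \<Rightarrow> real)) vector_bundle) \<Phi>.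
            oriented_vector_bundle (nsphere m) \<xi> (d - r + 1) \<Phi> \<and>
            bundle_isomorphic (adjoint_bundle G T A P \<pi> act)
              (whitney_sum \<xi> (trivial_bundle (nsphere m) (r - 1)))) \<and>
         (\<exists>s :: nat \<Rightarrow> (nat \<Rightarrow> real) \<Rightarrow> ('p \<times> (('g \<Rightarrow> real) \<Rightarrow> real)) set.
            (\<forall>i<r - 1. bundle_section (nsphere m) (adjoint_bundle G T A P \<pi> act) (s i)) \<and>
            (\<forall>x\<in>topspace (nsphere m).
               fibre_lin_indep (adjoint_bundle G T A P \<pi> act) x (\<lambda>i. s i x) (r - 1)))"
proof -
  interpret lie_group G T A by (rule assms(1))
  obtain \<psi> :: "'g \<Rightarrow> 'e" and \<theta> U \<rho> C a and J :: "'e \<Rightarrow> ('g \<Rightarrow> real) \<Rightarrow> real"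
    where lc: "lie_chart G T \<psi> \<theta> U \<rho> C a"
    and J: "homeomorphic_map euclidean (lie_algebra_topology G T A) J"
    "\<And>v w. J (v + w) = (\<lambda>f. J v f + J w f)" "\<And>c v. J (c *\<^sub>R v) = (\<lambda>f. c * J v f)"
    "\<And>g v. g \<in> carrier G \<Longrightarrow> Ad G g (J v) = J (a g v)"
    by (rule ex_lie_chart[OF assms(3)]) (rule that)
  interpret lc: lie_chart G T \<psi> \<theta> U \<rho> C a by (rule lc)
  obtain J' where J': "homeomorphic_maps euclidean (lie_algebra_topology G T A) J J'"
    using J(1) by (auto simp: homeomorphic_map_maps)
  have r1: "r \<ge> 1" by (rule lc.lie_rank_pos[OF assms(5)])
  obtain H where "torus_in G T r H" using assms(5) by (auto simp: lie_rank_def maximal_torus_in_def)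
  from lc.ex_torus_frame[OF this] obtain v \<tau> h0 c0 where fr: "lc.torus_frame r v \<tau> h0 c0" by blast
  have rd: "r \<le> DIM('e)" by (rule lc.torus_dim_le[OF fr])
  obtain S where S: "lc.line_frame (r - 1) v S" using lc.ex_line_frame[OF fr, of "r - 1"] r1 by auto
  interpret sb: sphere_bundle G T \<psi> \<theta> U \<rho> C a m P \<pi> act
    by (unfold_locales; fact)
  obtain sp where sp: "continuous_map (subtopology (nsphere m) {x. - 1 / 2 < x m}) P sp"
    "\<forall>x\<in>topspace (nsphere m). - 1 / 2 < x m \<longrightarrow> \<pi> (sp x) = x"
    using sb.sphere_section[of 1] by auto
  have neg: "{x. - 1 * x m > - 1 / 2} = {x. x m < (1 / 2 :: real)}" by auto
  obtain sm where sm: "continuous_map (subtopology (nsphere m) {x. x m < 1 / 2}) P sm"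
    "\<forall>x\<in>topspace (nsphere m). x m < 1 / 2 \<longrightarrow> \<pi> (sm x) = x"
    using sb.sphere_section[of "- 1", unfolded neg] by auto
  interpret ad: adjoint_sphere G T \<psi> \<theta> U \<rho> C a m P \<pi> act A J J' sp sm "r - 1" v S
    by unfold_locales (use assms(4) J' J sp sm S r1 rd in auto)
  \<comment> \<open>Both \<open>r \<ge> 1\<close> and \<open>r \<le> d\<close> enter here, as the
    subtractions are truncated.\<close>
  have "DIM('e) - (r - 1) = d - r + 1" using r1 rd assms(2) by simp
  then show ?thesis using ad.adjoint_splitting by simp
qed

end
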